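(* Let $\xi\in L^2(\Omega,\mathcal G,\mathbb P;\mathbb R^d)$ and $\eta\in L^2(\Omega,\mathcal G,\mathbb P;\mathbb R^k)$, let $\Gamma\in\mathbb R^{k\times m}$ and let $(\beta^\varepsilon)_{\varepsilon>0}$ be real numbers with $\beta^\varepsilon=o(\varepsilon)$ as $\varepsilon\to0$. Suppose that Assumptions (A), (C) and (D) stated in the context hold, and let $(\widehat X,\widehat Y,\widehat Z,\widehat\alpha)\in\mathbb S_d^2\times\mathbb S_d^2\times\mathbb H_{d\times m}^2\times\mathbb H_k^2$ be as in Assumption (D) for the initial condition $\xi$. For every $\varepsilon>0$ let $(X^\varepsilon,Y^\varepsilon,Z^\varepsilon,\bar Y^\varepsilon,\bar Z^\varepsilon,A^\varepsilon)\in\mathbb S_d^2\times\mathbb S_d^2\times\mathbb H_{d\times m}^2\times\mathbb S_k^2\times\mathbb H_{k\times m}^2\times\mathbb S_k^2$ be the unique solution of the two-scale forward-backward system on $[0,T]$ $$\begin{cases}dX^\varepsilon_t=b(t,X^\varepsilon_t,\mathbb P_{X_t^\varepsilon},A_t^\varepsilon,\mathbb P_{A_t^\varepsilon})\,dt+\sigma(t,X^\varepsilon_t,\mathbb P_{X_t^\varepsilon},A_t^\varepsilon,\mathbb P_{A_t^\varepsilon})\,dW_t,\\ dY_t^\varepsilon=-\Phi(t,X_t^\varepsilon,Y_t^\varepsilon,Z_t^\varepsilon,A_t^\varepsilon,\mathbb P_{(X_t^\varepsilon,Y_t^\varepsilon,Z_t^\varepsilon,A_t^\varepsilon)})\,dt+Z_t^\varepsilon\,dW_t,\\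 d\bar Y_t^\varepsilon=-\Psi(t,X_t^\varepsilon,Y_t^\varepsilon,Z_t^\varepsilon,A_t^\varepsilon,\mathbb P_{(X_t^\varepsilon,Y_t^\varepsilon,Z_t^\varepsilon,A_t^\varepsilon)})\,dt+\bar Z_t^\varepsilon\,dW_t,\\ \varepsilon\,dA^\varepsilon_t=-\bar Y_t^\varepsilon\,dt+\beta^\varepsilon\Gamma\,dW_t,\\ X^\varepsilon_0=\xi,\quad Y_T^\varepsilon=\phi(X_T^\varepsilon,\mathbb P_{X_T^\varepsilon}),\quad \bar Y_T^\varepsilon=0,\quad A^\varepsilon_0=\eta.\end{cases}$$ Then, as $\varepsilon\to0$, $$\big\|(A^\varepsilon,Y^\varepsilon,Z^\varepsilon,\bar Y^\varepsilon,\bar Z^\varepsilon)-(\widehat\alpha,\widehat Y,\widehat Z,0,0)\big\|_{\mathbb H^2}\longrightarrow0,\qquad \|X^\varepsilon-\widehat X\|_{\mathbb S^2}\longrightarrow0.$$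
   Context: Probabilistic setting. Fix $T>0$ and $d,k,m\in\mathbb N$. $(\Omega,\mathcal F,\mathbb P)$ is a complete probability space carrying an $m$-dimensional Brownian motion $W=(W_t)_{t\ge0}$; $(\mathcal F^W_t)_{t\ge0}$ is the $\mathbb P$-completion of the filtration generated by $W$. $\mathcal G\subset\mathcal F$ is a sub-$\sigma$-algebra independent of $\mathcal F^W_\infty$ such that there is a $\mathcal G$-measurable random variable uniformly distributed on $[0,1]$. The filtration $\mathbb F=(\mathcal F_t)_{t\ge0}$ is $\mathcal F_t=\mathcal G\vee\mathcal F_t^W$. $\mathbb P_\zeta$ denotes the law of a random variable $\zeta$. $L^2(\Omega,\mathcal H,\mathbb P;\mathbb R^n)$ is the space of square-integrable $\mathcal H$-measurable $\mathbb R^n$-valued random variables. Wasserstein space. $\mathcal P_2(E)$, for $E$ a Euclidean space (vectors, matrices, or products thereof), is the set of Borel probability measures on $E$ with finite second moment, endowed with the 2-Wasserstein metric $\mathcal W_2(\mu,\mu')=\inf_\pi(\int|x-y|^2\pi(dx,dy))^{1/2}$, infimum over couplings $\pi$ of $\mu,\mu'$; $\|\mu\|_2:=(\int_E|x|^2\mu(dx))^{1/2}$; $\delta_0$ is the Dirac mass at $0$. Process spaces on $[0,T]$. $\mathbb S_n^2$: continuous $\mathbb F$-adapted $\mathbb R^n$-valued processes $Y$ with $\|Y\|_{\mathbb S^2}^2:=\mathbb E[\sup_{0\le t\le T}|Y_t|^2]<\infty$. $\mathbb H_n^2$ (resp. $\mathbb H^2_{n\times\tilde n}$): $\mathbb F$-progressively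 measurable $\mathbb R^n$-valued (resp. $\mathbb R^{n\times\tilde n}$-valued) processes $Z$ with $\|Z\|_{\mathbb H^2}^2:=\mathbb E[\int_0^T|Z_t|^2dt]<\infty$. Assumption (A) (on $b,\sigma$). $b,\sigma:[0,T]\times\Omega\times\mathbb R^d\times\mathcal P_2(\mathbb R^d)\times\mathbb R^k\times\mathcal P_2(\mathbb R^k)\to\mathbb R^d,\mathbb R^{d\times m}$ (argument $\omega$ omitted in the notation) are measurable with respect to $Prog\otimes\mathcal B(\mathbb R^d)\otimes\mathcal B(\mathcal P_2(\mathbb R^d))\otimes\mathcal B(\mathbb R^k)\otimes\mathcal B(\mathcal P_2(\mathbb R^k))$, with $Prog$ the $\mathbb F$-progressive $\sigma$-algebra on $[0,T]\times\Omega$; and there is $K>0$ such that $|b|+|\sigma|\le K(1+|x|+\|\mu\|_2+|a|+\|\nu\|_2)$ at every $(t,\omega,x,\mu,a,\nu)$, and each $h\in\{b,\sigma\}$ satisfies $|h(t,\omega,x,\mu,a,\nu)-h(t,\omega,x',\mu',a',\nu')|\le K(|x-x'|+\mathcal W_2(\mu,\mu')+|a-a'|+\mathcal W_2(\nu,\nu'))$ for all arguments. Assumption (C). $\Phi,\Psi:[0,T]\times\mathbb R^d\times\mathbb R^d\times\mathbb R^{d\times m}\times\mathbb R^k\times\mathcal P_2(\mathbb R^d\times\mathbb R^d\times\mathbb R^{d\times m}\times\mathbb R^k)\to\mathbb R^d,\mathbb R^k$ and $\phi:\mathbb R^d\times\mathcal P_2(\mathbb R^d)\to\mathbb R^d$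 satisfy: 1) they are Borel measurable; 2) there is $K>0$ with $|\Phi(t,x,y,z,a,\pi)|+|\Psi(t,x,y,z,a,\pi)|+|\phi(x,\mu)|\le K(1+|x|+\|\mu\|_2+|y|+|z|+|a|+\|\pi\|_2)$ for all arguments; 3) there is $K>0$ with $|\Phi(t,x,y,z,a,\pi)-\Phi(t,x',y',z',a',\pi')|+|\Psi(t,x,y,z,a,\pi)-\Psi(t,x',y',z',a',\pi')|+|\phi(x,\mu)-\phi(x',\mu')|\le K(|x-x'|+\mathcal W_2(\mu,\mu')+|y-y'|+|z-z'|+|a-a'|+\mathcal W_2(\pi,\pi'))$ for all arguments; 4) there is $\lambda>0$ such that, for all $t\in[0,T]$ and all square-integrable $\mathcal F$-measurable random variables $\zeta_1,\zeta_1',\upsilon,\upsilon'$ ($\mathbb R^d$-valued), $\theta,\theta'$ ($\mathbb R^k$-valued), $\zeta,\zeta'$ ($\mathbb R^{d\times m}$-valued), $$\begin{aligned}&\mathbb E[\langle b(t,\zeta_1,\mathbb P_{\zeta_1},\theta,\mathbb P_\theta)-b(t,\zeta_1',\mathbb P_{\zeta_1'},\theta',\mathbb P_{\theta'}),\upsilon-\upsilon'\rangle]\\&+\mathbb E[\mathrm{tr}((\sigma(t,\zeta_1,\mathbb P_{\zeta_1},\theta,\mathbb P_\theta)-\sigma(t,\zeta_1',\mathbb P_{\zeta_1'},\theta',\mathbb P_{\theta'}))(\zeta-\zeta')^{\top})]\\&-\mathbb E[\langle\Phi(t,\zeta_1,\upsilon,\zeta,\theta,\mathbb P_{(\zeta_1,\upsilon,\zeta,\theta)})-\Phi(t,\zeta_1',\upsilon',\zeta',\theta',\mathbb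 P_{(\zeta_1',\upsilon',\zeta',\theta')}),\zeta_1-\zeta_1'\rangle]\\&-\mathbb E[\langle\Psi(t,\zeta_1,\upsilon,\zeta,\theta,\mathbb P_{(\zeta_1,\upsilon,\zeta,\theta)})-\Psi(t,\zeta_1',\upsilon',\zeta',\theta',\mathbb P_{(\zeta_1',\upsilon',\zeta',\theta')}),\theta-\theta'\rangle]\le-\lambda\,\mathbb E[|\theta-\theta'|^2]\end{aligned}$$ and $\mathbb E[\langle\phi(\zeta_1,\mathbb P_{\zeta_1})-\phi(\zeta_1',\mathbb P_{\zeta_1'}),\zeta_1-\zeta_1'\rangle]\ge0$. Assumption (D). Assumption (C) holds and for every $\xi\in L^2(\Omega,\mathcal G,\mathbb P;\mathbb R^d)$ there exists $\widehat\alpha\in\mathbb H_k^2$ such that $\mathbb E[\int_0^T|\Psi(t,\widehat X_t,\widehat Y_t,\widehat Z_t,\widehat\alpha_t,\mathbb P_{(\widehat X_t,\widehat Y_t,\widehat Z_t,\widehat\alpha_t)})|^2dt]=0$, where $(\widehat X,\widehat Y,\widehat Z)\in\mathbb S_d^2\times\mathbb S_d^2\times\mathbb H_{d\times m}^2$ is the unique solution of the (uncoupled) system on $[0,T]$ $$\begin{cases}d\widehat X_t=b(t,\widehat X_t,\mathbb P_{\widehat X_t},\widehat\alpha_t,\mathbb P_{\widehat\alpha_t})dt+\sigma(t,\widehat X_t,\mathbb P_{\widehat X_t},\widehat\alpha_t,\mathbb P_{\widehat\alpha_t})dW_t,\\ d\widehat Y_t=-\Phi(t,\widehat X_t,\widehat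 Y_t,\widehat Z_t,\widehat\alpha_t,\mathbb P_{(\widehat X_t,\widehat Y_t,\widehat Z_t,\widehat\alpha_t)})dt+\widehat Z_tdW_t,\\ \widehat X_0=\xi,\quad\widehat Y_T=\phi(\widehat X_T,\mathbb P_{\widehat X_T}).\end{cases}$$ *)

theory Defs
  imports "HOL-Probability.Probability" "HOL-Library.Landau_Symbols"
begin

text \<open>
  Dimensions are index types: vectors in $R^n$ are \<^typ>\<open>real^'n\<close>, and $n \times m$ matrices are
  \<^typ>\<open>real^'m^'n\<close>, whose library norm is the Frobenius norm. Products of Euclidean spaces carry the
  Euclidean product norm. Processes are curried, time first, and only their values for times in
  $[0,T]$ (for the Brownian motion: in $[0,\infty)$) and for \<open>\<omega> \<in> space M\<close> matter.
\<close>

section \<open>Square-integrable laws and the Wasserstein space\<close>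

definition P2 :: "'a::euclidean_space measure set" where
  "P2 = {\<mu>. sets \<mu> = sets borel \<and> prob_space \<mu> \<and> integrable \<mu> (\<lambda>x. (norm x)\<^sup>2)}"

definition couplings ::
  "'a::euclidean_space measure \<Rightarrow> 'a measure \<Rightarrow> ('a \<times> 'a) measure set" where
  "couplings \<mu> \<nu> = {\<pi>. sets \<pi> = sets borel \<and> prob_space \<pi> \<and>
     distr \<pi> borel fst = \<mu> \<and> distr \<pi> borel snd = \<nu>}"

text \<open>
  The value 0 outside \<^const>\<open>P2\<close> is never used; it is there because \<^locale>\<open>Metric_space\<close> asks
  for nonnegativity and symmetry on the whole type.
\<close>

definition W2 :: "'a::euclidean_space measure \<Rightarrow> 'a measure \<Rightarrow> real" where
  "W2 \<mu> \<nu> = (if \<mu> \<in> P2 \<and> \<nu> \<in> P2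
     then (INF \<pi>\<in>couplings \<mu> \<nu>. sqrt (\<integral>z. (norm (fst z - snd z))\<^sup>2 \<partial>\<pi>)) else 0)"

definition norm2 :: "'a::euclidean_space measure \<Rightarrow> real" where
  "norm2 \<mu> = sqrt (\<integral>x. (norm x)\<^sup>2 \<partial>\<mu>)"

definition P2_borel :: "'a::euclidean_space measure measure" where
  "P2_borel = sigma P2 {U. openin (Metric_space.mtopology P2 W2) U}"

definition L2_rv :: "'w measure \<Rightarrow> 'w measure \<Rightarrow> ('w \<Rightarrow> 'a::euclidean_space) set" where
  "L2_rv M H = {\<zeta> \<in> borel_measurable H. integrable M (\<lambda>\<omega>. (norm (\<zeta> \<omega>))\<^sup>2)}"

text \<open>
  The law of a random variable. The coefficients take laws in \<^const>\<open>P2\<close> only, but for a process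
  \<open>Z\<close> with $E \int_0^T |Z_t|^2 dt < \infty$ the variable $Z_t$ is square-integrable only for almost
  every \<open>t\<close>. On the remaining null set of times the law is replaced by the Dirac mass at 0, which
  keeps the coefficients along \<open>Z\<close> defined and measurable without affecting any integral in time.
\<close>

definition law :: "'w measure \<Rightarrow> ('w \<Rightarrow> 'a::euclidean_space) \<Rightarrow> 'a measure" where
  "law M \<zeta> = (if \<zeta> \<in> L2_rv M M then distr M borel \<zeta> else return borel 0)"

section \<open>Brownian motion and filtrations\<close>

definition brownian_motion :: "'w measure \<Rightarrow> (real \<Rightarrow> 'w \<Rightarrow> real^'m) \<Rightarrow> bool" where
  "brownian_motion M W \<longleftrightarrow>
     (\<forall>t\<ge>0. W t \<in> borel_measurable M) \<and>
     (AE \<omega> in M. W 0 \<omega> = 0) \<and>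
     (AE \<omega> in M. continuous_on {0..} (\<lambda>t. W t \<omega>)) \<and>
     (\<forall>s t. 0 \<le> s \<and> s < t \<longrightarrow>
        prob_space.indep_vars M (\<lambda>_. borel) (\<lambda>i \<omega>. (W t \<omega> - W s \<omega>) $ i) UNIV \<and>
        (\<forall>i. distributed M lborel (\<lambda>\<omega>. (W t \<omega> - W s \<omega>) $ i) (normal_density 0 (sqrt (t - s))))) \<and>
     (\<forall>(s :: nat \<Rightarrow> real) n. 0 \<le> s 0 \<and> (\<forall>i<n. s i < s (Suc i)) \<longrightarrow>
        prob_space.indep_vars M (\<lambda>_. borel) (\<lambda>i \<omega>. W (s (Suc i)) \<omega> - W (s i) \<omega>) {..<n})"

text \<open>
  The $\sigma$-algebra generated by \<open>W\<close> at the times in \<open>S\<close> and by the null sets. \<open>M\<close> will be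
  complete, so \<open>null_sets M\<close> contains all negligible sets.
\<close>

definition W_algebra :: "'w measure \<Rightarrow> (real \<Rightarrow> 'w \<Rightarrow> real^'m) \<Rightarrow> real set \<Rightarrow> 'w measure" where
  "W_algebra M W S =
     sigma (space M) ((\<Union>s\<in>S. {W s -` B \<inter> space M | B. B \<in> sets borel}) \<union> null_sets M)"

definition joint_filtration ::
  "'w measure \<Rightarrow> 'w measure \<Rightarrow> (real \<Rightarrow> 'w \<Rightarrow> real^'m) \<Rightarrow> real \<Rightarrow> 'w measure" where
  "joint_filtration M G W t = sigma (space M) (sets G \<union> sets (W_algebra M W {0..t}))"

locale brownian_setting = prob_space M + complete_measure M
  for M :: "'w measure"
    and G :: "'w measure"
    and W :: "real \<Rightarrow> 'w \<Rightarrow> real^'m"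
    and F :: "real \<Rightarrow> 'w measure"
    and T :: real +
  assumes T_pos: "0 < T"
    and brownian: "brownian_motion M W"
    and G_sub: "subalgebra M G"
    and G_indep: "indep_set (sets G) (sets (W_algebra M W {0..}))"
    and G_uniform: "\<exists>U \<in> borel_measurable G. distr M borel U = uniform_measure lborel {0..1::real}"
    and filtration: "F = joint_filtration M G W"

text \<open>The progressive $\sigma$-algebra on $[0,T] \times \Omega$.\<close>

definition Prog :: "'w measure \<Rightarrow> (real \<Rightarrow> 'w measure) \<Rightarrow> real \<Rightarrow> (real \<times> 'w) measure" where
  "Prog M F T = sigma ({0..T} \<times> space M)
     {A. A \<subseteq> {0..T} \<times> space M \<and>
         (\<forall>t\<in>{0..T}. A \<inter> ({0..t} \<times> space M) \<in> sets (restrict_space borel {0..t} \<Otimes>\<^sub>M F t))}"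

section \<open>Process spaces\<close>

definition S2_sq :: "'w measure \<Rightarrow> real \<Rightarrow> (real \<Rightarrow> 'w \<Rightarrow> 'a::euclidean_space) \<Rightarrow> ennreal" where
  "S2_sq M T Y = (\<integral>\<^sup>+\<omega>. (SUP t\<in>{0..T}. ennreal ((norm (Y t \<omega>))\<^sup>2)) \<partial>M)"

definition H2_sq :: "'w measure \<Rightarrow> real \<Rightarrow> (real \<Rightarrow> 'w \<Rightarrow> 'a::euclidean_space) \<Rightarrow> ennreal" where
  "H2_sq M T Z = (\<integral>\<^sup>+\<omega>. (\<integral>\<^sup>+t\<in>{0..T}. ennreal ((norm (Z t \<omega>))\<^sup>2) \<partial>lborel) \<partial>M)"

definition S2_norm :: "'w measure \<Rightarrow> real \<Rightarrow> (real \<Rightarrow> 'w \<Rightarrow> 'a::euclidean_space) \<Rightarrow> real" where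
  "S2_norm M T Y = sqrt (enn2real (S2_sq M T Y))"

definition H2_norm :: "'w measure \<Rightarrow> real \<Rightarrow> (real \<Rightarrow> 'w \<Rightarrow> 'a::euclidean_space) \<Rightarrow> real" where
  "H2_norm M T Z = sqrt (enn2real (H2_sq M T Z))"

definition continuous_adapted ::
  "'w measure \<Rightarrow> (real \<Rightarrow> 'w measure) \<Rightarrow> real \<Rightarrow> (real \<Rightarrow> 'w \<Rightarrow> 'a::euclidean_space) \<Rightarrow> bool" where
  "continuous_adapted M F T Y \<longleftrightarrow>
     (\<forall>\<omega>\<in>space M. continuous_on {0..T} (\<lambda>t. Y t \<omega>)) \<and>
     (\<forall>t\<in>{0..T}. Y t \<in> borel_measurable (F t))"

definition S2 ::
  "'w measure \<Rightarrow> (real \<Rightarrow> 'w measure) \<Rightarrow> real \<Rightarrow> (real \<Rightarrow> 'w \<Rightarrow> 'a::euclidean_space) set" where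
  "S2 M F T = {Y. continuous_adapted M F T Y \<and> S2_sq M T Y < \<infinity>}"

definition H2 ::
  "'w measure \<Rightarrow> (real \<Rightarrow> 'w measure) \<Rightarrow> real \<Rightarrow> (real \<Rightarrow> 'w \<Rightarrow> 'a::euclidean_space) set" where
  "H2 M F T = {Z. (\<lambda>(t, \<omega>). Z t \<omega>) \<in> borel_measurable (Prog M F T) \<and> H2_sq M T Z < \<infinity>}"

section \<open>Ito integral and Ito processes\<close>

text \<open>
  Simple integrands $\sum_{i<n} \theta_i 1_{(s_i, s_{i+1}]}$ with \<open>\<theta> i\<close> bounded and measurable at
  time \<open>s i\<close>, and their integrals.
\<close>

definition simple_integrand ::
  "'w measure \<Rightarrow> (real \<Rightarrow> 'w measure) \<Rightarrow> real \<Rightarrow> nat \<Rightarrow> (nat \<Rightarrow> real) \<Rightarrow>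
   (nat \<Rightarrow> 'w \<Rightarrow> real^'m^'n) \<Rightarrow> bool" where
  "simple_integrand M F T n s \<theta> \<longleftrightarrow>
     0 \<le> s 0 \<and> s n \<le> T \<and> (\<forall>i<n. s i < s (Suc i)) \<and>
     (\<forall>i<n. \<theta> i \<in> borel_measurable (F (s i)) \<and> (\<exists>C. \<forall>\<omega>\<in>space M. norm (\<theta> i \<omega>) \<le> C))"

definition simple_process ::
  "nat \<Rightarrow> (nat \<Rightarrow> real) \<Rightarrow> (nat \<Rightarrow> 'w \<Rightarrow> real^'m^'n) \<Rightarrow> real \<Rightarrow> 'w \<Rightarrow> real^'m^'n" where
  "simple_process n s \<theta> t \<omega> = (\<Sum>i<n. indicator {s i<..s (Suc i)} t *\<^sub>R \<theta> i \<omega>)"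

definition simple_ito ::
  "(real \<Rightarrow> 'w \<Rightarrow> real^'m) \<Rightarrow> nat \<Rightarrow> (nat \<Rightarrow> real) \<Rightarrow> (nat \<Rightarrow> 'w \<Rightarrow> real^'m^'n) \<Rightarrow>
   real \<Rightarrow> 'w \<Rightarrow> real^'n" where
  "simple_ito W n s \<theta> t \<omega> = (\<Sum>i<n. \<theta> i \<omega> *v (W (min (s (Suc i)) t) \<omega> - W (min (s i) t) \<omega>))"

text \<open>
  \<open>J\<close> is a continuous version of $\int_0^\cdot Z_s dW_s$: the limit, in $L^2$ at each time, of the
  integrals of simple processes that converge to \<open>Z\<close> in the norm of \<open>H2\<close>.
\<close>

definition has_ito_integral ::
  "'w measure \<Rightarrow> (real \<Rightarrow> 'w measure) \<Rightarrow> (real \<Rightarrow> 'w \<Rightarrow> real^'m) \<Rightarrow> real \<Rightarrow>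
   (real \<Rightarrow> 'w \<Rightarrow> real^'m^'n) \<Rightarrow> (real \<Rightarrow> 'w \<Rightarrow> real^'n) \<Rightarrow> bool" where
  "has_ito_integral M F W T Z J \<longleftrightarrow>
     Z \<in> H2 M F T \<and> continuous_adapted M F T J \<and>
     (\<exists>n s \<theta>. (\<forall>j::nat. simple_integrand M F T (n j) (s j) (\<theta> j)) \<and>
        (\<lambda>j. H2_sq M T (\<lambda>t \<omega>. simple_process (n j) (s j) (\<theta> j) t \<omega> - Z t \<omega>)) \<longlonglongrightarrow> 0 \<and>
        (\<forall>t\<in>{0..T}. (\<lambda>j. \<integral>\<^sup>+\<omega>. ennreal ((norm (simple_ito W (n j) (s j) (\<theta> j) t \<omega> - J t \<omega>))\<^sup>2) \<partial>M)
           \<longlonglongrightarrow> 0))"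

text \<open>$dX_t = f_t dt + g_t dW_t$ on $[0,T]$.\<close>

definition ito_differential ::
  "'w measure \<Rightarrow> (real \<Rightarrow> 'w measure) \<Rightarrow> (real \<Rightarrow> 'w \<Rightarrow> real^'m) \<Rightarrow> real \<Rightarrow>
   (real \<Rightarrow> 'w \<Rightarrow> real^'n) \<Rightarrow> (real \<Rightarrow> 'w \<Rightarrow> real^'n) \<Rightarrow> (real \<Rightarrow> 'w \<Rightarrow> real^'m^'n) \<Rightarrow> bool" where
  "ito_differential M F W T X f g \<longleftrightarrow>
     (AE \<omega> in M. set_integrable lborel {0..T} (\<lambda>s. f s \<omega>)) \<and>
     (\<exists>J. has_ito_integral M F W T g J \<and>
        (AE \<omega> in M. \<forall>t\<in>{0..T}. X t \<omega> = X 0 \<omega> + (LINT s:{0..t}|lborel. f s \<omega>) + J t \<omega>))"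

section \<open>The coefficients and the systems\<close>

type_synonym ('w, 'd, 'k, 'e) forward_coeff =
  "real \<Rightarrow> 'w \<Rightarrow> real^'d \<Rightarrow> (real^'d) measure \<Rightarrow> real^'k \<Rightarrow> (real^'k) measure \<Rightarrow> 'e"

type_synonym ('d, 'k, 'm, 'e) backward_coeff =
  "real \<Rightarrow> real^'d \<Rightarrow> real^'d \<Rightarrow> real^'m^'d \<Rightarrow> real^'k \<Rightarrow>
   ((real^'d) \<times> (real^'d) \<times> (real^'m^'d) \<times> (real^'k)) measure \<Rightarrow> 'e"

definition along_XA ::
  "'w measure \<Rightarrow> ('w, 'd::finite, 'k::finite, 'e) forward_coeff \<Rightarrow> (real \<Rightarrow> 'w \<Rightarrow> real^'d) \<Rightarrow>
   (real \<Rightarrow> 'w \<Rightarrow> real^'k) \<Rightarrow> real \<Rightarrow> 'w \<Rightarrow> 'e" where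
  "along_XA M h X A t \<omega> = h t \<omega> (X t \<omega>) (law M (X t)) (A t \<omega>) (law M (A t))"

definition along_XYZA ::
  "'w measure \<Rightarrow> ('d::finite, 'k::finite, 'm::finite, 'e) backward_coeff \<Rightarrow>
   (real \<Rightarrow> 'w \<Rightarrow> real^'d) \<Rightarrow> (real \<Rightarrow> 'w \<Rightarrow> real^'d) \<Rightarrow> (real \<Rightarrow> 'w \<Rightarrow> real^'m^'d) \<Rightarrow>
   (real \<Rightarrow> 'w \<Rightarrow> real^'k) \<Rightarrow> real \<Rightarrow> 'w \<Rightarrow> 'e" where
  "along_XYZA M h X Y Z A t \<omega> =
     h t (X t \<omega>) (Y t \<omega>) (Z t \<omega>) (A t \<omega>) (law M (\<lambda>\<omega>. (X t \<omega>, Y t \<omega>, Z t \<omega>, A t \<omega>)))"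

definition forward_measurable ::
  "'w measure \<Rightarrow> (real \<Rightarrow> 'w measure) \<Rightarrow> real \<Rightarrow>
   ('w, 'd::finite, 'k::finite, 'e::euclidean_space) forward_coeff \<Rightarrow> bool" where
  "forward_measurable M F T h \<longleftrightarrow>
     (\<lambda>((t, \<omega>), x, \<mu>, a, \<nu>). h t \<omega> x \<mu> a \<nu>)
       \<in> borel_measurable (Prog M F T \<Otimes>\<^sub>M borel \<Otimes>\<^sub>M P2_borel \<Otimes>\<^sub>M borel \<Otimes>\<^sub>M P2_borel)"

definition forward_lipschitz ::
  "'w measure \<Rightarrow> real \<Rightarrow> real \<Rightarrow>
   ('w, 'd::finite, 'k::finite, 'e::euclidean_space) forward_coeff \<Rightarrow> bool" where
  "forward_lipschitz M T K h \<longleftrightarrow>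
     (\<forall>t\<in>{0..T}. \<forall>\<omega>\<in>space M. \<forall>x x' a a'. \<forall>\<mu>\<in>P2. \<forall>\<mu>'\<in>P2. \<forall>\<nu>\<in>P2. \<forall>\<nu>'\<in>P2.
        norm (h t \<omega> x \<mu> a \<nu> - h t \<omega> x' \<mu>' a' \<nu>')
          \<le> K * (norm (x - x') + W2 \<mu> \<mu>' + norm (a - a') + W2 \<nu> \<nu>'))"

definition assumption_A ::
  "'w measure \<Rightarrow> (real \<Rightarrow> 'w measure) \<Rightarrow> real \<Rightarrow>
   ('w, 'd::finite, 'k::finite, real^'d) forward_coeff \<Rightarrow>
   ('w, 'd, 'k, real^'m^'d) forward_coeff \<Rightarrow> bool" where
  "assumption_A M F T b \<sigma> \<longleftrightarrow>
     forward_measurable M F T b \<and> forward_measurable M F T \<sigma> \<and>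
     (\<exists>K>0.
        (\<forall>t\<in>{0..T}. \<forall>\<omega>\<in>space M. \<forall>x a. \<forall>\<mu>\<in>P2. \<forall>\<nu>\<in>P2.
           norm (b t \<omega> x \<mu> a \<nu>) + norm (\<sigma> t \<omega> x \<mu> a \<nu>)
             \<le> K * (1 + norm x + norm2 \<mu> + norm a + norm2 \<nu>)) \<and>
        forward_lipschitz M T K b \<and> forward_lipschitz M T K \<sigma>)"

definition backward_measurable ::
  "real \<Rightarrow> ('d::finite, 'k::finite, 'm::finite, 'e::euclidean_space) backward_coeff \<Rightarrow> bool" where
  "backward_measurable T h \<longleftrightarrow>
     (\<lambda>(t, x, y, z, a, \<pi>). h t x y z a \<pi>)
       \<in> borel_measurable (restrict_space borel {0..T} \<Otimes>\<^sub>M borel \<Otimes>\<^sub>M borel \<Otimes>\<^sub>M borel \<Otimes>\<^sub>M borel \<Otimes>\<^sub>M P2_borel)"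

definition backward_growth ::
  "real \<Rightarrow> ('d::finite, 'k::finite, 'm::finite, real^'d) backward_coeff \<Rightarrow>
   ('d, 'k, 'm, real^'k) backward_coeff \<Rightarrow>
   (real^'d \<Rightarrow> (real^'d) measure \<Rightarrow> real^'d) \<Rightarrow> bool" where
  "backward_growth T \<Phi> \<Psi> \<phi> \<longleftrightarrow>
     (\<exists>K>0. \<forall>t\<in>{0..T}. \<forall>x y z a. \<forall>\<mu>\<in>P2. \<forall>\<pi>\<in>P2.
        norm (\<Phi> t x y z a \<pi>) + norm (\<Psi> t x y z a \<pi>) + norm (\<phi> x \<mu>)
          \<le> K * (1 + norm x + norm2 \<mu> + norm y + norm z + norm a + norm2 \<pi>))"

definition backward_lipschitz ::
  "real \<Rightarrow> ('d::finite, 'k::finite, 'm::finite, real^'d) backward_coeff \<Rightarrow>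
   ('d, 'k, 'm, real^'k) backward_coeff \<Rightarrow>
   (real^'d \<Rightarrow> (real^'d) measure \<Rightarrow> real^'d) \<Rightarrow> bool" where
  "backward_lipschitz T \<Phi> \<Psi> \<phi> \<longleftrightarrow>
     (\<exists>K>0. \<forall>t\<in>{0..T}. \<forall>x x' y y' z z' a a'. \<forall>\<mu>\<in>P2. \<forall>\<mu>'\<in>P2. \<forall>\<pi>\<in>P2. \<forall>\<pi>'\<in>P2.
        norm (\<Phi> t x y z a \<pi> - \<Phi> t x' y' z' a' \<pi>') + norm (\<Psi> t x y z a \<pi> - \<Psi> t x' y' z' a' \<pi>')
            + norm (\<phi> x \<mu> - \<phi> x' \<mu>')
          \<le> K * (norm (x - x') + W2 \<mu> \<mu>' + norm (y - y') + norm (z - z') + norm (a - a')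
                  + W2 \<pi> \<pi>'))"

definition monotonicity ::
  "'w measure \<Rightarrow> real \<Rightarrow>
   ('w, 'd::finite, 'k::finite, real^'d) forward_coeff \<Rightarrow>
   ('w, 'd, 'k, real^'m^'d) forward_coeff \<Rightarrow>
   ('d, 'k, 'm::finite, real^'d) backward_coeff \<Rightarrow>
   ('d, 'k, 'm, real^'k) backward_coeff \<Rightarrow> bool" where
  "monotonicity M T b \<sigma> \<Phi> \<Psi> \<longleftrightarrow>
     (\<exists>c>0. \<forall>t\<in>{0..T}.
        \<forall>\<zeta>\<^sub>1\<in>L2_rv M M. \<forall>\<zeta>\<^sub>1'\<in>L2_rv M M. \<forall>\<upsilon>\<in>L2_rv M M. \<forall>\<upsilon>'\<in>L2_rv M M.
        \<forall>\<theta>\<in>L2_rv M M. \<forall>\<theta>'\<in>L2_rv M M. \<forall>\<zeta>\<in>L2_rv M M. \<forall>\<zeta>'\<in>L2_rv M M.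
          (let \<pi> = law M (\<lambda>\<omega>. (\<zeta>\<^sub>1 \<omega>, \<upsilon> \<omega>, \<zeta> \<omega>, \<theta> \<omega>));
               \<pi>' = law M (\<lambda>\<omega>. (\<zeta>\<^sub>1' \<omega>, \<upsilon>' \<omega>, \<zeta>' \<omega>, \<theta>' \<omega>))
           in
             (\<integral>\<omega>. (b t \<omega> (\<zeta>\<^sub>1 \<omega>) (law M \<zeta>\<^sub>1) (\<theta> \<omega>) (law M \<theta>)
                   - b t \<omega> (\<zeta>\<^sub>1' \<omega>) (law M \<zeta>\<^sub>1') (\<theta>' \<omega>) (law M \<theta>')) \<bullet> (\<upsilon> \<omega> - \<upsilon>' \<omega>) \<partial>M)
           + (\<integral>\<omega>. trace ((\<sigma> t \<omega> (\<zeta>\<^sub>1 \<omega>) (law M \<zeta>\<^sub>1) (\<theta> \<omega>) (law M \<theta>)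
                   - \<sigma> t \<omega> (\<zeta>\<^sub>1' \<omega>) (law M \<zeta>\<^sub>1') (\<theta>' \<omega>) (law M \<theta>')) ** transpose (\<zeta> \<omega> - \<zeta>' \<omega>)) \<partial>M)
           - (\<integral>\<omega>. (\<Phi> t (\<zeta>\<^sub>1 \<omega>) (\<upsilon> \<omega>) (\<zeta> \<omega>) (\<theta> \<omega>) \<pi>
                   - \<Phi> t (\<zeta>\<^sub>1' \<omega>) (\<upsilon>' \<omega>) (\<zeta>' \<omega>) (\<theta>' \<omega>) \<pi>') \<bullet> (\<zeta>\<^sub>1 \<omega> - \<zeta>\<^sub>1' \<omega>) \<partial>M)
           - (\<integral>\<omega>. (\<Psi> t (\<zeta>\<^sub>1 \<omega>) (\<upsilon> \<omega>) (\<zeta> \<omega>) (\<theta> \<omega>) \<pi>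
                   - \<Psi> t (\<zeta>\<^sub>1' \<omega>) (\<upsilon>' \<omega>) (\<zeta>' \<omega>) (\<theta>' \<omega>) \<pi>') \<bullet> (\<theta> \<omega> - \<theta>' \<omega>) \<partial>M)
           \<le> - c * (\<integral>\<omega>. (norm (\<theta> \<omega> - \<theta>' \<omega>))\<^sup>2 \<partial>M)))"

definition terminal_monotonicity ::
  "'w measure \<Rightarrow> (real^'d \<Rightarrow> (real^'d) measure \<Rightarrow> real^'d) \<Rightarrow> bool" where
  "terminal_monotonicity M \<phi> \<longleftrightarrow>
     (\<forall>\<zeta>\<in>L2_rv M M. \<forall>\<zeta>'\<in>L2_rv M M.
        0 \<le> (\<integral>\<omega>. (\<phi> (\<zeta> \<omega>) (law M \<zeta>) - \<phi> (\<zeta>' \<omega>) (law M \<zeta>')) \<bullet> (\<zeta> \<omega> - \<zeta>' \<omega>) \<partial>M))"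

definition assumption_C ::
  "'w measure \<Rightarrow> real \<Rightarrow>
   ('w, 'd::finite, 'k::finite, real^'d) forward_coeff \<Rightarrow>
   ('w, 'd, 'k, real^'m^'d) forward_coeff \<Rightarrow>
   ('d, 'k, 'm::finite, real^'d) backward_coeff \<Rightarrow>
   ('d, 'k, 'm, real^'k) backward_coeff \<Rightarrow>
   (real^'d \<Rightarrow> (real^'d) measure \<Rightarrow> real^'d) \<Rightarrow> bool" where
  "assumption_C M T b \<sigma> \<Phi> \<Psi> \<phi> \<longleftrightarrow>
     backward_measurable T \<Phi> \<and> backward_measurable T \<Psi> \<and>
     (\<lambda>(x, \<mu>). \<phi> x \<mu>) \<in> borel_measurable (borel \<Otimes>\<^sub>M P2_borel) \<and>
     backward_growth T \<Phi> \<Psi> \<phi> \<and> backward_lipschitz T \<Phi> \<Psi> \<phi> \<and>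
     monotonicity M T b \<sigma> \<Phi> \<Psi> \<and> terminal_monotonicity M \<phi>"

definition uncoupled_system ::
  "'w measure \<Rightarrow> (real \<Rightarrow> 'w measure) \<Rightarrow> (real \<Rightarrow> 'w \<Rightarrow> real^'m) \<Rightarrow> real \<Rightarrow>
   ('w, 'd::finite, 'k::finite, real^'d) forward_coeff \<Rightarrow>
   ('w, 'd, 'k, real^'m^'d) forward_coeff \<Rightarrow>
   ('d, 'k, 'm::finite, real^'d) backward_coeff \<Rightarrow>
   (real^'d \<Rightarrow> (real^'d) measure \<Rightarrow> real^'d) \<Rightarrow> ('w \<Rightarrow> real^'d) \<Rightarrow>
   (real \<Rightarrow> 'w \<Rightarrow> real^'k) \<Rightarrow> (real \<Rightarrow> 'w \<Rightarrow> real^'d) \<Rightarrow> (real \<Rightarrow> 'w \<Rightarrow> real^'d) \<Rightarrow>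
   (real \<Rightarrow> 'w \<Rightarrow> real^'m^'d) \<Rightarrow> bool" where
  "uncoupled_system M F W T b \<sigma> \<Phi> \<phi> \<xi> \<alpha> X Y Z \<longleftrightarrow>
     X \<in> S2 M F T \<and> Y \<in> S2 M F T \<and> Z \<in> H2 M F T \<and>
     ito_differential M F W T X (along_XA M b X \<alpha>) (along_XA M \<sigma> X \<alpha>) \<and>
     ito_differential M F W T Y (\<lambda>t \<omega>. - along_XYZA M \<Phi> X Y Z \<alpha> t \<omega>) Z \<and>
     (AE \<omega> in M. X 0 \<omega> = \<xi> \<omega>) \<and>
     (AE \<omega> in M. Y T \<omega> = \<phi> (X T \<omega>) (law M (X T)))"

text \<open>
  The limiting object for the initial condition \<open>\<xi>\<close>: a control \<open>\<alpha>\<close>, together with the solution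
  of the system it drives, along which \<open>\<Psi>\<close> vanishes.
\<close>

definition stationary_solution ::
  "'w measure \<Rightarrow> (real \<Rightarrow> 'w measure) \<Rightarrow> (real \<Rightarrow> 'w \<Rightarrow> real^'m) \<Rightarrow> real \<Rightarrow>
   ('w, 'd::finite, 'k::finite, real^'d) forward_coeff \<Rightarrow>
   ('w, 'd, 'k, real^'m^'d) forward_coeff \<Rightarrow>
   ('d, 'k, 'm::finite, real^'d) backward_coeff \<Rightarrow>
   ('d, 'k, 'm, real^'k) backward_coeff \<Rightarrow>
   (real^'d \<Rightarrow> (real^'d) measure \<Rightarrow> real^'d) \<Rightarrow> ('w \<Rightarrow> real^'d) \<Rightarrow>
   (real \<Rightarrow> 'w \<Rightarrow> real^'d) \<Rightarrow> (real \<Rightarrow> 'w \<Rightarrow> real^'d) \<Rightarrow> (real \<Rightarrow> 'w \<Rightarrow> real^'m^'d) \<Rightarrow>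
   (real \<Rightarrow> 'w \<Rightarrow> real^'k) \<Rightarrow> bool" where
  "stationary_solution M F W T b \<sigma> \<Phi> \<Psi> \<phi> \<xi> X Y Z \<alpha> \<longleftrightarrow>
     \<alpha> \<in> H2 M F T \<and> uncoupled_system M F W T b \<sigma> \<Phi> \<phi> \<xi> \<alpha> X Y Z \<and>
     H2_sq M T (along_XYZA M \<Psi> X Y Z \<alpha>) = 0"

definition assumption_D ::
  "'w measure \<Rightarrow> 'w measure \<Rightarrow> (real \<Rightarrow> 'w measure) \<Rightarrow> (real \<Rightarrow> 'w \<Rightarrow> real^'m) \<Rightarrow> real \<Rightarrow>
   ('w, 'd::finite, 'k::finite, real^'d) forward_coeff \<Rightarrow>
   ('w, 'd, 'k, real^'m^'d) forward_coeff \<Rightarrow>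
   ('d, 'k, 'm::finite, real^'d) backward_coeff \<Rightarrow>
   ('d, 'k, 'm, real^'k) backward_coeff \<Rightarrow>
   (real^'d \<Rightarrow> (real^'d) measure \<Rightarrow> real^'d) \<Rightarrow> bool" where
  "assumption_D M G F W T b \<sigma> \<Phi> \<Psi> \<phi> \<longleftrightarrow>
     assumption_C M T b \<sigma> \<Phi> \<Psi> \<phi> \<and>
     (\<forall>\<xi>\<in>L2_rv M G. \<exists>X Y Z \<alpha>. stationary_solution M F W T b \<sigma> \<Phi> \<Psi> \<phi> \<xi> X Y Z \<alpha>)"

definition two_scale_system ::
  "'w measure \<Rightarrow> (real \<Rightarrow> 'w measure) \<Rightarrow> (real \<Rightarrow> 'w \<Rightarrow> real^'m) \<Rightarrow> real \<Rightarrow>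
   ('w, 'd::finite, 'k::finite, real^'d) forward_coeff \<Rightarrow>
   ('w, 'd, 'k, real^'m^'d) forward_coeff \<Rightarrow>
   ('d, 'k, 'm::finite, real^'d) backward_coeff \<Rightarrow>
   ('d, 'k, 'm, real^'k) backward_coeff \<Rightarrow>
   (real^'d \<Rightarrow> (real^'d) measure \<Rightarrow> real^'d) \<Rightarrow> real^'m^'k \<Rightarrow>
   ('w \<Rightarrow> real^'d) \<Rightarrow> ('w \<Rightarrow> real^'k) \<Rightarrow> real \<Rightarrow> real \<Rightarrow>
   (real \<Rightarrow> 'w \<Rightarrow> real^'d) \<Rightarrow> (real \<Rightarrow> 'w \<Rightarrow> real^'d) \<Rightarrow> (real \<Rightarrow> 'w \<Rightarrow> real^'m^'d) \<Rightarrow>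
   (real \<Rightarrow> 'w \<Rightarrow> real^'k) \<Rightarrow> (real \<Rightarrow> 'w \<Rightarrow> real^'m^'k) \<Rightarrow> (real \<Rightarrow> 'w \<Rightarrow> real^'k) \<Rightarrow> bool" where
  "two_scale_system M F W T b \<sigma> \<Phi> \<Psi> \<phi> \<Gamma> \<xi> \<eta> \<epsilon> \<beta> X Y Z Ybar Zbar A \<longleftrightarrow>
     X \<in> S2 M F T \<and> Y \<in> S2 M F T \<and> Z \<in> H2 M F T \<and>
     Ybar \<in> S2 M F T \<and> Zbar \<in> H2 M F T \<and> A \<in> S2 M F T \<and>
     ito_differential M F W T X (along_XA M b X A) (along_XA M \<sigma> X A) \<and>
     ito_differential M F W T Y (\<lambda>t \<omega>. - along_XYZA M \<Phi> X Y Z A t \<omega>) Z \<and>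
     ito_differential M F W T Ybar (\<lambda>t \<omega>. - along_XYZA M \<Psi> X Y Z A t \<omega>) Zbar \<and>
     ito_differential M F W T (\<lambda>t \<omega>. \<epsilon> *\<^sub>R A t \<omega>) (\<lambda>t \<omega>. - Ybar t \<omega>) (\<lambda>t \<omega>. \<beta> *\<^sub>R \<Gamma>) \<and>
     (AE \<omega> in M. X 0 \<omega> = \<xi> \<omega>) \<and>
     (AE \<omega> in M. Y T \<omega> = \<phi> (X T \<omega>) (law M (X T))) \<and>
     (AE \<omega> in M. Ybar T \<omega> = 0) \<and>
     (AE \<omega> in M. A 0 \<omega> = \<eta> \<omega>)"

end

theory Submission
  imports Defs
begin

text \<open>
  Write \<open>D\<close> for the norm of \<open>A\<^sup>\<epsilon> - \<alpha>hat\<close>. Gronwall estimates for the forward and the backward equation bound the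
  distance of \<open>(X\<^sup>\<epsilon>, Y\<^sup>\<epsilon>, Z\<^sup>\<epsilon>)\<close> from \<open>(Xhat, Yhat, Zhat)\<close>, the norm of \<open>\<Psi>\<close> along the two-scale solution (\<open>\<Psi>\<close> vanishes
  along the limit), and hence \<open>Ybar\<close> and \<open>Zbar\<close>, by a constant times \<open>D\<close>. The product rule for \<open>X\<^sup>\<epsilon> - Xhat\<close> and
  \<open>Y\<^sup>\<epsilon> - Yhat\<close> turns monotonicity into \<open>\<lambda> D\<^sup>2 \<le> \<langle>\<Psi>, A\<^sup>\<epsilon> - \<alpha>hat\<rangle>\<close>. Approximate \<open>\<alpha>hat\<close> within \<open>\<delta>\<close> by an adapted process
  \<open>a = \<eta> + \<integral> a'\<close>; the product rules for \<open>Ybar\<close> against \<open>\<epsilon> A\<^sup>\<epsilon>\<close> and against \<open>a\<close> give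
  \<open>\<langle>\<Psi>, A\<^sup>\<epsilon> - a\<rangle> = - \<parallel>Ybar\<parallel>\<^sup>2 / \<epsilon> + (\<beta> / \<epsilon>) \<langle>Zbar, \<Gamma>\<rangle> - \<langle>Ybar, a'\<rangle>\<close>. The first term absorbs the last up to
  \<open>\<epsilon> \<parallel>a'\<parallel>\<^sup>2 / 4\<close>, so \<open>D\<^sup>2 \<le> C (\<bar>\<beta>\<bar> / \<epsilon> + \<delta>) D + C \<epsilon> \<parallel>a'\<parallel>\<^sup>2\<close>, and \<open>D\<close> tends to 0 as \<open>\<epsilon>\<close> and then \<open>\<delta>\<close> do.
  Only the expectations of products of Ito processes enter, so the isometry and the martingale property
  replace Ito's formula.
\<close>

section \<open>Square-integrable functions\<close>

text \<open>Three obstacles shape the development. The limit control is merely progressive and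
  square-integrable, so no product rule pairs it with \<open>Ybar\<close>, although that pairing is
  how the fast equation informs about \<open>A\<close>. It is replaced by an absolutely continuous
  process, whose derivative has no bound as the approximation improves; hence
  \<open>\<epsilon>\<close> tends to 0 first and no rate results. The control starts at
  \<open>\<eta>\<close>, which is unrelated to the limit control, so the replacement carries an
  initial layer that is small in mean square but not in supremum norm; accordingly \<open>A\<close>
  converges in the weaker norm.

  The coefficients contain the law of the solution at each time. Progressive drifts therefore
  require a measurable flow of laws for the Borel sets of the Wasserstein topology, which in turn
  requires that \<open>W2\<close> is a metric and that membership of a law in an open set can be
  read off a real function.

  The supremum norm of \<open>X\<close> needs a maximal inequality; it comes from a deterministic
  inequality for finite sequences.\<close>

definition l2n :: "'a measure \<Rightarrow> ('a \<Rightarrow> 'b::euclidean_space) \<Rightarrow> real" where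
  "l2n N f = sqrt (\<integral>x. (norm (f x))\<^sup>2 \<partial>N)"

lemma l2n_nonneg [simp]: "0 \<le> l2n N f"
  by (simp add: l2n_def)

lemma l2n_sq: "(l2n N f)\<^sup>2 = (\<integral>x. (norm (f x))\<^sup>2 \<partial>N)"
  by (simp add: l2n_def)

lemma L2_rvI:
  "f \<in> borel_measurable N \<Longrightarrow> integrable M (\<lambda>x. (norm (f x))\<^sup>2) \<Longrightarrow> f \<in> L2_rv M N"
  by (simp add: L2_rv_def)

lemma L2_rvD:
  assumes "f \<in> L2_rv M N"
  shows "f \<in> borel_measurable N" "integrable M (\<lambda>x. (norm (f x))\<^sup>2)"
  using assms by (auto simp: L2_rv_def)

lemma L2_rv_dominated:
  fixes f :: "'a \<Rightarrow> 'b::euclidean_space"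
  assumes "f \<in> borel_measurable N" "integrable N g" "AE x in N. (norm (f x))\<^sup>2 \<le> g x"
  shows "f \<in> L2_rv N N"
proof (rule L2_rvI)
  show "integrable N (\<lambda>x. (norm (f x))\<^sup>2)"
  proof (rule Bochner_Integration.integrable_bound[OF assms(2)])
    show "AE x in N. norm ((norm (f x))\<^sup>2) \<le> norm (g x)"
      using assms(3) by eventually_elim auto
  qed (use assms(1) in measurable)
qed fact

lemma norm_add_sq_le: "(norm (x + y))\<^sup>2 \<le> 2 * (norm x)\<^sup>2 + 2 * (norm (y::'b::real_normed_vector))\<^sup>2"
proof -
  have "(norm (x + y))\<^sup>2 \<le> (norm x + norm y)\<^sup>2"
    by (intro power_mono norm_triangle_ineq) auto
  also have "\<dots> \<le> 2 * (norm x)\<^sup>2 + 2 * (norm y)\<^sup>2"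
    using zero_le_power2[of "norm x - norm y"] by (simp add: power2_eq_square algebra_simps)
  finally show ?thesis .
qed

lemma L2_rv_add:
  fixes f g :: "'a \<Rightarrow> 'b::euclidean_space"
  assumes "f \<in> L2_rv N N" "g \<in> L2_rv N N"
  shows "(\<lambda>x. f x + g x) \<in> L2_rv N N"
  by (rule L2_rv_dominated[where g = "\<lambda>x. 2 * (norm (f x))\<^sup>2 + 2 * (norm (g x))\<^sup>2"])
     (use assms in \<open>auto simp: L2_rv_def norm_add_sq_le\<close>)

lemma L2_rv_scaleR:
  fixes f :: "'a \<Rightarrow> 'b::euclidean_space"
  assumes "f \<in> L2_rv N N"
  shows "(\<lambda>x. c *\<^sub>R f x) \<in> L2_rv N N"
  using assms by (auto simp: L2_rv_def power_mult_distrib)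

lemma L2_rv_uminus:
  fixes f :: "'a \<Rightarrow> 'b::euclidean_space"
  assumes "f \<in> L2_rv N N"
  shows "(\<lambda>x. - f x) \<in> L2_rv N N"
  using assms by (auto simp: L2_rv_def)

lemma L2_rv_diff:
  fixes f g :: "'a \<Rightarrow> 'b::euclidean_space"
  assumes "f \<in> L2_rv N N" "g \<in> L2_rv N N"
  shows "(\<lambda>x. f x - g x) \<in> L2_rv N N"
  using L2_rv_add[OF assms(1) L2_rv_uminus[OF assms(2)]] by simp

lemma L2_rv_zero [simp]: "(\<lambda>x. 0) \<in> L2_rv N N"
  by (auto simp: L2_rv_def)

lemma L2_rv_sum:
  fixes f :: "'i \<Rightarrow> 'a \<Rightarrow> 'b::euclidean_space"
  assumes "\<And>i. i \<in> I \<Longrightarrow> f i \<in> L2_rv N N"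
  shows "(\<lambda>x. \<Sum>i\<in>I. f i x) \<in> L2_rv N N"
  using assms by (induction I rule: infinite_finite_induct) (auto intro: L2_rv_add)

lemma L2_rv_norm_le:
  fixes f :: "'a \<Rightarrow> 'b::euclidean_space" and g :: "'a \<Rightarrow> 'c::euclidean_space"
  assumes "f \<in> borel_measurable N" "g \<in> L2_rv N N" "AE x in N. norm (f x) \<le> norm (g x)"
  shows "f \<in> L2_rv N N"
  by (rule L2_rv_dominated[OF assms(1) L2_rvD(2)[OF assms(2)]])
     (use assms(3) in \<open>eventually_elim, auto intro: power_mono\<close>)

lemma L2_rv_norm:
  fixes f :: "'a \<Rightarrow> 'b::euclidean_space"
  shows "f \<in> L2_rv N N \<Longrightarrow> (\<lambda>x. norm (f x)) \<in> L2_rv N N"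
  by (auto simp: L2_rv_def)

lemma L2_rv_cong_AE:
  fixes f :: "'a \<Rightarrow> 'b::euclidean_space"
  assumes "f \<in> L2_rv N N" "g \<in> borel_measurable N" "AE x in N. f x = g x"
  shows "g \<in> L2_rv N N"
  by (rule L2_rv_norm_le[OF assms(2,1)]) (use assms(3) in auto)

lemma L2_inner_integrable:
  fixes f g :: "'a \<Rightarrow> 'b::euclidean_space"
  assumes "f \<in> L2_rv N N" "g \<in> L2_rv N N"
  shows "integrable N (\<lambda>x. f x \<bullet> g x)"
proof (rule Bochner_Integration.integrable_bound)
  show "integrable N (\<lambda>x. (norm (f x))\<^sup>2 + (norm (g x))\<^sup>2)"
    using assms by (auto dest: L2_rvD)
  show "(\<lambda>x. f x \<bullet> g x) \<in> borel_measurable N"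
    using assms[THEN L2_rvD(1)] by measurable
  have "\<bar>f x \<bullet> g x\<bar> \<le> (norm (f x))\<^sup>2 + (norm (g x))\<^sup>2" for x
  proof -
    have "\<bar>f x \<bullet> g x\<bar> \<le> norm (f x) * norm (g x)" by (rule Cauchy_Schwarz_ineq2)
    also have "\<dots> \<le> (norm (f x))\<^sup>2 + (norm (g x))\<^sup>2"
      using zero_le_power2[of "norm (f x) - norm (g x)"] zero_le_power2[of "norm (f x) + norm (g x)"]
      unfolding power2_diff power2_sum by linarith
    finally show ?thesis .
  qed
  then show "AE x in N. norm (f x \<bullet> g x) \<le> norm ((norm (f x))\<^sup>2 + (norm (g x))\<^sup>2)"
    by auto
qed

lemma integral_norm_add_sq:
  fixes f g :: "'a \<Rightarrow> 'b::euclidean_space"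
  assumes "f \<in> L2_rv N N" "g \<in> L2_rv N N"
  shows "(\<integral>x. (norm (f x + c *\<^sub>R g x))\<^sup>2 \<partial>N)
    = (\<integral>x. (norm (f x))\<^sup>2 \<partial>N) + 2 * c * (\<integral>x. f x \<bullet> g x \<partial>N) + c\<^sup>2 * (\<integral>x. (norm (g x))\<^sup>2 \<partial>N)"
proof -
  have *: "(norm (f x + c *\<^sub>R g x))\<^sup>2
      = (norm (f x))\<^sup>2 + (2 * c) * (f x \<bullet> g x) + c\<^sup>2 * (norm (g x))\<^sup>2" for x
    unfolding power2_norm_eq_inner power2_eq_square[of c]
    by (simp add: algebra_simps inner_commute)
  show ?thesis
    unfolding * using assms L2_inner_integrable[OF assms] by (simp add: L2_rv_def)
qed

text \<open>The polynomial \<open>t \<mapsto> \<integral> |f + t g|^2\<close> is nonnegative, so its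
  discriminant cannot be positive.\<close>

lemma L2_Cauchy_Schwarz:
  fixes f g :: "'a \<Rightarrow> 'b::euclidean_space"
  assumes "f \<in> L2_rv N N" "g \<in> L2_rv N N"
  shows "\<bar>\<integral>x. f x \<bullet> g x \<partial>N\<bar> \<le> l2n N f * l2n N g"
proof -
  define a b c where "a = (\<integral>x. (norm (f x))\<^sup>2 \<partial>N)" and "b = (\<integral>x. f x \<bullet> g x \<partial>N)"
    and "c = (\<integral>x. (norm (g x))\<^sup>2 \<partial>N)"
  have ac: "a \<ge> 0" "c \<ge> 0" by (auto simp: a_def c_def)
  have q: "0 \<le> a + 2 * t * b + t\<^sup>2 * c" for t
    unfolding a_def b_def c_def integral_norm_add_sq[OF assms, symmetric] by simp
  have "b\<^sup>2 \<le> a * c"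
  proof (cases "c = 0")
    case True
    have "b = 0"
    proof (rule ccontr)
      assume "b \<noteq> 0"
      \<comment> \<open>For \<open>c = 0\<close> the polynomial is affine with slope
        \<open>2 * b\<close>; the chosen argument gives it the value -1.\<close>
      then show False using q[of "- (a + 1) / (2 * b)"] True ac by (simp add: field_simps)
    qed
    then show ?thesis using True by simp
  next
    case False
    then have "c > 0" using ac by simp
    have "0 \<le> c * (a + 2 * (- b / c) * b + (- b / c)\<^sup>2 * c)"
      using q[of "- b / c"] \<open>c > 0\<close> by (intro mult_nonneg_nonneg) auto
    also have "\<dots> = a * c - b\<^sup>2"
      using \<open>c > 0\<close> by (simp add: field_simps power2_eq_square)
    finally show ?thesis by simp
  qed
  then have "sqrt (b\<^sup>2) \<le> sqrt (a * c)" by (rule real_sqrt_le_mono)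
  then show ?thesis by (simp add: real_sqrt_mult l2n_def a_def b_def c_def)
qed

lemma l2n_add:
  fixes f g :: "'a \<Rightarrow> 'b::euclidean_space"
  assumes "f \<in> L2_rv N N" "g \<in> L2_rv N N"
  shows "l2n N (\<lambda>x. f x + g x) \<le> l2n N f + l2n N g"
proof (rule power2_le_imp_le)
  have "(l2n N (\<lambda>x. f x + g x))\<^sup>2 = (l2n N f)\<^sup>2 + 2 * (\<integral>x. f x \<bullet> g x \<partial>N) + (l2n N g)\<^sup>2"
    using integral_norm_add_sq[OF assms, of 1] by (simp add: l2n_sq)
  also have "\<dots> \<le> (l2n N f)\<^sup>2 + 2 * (l2n N f * l2n N g) + (l2n N g)\<^sup>2"
    using L2_Cauchy_Schwarz[OF assms] by auto
  finally show "(l2n N (\<lambda>x. f x + g x))\<^sup>2 \<le> (l2n N f + l2n N g)\<^sup>2"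
    by (simp add: power2_sum)
qed simp

lemma l2n_scaleR:
  fixes f :: "'a \<Rightarrow> 'b::euclidean_space"
  shows "l2n N (\<lambda>x. c *\<^sub>R f x) = \<bar>c\<bar> * l2n N f"
  by (simp add: l2n_def power_mult_distrib real_sqrt_mult)

lemma l2n_uminus:
  fixes f :: "'a \<Rightarrow> 'b::euclidean_space"
  shows "l2n N (\<lambda>x. - f x) = l2n N f"
  by (simp add: l2n_def)

lemma l2n_minus_commute:
  fixes f g :: "'a \<Rightarrow> 'b::euclidean_space"
  shows "l2n N (\<lambda>x. f x - g x) = l2n N (\<lambda>x. g x - f x)"
  by (simp add: l2n_def norm_minus_commute)

lemma l2n_triangle:
  fixes f g h :: "'a \<Rightarrow> 'b::euclidean_space"
  assumes "f \<in> L2_rv N N" "g \<in> L2_rv N N" "h \<in> L2_rv N N"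
  shows "l2n N (\<lambda>x. f x - h x) \<le> l2n N (\<lambda>x. f x - g x) + l2n N (\<lambda>x. g x - h x)"
  using l2n_add[OF L2_rv_diff[OF assms(1,2)] L2_rv_diff[OF assms(2,3)]] by simp

text \<open>A Bochner integral that does not exist is 0, so the smaller function may be arbitrary.
  This lets coefficients along a process be estimated at a fixed time before anything is known about
  their measurability in \<open>\<omega>\<close>.\<close>

lemma l2n_mono:
  fixes f :: "'a \<Rightarrow> 'b::euclidean_space" and g :: "'a \<Rightarrow> 'c::euclidean_space"
  assumes "g \<in> L2_rv N N" "AE x in N. norm (f x) \<le> norm (g x)"
  shows "l2n N f \<le> l2n N g"
  unfolding l2n_def
proof (rule real_sqrt_le_mono)
  show "(\<integral>x. (norm (f x))\<^sup>2 \<partial>N) \<le> (\<integral>x. (norm (g x))\<^sup>2 \<partial>N)"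
  proof (cases "integrable N (\<lambda>x. (norm (f x))\<^sup>2)")
    case True
    then show ?thesis
      by (rule integral_mono_AE[OF _ L2_rvD(2)[OF assms(1)]])
         (use assms(2) in \<open>auto elim!: AE_mp intro!: AE_I2 power_mono\<close>)
  qed (simp add: not_integrable_integral_eq)
qed

lemma l2n_cong_AE:
  fixes f g :: "'a \<Rightarrow> 'b::euclidean_space"
  assumes "f \<in> borel_measurable N" "g \<in> borel_measurable N" "AE x in N. f x = g x"
  shows "l2n N f = l2n N g"
  unfolding l2n_def
  by (intro arg_cong[where f = sqrt] integral_cong_AE) (use assms in auto)

text \<open>Carries identities for simple integrands to the limit. The error consists of a product
  of two errors and two cross terms, each controlled by Cauchy-Schwarz.\<close>

lemma L2_inner_tendsto:
  fixes f g :: "nat \<Rightarrow> 'a \<Rightarrow> 'b::euclidean_space"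
  assumes L2: "\<And>n. f n \<in> L2_rv N N" "\<And>n. g n \<in> L2_rv N N" "F \<in> L2_rv N N" "G \<in> L2_rv N N"
    and f: "(\<lambda>n. l2n N (\<lambda>x. f n x - F x)) \<longlonglongrightarrow> 0"
    and g: "(\<lambda>n. l2n N (\<lambda>x. g n x - G x)) \<longlonglongrightarrow> 0"
  shows "(\<lambda>n. \<integral>x. f n x \<bullet> g n x \<partial>N) \<longlonglongrightarrow> (\<integral>x. F x \<bullet> G x \<partial>N)"
proof -
  let ?a = "\<lambda>n. l2n N (\<lambda>x. f n x - F x)" and ?b = "\<lambda>n. l2n N (\<lambda>x. g n x - G x)"
  have bd: "norm ((\<integral>x. f n x \<bullet> g n x \<partial>N) - (\<integral>x. F x \<bullet> G x \<partial>N))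
      \<le> ?a n * ?b n + ?a n * l2n N G + l2n N F * ?b n" for n
  proof -
    have d: "(\<lambda>x. f n x - F x) \<in> L2_rv N N" "(\<lambda>x. g n x - G x) \<in> L2_rv N N"
      by (intro L2_rv_diff L2)+
    have "(\<integral>x. f n x \<bullet> g n x \<partial>N) - (\<integral>x. F x \<bullet> G x \<partial>N)
        = (\<integral>x. f n x \<bullet> g n x - F x \<bullet> G x \<partial>N)"
      by (intro Bochner_Integration.integral_diff[symmetric] L2_inner_integrable L2)
    also have "\<dots> = (\<integral>x. (f n x - F x) \<bullet> (g n x - G x) + (f n x - F x) \<bullet> G x
        + F x \<bullet> (g n x - G x) \<partial>N)"
      by (simp add: algebra_simps)
    also have "\<dots> = (\<integral>x. (f n x - F x) \<bullet> (g n x - G x) \<partial>N) + (\<integral>x. (f n x - F x) \<bullet> G x \<partial>N)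
        + (\<integral>x. F x \<bullet> (g n x - G x) \<partial>N)"
      by (simp add: L2_inner_integrable L2 d)
    finally show ?thesis
      using L2_Cauchy_Schwarz[OF d] L2_Cauchy_Schwarz[OF d(1) L2(4)] L2_Cauchy_Schwarz[OF L2(3) d(2)]
      by (simp add: real_norm_def)
  qed
  have "(\<lambda>n. ?a n * ?b n + ?a n * l2n N G + l2n N F * ?b n) \<longlonglongrightarrow> 0 * 0 + 0 * l2n N G + l2n N F * 0"
    by (intro tendsto_intros f g)
  then have lim: "(\<lambda>n. ?a n * ?b n + ?a n * l2n N G + l2n N F * ?b n) \<longlonglongrightarrow> 0" by simp
  have "(\<lambda>n. (\<integral>x. f n x \<bullet> g n x \<partial>N) - (\<integral>x. F x \<bullet> G x \<partial>N)) \<longlonglongrightarrow> 0"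
    by (rule Lim_null_comparison[OF always_eventually lim]) (use bd in blast)
  then show ?thesis by (rule LIM_zero_cancel)
qed

lemma nn_integral_norm_sq:
  assumes "f \<in> L2_rv N N"
  shows "(\<integral>\<^sup>+x. ennreal ((norm (f x))\<^sup>2) \<partial>N) = ennreal ((l2n N f)\<^sup>2)"
  using assms unfolding l2n_sq by (intro nn_integral_eq_integral) (auto dest: L2_rvD)

lemma L2_rv_if_nn_integral:
  fixes f :: "'a \<Rightarrow> 'b::euclidean_space"
  assumes "f \<in> borel_measurable N" "(\<integral>\<^sup>+x. ennreal ((norm (f x))\<^sup>2) \<partial>N) < \<infinity>"
  shows "f \<in> L2_rv N N"
  by (rule L2_rvI[OF assms(1)]) (use assms in \<open>auto intro!: integrableI_bounded\<close>)

lemma (in finite_measure) L2_rv_const: "(\<lambda>x. c) \<in> L2_rv M M"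
  by (simp add: L2_rv_def)

lemma (in finite_measure) L2_rv_integrable:
  fixes f :: "'a \<Rightarrow> 'b::euclidean_space"
  assumes "f \<in> L2_rv M M"
  shows "integrable M f"
proof (rule Bochner_Integration.integrable_bound)
  show "integrable M (\<lambda>x. 1 + (norm (f x))\<^sup>2)"
    using assms by (auto dest: L2_rvD)
  have "norm (f x) \<le> 1 + (norm (f x))\<^sup>2" for x
    using zero_le_power2[of "norm (f x) - 1"] norm_ge_zero[of "f x"]
    unfolding power2_diff power_one mult_1_right by linarith
  then show "AE x in M. norm (f x) \<le> norm (1 + (norm (f x))\<^sup>2)" by (intro AE_I2) auto
qed (use assms in \<open>auto dest: L2_rvD\<close>)

section \<open>The Wasserstein metric\<close>

lemma P2D:
  assumes "\<mu> \<in> P2"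
  shows "sets \<mu> = sets borel" "prob_space \<mu>" "(\<lambda>x. x) \<in> L2_rv \<mu> \<mu>"
proof -
  show *: "sets \<mu> = sets borel" "prob_space \<mu>" using assms by (auto simp: P2_def)
  show "(\<lambda>x. x) \<in> L2_rv \<mu> \<mu>"
    using assms measurable_ident_sets[OF *(1)] by (auto simp: P2_def L2_rv_def id_def)
qed

lemma L2_rv_distr:
  fixes f :: "'b \<Rightarrow> 'c::euclidean_space"
  assumes "g \<in> N \<rightarrow>\<^sub>M K" "f \<in> borel_measurable K"
  shows "f \<in> L2_rv (distr N K g) (distr N K g) \<longleftrightarrow> (\<lambda>x. f (g x)) \<in> L2_rv N N"
  using assms measurable_compose[OF assms] by (auto simp: L2_rv_def integrable_distr_eq)

lemma l2n_distr:
  fixes f :: "'b \<Rightarrow> 'c::euclidean_space"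
  assumes "g \<in> N \<rightarrow>\<^sub>M K" "f \<in> borel_measurable K"
  shows "l2n (distr N K g) f = l2n N (\<lambda>x. f (g x))"
  using assms by (simp add: l2n_def integral_distr)

lemma (in prob_space) distr_P2:
  fixes \<zeta> :: "'a \<Rightarrow> 'b::euclidean_space"
  assumes "\<zeta> \<in> L2_rv M M"
  shows "distr M borel \<zeta> \<in> P2"
  using assms by (auto simp: P2_def L2_rv_def integrable_distr_eq intro!: prob_space_distr)

text \<open>Square-integrability of a coordinate depends on its marginal alone, so every coupling of
  laws in \<open>P2\<close> has square-integrable coordinates and is open to the mean-square
  calculus.\<close>

lemma couplings_P2D:
  assumes "\<pi> \<in> couplings \<mu> \<nu>" "\<mu> \<in> P2" "\<nu> \<in> P2"
  shows "prob_space \<pi>" "sets \<pi> = sets borel" "fst \<in> L2_rv \<pi> \<pi>" "snd \<in> L2_rv \<pi> \<pi>"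
    "distr \<pi> borel fst = \<mu>" "distr \<pi> borel snd = \<nu>"
proof -
  show *: "prob_space \<pi>" "sets \<pi> = sets borel" "distr \<pi> borel fst = \<mu>" "distr \<pi> borel snd = \<nu>"
    using assms(1) by (auto simp: couplings_def)
  have m: "fst \<in> \<pi> \<rightarrow>\<^sub>M borel" "snd \<in> \<pi> \<rightarrow>\<^sub>M borel"
    unfolding measurable_cong_sets[OF *(2) refl]
    by (intro borel_measurable_continuous_onI continuous_intros)+
  show "fst \<in> L2_rv \<pi> \<pi>" "snd \<in> L2_rv \<pi> \<pi>"
    using L2_rv_distr[OF m(1), of "\<lambda>x. x"] L2_rv_distr[OF m(2), of "\<lambda>x. x"] *(3,4)
      P2D(3)[OF assms(2)] P2D(3)[OF assms(3)] by simp_all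
qed

lemma W2_le_coupling:
  assumes "\<pi> \<in> couplings \<mu> \<nu>" "\<mu> \<in> P2" "\<nu> \<in> P2"
  shows "W2 \<mu> \<nu> \<le> l2n \<pi> (\<lambda>z. fst z - snd z)"
  unfolding W2_def l2n_def using assms by (auto intro!: cINF_lower bdd_belowI2[where m = 0])

text \<open>The joint law of the two variables is an admissible coupling. Later estimates of
  Wasserstein distances between laws of processes reduce to mean-square distances in this
  way.\<close>

lemma (in prob_space) W2_distr_le:
  fixes \<zeta> \<zeta>' :: "'a \<Rightarrow> 'b::euclidean_space"
  assumes "\<zeta> \<in> L2_rv M M" "\<zeta>' \<in> L2_rv M M"
  shows "W2 (distr M borel \<zeta>) (distr M borel \<zeta>') \<le> l2n M (\<lambda>\<omega>. \<zeta> \<omega> - \<zeta>' \<omega>)"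
proof -
  let ?\<pi> = "distr M borel (\<lambda>\<omega>. (\<zeta> \<omega>, \<zeta>' \<omega>))"
  have m[measurable]: "\<zeta> \<in> borel_measurable M" "\<zeta>' \<in> borel_measurable M"
    using assms by (auto dest: L2_rvD)
  have p: "(\<lambda>\<omega>. (\<zeta> \<omega>, \<zeta>' \<omega>)) \<in> borel_measurable M" by measurable
  have fs: "fst \<in> (borel :: ('b \<times> 'b) measure) \<rightarrow>\<^sub>M (borel :: 'b measure)"
    "snd \<in> (borel :: ('b \<times> 'b) measure) \<rightarrow>\<^sub>M (borel :: 'b measure)"
    by (intro borel_measurable_continuous_onI continuous_intros)+
  have "?\<pi> \<in> couplings (distr M borel \<zeta>) (distr M borel \<zeta>')"
    by (auto simp: couplings_def distr_distr[OF fs(1) p] distr_distr[OF fs(2) p] comp_def p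
        intro!: prob_space_distr)
  from W2_le_coupling[OF this distr_P2[OF assms(1)] distr_P2[OF assms(2)]] show ?thesis
    by (subst (asm) l2n_distr[OF p])
       (auto intro!: borel_measurable_continuous_onI continuous_intros)
qed

text \<open>The product measure is a coupling. Over an empty set the real infimum in
  \<open>W2\<close> would be unspecified, so the order properties of \<open>W2\<close> start
  here.\<close>

lemma couplings_nonempty:
  assumes "\<mu> \<in> P2" "\<nu> \<in> (P2 :: 'a::euclidean_space measure set)"
  shows "couplings \<mu> \<nu> \<noteq> {}"
proof -
  interpret a: prob_space \<mu> by (rule P2D[OF assms(1)])
  interpret b: prob_space \<nu> by (rule P2D[OF assms(2)])
  interpret ab: pair_prob_space \<mu> \<nu> ..
  have s: "sets (\<mu> \<Otimes>\<^sub>M \<nu>) = sets borel"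
    unfolding borel_prod[symmetric] using assms by (intro sets_pair_measure_cong P2D)
  have d1: "distr (\<mu> \<Otimes>\<^sub>M \<nu>) borel fst = \<mu>"
    using b.distr_pair_fst[of \<mu>] P2D(1)[OF assms(1)] by (metis distr_cong)
  have d2: "distr (\<mu> \<Otimes>\<^sub>M \<nu>) borel snd = \<nu>"
  proof (rule measure_eqI)
    fix A assume "A \<in> sets (distr (\<mu> \<Otimes>\<^sub>M \<nu>) borel snd)"
    then have A: "A \<in> sets \<nu>" using P2D(1)[OF assms(2)] by simp
    have m: "snd \<in> \<mu> \<Otimes>\<^sub>M \<nu> \<rightarrow>\<^sub>M borel"
      using measurable_snd[of \<mu> \<nu>] P2D(1)[OF assms(2)] by (simp cong: measurable_cong_sets)
    have "snd -` A \<inter> space (\<mu> \<Otimes>\<^sub>M \<nu>) = space \<mu> \<times> A"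
      using sets.sets_into_space[OF A] by (auto simp: space_pair_measure)
    then show "emeasure (distr (\<mu> \<Otimes>\<^sub>M \<nu>) borel snd) A = emeasure \<nu> A"
      using A P2D(1)[OF assms(2)] m
      by (simp add: emeasure_distr b.emeasure_pair_measure_Times a.emeasure_space_1)
  qed (simp add: P2D(1)[OF assms(2)])
  have "\<mu> \<Otimes>\<^sub>M \<nu> \<in> couplings \<mu> \<nu>"
    using s d1 d2 by (simp add: couplings_def ab.prob_space_axioms)
  then show ?thesis by blast
qed

lemma W2_nonneg: "0 \<le> W2 \<mu> \<nu>"
proof -
  have "0 \<le> (INF \<pi>\<in>couplings \<mu> \<nu>. sqrt (\<integral>z. (norm (fst z - snd z))\<^sup>2 \<partial>\<pi>))"
    if "\<mu> \<in> P2" "\<nu> \<in> P2"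
    by (rule cINF_greatest[OF couplings_nonempty[OF that]]) simp
  then show ?thesis by (simp add: W2_def)
qed

lemma W2_approx:
  assumes "\<mu> \<in> P2" "\<nu> \<in> P2" "0 < e"
  obtains \<pi> where "\<pi> \<in> couplings \<mu> \<nu>" "l2n \<pi> (\<lambda>z. fst z - snd z) < W2 \<mu> \<nu> + e"
proof -
  have "(INF \<pi>\<in>couplings \<mu> \<nu>. sqrt (\<integral>z. (norm (fst z - snd z))\<^sup>2 \<partial>\<pi>)) < W2 \<mu> \<nu> + e"
    using assms by (simp add: W2_def)
  then obtain \<pi> where "\<pi> \<in> couplings \<mu> \<nu>" "sqrt (\<integral>z. (norm (fst z - snd z))\<^sup>2 \<partial>\<pi>) < W2 \<mu> \<nu> + e"
    by (subst (asm) cINF_less_iff[OF couplings_nonempty[OF assms(1,2)]])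
       (auto intro!: bdd_belowI2[where m = 0])
  then show ?thesis by (intro that) (auto simp: l2n_def)
qed

lemma W2_self:
  assumes "\<mu> \<in> P2"
  shows "W2 \<mu> \<mu> = 0"
proof -
  interpret prob_space \<mu> by (rule P2D[OF assms])
  have "distr \<mu> borel (\<lambda>x. x) = \<mu>"
    by (metis P2D(1)[OF assms] distr_id2)
  with W2_distr_le[OF P2D(3)[OF assms] P2D(3)[OF assms]] have "W2 \<mu> \<mu> \<le> 0"
    by (simp add: l2n_def)
  with W2_nonneg[of \<mu> \<mu>] show ?thesis by simp
qed

lemma W2_commute: "W2 \<mu> \<nu> = W2 \<nu> \<mu>"
proof -
  have le: "W2 \<nu> \<mu> \<le> W2 \<mu> \<nu>" if P: "\<mu> \<in> P2" "\<nu> \<in> P2" for \<mu> \<nu> :: "'a measure"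
  proof (rule field_le_epsilon)
    fix e :: real assume "0 < e"
    from W2_approx[OF P this] obtain \<pi>
      where \<pi>: "\<pi> \<in> couplings \<mu> \<nu>" "l2n \<pi> (\<lambda>z. fst z - snd z) < W2 \<mu> \<nu> + e" .
    note c = couplings_P2D[OF \<pi>(1) P]
    interpret prob_space \<pi> by (rule c(1))
    have "W2 \<nu> \<mu> \<le> l2n \<pi> (\<lambda>z. snd z - fst z)"
      using W2_distr_le[OF c(4,3)] c(5,6) by simp
    then show "W2 \<nu> \<mu> \<le> W2 \<mu> \<nu> + e"
      using \<pi>(2) l2n_minus_commute[of \<pi> snd fst] by linarith
  qed
  show ?thesis
  proof (cases "\<mu> \<in> P2 \<and> \<nu> \<in> P2")
    case True
    then show ?thesis using le[of \<mu> \<nu>] le[of \<nu> \<mu>] by auto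
  qed (auto simp: W2_def)
qed

lemma (in finite_measure) integral_norm_le_l2n:
  fixes f :: "'a \<Rightarrow> 'b::euclidean_space"
  assumes "f \<in> L2_rv M M" "prob_space M"
  shows "(\<integral>x. norm (f x) \<partial>M) \<le> l2n M f"
  using L2_Cauchy_Schwarz[OF L2_rv_norm[OF assms(1)] L2_rv_const[of "1::real"]]
    prob_space.prob_space[OF assms(2)]
  by (simp add: l2n_def)

text \<open>The easy half of Kantorovich duality: under a coupling the difference of the integrals
  is the mean of \<open>f (fst z) - f (snd z)\<close>, at most \<open>L\<close> times the mean
  distance, which the mean-square distance dominates.\<close>

lemma W2_integral_lipschitz:
  fixes f :: "'a::euclidean_space \<Rightarrow> real"
  assumes P: "\<mu> \<in> P2" "\<nu> \<in> P2"
    and f: "f \<in> borel_measurable borel" "\<And>x. \<bar>f x\<bar> \<le> 1" "\<And>x y. \<bar>f x - f y\<bar> \<le> L * norm (x - y)"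
    and L: "0 \<le> L"
  shows "\<bar>(\<integral>x. f x \<partial>\<mu>) - (\<integral>x. f x \<partial>\<nu>)\<bar> \<le> L * W2 \<mu> \<nu>"
proof (rule field_le_epsilon)
  fix e :: real assume "0 < e"
  \<comment> \<open>The denominator \<open>L + 1\<close> keeps the slack defined for
    \<open>L = 0\<close> and at most \<open>e\<close> after multiplication by
    \<open>L\<close>.\<close>
  then have e: "0 < e / (L + 1)" using L by simp
  from W2_approx[OF P this] obtain \<pi>
    where \<pi>: "\<pi> \<in> couplings \<mu> \<nu>" "l2n \<pi> (\<lambda>z. fst z - snd z) < W2 \<mu> \<nu> + e / (L + 1)" .
  note c = couplings_P2D[OF \<pi>(1) P]
  interpret prob_space \<pi> by (rule c(1))
  have m[measurable]: "fst \<in> borel_measurable \<pi>" "snd \<in> borel_measurable \<pi>"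
    using c(3,4) by (auto dest: L2_rvD)
  note f(1)[measurable]
  have i: "integrable \<pi> (\<lambda>z. f (fst z))" "integrable \<pi> (\<lambda>z. f (snd z))"
    by (rule integrable_const_bound[where B = 1]; use f(2) in simp)+
  have d: "(\<lambda>z. fst z - snd z) \<in> L2_rv \<pi> \<pi>" by (intro L2_rv_diff c)
  have "(\<integral>x. f x \<partial>\<mu>) = (\<integral>z. f (fst z) \<partial>\<pi>)" "(\<integral>x. f x \<partial>\<nu>) = (\<integral>z. f (snd z) \<partial>\<pi>)"
    unfolding c(5)[symmetric] c(6)[symmetric] by (simp_all add: integral_distr)
  then have "\<bar>(\<integral>x. f x \<partial>\<mu>) - (\<integral>x. f x \<partial>\<nu>)\<bar> = \<bar>\<integral>z. f (fst z) - f (snd z) \<partial>\<pi>\<bar>"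
    using i by simp
  also have "\<dots> \<le> (\<integral>z. \<bar>f (fst z) - f (snd z)\<bar> \<partial>\<pi>)"
    by (rule integral_abs_bound)
  also have "\<dots> \<le> (\<integral>z. L * norm (fst z - snd z) \<partial>\<pi>)"
    by (rule integral_mono) (use i f(3) L2_rv_integrable[OF d] in auto)
  also have "\<dots> \<le> L * l2n \<pi> (\<lambda>z. fst z - snd z)"
    using integral_norm_le_l2n[OF d] L prob_space_axioms by (simp add: mult_left_mono)
  also have "\<dots> \<le> L * (W2 \<mu> \<nu> + e / (L + 1))"
    using \<pi>(2) L by (intro mult_left_mono) auto
  also have "\<dots> \<le> L * W2 \<mu> \<nu> + e"
    using L \<open>0 < e\<close> by (simp add: field_simps)
  finally show "\<bar>(\<integral>x. f x \<partial>\<mu>) - (\<integral>x. f x \<partial>\<nu>)\<bar> \<le> L * W2 \<mu> \<nu> + e" .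
qed

text \<open>Distance 0 makes the integrals of all bounded Lipschitz functions agree. Such functions
  tend to indicators of closed sets, and the closed sets form a generator that is stable under
  intersection.\<close>

lemma W2_eq_0_imp_eq:
  fixes \<mu> \<nu> :: "'a::euclidean_space measure"
  assumes P: "\<mu> \<in> P2" "\<nu> \<in> P2" and 0: "W2 \<mu> \<nu> = 0"
  shows "\<mu> = \<nu>"
proof -
  interpret a: prob_space \<mu> by (rule P2D[OF P(1)])
  interpret b: prob_space \<nu> by (rule P2D[OF P(2)])
  have closed_eq: "emeasure \<mu> C = emeasure \<nu> C" if C: "closed C" "C \<noteq> {}" for C
  proof -
    \<comment> \<open>A Lipschitz cutoff with constant \<open>n\<close> that is 1 on
      \<open>C\<close> and 0 from distance \<open>1 / n\<close> on. Closedness gives points outside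
      \<open>C\<close> a positive distance, so the cutoffs tend to the indicator.\<close>
    define f where "f n x = max 0 (1 - real n * infdist x C)" for n x
    have fm[measurable]: "f n \<in> borel_measurable borel" for n
      unfolding f_def by (intro borel_measurable_continuous_onI continuous_intros)
    have lip: "\<bar>f n x - f n y\<bar> \<le> real n * norm (x - y)" for n x y
    proof -
      have "\<bar>f n x - f n y\<bar> \<le> \<bar>real n * infdist x C - real n * infdist y C\<bar>"
        unfolding f_def by (auto simp: max_def)
      also have "\<dots> = real n * \<bar>infdist x C - infdist y C\<bar>"
        by (simp add: abs_mult right_diff_distrib[symmetric])
      also have "\<dots> \<le> real n * norm (x - y)"
        using infdist_triangle_abs[of x C y] by (intro mult_left_mono) (auto simp: dist_norm)
      finally show ?thesis .
    qed
    have bd: "\<bar>f n x\<bar> \<le> 1" for n x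
      unfolding f_def using infdist_nonneg[of x C] by (auto simp: max_def)
    have eq: "(\<integral>x. f n x \<partial>\<mu>) = (\<integral>x. f n x \<partial>\<nu>)" for n
      using W2_integral_lipschitz[OF P fm bd lip] 0 by simp
    have lim: "(\<lambda>n. f n x) \<longlonglongrightarrow> indicator C x" for x
    proof (cases "x \<in> C")
      case True
      then show ?thesis by (simp add: f_def)
    next
      case False
      then have pos: "0 < infdist x C"
        using C infdist_nonneg[of x C] by (auto simp: less_le in_closed_iff_infdist_zero)
      obtain N :: nat where N: "1 / infdist x C < real N" using reals_Archimedean2 by blast
      have "f n x = 0" if "n \<ge> N" for n
      proof -
        have "1 / infdist x C < real n" using N that by linarith
        then have "1 < real n * infdist x C" using pos by (simp add: field_simps)
        then show ?thesis by (simp add: f_def)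
      qed
      then have "eventually (\<lambda>n. f n x = 0) sequentially"
        by (auto simp: eventually_sequentially)
      then show ?thesis using False by (simp add: tendsto_eventually)
    qed
    have Cs: "C \<in> sets \<mu>" "C \<in> sets \<nu>"
      using borel_closed[OF C(1)] P2D(1)[OF P(1)] P2D(1)[OF P(2)] by auto
    have "(\<lambda>n. \<integral>x. f n x \<partial>\<mu>) \<longlonglongrightarrow> (\<integral>x. indicator C x \<partial>\<mu>)"
      by (rule integral_dominated_convergence[where w = "\<lambda>_. 1"])
         (use lim bd Cs P2D(1)[OF P(1)] fm in \<open>auto cong: measurable_cong_sets\<close>)
    moreover have "(\<lambda>n. \<integral>x. f n x \<partial>\<nu>) \<longlonglongrightarrow> (\<integral>x. indicator C x \<partial>\<nu>)"
      by (rule integral_dominated_convergence[where w = "\<lambda>_. 1"])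
         (use lim bd Cs P2D(1)[OF P(2)] fm in \<open>auto cong: measurable_cong_sets\<close>)
    ultimately have "(\<integral>x. indicator C x \<partial>\<mu>) = (\<integral>x. indicator C x \<partial>\<nu> :: real)"
      unfolding eq by (rule LIMSEQ_unique)
    then have "measure \<mu> C = measure \<nu> C" using Cs sets.sets_into_space by (simp add: Int_absorb2)
    then show ?thesis by (simp add: a.emeasure_eq_measure b.emeasure_eq_measure)
  qed
  show ?thesis
  proof (rule measure_eqI_generator_eq[where E = "Collect closed" and \<Omega> = UNIV and A = "\<lambda>_. UNIV"])
    show "Int_stable (Collect closed :: 'a set set)" by (auto simp: Int_stable_def)
    show "emeasure \<mu> X = emeasure \<nu> X" if "X \<in> Collect closed" for X
      using that closed_eq by (cases "X = {}") auto
    show "sets \<mu> = sigma_sets UNIV (Collect closed)" "sets \<nu> = sigma_sets UNIV (Collect closed)"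
      using P2D(1) P by (auto simp: borel_eq_closed)
  qed auto
qed

text \<open>Enumerate a countable dense set and label a point by the first member within
  \<open>d / 2\<close>. A least index is determined by countably many measurable conditions, and
  equal labels put two points within \<open>d\<close> of each other.\<close>

lemma ex_measurable_cells:
  assumes "0 < (d::real)"
  obtains c :: "'a::euclidean_space \<Rightarrow> nat"
  where "c \<in> borel \<rightarrow>\<^sub>M count_space UNIV" "\<And>x y. c x = c y \<Longrightarrow> norm (x - y) \<le> d"
proof -
  obtain D :: "'a set" where D: "countable D" "\<And>X. open X \<Longrightarrow> X \<noteq> {} \<Longrightarrow> \<exists>d\<in>D. d \<in> X"
    using countable_dense_exists by (metis (no_types, lifting))
  have "D \<noteq> {}" using D(2)[of UNIV] by auto
  define c where "c x = (LEAST n. dist (from_nat_into D n) x < d / 2)" for x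
  have c: "dist (from_nat_into D (c x)) x < d / 2" for x
  proof -
    obtain y where "y \<in> D" "y \<in> ball x (d / 2)" using D(2)[of "ball x (d / 2)"] assms by auto
    then have "dist (from_nat_into D (to_nat_on D y)) x < d / 2"
      using D(1) by (simp add: dist_commute)
    then show ?thesis unfolding c_def by (rule LeastI)
  qed
  show ?thesis
  proof (rule that[of c])
    show "c \<in> borel \<rightarrow>\<^sub>M count_space UNIV" unfolding c_def by measurable
    fix x y assume "c x = c y"
    then have "dist x y < d" using c[of x] c[of y] dist_triangle_half_r by metis
    then show "norm (x - y) \<le> d" by (simp add: dist_norm)
  qed
qed

text \<open>
  The couplings are glued along a partition of the middle space into small cells, which
  avoids disintegration and costs only the diameter of the cells.
\<close>

lemma W2_triangle_aux:
  fixes \<mu> \<nu> \<rho> :: "'a::euclidean_space measure"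
  assumes P: "\<mu> \<in> P2" "\<nu> \<in> P2" "\<rho> \<in> P2" and d: "0 < d"
    and \<pi>: "\<pi>\<^sub>1 \<in> couplings \<mu> \<nu>" "\<pi>\<^sub>2 \<in> couplings \<nu> \<rho>"
  shows "W2 \<mu> \<rho> \<le> l2n \<pi>\<^sub>1 (\<lambda>z. fst z - snd z) + d + l2n \<pi>\<^sub>2 (\<lambda>z. fst z - snd z)"
proof -
  obtain c :: "'a \<Rightarrow> nat" where c[measurable]: "c \<in> borel \<rightarrow>\<^sub>M count_space UNIV"
    and cd: "\<And>x y. c x = c y \<Longrightarrow> norm (x - y) \<le> d"
    using ex_measurable_cells[OF d] by blast
  note c1 = couplings_P2D[OF \<pi>(1) P(1,2)] and c2 = couplings_P2D[OF \<pi>(2) P(2,3)]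
  interpret p1: prob_space \<pi>\<^sub>1 by (rule c1)
  interpret p2: prob_space \<pi>\<^sub>2 by (rule c2)
  interpret n: prob_space \<nu> by (rule P2D[OF P(2)])
  interpret p: pair_prob_space \<pi>\<^sub>1 \<pi>\<^sub>2 ..
  have m[measurable]: "fst \<in> borel_measurable \<pi>\<^sub>1" "snd \<in> borel_measurable \<pi>\<^sub>1"
    "fst \<in> borel_measurable \<pi>\<^sub>2" "snd \<in> borel_measurable \<pi>\<^sub>2"
    using c1(3,4) c2(3,4) by (auto dest: L2_rvD)
  define q where "q i = measure \<nu> {y. c y = i}" for i
  \<comment> \<open>Density of the glued measure with respect to the product: once both middle
    points fall into the cell \<open>i\<close>, whose mass under \<open>\<nu>\<close> is
    \<open>q i\<close>, the two couplings are taken independent. A cell of mass 0 gets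
    \<open>1 / 0 = 0\<close>, and almost no point lies in it.\<close>
  define w where "w z = (if c (snd (fst z)) = c (fst (snd z)) then ennreal (1 / q (c (snd (fst z)))) else 0)"
    for z :: "('a \<times> 'a) \<times> ('a \<times> 'a)"
  have wm[measurable]: "w \<in> borel_measurable (\<pi>\<^sub>1 \<Otimes>\<^sub>M \<pi>\<^sub>2)"
  proof -
    have [measurable]: "(\<lambda>z. c (snd (fst z))) \<in> \<pi>\<^sub>1 \<Otimes>\<^sub>M \<pi>\<^sub>2 \<rightarrow>\<^sub>M count_space UNIV"
      "(\<lambda>z. c (fst (snd z))) \<in> \<pi>\<^sub>1 \<Otimes>\<^sub>M \<pi>\<^sub>2 \<rightarrow>\<^sub>M count_space UNIV"
      by measurable
    have "(\<lambda>z. if i = c (fst (snd z)) then ennreal (1 / q i) else 0) \<in> borel_measurable (\<pi>\<^sub>1 \<Otimes>\<^sub>M \<pi>\<^sub>2)" for i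
      by measurable
    then show ?thesis unfolding w_def
      by (rule measurable_compose_countable[where g = "\<lambda>z. c (snd (fst z))"]) measurable
  qed
  have cs: "{y. c y = i} \<in> sets \<nu>" for i
    using measurable_sets[OF c, of "{i}"] by (simp add: P2D(1)[OF P(2)] vimage_def)
  have q1: "emeasure \<pi>\<^sub>1 {z \<in> space \<pi>\<^sub>1. c (snd z) = i} = ennreal (q i)" for i
  proof -
    have "emeasure \<nu> {y. c y = i} = emeasure \<pi>\<^sub>1 (snd -` {y. c y = i} \<inter> space \<pi>\<^sub>1)"
      using cs[of i] P2D(1)[OF P(2)] by (subst c1(6)[symmetric], subst emeasure_distr) auto
    then show ?thesis
      by (simp add: q_def n.emeasure_eq_measure vimage_def Int_def conj_commute)
  qed
  have q2: "emeasure \<pi>\<^sub>2 {z \<in> space \<pi>\<^sub>2. c (fst z) = i} = ennreal (q i)" for i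
  proof -
    have "emeasure \<nu> {y. c y = i} = emeasure \<pi>\<^sub>2 (fst -` {y. c y = i} \<inter> space \<pi>\<^sub>2)"
      using cs[of i] P2D(1)[OF P(2)] by (subst c2(5)[symmetric], subst emeasure_distr) auto
    then show ?thesis
      by (simp add: q_def n.emeasure_eq_measure vimage_def Int_def conj_commute)
  qed
  have q1_ne: "AE z in \<pi>\<^sub>1. q (c (snd z)) \<noteq> 0"
  proof -
    have "AE z in \<pi>\<^sub>1. \<not> (c (snd z) = i \<and> q i = 0)" for i
      by (rule AE_I[where N = "if q i = 0 then {z \<in> space \<pi>\<^sub>1. c (snd z) = i} else {}"])
         (use q1[of i] in auto)
    then have "AE z in \<pi>\<^sub>1. \<forall>i. \<not> (c (snd z) = i \<and> q i = 0)"
      unfolding AE_all_countable by blast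
    then show ?thesis by (rule eventually_mono) blast
  qed
  have q2_ne: "AE z in \<pi>\<^sub>2. q (c (fst z)) \<noteq> 0"
  proof -
    have "AE z in \<pi>\<^sub>2. \<not> (c (fst z) = i \<and> q i = 0)" for i
      by (rule AE_I[where N = "if q i = 0 then {z \<in> space \<pi>\<^sub>2. c (fst z) = i} else {}"])
         (use q2[of i] in auto)
    then have "AE z in \<pi>\<^sub>2. \<forall>i. \<not> (c (fst z) = i \<and> q i = 0)"
      unfolding AE_all_countable by blast
    then show ?thesis by (rule eventually_mono) blast
  qed
  have qq: "ennreal (1 / q i) * ennreal (q i) = 1" if "q i \<noteq> 0" for i
    using that measure_nonneg[of \<nu> "{y. c y = i}"]
    by (simp add: ennreal_mult'[symmetric] q_def)
  have int2: "AE z1 in \<pi>\<^sub>1. (\<integral>\<^sup>+z2. w (z1, z2) \<partial>\<pi>\<^sub>2) = 1"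
    using q1_ne
  proof eventually_elim
    case (elim z1)
    have "(\<integral>\<^sup>+z2. w (z1, z2) \<partial>\<pi>\<^sub>2)
      = (\<integral>\<^sup>+z2. ennreal (1 / q (c (snd z1))) * indicator {z \<in> space \<pi>\<^sub>2. c (fst z) = c (snd z1)} z2 \<partial>\<pi>\<^sub>2)"
      by (intro nn_integral_cong) (auto simp: w_def indicator_def)
    also have "\<dots> = ennreal (1 / q (c (snd z1))) * ennreal (q (c (snd z1)))"
      by (subst nn_integral_cmult_indicator) (auto simp: q2)
    finally show ?case using qq[OF elim] by simp
  qed
  have int1: "AE z2 in \<pi>\<^sub>2. (\<integral>\<^sup>+z1. w (z1, z2) \<partial>\<pi>\<^sub>1) = 1"
    using q2_ne
  proof eventually_elim
    case (elim z2)
    have "(\<integral>\<^sup>+z1. w (z1, z2) \<partial>\<pi>\<^sub>1)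
      = (\<integral>\<^sup>+z1. ennreal (1 / q (c (fst z2))) * indicator {z \<in> space \<pi>\<^sub>1. c (snd z) = c (fst z2)} z1 \<partial>\<pi>\<^sub>1)"
      by (intro nn_integral_cong) (auto simp: w_def indicator_def)
    also have "\<dots> = ennreal (1 / q (c (fst z2))) * ennreal (q (c (fst z2)))"
      by (subst nn_integral_cmult_indicator) (auto simp: q1)
    finally show ?case using qq[OF elim] by simp
  qed
  define \<gamma> where "\<gamma> = density (\<pi>\<^sub>1 \<Otimes>\<^sub>M \<pi>\<^sub>2) w"
  have fm: "fst \<in> \<gamma> \<rightarrow>\<^sub>M \<pi>\<^sub>1" "snd \<in> \<gamma> \<rightarrow>\<^sub>M \<pi>\<^sub>2" by (simp_all add: \<gamma>_def)
  \<comment> \<open>Integrating out the second pair leaves \<open>(1 / q i) * q i = 1\<close>, so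
    the first pair keeps its law \<open>\<pi>\<^sub>1\<close>; in particular the glued measure has
    total mass 1.\<close>
  have d1: "distr \<gamma> \<pi>\<^sub>1 fst = \<pi>\<^sub>1"
  proof (rule measure_eqI)
    fix A assume "A \<in> sets (distr \<gamma> \<pi>\<^sub>1 fst)"
    then have A[measurable]: "A \<in> sets \<pi>\<^sub>1" by simp
    have "emeasure (distr \<gamma> \<pi>\<^sub>1 fst) A = (\<integral>\<^sup>+z. w z * indicator A (fst z) \<partial>(\<pi>\<^sub>1 \<Otimes>\<^sub>M \<pi>\<^sub>2))"
      using A fm(1) unfolding \<gamma>_def
      by (subst emeasure_distr) (auto simp: emeasure_density intro!: nn_integral_cong split: split_indicator)
    also have "\<dots> = (\<integral>\<^sup>+z1. (\<integral>\<^sup>+z2. w (z1, z2) * indicator A z1 \<partial>\<pi>\<^sub>2) \<partial>\<pi>\<^sub>1)"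
      by (subst p2.nn_integral_fst[symmetric]) auto
    also have "\<dots> = (\<integral>\<^sup>+z1. (\<integral>\<^sup>+z2. w (z1, z2) \<partial>\<pi>\<^sub>2) * indicator A z1 \<partial>\<pi>\<^sub>1)"
      by (intro nn_integral_cong nn_integral_multc) measurable
    also have "\<dots> = (\<integral>\<^sup>+z1. indicator A z1 \<partial>\<pi>\<^sub>1)"
      by (rule nn_integral_cong_AE, rule eventually_mono[OF int2], simp)
    finally show "emeasure (distr \<gamma> \<pi>\<^sub>1 fst) A = emeasure \<pi>\<^sub>1 A" by simp
  qed simp
  have d2: "distr \<gamma> \<pi>\<^sub>2 snd = \<pi>\<^sub>2"
  proof (rule measure_eqI)
    fix A assume "A \<in> sets (distr \<gamma> \<pi>\<^sub>2 snd)"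
    then have A[measurable]: "A \<in> sets \<pi>\<^sub>2" by simp
    have "emeasure (distr \<gamma> \<pi>\<^sub>2 snd) A = (\<integral>\<^sup>+z. w z * indicator A (snd z) \<partial>(\<pi>\<^sub>1 \<Otimes>\<^sub>M \<pi>\<^sub>2))"
      using A fm(2) unfolding \<gamma>_def
      by (subst emeasure_distr) (auto simp: emeasure_density intro!: nn_integral_cong split: split_indicator)
    also have "\<dots> = (\<integral>\<^sup>+z2. (\<integral>\<^sup>+z1. w (z1, z2) * indicator A z2 \<partial>\<pi>\<^sub>1) \<partial>\<pi>\<^sub>2)"
      by (subst p.nn_integral_snd[symmetric]) auto
    also have "\<dots> = (\<integral>\<^sup>+z2. (\<integral>\<^sup>+z1. w (z1, z2) \<partial>\<pi>\<^sub>1) * indicator A z2 \<partial>\<pi>\<^sub>2)"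
      by (intro nn_integral_cong nn_integral_multc) measurable
    also have "\<dots> = (\<integral>\<^sup>+z2. indicator A z2 \<partial>\<pi>\<^sub>2)"
      by (rule nn_integral_cong_AE, rule eventually_mono[OF int1], simp)
    finally show "emeasure (distr \<gamma> \<pi>\<^sub>2 snd) A = emeasure \<pi>\<^sub>2 A" by simp
  qed simp
  have "prob_space \<gamma>"
    by (rule prob_space_distrD[OF fm(1)]) (simp add: d1 p1.prob_space_axioms)
  then interpret g: prob_space \<gamma> .
  let ?x = "\<lambda>z :: ('a \<times> 'a) \<times> ('a \<times> 'a). fst (fst z)" and ?y = "\<lambda>z :: ('a \<times> 'a) \<times> ('a \<times> 'a). snd (fst z)"
  let ?y' = "\<lambda>z :: ('a \<times> 'a) \<times> ('a \<times> 'a). fst (snd z)" and ?z = "\<lambda>z :: ('a \<times> 'a) \<times> ('a \<times> 'a). snd (snd z)"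
  have L: "?x \<in> L2_rv \<gamma> \<gamma>" "?y \<in> L2_rv \<gamma> \<gamma>" "?y' \<in> L2_rv \<gamma> \<gamma>" "?z \<in> L2_rv \<gamma> \<gamma>"
    using L2_rv_distr[OF fm(1) m(1)] L2_rv_distr[OF fm(1) m(2)]
      L2_rv_distr[OF fm(2) m(3)] L2_rv_distr[OF fm(2) m(4)] d1 d2 c1(3,4) c2(3,4) by auto
  have dx: "distr \<gamma> borel ?x = \<mu>"
    using distr_distr[OF m(1) fm(1)] d1 c1(5) by (simp add: comp_def)
  have dz: "distr \<gamma> borel ?z = \<rho>"
    using distr_distr[OF m(4) fm(2)] d2 c2(6) by (simp add: comp_def)
  have "W2 \<mu> \<rho> \<le> l2n \<gamma> (\<lambda>v. ?x v - ?z v)"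
    using g.W2_distr_le[OF L(1,4)] dx dz by simp
  also have "\<dots> \<le> l2n \<gamma> (\<lambda>v. ?x v - ?y v) + l2n \<gamma> (\<lambda>v. ?y v - ?z v)"
    by (rule l2n_triangle[OF L(1,2,4)])
  also have "\<dots> \<le> l2n \<gamma> (\<lambda>v. ?x v - ?y v) + (l2n \<gamma> (\<lambda>v. ?y v - ?y' v) + l2n \<gamma> (\<lambda>v. ?y' v - ?z v))"
    using l2n_triangle[OF L(2,3,4)] by simp
  also have "l2n \<gamma> (\<lambda>v. ?x v - ?y v) = l2n \<pi>\<^sub>1 (\<lambda>z. fst z - snd z)"
    using l2n_distr[OF fm(1), of "\<lambda>z. fst z - snd z"] d1 by simp
  also have "l2n \<gamma> (\<lambda>v. ?y' v - ?z v) = l2n \<pi>\<^sub>2 (\<lambda>z. fst z - snd z)"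
    using l2n_distr[OF fm(2), of "\<lambda>z. fst z - snd z"] d2 by simp
  \<comment> \<open>The density vanishes unless the two middle points share a cell, so their
    discrepancy is at most \<open>d\<close>.\<close>
  also have "l2n \<gamma> (\<lambda>v. ?y v - ?y' v) \<le> l2n \<gamma> (\<lambda>_. d)"
  proof (rule l2n_mono[OF g.L2_rv_const])
    show "AE v in \<gamma>. norm (?y v - ?y' v) \<le> norm d"
      unfolding \<gamma>_def
      by (subst AE_density[OF wm]) (use cd d in \<open>auto simp: w_def intro!: AE_I2\<close>)
  qed
  also have "l2n \<gamma> (\<lambda>_. d) = d" using d by (simp add: l2n_def g.prob_space)
  finally show ?thesis by simp
qed

text \<open>Two near-optimal couplings and the diameter of the cells each receive a third of the
  slack.\<close>

lemma W2_triangle: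
  assumes P: "\<mu> \<in> P2" "\<nu> \<in> P2" "\<rho> \<in> P2"
  shows "W2 \<mu> \<rho> \<le> W2 \<mu> \<nu> + W2 \<nu> \<rho>"
proof (rule field_le_epsilon)
  fix e :: real assume "0 < e"
  then have e: "0 < e / 3" by simp
  obtain \<pi>\<^sub>1 where 1: "\<pi>\<^sub>1 \<in> couplings \<mu> \<nu>" "l2n \<pi>\<^sub>1 (\<lambda>z. fst z - snd z) < W2 \<mu> \<nu> + e / 3"
    by (rule W2_approx[OF P(1,2) e])
  obtain \<pi>\<^sub>2 where 2: "\<pi>\<^sub>2 \<in> couplings \<nu> \<rho>" "l2n \<pi>\<^sub>2 (\<lambda>z. fst z - snd z) < W2 \<nu> \<rho> + e / 3"
    by (rule W2_approx[OF P(2,3) e])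
  show "W2 \<mu> \<rho> \<le> W2 \<mu> \<nu> + W2 \<nu> \<rho> + e"
    using W2_triangle_aux[OF P e 1(1) 2(1)] 1(2) 2(2) by linarith
qed

text \<open>\<open>P2_borel\<close> is generated by the open sets of
  \<open>Metric_space.mtopology\<close>, and these are characterised by balls only once the metric
  axioms are established.\<close>

lemma Metric_space_W2: "Metric_space P2 W2"
  by (standard) (auto simp: W2_nonneg W2_commute W2_self W2_triangle intro: W2_eq_0_imp_eq)

lemma openin_W2_ball:
  assumes "openin (Metric_space.mtopology P2 W2) U" "\<mu> \<in> U"
  obtains r where "r > 0" "\<And>\<nu>. \<nu> \<in> P2 \<Longrightarrow> W2 \<mu> \<nu> < r \<Longrightarrow> \<nu> \<in> U"
proof -
  note ms = Metric_space_W2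
  obtain r where r: "r > 0" "Metric_space.mball P2 W2 \<mu> r \<subseteq> U" and "U \<subseteq> P2"
    using assms unfolding Metric_space.openin_mtopology[OF ms] by auto
  then have "\<mu> \<in> P2" using assms(2) by auto
  show ?thesis
    by (rule that[OF r(1)]) (use r(2) \<open>\<mu> \<in> P2\<close> in \<open>auto simp: Metric_space.mball_def[OF ms]\<close>)
qed

section \<open>Brownian increments\<close>

context brownian_setting
begin

lemma W_measurable [measurable]: "0 \<le> t \<Longrightarrow> W t \<in> borel_measurable M"
  using brownian by (simp add: brownian_motion_def)

lemma W_algebra_gen: "S \<subseteq> {0..} \<Longrightarrow>
    (\<Union>s\<in>S. {W s -` B \<inter> space M | B. B \<in> sets borel}) \<union> null_sets M \<subseteq> sets M"
  by (auto intro!: measurable_sets[OF W_measurable])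

lemma W_algebra_sets: "S \<subseteq> {0..} \<Longrightarrow> sets (W_algebra M W S) =
    sigma_sets (space M) ((\<Union>s\<in>S. {W s -` B \<inter> space M | B. B \<in> sets borel}) \<union> null_sets M)"
  unfolding W_algebra_def
  by (intro sets_measure_of order_trans[OF W_algebra_gen sets.space_closed]) auto

lemma space_W_algebra [simp]: "space (W_algebra M W S) = space M"
  by (simp add: W_algebra_def space_measure_of_conv)

lemma W_algebra_sub: "S \<subseteq> {0..} \<Longrightarrow> sets (W_algebra M W S) \<subseteq> sets M"
  unfolding W_algebra_sets by (intro sets.sigma_sets_subset W_algebra_gen) auto

lemma W_algebra_mono: "S \<subseteq> S' \<Longrightarrow> S' \<subseteq> {0..} \<Longrightarrow> sets (W_algebra M W S) \<subseteq> sets (W_algebra M W S')"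
  by (subst (1 2) W_algebra_sets) (auto intro!: sigma_sets_mono')

lemma W_algebra_measurable:
  assumes "S \<subseteq> {0..}" "u \<in> S"
  shows "W u \<in> borel_measurable (W_algebra M W S)"
proof (rule measurableI)
  fix A :: "(real^'m) set" assume "A \<in> sets borel"
  then show "W u -` A \<inter> space (W_algebra M W S) \<in> sets (W_algebra M W S)"
    using assms by (subst W_algebra_sets) (auto intro!: sigma_sets.Basic)
qed simp

lemma F_eq: "F t = sigma (space M) (sets G \<union> sets (W_algebra M W {0..t}))"
  by (simp add: filtration joint_filtration_def)

lemma F_gen: "sets G \<union> sets (W_algebra M W {0..t}) \<subseteq> sets M"
  using G_sub W_algebra_sub[of "{0..t}"] by (auto simp: subalgebra_def)

lemma sets_F: "sets (F t) = sigma_sets (space M) (sets G \<union> sets (W_algebra M W {0..t}))"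
  unfolding F_eq by (intro sets_measure_of order_trans[OF F_gen sets.space_closed])

lemma space_F [simp]: "space (F t) = space M"
  by (simp add: F_eq space_measure_of_conv)

lemma F_sub: "sets (F t) \<subseteq> sets M"
  unfolding sets_F by (intro sets.sigma_sets_subset F_gen)

lemma F_mono: "s \<le> t \<Longrightarrow> sets (F s) \<subseteq> sets (F t)"
  unfolding sets_F by (intro sigma_sets_mono' Un_mono W_algebra_mono) auto

lemma G_F: "sets G \<subseteq> sets (F t)"
  unfolding sets_F by (auto intro: sigma_sets.Basic)

lemma null_F: "N \<in> null_sets M \<Longrightarrow> N \<in> sets (F t)"
  unfolding sets_F by (intro sigma_sets.Basic UnI2, subst W_algebra_sets) (auto intro: sigma_sets.Basic)

lemma measurable_F_M: "X \<in> F t \<rightarrow>\<^sub>M N \<Longrightarrow> X \<in> M \<rightarrow>\<^sub>M N"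
  by (rule measurable_from_subalg[of M "F t"]) (auto simp: subalgebra_def dest: F_sub[THEN subsetD])

lemma measurable_F_mono: "s \<le> t \<Longrightarrow> X \<in> F s \<rightarrow>\<^sub>M N \<Longrightarrow> X \<in> F t \<rightarrow>\<^sub>M N"
  by (rule measurable_from_subalg[of "F t" "F s"]) (auto simp: subalgebra_def dest: F_mono[THEN subsetD])

lemma measurable_G_F: "X \<in> G \<rightarrow>\<^sub>M N \<Longrightarrow> X \<in> F t \<rightarrow>\<^sub>M N"
  by (rule measurable_from_subalg[of "F t" G])
     (use G_sub in \<open>auto intro: G_F[THEN subsetD] simp: subalgebra_def\<close>)

lemma W_measurable_F: "0 \<le> s \<Longrightarrow> s \<le> t \<Longrightarrow> W s \<in> borel_measurable (F t)"
  by (rule measurable_from_subalg[of "F t" "W_algebra M W {0..t}", OF _ W_algebra_measurable])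
     (auto simp: subalgebra_def sets_F)

text \<open>Each \<open>F t\<close> contains all null sets of the complete measure, so altering a
  variable on a null set keeps it measurable. Almost sure equations such as the terminal condition
  thereby yield measurability of their right-hand sides.\<close>

lemma F_measurable_AE:
  fixes X X' :: "'w \<Rightarrow> 'b::topological_space"
  assumes "X \<in> borel_measurable (F t)" "AE \<omega> in M. X \<omega> = X' \<omega>"
  shows "X' \<in> borel_measurable (F t)"
proof (rule measurableI)
  obtain N where N: "N \<in> null_sets M" "{\<omega>\<in>space M. X \<omega> \<noteq> X' \<omega>} \<subseteq> N"
    using assms(2) by (auto elim: AE_E simp: null_sets_def)
  fix A :: "'b set" assume A: "A \<in> sets borel"
  have c: "S \<in> null_sets M" if "S \<subseteq> N" for S
    using complete[OF that N(1)] N(1) emeasure_mono[OF that, of M] by (auto simp: null_sets_def)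
  have "X' -` A \<inter> space M = (X -` A \<inter> space M - (X -` A \<inter> space M \<inter> N)) \<union> (X' -` A \<inter> space M \<inter> N)"
    using N(2) by auto
  also have "\<dots> \<in> sets (F t)"
    using measurable_sets[OF assms(1) A] null_F[OF c[of "X -` A \<inter> space M \<inter> N"]]
      null_F[OF c[of "X' -` A \<inter> space M \<inter> N"]]
    by (intro sets.Un sets.Diff) auto
  finally show "X' -` A \<inter> space (F t) \<in> sets (F t)" by simp
qed simp

text \<open>The definition of Brownian motion speaks only of consecutive increments. On a sorted
  grid containing 0, \<open>s\<close> and \<open>J\<close>, the values at the times in
  \<open>J\<close> are partial sums of increments up to \<open>s\<close>, while one further
  increment leads from \<open>s\<close> to \<open>t\<close>.\<close>

lemma cylinder_indep:
  assumes st: "0 \<le> s" "s < t" and J: "finite J" "J \<subseteq> {0..s}"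
    and B: "\<And>u. u \<in> J \<Longrightarrow> B u \<in> sets borel" and C: "C \<in> sets borel"
  shows "prob ({\<omega>\<in>space M. \<forall>u\<in>J. W u \<omega> \<in> B u} \<inter> {\<omega>\<in>space M. W t \<omega> - W s \<omega> \<in> C})
    = prob {\<omega>\<in>space M. \<forall>u\<in>J. W u \<omega> \<in> B u} * prob {\<omega>\<in>space M. W t \<omega> - W s \<omega> \<in> C}"
proof -
  define K where "K = insert 0 (insert s J)"
  have K: "finite K" "K \<subseteq> {0..s}" "0 \<in> K" "s \<in> K" using J st by (auto simp: K_def)
  define L where "L = sorted_list_of_set K"
  define n where "n = length L"
  have L: "set L = K" "sorted_wrt (<) L" using K by (auto simp: L_def)
  have n: "0 < n" using L(1) K(3) by (auto simp: n_def)
  \<comment> \<open>Past the last grid point \<open>s\<close> the grid continues with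
    \<open>t\<close>, so the last of the \<open>n\<close> increments of \<open>r\<close> is
    \<open>W t - W s\<close>.\<close>
  define r where "r i = (if i < n then L ! i else t)" for i
  have LK: "L ! i \<in> K" if "i < n" for i using L(1) that by (metis n_def nth_mem)
  have Lless: "L ! i < L ! j" if "i < j" "j < n" for i j
    using L(2) that by (simp add: sorted_wrt_iff_nth_less n_def)
  have r0: "r 0 = 0"
  proof -
    obtain i where i: "i < n" "L ! i = 0" using L(1) K(3) by (metis in_set_conv_nth n_def)
    have "0 \<le> L ! 0" using LK[OF n] K(2) by auto
    then have "i = 0" using Lless[of 0 i] i by (cases i) auto
    then show ?thesis using i n by (simp add: r_def)
  qed
  have rn: "r (n - 1) = s"
  proof -
    obtain i where i: "i < n" "L ! i = s" using L(1) K(4) by (metis in_set_conv_nth n_def)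
    have "L ! (n - 1) \<le> s" using LK[of "n - 1"] n K(2) by auto
    then have "\<not> i < n - 1" using Lless[of i "n - 1"] i n by auto
    then have "i = n - 1" using i by linarith
    then show ?thesis using i n by (simp add: r_def)
  qed
  have rS: "r i < r (Suc i)" if "i < n" for i
  proof (cases "Suc i < n")
    case True then show ?thesis using Lless[of i "Suc i"] by (simp add: r_def)
  next
    case False
    then have "i = n - 1" using that by simp
    then show ?thesis using rn st n by (simp add: r_def)
  qed
  have rpos: "0 \<le> r i" for i using LK[of i] K(2) st by (auto simp: r_def)
  define D where "D i \<omega> = W (r (Suc i)) \<omega> - W (r i) \<omega>" for i \<omega>
  have ind: "indep_vars (\<lambda>_. borel) D {..<n}"
    using brownian r0 rS unfolding brownian_motion_def D_def by auto
  \<comment> \<open>Grid points inserted besides those of \<open>J\<close> carry no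
    condition.\<close>
  define B' where "B' i = (if L ! i \<in> J then B (L ! i) else UNIV)" for i
  have B'[measurable]: "B' i \<in> sets borel" for i using B by (auto simp: B'_def)
  note C[measurable]
  define f where "f x = (\<Prod>i<n. indicator (B' i) (\<Sum>j<i. x j) :: real)" for x :: "nat \<Rightarrow> real^'m"
  define g where "g x = (indicator C (x (n - 1)) :: real)" for x :: "nat \<Rightarrow> real^'m"
  have fm: "f \<in> borel_measurable (PiM {..<n - 1} (\<lambda>_. borel))"
  proof -
    have "(\<lambda>x. \<Sum>j<i. x j) \<in> borel_measurable (PiM {..<n - 1} (\<lambda>_. borel :: (real^'m) measure))" if "i < n" for i
      using that by (intro borel_measurable_sum measurable_component_singleton) auto
    then show ?thesis unfolding f_def
      by (intro borel_measurable_prod measurable_compose[OF _ borel_measurable_indicator[OF B']]) auto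
  qed
  have gm: "g \<in> borel_measurable (PiM {n - 1} (\<lambda>_. borel))"
    unfolding g_def by (intro measurable_compose[OF _ borel_measurable_indicator[OF C]] measurable_component_singleton) auto
  have "indep_var (PiM {..<n - 1} (\<lambda>_. borel)) (\<lambda>\<omega>. restrict (\<lambda>i. D i \<omega>) {..<n - 1})
      (PiM {n - 1} (\<lambda>_. borel)) (\<lambda>\<omega>. restrict (\<lambda>i. D i \<omega>) {n - 1})"
    by (rule indep_var_restrict[OF ind]) (use n in auto)
  from indep_var_compose[OF this fm gm]
  have iv: "indep_var borel (f \<circ> (\<lambda>\<omega>. restrict (\<lambda>i. D i \<omega>) {..<n - 1}))
      borel (g \<circ> (\<lambda>\<omega>. restrict (\<lambda>i. D i \<omega>) {n - 1}))" .
  let ?E = "{\<omega>\<in>space M. \<forall>u\<in>J. W u \<omega> \<in> B u}" and ?D = "{\<omega>\<in>space M. W t \<omega> - W s \<omega> \<in> C}"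
  have Wm: "{\<omega>\<in>space M. W u \<omega> \<in> B u} \<in> sets M" if "u \<in> J" for u
    using measurable_sets[OF W_measurable[of u] B[OF that]] J(2) that by (auto simp: vimage_def Int_def conj_commute)
  have Es: "?E \<in> sets M" using J(1) Wm by (intro sets.sets_Collect_finite_All) auto
  have Ds: "?D \<in> sets M"
  proof -
    have "(\<lambda>\<omega>. W t \<omega> - W s \<omega>) \<in> borel_measurable M"
      by (intro borel_measurable_diff W_measurable) (use st in auto)
    from measurable_sets[OF this C] show ?thesis by (simp add: vimage_def Int_def conj_commute)
  qed
  have tel: "(\<Sum>j<i. D j \<omega>) = W (r i) \<omega> - W 0 \<omega>" for i \<omega>
    unfolding D_def using sum_lessThan_telescope[of "\<lambda>i. W (r i) \<omega>" i] r0 by simp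
  have f1: "(f \<circ> (\<lambda>\<omega>. restrict (\<lambda>i. D i \<omega>) {..<n - 1})) \<omega> = (\<Prod>i<n. indicator (B' i) (W (r i) \<omega> - W 0 \<omega>))" for \<omega>
  proof -
    have "(\<Sum>j<i. restrict (\<lambda>i. D i \<omega>) {..<n - 1} j) = W (r i) \<omega> - W 0 \<omega>" if "i < n" for i
      unfolding tel[symmetric] using that by (intro sum.cong) auto
    then show ?thesis unfolding f_def comp_def by (intro prod.cong) auto
  qed
  have g1: "(g \<circ> (\<lambda>\<omega>. restrict (\<lambda>i. D i \<omega>) {n - 1})) \<omega> = indicator ?D \<omega>" if "\<omega> \<in> space M" for \<omega>
    using that n rn by (auto simp: g_def D_def r_def indicator_def)
  have EB: "(\<Prod>i<n. indicator (B' i) (W (r i) \<omega>)) = (indicator ?E \<omega> :: real)" if ws: "\<omega> \<in> space M" for \<omega>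
  proof (cases "\<omega> \<in> ?E")
    case True
    then have "W (r i) \<omega> \<in> B' i" if "i < n" for i
      using that ws by (auto simp: B'_def r_def)
    then show ?thesis using True by simp
  next
    case False
    then obtain u where u: "u \<in> J" "W u \<omega> \<notin> B u" using ws by auto
    then obtain i where "i < n" "L ! i = u" using L(1) by (metis in_set_conv_nth n_def K_def insertCI)
    then have "indicator (B' i) (W (r i) \<omega>) = (0::real)" "i < n" using u by (auto simp: B'_def r_def)
    then have "(\<Prod>i<n. indicator (B' i) (W (r i) \<omega>)) = (0::real)" by (intro prod_zero) auto
    then show ?thesis using False by simp
  qed
  \<comment> \<open>The partial sums recover \<open>W u - W 0\<close>, and the path starts at 0 only
    almost surely; hence the cylinder is recovered only almost everywhere.\<close>
  have W0: "AE \<omega> in M. W 0 \<omega> = 0" using brownian by (simp add: brownian_motion_def)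
  have f2: "AE \<omega> in M. (f \<circ> (\<lambda>\<omega>. restrict (\<lambda>i. D i \<omega>) {..<n - 1})) \<omega> = indicator ?E \<omega>"
    using W0 AE_space by eventually_elim (simp only: f1 diff_0_right EB)
  have g2: "AE \<omega> in M. (g \<circ> (\<lambda>\<omega>. restrict (\<lambda>i. D i \<omega>) {n - 1})) \<omega> = indicator ?D \<omega>"
    using AE_space by eventually_elim (rule g1)
  have fr: "random_variable borel (f \<circ> (\<lambda>\<omega>. restrict (\<lambda>i. D i \<omega>) {..<n - 1}))"
    and gr: "random_variable borel (g \<circ> (\<lambda>\<omega>. restrict (\<lambda>i. D i \<omega>) {n - 1}))"
    using iv by (auto simp: indep_var_eq)
  let ?f = "f \<circ> (\<lambda>\<omega>. restrict (\<lambda>i. D i \<omega>) {..<n - 1})" and ?g = "g \<circ> (\<lambda>\<omega>. restrict (\<lambda>i. D i \<omega>) {n - 1})"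
  have "integrable M ?f"
    by (rule integrable_const_bound[OF _ fr, where B = 1])
       (use f2 in \<open>eventually_elim, auto simp: indicator_def\<close>)
  moreover have "integrable M ?g"
    by (rule integrable_const_bound[OF _ gr, where B = 1])
       (use g2 in \<open>eventually_elim, auto simp: indicator_def\<close>)
  ultimately have "(\<integral>\<omega>. ?f \<omega> * ?g \<omega> \<partial>M) = (\<integral>\<omega>. ?f \<omega> \<partial>M) * (\<integral>\<omega>. ?g \<omega> \<partial>M)"
    by (rule indep_var_lebesgue_integral[OF iv])
  moreover have "(\<integral>\<omega>. ?f \<omega> * ?g \<omega> \<partial>M) = (\<integral>\<omega>. indicator (?E \<inter> ?D) \<omega> \<partial>M)"
  proof (rule integral_cong_AE)
    show "(\<lambda>\<omega>. ?f \<omega> * ?g \<omega>) \<in> borel_measurable M" by (rule borel_measurable_times[OF fr gr])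
    show "indicator (?E \<inter> ?D) \<in> borel_measurable M" using Es Ds by auto
    show "AE \<omega> in M. ?f \<omega> * ?g \<omega> = indicator (?E \<inter> ?D) \<omega>"
      using f2 g2 by eventually_elim (simp add: indicator_inter_arith)
  qed
  moreover have "(\<integral>\<omega>. ?f \<omega> \<partial>M) = (\<integral>\<omega>. indicator ?E \<omega> \<partial>M)"
    by (rule integral_cong_AE[OF fr _ f2]) (use Es in simp)
  moreover have "(\<integral>\<omega>. ?g \<omega> \<partial>M) = (\<integral>\<omega>. indicator ?D \<omega> \<partial>M)"
    by (rule integral_cong_AE[OF gr _ g2]) (use Ds in simp)
  ultimately show ?thesis using Es Ds by (simp add: Int_absorb2 sets.sets_into_space)
qed

text \<open>Two rounds of the pi-lambda argument: cylinders and null sets generate the past of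
  \<open>W\<close>, and intersections of its events with events of \<open>G\<close> generate
  \<open>F s\<close>. In the second round \<open>G\<close> is independent of past and increment
  jointly, because it is independent of the whole path.\<close>

lemma increment_indep_F:
  assumes st: "0 \<le> s" "s < t"
  shows "indep_set (sets (F s)) {{\<omega>\<in>space M. W t \<omega> - W s \<omega> \<in> C} | C. C \<in> sets borel}"
proof -
  \<comment> \<open>The null sets belong to the generator because the filtration is completed;
    intersections with null sets are null, so stability under intersection survives.\<close>
  define E where "E = {{\<omega>\<in>space M. \<forall>u\<in>J. W u \<omega> \<in> B u} | J B.
    finite J \<and> J \<subseteq> {0..s} \<and> (\<forall>u. B u \<in> sets (borel :: (real^'m) measure))} \<union> null_sets M"
  define D where "D = {{\<omega>\<in>space M. W t \<omega> - W s \<omega> \<in> C} | C. C \<in> sets (borel :: (real^'m) measure)}"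
  have WtWs: "(\<lambda>\<omega>. W t \<omega> - W s \<omega>) \<in> borel_measurable (W_algebra M W {0..})"
    by (intro borel_measurable_diff W_algebra_measurable) (use st in auto)
  have DW: "D \<subseteq> sets (W_algebra M W {0..})"
    using measurable_sets[OF WtWs] by (auto simp: D_def vimage_def Int_def conj_commute)
  then have DM: "D \<subseteq> sets M" using W_algebra_sub[of "{0..}"] by auto
  have Wm: "{\<omega>\<in>space M. W u \<omega> \<in> B u} \<in> sets M" if "0 \<le> u" "B u \<in> sets borel" for u B
    using measurable_sets[OF W_measurable[of u] that(2)] that by (auto simp: vimage_def Int_def conj_commute)
  have EM: "E \<subseteq> sets M"
    unfolding E_def by (auto intro!: sets.sets_Collect_finite_All Wm)
  have DI: "Int_stable D"
  proof (rule Int_stableI)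
    fix a b assume "a \<in> D" "b \<in> D"
    then obtain C C' where "C \<in> sets borel" "C' \<in> sets borel"
      "a = {\<omega>\<in>space M. W t \<omega> - W s \<omega> \<in> C}" "b = {\<omega>\<in>space M. W t \<omega> - W s \<omega> \<in> C'}"
      by (auto simp: D_def)
    then have "a \<inter> b = {\<omega>\<in>space M. W t \<omega> - W s \<omega> \<in> C \<inter> C'}" "C \<inter> C' \<in> sets borel" by auto
    then show "a \<inter> b \<in> D" unfolding D_def by blast
  qed
  have EI: "Int_stable E"
  proof (rule Int_stableI)
    fix a b assume a: "a \<in> E" and b: "b \<in> E"
    show "a \<inter> b \<in> E"
    proof (cases "a \<in> null_sets M \<or> b \<in> null_sets M")
      case True
      then have "a \<inter> b \<in> null_sets M" using a b EM by (auto intro: null_set_Int1 null_set_Int2)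
      then show ?thesis by (simp add: E_def)
    next
      case False
      then obtain J B J' B' where *: "finite J" "J \<subseteq> {0..s}" "\<forall>u. B u \<in> sets (borel :: (real^'m) measure)"
          "a = {\<omega>\<in>space M. \<forall>u\<in>J. W u \<omega> \<in> B u}"
          and k2: "finite J'" "J' \<subseteq> {0..s}" "\<forall>u. B' u \<in> sets (borel :: (real^'m) measure)"
          "b = {\<omega>\<in>space M. \<forall>u\<in>J'. W u \<omega> \<in> B' u}"
        using a b unfolding E_def by blast
      let ?B = "\<lambda>u. (if u \<in> J then B u else UNIV) \<inter> (if u \<in> J' then B' u else UNIV)"
      have "a \<inter> b = {\<omega>\<in>space M. \<forall>u\<in>J \<union> J'. W u \<omega> \<in> ?B u}" using *(4) k2(4) by auto
      moreover have "\<forall>u. ?B u \<in> sets borel" using *(3) k2(3) by auto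
      moreover have "finite (J \<union> J')" "J \<union> J' \<subseteq> {0..s}" using * k2 by auto
      ultimately have "\<exists>J B. a \<inter> b = {\<omega>\<in>space M. \<forall>u\<in>J. W u \<omega> \<in> B u} \<and> finite J \<and> J \<subseteq> {0..s}
          \<and> (\<forall>u. B u \<in> sets (borel :: (real^'m) measure))"
        by (intro exI[of _ "J \<union> J'"] exI[of _ ?B] conjI) assumption+
      then show ?thesis unfolding E_def by (intro UnI1 CollectI)
    qed
  qed
  have "indep_set E D"
  proof (rule indep_setI[OF EM DM])
    fix a b assume a: "a \<in> E" and b: "b \<in> D"
    show "prob (a \<inter> b) = prob a * prob b"
    proof (cases "a \<in> null_sets M")
      case True
      then have "a \<inter> b \<in> null_sets M" using b DM by (auto intro: null_set_Int2)
      then show ?thesis using True by (simp add: measure_eq_emeasure_eq_ennreal[of 0] null_setsD1)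
    next
      case False
      then show ?thesis using a b cylinder_indep[OF st] unfolding E_def D_def by blast
    qed
  qed
  from indep_set_sigma_sets[OF this EI DI]
  have i1: "indep_set (sigma_sets (space M) E) (sigma_sets (space M) D)" .
  have WE: "sets (W_algebra M W {0..s}) \<subseteq> sigma_sets (space M) E"
  proof -
    have "W u -` B \<inter> space M \<in> E" if "u \<in> {0..s}" "B \<in> sets borel" for u B
    proof -
      have "W u -` B \<inter> space M = {\<omega>\<in>space M. \<forall>u\<in>{u}. W u \<omega> \<in> (\<lambda>_. B) u}" by auto
      then show ?thesis unfolding E_def using that
        by (intro UnI1 CollectI exI[of _ "{u}"] exI[of _ "\<lambda>_. B"]) auto
    qed
    moreover have "null_sets M \<subseteq> E" by (simp add: E_def)
    ultimately have "(\<Union>u\<in>{0..s}. {W u -` B \<inter> space M |B. B \<in> sets borel}) \<union> null_sets M \<subseteq> E"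
      by blast
    then show ?thesis by (subst W_algebra_sets) (auto intro!: sigma_sets_mono')
  qed
  define H where "H = {g \<inter> w | g w. g \<in> sets G \<and> w \<in> sets (W_algebra M W {0..s})}"
  have GM: "sets G \<subseteq> sets M" "space G = space M" using G_sub by (auto simp: subalgebra_def)
  have HM: "H \<subseteq> sets M" using GM W_algebra_sub[of "{0..s}"] by (auto simp: H_def)
  have HI: "Int_stable H"
  proof (rule Int_stableI)
    fix a b assume "a \<in> H" "b \<in> H"
    then obtain g w g' w' where *: "g \<in> sets G" "w \<in> sets (W_algebra M W {0..s})" "a = g \<inter> w"
      "g' \<in> sets G" "w' \<in> sets (W_algebra M W {0..s})" "b = g' \<inter> w'" by (auto simp: H_def)
    then have "a \<inter> b = (g \<inter> g') \<inter> (w \<inter> w')" by auto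
    then show "a \<inter> b \<in> H" unfolding H_def using * by blast
  qed
  have "indep_set H D"
  proof (rule indep_setI[OF HM DM])
    fix a b assume "a \<in> H" and b: "b \<in> D"
    then obtain g w where *: "g \<in> sets G" "w \<in> sets (W_algebra M W {0..s})" "a = g \<inter> w"
      by (auto simp: H_def)
    have w: "w \<in> sets (W_algebra M W {0..})" using *(2) W_algebra_mono[of "{0..s}" "{0..}"] by auto
    have "prob (a \<inter> b) = prob (g \<inter> (w \<inter> b))" using * by (simp add: Int_assoc)
    also have "\<dots> = prob g * prob (w \<inter> b)"
      by (rule indep_setD[OF G_indep *(1)]) (use w b DW in auto)
    also have "prob (w \<inter> b) = prob w * prob b"
      by (rule indep_setD[OF i1]) (use *(2) WE b in auto)
    also have "prob g * (prob w * prob b) = prob (g \<inter> w) * prob b"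
      using indep_setD[OF G_indep *(1) w] by simp
    finally show "prob (a \<inter> b) = prob a * prob b" using * by simp
  qed
  from indep_set_sigma_sets[OF this HI DI]
  have i2: "indep_set (sigma_sets (space M) H) (sigma_sets (space M) D)" .
  have "sets G \<union> sets (W_algebra M W {0..s}) \<subseteq> H"
  proof safe
    fix g assume g: "g \<in> sets G"
    have "g = g \<inter> space (W_algebra M W {0..s})" using sets.sets_into_space[OF g] GM by auto
    then show "g \<in> H" unfolding H_def using g by blast
  next
    fix w assume w: "w \<in> sets (W_algebra M W {0..s})"
    have "w = space G \<inter> w" using sets.sets_into_space[OF w] GM by auto
    then show "w \<in> H" unfolding H_def using w by blast
  qed
  then have "sets (F s) \<subseteq> sigma_sets (space M) H" unfolding sets_F by (rule sigma_sets_mono')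
  then have "indep_set (sets (F s)) D"
    by (intro indep_setI F_sub DM indep_setD[OF i2]) auto
  then show ?thesis by (simp add: D_def)
qed

text \<open>The free function \<open>h\<close> serves for coordinates of the increment and for
  products of two coordinates, that is, for mean and covariance.\<close>

lemma increment_indep_var:
  assumes st: "0 \<le> s" "s < t" and X: "X \<in> borel_measurable (F s)" and h: "h \<in> borel_measurable borel"
  shows "indep_var borel X borel (\<lambda>\<omega>. h (W t \<omega> - W s \<omega>))"
  unfolding indep_var_eq
proof (intro conjI indep_set_sigma_sets)
  have D: "(\<lambda>\<omega>. W t \<omega> - W s \<omega>) \<in> borel_measurable M"
    using st by (intro borel_measurable_diff W_measurable) auto
  show hD: "(\<lambda>\<omega>. h (W t \<omega> - W s \<omega>)) \<in> borel_measurable M" by (rule measurable_compose[OF D h])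
  show X': "X \<in> borel_measurable M" by (rule measurable_F_M[OF X])
  show "indep_set {X -` A \<inter> space M |A. A \<in> sets borel} {(\<lambda>\<omega>. h (W t \<omega> - W s \<omega>)) -` A \<inter> space M |A. A \<in> sets borel}"
  proof (rule indep_setI)
    fix a b assume "a \<in> {X -` A \<inter> space M |A. A \<in> sets borel}"
      and "b \<in> {(\<lambda>\<omega>. h (W t \<omega> - W s \<omega>)) -` A \<inter> space M |A. A \<in> sets borel}"
    then obtain A A' where *: "A \<in> sets borel" "A' \<in> sets borel" "a = X -` A \<inter> space M"
      "b = (\<lambda>\<omega>. h (W t \<omega> - W s \<omega>)) -` A' \<inter> space M" by auto
    have "b = {\<omega>\<in>space M. W t \<omega> - W s \<omega> \<in> h -` A'}" using * by auto
    moreover have "h -` A' \<in> sets borel" using measurable_sets[OF h *(2)] by simp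
    moreover have "a \<in> sets (F s)" using measurable_sets[OF X *(1)] * by simp
    ultimately show "prob (a \<inter> b) = prob a * prob b"
      by (intro indep_setD[OF increment_indep_F[OF st]]) auto
  qed (use X' hD in auto)
qed (auto intro!: Int_stableI simp: vimage_Int[symmetric] Int_assoc, (metis (no_types, lifting) Int_assoc Int_left_absorb inf_commute sets.Int vimage_Int)+)

lemma increment_component:
  assumes st: "0 \<le> s" "s < t"
  shows "(\<lambda>\<omega>. (W t \<omega> - W s \<omega>) $ i) \<in> L2_rv M M" "(\<integral>\<omega>. (W t \<omega> - W s \<omega>) $ i \<partial>M) = 0"
    "(\<integral>\<omega>. ((W t \<omega> - W s \<omega>) $ i) * ((W t \<omega> - W s \<omega>) $ j) \<partial>M) = (if i = j then t - s else 0)"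
proof -
  let ?X = "\<lambda>i \<omega>. (W t \<omega> - W s \<omega>) $ i"
  let ?d = "normal_density 0 (sqrt (t - s))"
  have D: "distributed M lborel (?X i) ?d" and iv: "indep_vars (\<lambda>_. borel) ?X UNIV" for i
    using brownian st by (auto simp: brownian_motion_def)
  have pos: "0 < sqrt (t - s)" using st by simp
  have m: "?X i \<in> borel_measurable M" for i using distributed_measurable[OF D[of i]] by simp
  have L2: "?X i \<in> L2_rv M M" and E2: "(\<integral>\<omega>. (?X i \<omega>)\<^sup>2 \<partial>M) = t - s" for i
  proof -
    have "integrable lborel (\<lambda>x. ?d x * (x - 0)\<^sup>2)" by (rule integrable_normal_moment[OF pos])
    then have "integrable M (\<lambda>\<omega>. (?X i \<omega>)\<^sup>2)"
      by (subst distributed_integrable[OF D[of i], symmetric]) auto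
    then show "?X i \<in> L2_rv M M" using m by (auto simp: L2_rv_def)
    have "(\<integral>\<omega>. (?X i \<omega>)\<^sup>2 \<partial>M) = (\<integral>x. ?d x * (x - 0)^(2 * 1) \<partial>lborel)"
      by (subst distributed_integral[OF D[of i], symmetric]) auto
    also have "\<dots> = t - s"
      using st by (subst integral_normal_moment_even[OF pos]) (simp add: power_divide)
    finally show "(\<integral>\<omega>. (?X i \<omega>)\<^sup>2 \<partial>M) = t - s" .
  qed
  have E1: "(\<integral>\<omega>. ?X i \<omega> \<partial>M) = 0" for i
  proof -
    have "(\<integral>\<omega>. ?X i \<omega> \<partial>M) = (\<integral>x. ?d x * x \<partial>lborel)"
      by (subst distributed_integral[OF D[of i], symmetric]) auto
    also have "\<dots> = 0" using integral_normal_moment_nz_1[OF pos, of 0] by simp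
    finally show ?thesis .
  qed
  show "?X i \<in> L2_rv M M" "(\<integral>\<omega>. ?X i \<omega> \<partial>M) = 0" by fact+
  show "(\<integral>\<omega>. ?X i \<omega> * ?X j \<omega> \<partial>M) = (if i = j then t - s else 0)"
  proof (cases "i = j")
    case True then show ?thesis using E2[of i] by (simp add: power2_eq_square)
  next
    case False
    have "indep_var (PiM {i} (\<lambda>_. borel)) (\<lambda>\<omega>. restrict (\<lambda>i. ?X i \<omega>) {i})
       (PiM {j} (\<lambda>_. borel)) (\<lambda>\<omega>. restrict (\<lambda>i. ?X i \<omega>) {j})"
      by (rule indep_var_restrict[OF iv]) (use False in auto)
    from indep_var_compose[OF this measurable_component_singleton measurable_component_singleton]
    have "indep_var borel (?X i) borel (?X j)" by (auto simp: comp_def)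
    from indep_var_lebesgue_integral[OF this L2_rv_integrable[OF L2] L2_rv_integrable[OF L2]]
    show ?thesis using E1 False by simp
  qed
qed

end

section \<open>Isometry and martingale property of the Ito integral\<close>

lemma matrix_vector_mult_component: "(A *v x) $ i = A $ i \<bullet> (x :: real^'m)"
  by (simp add: matrix_vector_mult_def inner_vec_def)

text \<open>The matrix norm is the Frobenius norm; Cauchy-Schwarz in each row shows that it
  dominates the operator norm.\<close>

lemma norm_matrix_vector_mult_le: "norm (A *v x) \<le> norm A * norm (x :: real^'m)"
proof (rule power2_le_imp_le)
  have "(norm (A *v x))\<^sup>2 = (\<Sum>i\<in>UNIV. (A $ i \<bullet> x)\<^sup>2)"
    by (simp add: norm_vec_def L2_set_def sum_nonneg matrix_vector_mult_component)
  also have "\<dots> \<le> (\<Sum>i\<in>UNIV. (norm (A $ i))\<^sup>2 * (norm x)\<^sup>2)"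
  proof (rule sum_mono)
    fix i
    have "\<bar>A $ i \<bullet> x\<bar>\<^sup>2 \<le> (norm (A $ i) * norm x)\<^sup>2"
      by (intro power_mono Cauchy_Schwarz_ineq2) auto
    then show "(A $ i \<bullet> x)\<^sup>2 \<le> (norm (A $ i))\<^sup>2 * (norm x)\<^sup>2" by (simp add: power_mult_distrib)
  qed
  also have "\<dots> = (norm A * norm x)\<^sup>2"
    by (simp add: norm_vec_def[of A] L2_set_def sum_nonneg power_mult_distrib sum_distrib_right)
  finally show "(norm (A *v x))\<^sup>2 \<le> (norm A * norm x)\<^sup>2" .
qed simp

lemma inner_matrix_vector_mult:
  fixes A B :: "real^'m^'n"
  shows "(A *v x) \<bullet> (B *v y) = (\<Sum>i\<in>UNIV. \<Sum>j\<in>UNIV. \<Sum>k\<in>UNIV. A $ i $ j * B $ i $ k * (x $ j * y $ k))"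
  unfolding matrix_vector_mult_def
  by (simp add: inner_vec_def sum_product mult_ac)

lemma inner_matrix: "A \<bullet> B = (\<Sum>i\<in>UNIV. \<Sum>j\<in>UNIV. A $ i $ j * (B::real^'m^'n) $ i $ j)"
  by (simp add: inner_vec_def)

lemma borel_measurable_vec_nth2:
  assumes "\<theta> \<in> borel_measurable N"
  shows "(\<lambda>\<omega>. (\<theta> \<omega> :: real^'m^'n) $ i $ j) \<in> borel_measurable N"
proof -
  have "(\<lambda>A :: real^'m^'n. A $ i $ j) \<in> borel_measurable borel"
    by (intro borel_measurable_continuous_onI continuous_intros)
  from measurable_compose[OF assms this] show ?thesis .
qed

lemma borel_measurable_vec_nth1:
  assumes "\<theta> \<in> borel_measurable N"
  shows "(\<lambda>\<omega>. (\<theta> \<omega> :: ('b::euclidean_space)^'n) $ i) \<in> borel_measurable N"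
proof -
  have "(\<lambda>A :: 'b^'n. A $ i) \<in> borel_measurable borel"
    by (intro borel_measurable_continuous_onI continuous_intros)
  from measurable_compose[OF assms this] show ?thesis .
qed

lemma borel_measurable_matrix_vector_mult:
  assumes "\<theta> \<in> borel_measurable N" "x \<in> borel_measurable N"
  shows "(\<lambda>\<omega>. (\<theta> \<omega> :: real^'m^'n) *v x \<omega>) \<in> borel_measurable N"
proof (rule borel_measurable_continuous_Pair[OF assms, where H = "\<lambda>A x. A *v x"])
  show "continuous_on UNIV (\<lambda>z :: (real^'m^'n) \<times> (real^'m). fst z *v snd z)"
    unfolding matrix_vector_mult_def by (intro continuous_intros)
qed

definition bounded_on_space :: "'w measure \<Rightarrow> ('w \<Rightarrow> 'b::real_normed_vector) \<Rightarrow> bool" where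
  "bounded_on_space M \<theta> \<longleftrightarrow> (\<exists>C. \<forall>\<omega>\<in>space M. norm (\<theta> \<omega>) \<le> C)"

context brownian_setting
begin

lemma bounded_L2:
  fixes \<theta> :: "'w \<Rightarrow> 'b::euclidean_space"
  assumes "\<theta> \<in> borel_measurable M" "bounded_on_space M \<theta>"
  shows "\<theta> \<in> L2_rv M M"
proof -
  obtain C where C: "\<forall>\<omega>\<in>space M. norm (\<theta> \<omega>) \<le> C" using assms(2) by (auto simp: bounded_on_space_def)
  show ?thesis
    by (rule L2_rv_norm_le[OF assms(1) L2_rv_const[of "C :: real"]]) (use C in \<open>auto intro!: AE_I2\<close>)
qed

lemma increment_L2:
  assumes "0 \<le> s" "s \<le> t"
  shows "(\<lambda>\<omega>. W t \<omega> - W s \<omega>) \<in> L2_rv M M"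
proof (cases "s = t")
  case False
  with assms have st: "0 \<le> s" "s < t" by auto
  show ?thesis
  proof (rule L2_rvI)
    show "(\<lambda>\<omega>. W t \<omega> - W s \<omega>) \<in> borel_measurable M"
      by (intro borel_measurable_diff W_measurable) (use assms in auto)
    have "(norm (W t \<omega> - W s \<omega>))\<^sup>2 = (\<Sum>i\<in>UNIV. (norm ((W t \<omega> - W s \<omega>) $ i))\<^sup>2)" for \<omega>
      by (simp add: norm_vec_def L2_set_def sum_nonneg)
    then show "integrable M (\<lambda>\<omega>. (norm (W t \<omega> - W s \<omega>))\<^sup>2)"
      using L2_rvD(2)[OF increment_component(1)[OF st]] by simp
  qed
qed simp

lemma increment_mean_zero:
  fixes X :: "'w \<Rightarrow> real"
  assumes "0 \<le> s" "s < t" "X \<in> borel_measurable (F s)" "integrable M X"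
  shows "integrable M (\<lambda>\<omega>. X \<omega> * (W t \<omega> - W s \<omega>) $ j)" "(\<integral>\<omega>. X \<omega> * (W t \<omega> - W s \<omega>) $ j \<partial>M) = 0"
proof -
  have "(\<lambda>x :: real^'m. x $ j) \<in> borel_measurable borel"
    by (intro borel_measurable_continuous_onI continuous_intros)
  from increment_indep_var[OF assms(1-3) this]
  have iv: "indep_var borel X borel (\<lambda>\<omega>. (W t \<omega> - W s \<omega>) $ j)" .
  note i = L2_rv_integrable[OF increment_component(1)[OF assms(1,2), of j]]
  show "integrable M (\<lambda>\<omega>. X \<omega> * (W t \<omega> - W s \<omega>) $ j)"
    by (rule indep_var_integrable[OF iv assms(4) i])
  show "(\<integral>\<omega>. X \<omega> * (W t \<omega> - W s \<omega>) $ j \<partial>M) = 0"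
    using indep_var_lebesgue_integral[OF iv assms(4) i] increment_component(2)[OF assms(1,2), of j] by simp
qed

lemma increment_covariance:
  fixes X :: "'w \<Rightarrow> real"
  assumes "0 \<le> s" "s < t" "X \<in> borel_measurable (F s)" "integrable M X"
  shows "integrable M (\<lambda>\<omega>. X \<omega> * ((W t \<omega> - W s \<omega>) $ j * (W t \<omega> - W s \<omega>) $ k))"
    "(\<integral>\<omega>. X \<omega> * ((W t \<omega> - W s \<omega>) $ j * (W t \<omega> - W s \<omega>) $ k) \<partial>M) = (if j = k then t - s else 0) * (\<integral>\<omega>. X \<omega> \<partial>M)"
proof -
  have "(\<lambda>x :: real^'m. x $ j * x $ k) \<in> borel_measurable borel"
    by (intro borel_measurable_continuous_onI continuous_intros)
  from increment_indep_var[OF assms(1-3) this]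
  have iv: "indep_var borel X borel (\<lambda>\<omega>. (W t \<omega> - W s \<omega>) $ j * (W t \<omega> - W s \<omega>) $ k)" .
  have i: "integrable M (\<lambda>\<omega>. (W t \<omega> - W s \<omega>) $ j * (W t \<omega> - W s \<omega>) $ k)"
    using L2_inner_integrable[OF increment_component(1)[OF assms(1,2), of j] increment_component(1)[OF assms(1,2), of k]]
    by simp
  show "integrable M (\<lambda>\<omega>. X \<omega> * ((W t \<omega> - W s \<omega>) $ j * (W t \<omega> - W s \<omega>) $ k))"
    by (rule indep_var_integrable[OF iv assms(4) i])
  show "(\<integral>\<omega>. X \<omega> * ((W t \<omega> - W s \<omega>) $ j * (W t \<omega> - W s \<omega>) $ k) \<partial>M) = (if j = k then t - s else 0) * (\<integral>\<omega>. X \<omega> \<partial>M)"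
    using indep_var_lebesgue_integral[OF iv assms(4) i] increment_component(3)[OF assms(1,2), of j k] by simp
qed

lemma component_L2:
  fixes \<zeta> :: "'w \<Rightarrow> ('b::euclidean_space)^'n"
  assumes "\<zeta> \<in> L2_rv M M"
  shows "(\<lambda>\<omega>. \<zeta> \<omega> $ i) \<in> L2_rv M M"
  by (rule L2_rv_norm_le[OF _ assms])
     (use L2_rvD(1)[OF assms] in \<open>auto intro: borel_measurable_vec_nth1 intro!: AE_I2 component_le_norm_cart simp: Finite_Cartesian_Product.norm_nth_le\<close>)

lemma bounded_component:
  assumes "bounded_on_space M (\<theta> :: 'w \<Rightarrow> real^'m^'n)"
  shows "bounded_on_space M (\<lambda>\<omega>. \<theta> \<omega> $ i $ j)"
  using assms unfolding bounded_on_space_def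
  by (meson Finite_Cartesian_Product.norm_nth_le order_trans)

lemma increment_mult_L2:
  fixes \<theta> :: "'w \<Rightarrow> real^'m^'n"
  assumes "0 \<le> s" "s \<le> t" "\<theta> \<in> borel_measurable M" "bounded_on_space M \<theta>"
  shows "(\<lambda>\<omega>. \<theta> \<omega> *v (W t \<omega> - W s \<omega>)) \<in> L2_rv M M"
proof -
  obtain C where C: "\<forall>\<omega>\<in>space M. norm (\<theta> \<omega>) \<le> C" using assms(4) by (auto simp: bounded_on_space_def)
  note d = increment_L2[OF assms(1,2)]
  show ?thesis
  proof (rule L2_rv_norm_le[OF _ L2_rv_scaleR[OF d, of C]])
    show "(\<lambda>\<omega>. \<theta> \<omega> *v (W t \<omega> - W s \<omega>)) \<in> borel_measurable M"
      by (intro borel_measurable_matrix_vector_mult assms L2_rvD(1)[OF d])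
    show "AE \<omega> in M. norm (\<theta> \<omega> *v (W t \<omega> - W s \<omega>)) \<le> norm (C *\<^sub>R (W t \<omega> - W s \<omega>))"
    proof (rule AE_I2)
      fix \<omega> assume "\<omega> \<in> space M"
      then have "norm (\<theta> \<omega>) \<le> \<bar>C\<bar>" using C by fastforce
      then have "norm (\<theta> \<omega>) * norm (W t \<omega> - W s \<omega>) \<le> \<bar>C\<bar> * norm (W t \<omega> - W s \<omega>)"
        by (intro mult_right_mono) auto
      then show "norm (\<theta> \<omega> *v (W t \<omega> - W s \<omega>)) \<le> norm (C *\<^sub>R (W t \<omega> - W s \<omega>))"
        using norm_matrix_vector_mult_le[of "\<theta> \<omega>" "W t \<omega> - W s \<omega>"] by simp
    qed
  qed
qed

text \<open>The martingale property in its smallest form: entries of the matrix and of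
  \<open>\<zeta>\<close> combine to factors known at time \<open>s\<close>, hence independent of the
  centred increment.\<close>

lemma increment_orthogonal:
  fixes \<theta> :: "'w \<Rightarrow> real^'m^'n"
  assumes st: "0 \<le> s" "s \<le> t" and \<theta>: "\<theta> \<in> borel_measurable (F s)" "bounded_on_space M \<theta>"
    and \<zeta>: "\<zeta> \<in> borel_measurable (F s)" "\<zeta> \<in> L2_rv M M"
  shows "(\<integral>\<omega>. \<zeta> \<omega> \<bullet> (\<theta> \<omega> *v (W t \<omega> - W s \<omega>)) \<partial>M) = 0"
proof (cases "s = t")
  case False
  then have "s < t" using st by simp
  have Xm: "(\<lambda>\<omega>. \<zeta> \<omega> $ i * \<theta> \<omega> $ i $ j) \<in> borel_measurable (F s)" for i j
    by (intro borel_measurable_times borel_measurable_vec_nth1 borel_measurable_vec_nth2 \<zeta> \<theta>)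
  have Xi: "integrable M (\<lambda>\<omega>. \<zeta> \<omega> $ i * \<theta> \<omega> $ i $ j)" for i j
    using L2_inner_integrable[OF component_L2[OF \<zeta>(2), of i] bounded_L2[OF _ bounded_component[OF \<theta>(2), of i j]]]
      borel_measurable_vec_nth2[OF measurable_F_M[OF \<theta>(1)]] by simp
  have "(\<integral>\<omega>. \<zeta> \<omega> \<bullet> (\<theta> \<omega> *v (W t \<omega> - W s \<omega>)) \<partial>M)
    = (\<integral>\<omega>. (\<Sum>i\<in>UNIV. \<Sum>j\<in>UNIV. (\<zeta> \<omega> $ i * \<theta> \<omega> $ i $ j) * (W t \<omega> - W s \<omega>) $ j) \<partial>M)"
    by (simp add: inner_vec_def matrix_vector_mult_def sum_distrib_left mult.assoc)
  also have "\<dots> = (\<Sum>i\<in>UNIV. \<Sum>j\<in>UNIV. (\<integral>\<omega>. (\<zeta> \<omega> $ i * \<theta> \<omega> $ i $ j) * (W t \<omega> - W s \<omega>) $ j \<partial>M))"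
    using increment_mean_zero(1)[OF st(1) \<open>s < t\<close> Xm Xi]
    by (simp add: Bochner_Integration.integral_sum Bochner_Integration.integrable_sum)
  also have "\<dots> = 0"
    using increment_mean_zero(2)[OF st(1) \<open>s < t\<close> Xm Xi] by simp
  finally show ?thesis .
qed simp

lemma same_increment:
  fixes \<theta> \<theta>' :: "'w \<Rightarrow> real^'m^'n"
  assumes st: "0 \<le> s" "s < t" and \<theta>: "\<theta> \<in> borel_measurable (F s)" "bounded_on_space M \<theta>"
    and \<theta>': "\<theta>' \<in> borel_measurable (F s)" "bounded_on_space M \<theta>'"
  shows "(\<integral>\<omega>. (\<theta> \<omega> *v (W t \<omega> - W s \<omega>)) \<bullet> (\<theta>' \<omega> *v (W t \<omega> - W s \<omega>)) \<partial>M)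
    = (t - s) * (\<integral>\<omega>. \<theta> \<omega> \<bullet> \<theta>' \<omega> \<partial>M)"
proof -
  have Xm: "(\<lambda>\<omega>. \<theta> \<omega> $ i $ j * \<theta>' \<omega> $ i $ k) \<in> borel_measurable (F s)" for i j k
    by (intro borel_measurable_times borel_measurable_vec_nth2 \<theta> \<theta>')
  have Xi: "integrable M (\<lambda>\<omega>. \<theta> \<omega> $ i $ j * \<theta>' \<omega> $ i $ k)" for i j k
    using L2_inner_integrable[OF bounded_L2[OF _ bounded_component[OF \<theta>(2), of i j]] bounded_L2[OF _ bounded_component[OF \<theta>'(2), of i k]]]
      borel_measurable_vec_nth2[OF measurable_F_M[OF \<theta>(1)]] borel_measurable_vec_nth2[OF measurable_F_M[OF \<theta>'(1)]] by simp
  note c = increment_covariance[OF st Xm Xi]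
  have "(\<integral>\<omega>. (\<theta> \<omega> *v (W t \<omega> - W s \<omega>)) \<bullet> (\<theta>' \<omega> *v (W t \<omega> - W s \<omega>)) \<partial>M)
    = (\<Sum>i\<in>UNIV. \<Sum>j\<in>UNIV. \<Sum>k\<in>UNIV. (\<integral>\<omega>. \<theta> \<omega> $ i $ j * \<theta>' \<omega> $ i $ k * ((W t \<omega> - W s \<omega>) $ j * (W t \<omega> - W s \<omega>) $ k) \<partial>M))"
    unfolding inner_matrix_vector_mult using c(1)
    by (simp only: Bochner_Integration.integral_sum Bochner_Integration.integrable_sum)
  also have "\<dots> = (\<Sum>i\<in>UNIV. \<Sum>j\<in>UNIV. (t - s) * (\<integral>\<omega>. \<theta> \<omega> $ i $ j * \<theta>' \<omega> $ i $ j \<partial>M))"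
    by (simp only: c(2)) (simp add: if_distrib[where f = "\<lambda>x. x * _"] cong: if_cong)
  also have "\<dots> = (t - s) * (\<integral>\<omega>. \<theta> \<omega> \<bullet> \<theta>' \<omega> \<partial>M)"
    unfolding inner_matrix using Xi
    by (simp only: Bochner_Integration.integral_sum Bochner_Integration.integrable_sum sum_distrib_left)
  finally show ?thesis .
qed

text \<open>Whatever part of one interval lies outside the other drops out, because there one
  increment comes after everything it is multiplied with. On the common interval the covariance of
  \<open>W\<close> contributes the length.\<close>

lemma two_increments_ordered:
  fixes \<theta> \<theta>' :: "'w \<Rightarrow> real^'m^'n"
  assumes ab: "0 \<le> a" "a < b" and cd: "c < d" and ac: "a \<le> c"
    and \<theta>: "\<theta> \<in> borel_measurable (F a)" "bounded_on_space M \<theta>"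
    and \<theta>': "\<theta>' \<in> borel_measurable (F c)" "bounded_on_space M \<theta>'"
  shows "(\<integral>\<omega>. (\<theta> \<omega> *v (W b \<omega> - W a \<omega>)) \<bullet> (\<theta>' \<omega> *v (W d \<omega> - W c \<omega>)) \<partial>M)
    = max 0 (min b d - max a c) * (\<integral>\<omega>. \<theta> \<omega> \<bullet> \<theta>' \<omega> \<partial>M)"
proof -
  \<comment> \<open>Both coefficients have to be known only when the later interval begins, which
    holds for all pieces created by the splittings below.\<close>
  have orth: "(\<integral>\<omega>. (\<theta>\<^sub>1 \<omega> *v (W q \<omega> - W p \<omega>)) \<bullet> (\<theta>\<^sub>2 \<omega> *v (W v \<omega> - W u \<omega>)) \<partial>M) = 0"
    if "0 \<le> p" "p \<le> q" "q \<le> u" "u \<le> v" "\<theta>\<^sub>1 \<in> borel_measurable (F u)" "\<theta>\<^sub>2 \<in> borel_measurable (F u)"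
      "bounded_on_space M \<theta>\<^sub>1" "bounded_on_space M \<theta>\<^sub>2" for p q u v and \<theta>\<^sub>1 \<theta>\<^sub>2 :: "'w \<Rightarrow> real^'m^'n"
  proof (rule increment_orthogonal)
    show "(\<lambda>\<omega>. \<theta>\<^sub>1 \<omega> *v (W q \<omega> - W p \<omega>)) \<in> borel_measurable (F u)"
      by (intro borel_measurable_matrix_vector_mult borel_measurable_diff W_measurable_F) (use that in auto)
    show "(\<lambda>\<omega>. \<theta>\<^sub>1 \<omega> *v (W q \<omega> - W p \<omega>)) \<in> L2_rv M M"
      by (intro increment_mult_L2 measurable_F_M[of _ u]) (use that in auto)
  qed (use that in auto)
  have c: "0 \<le> c" using ab ac by simp
  have \<theta>c: "\<theta> \<in> borel_measurable (F c)" by (rule measurable_F_mono[OF ac \<theta>(1)])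
  have M: "\<theta> \<in> borel_measurable M" "\<theta>' \<in> borel_measurable M"
    using \<theta>(1) \<theta>'(1) by (auto intro: measurable_F_M)
  show ?thesis
  proof (cases "b \<le> c")
    case True
    then show ?thesis using orth[of a b c d \<theta> \<theta>'] ab cd ac \<theta>c \<theta> \<theta>' by simp
  next
    case False
    have split: "(\<integral>\<omega>. (X \<omega> *v (W r \<omega> - W p \<omega>)) \<bullet> (Y \<omega> *v (W v \<omega> - W u \<omega>)) \<partial>M)
        = (\<integral>\<omega>. (X \<omega> *v (W q \<omega> - W p \<omega>)) \<bullet> (Y \<omega> *v (W v \<omega> - W u \<omega>)) \<partial>M)
        + (\<integral>\<omega>. (X \<omega> *v (W r \<omega> - W q \<omega>)) \<bullet> (Y \<omega> *v (W v \<omega> - W u \<omega>)) \<partial>M)"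
      if "0 \<le> p" "p \<le> q" "q \<le> r" "0 \<le> u" "u \<le> v" "X \<in> borel_measurable M" "bounded_on_space M X"
        "Y \<in> borel_measurable M" "bounded_on_space M Y" for p q r u v and X Y :: "'w \<Rightarrow> real^'m^'n"
    proof -
      have L: "(\<lambda>\<omega>. X \<omega> *v (W q \<omega> - W p \<omega>)) \<in> L2_rv M M" "(\<lambda>\<omega>. X \<omega> *v (W r \<omega> - W q \<omega>)) \<in> L2_rv M M"
        "(\<lambda>\<omega>. Y \<omega> *v (W v \<omega> - W u \<omega>)) \<in> L2_rv M M"
        by (intro increment_mult_L2; use that in simp)+
      have "W r \<omega> - W p \<omega> = (W q \<omega> - W p \<omega>) + (W r \<omega> - W q \<omega>)" for \<omega> by simp
      then show ?thesis
        using L2_inner_integrable[OF L(1,3)] L2_inner_integrable[OF L(2,3)]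
        by (simp only: matrix_vector_right_distrib inner_add_left Bochner_Integration.integral_add)
    qed
    have cb: "c < b" using False by simp
    have 1: "(\<integral>\<omega>. (\<theta> \<omega> *v (W b \<omega> - W a \<omega>)) \<bullet> (\<theta>' \<omega> *v (W d \<omega> - W c \<omega>)) \<partial>M)
      = (\<integral>\<omega>. (\<theta> \<omega> *v (W b \<omega> - W c \<omega>)) \<bullet> (\<theta>' \<omega> *v (W d \<omega> - W c \<omega>)) \<partial>M)"
      using split[of a c b c d \<theta> \<theta>'] orth[of a c c d \<theta> \<theta>'] ab ac cd c cb M \<theta>(2) \<theta>' \<theta>c by simp
    show ?thesis
    proof (cases "b \<le> d")
      case True
      have "(\<integral>\<omega>. (\<theta> \<omega> *v (W b \<omega> - W c \<omega>)) \<bullet> (\<theta>' \<omega> *v (W d \<omega> - W c \<omega>)) \<partial>M)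
        = (\<integral>\<omega>. (\<theta>' \<omega> *v (W d \<omega> - W c \<omega>)) \<bullet> (\<theta> \<omega> *v (W b \<omega> - W c \<omega>)) \<partial>M)"
        by (simp add: inner_commute)
      also have "\<dots> = (\<integral>\<omega>. (\<theta>' \<omega> *v (W b \<omega> - W c \<omega>)) \<bullet> (\<theta> \<omega> *v (W b \<omega> - W c \<omega>)) \<partial>M)
        + (\<integral>\<omega>. (\<theta>' \<omega> *v (W d \<omega> - W b \<omega>)) \<bullet> (\<theta> \<omega> *v (W b \<omega> - W c \<omega>)) \<partial>M)"
        using split[of c b d c b \<theta>' \<theta>] True c cb M \<theta>(2) \<theta>'(2) by simp
      also have "(\<integral>\<omega>. (\<theta>' \<omega> *v (W d \<omega> - W b \<omega>)) \<bullet> (\<theta> \<omega> *v (W b \<omega> - W c \<omega>)) \<partial>M) = 0"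
        using orth[of c b b d \<theta> \<theta>'] True c cb \<theta>(2) \<theta>'(2)
          measurable_F_mono[OF less_imp_le[OF cb] \<theta>c] measurable_F_mono[OF less_imp_le[OF cb] \<theta>'(1)]
        by (simp add: inner_commute)
      also have "(\<integral>\<omega>. (\<theta>' \<omega> *v (W b \<omega> - W c \<omega>)) \<bullet> (\<theta> \<omega> *v (W b \<omega> - W c \<omega>)) \<partial>M) = (b - c) * (\<integral>\<omega>. \<theta> \<omega> \<bullet> \<theta>' \<omega> \<partial>M)"
        using same_increment[OF c cb \<theta>' \<theta>c \<theta>(2)] by (simp add: inner_commute)
      finally show ?thesis using 1 True cb ac by simp
    next
      case False
      have "(\<integral>\<omega>. (\<theta> \<omega> *v (W b \<omega> - W c \<omega>)) \<bullet> (\<theta>' \<omega> *v (W d \<omega> - W c \<omega>)) \<partial>M)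
        = (\<integral>\<omega>. (\<theta> \<omega> *v (W d \<omega> - W c \<omega>)) \<bullet> (\<theta>' \<omega> *v (W d \<omega> - W c \<omega>)) \<partial>M)
        + (\<integral>\<omega>. (\<theta> \<omega> *v (W b \<omega> - W d \<omega>)) \<bullet> (\<theta>' \<omega> *v (W d \<omega> - W c \<omega>)) \<partial>M)"
        using split[of c d b c d \<theta> \<theta>'] False c cd M \<theta>(2) \<theta>'(2) by simp
      also have "(\<integral>\<omega>. (\<theta> \<omega> *v (W b \<omega> - W d \<omega>)) \<bullet> (\<theta>' \<omega> *v (W d \<omega> - W c \<omega>)) \<partial>M) = 0"
        using orth[of c d d b \<theta>' \<theta>] False c cd \<theta>(2) \<theta>'(2)
          measurable_F_mono[OF less_imp_le[OF cd] \<theta>c] measurable_F_mono[OF less_imp_le[OF cd] \<theta>'(1)]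
        by (simp add: inner_commute)
      also have "(\<integral>\<omega>. (\<theta> \<omega> *v (W d \<omega> - W c \<omega>)) \<bullet> (\<theta>' \<omega> *v (W d \<omega> - W c \<omega>)) \<partial>M) = (d - c) * (\<integral>\<omega>. \<theta> \<omega> \<bullet> \<theta>' \<omega> \<partial>M)"
        using same_increment[OF c cd \<theta>c \<theta>(2) \<theta>'] .
      finally show ?thesis using 1 False cd ac by simp
    qed
  qed
qed

text \<open>Measurability is asked of nondegenerate intervals only: a grid interval clipped at
  \<open>t\<close> may collapse to the point \<open>t\<close>, and its coefficient may then become
  known only after \<open>t\<close>.\<close>

lemma two_increments:
  fixes \<theta> \<theta>' :: "'w \<Rightarrow> real^'m^'n"
  assumes ab: "0 \<le> a" "a \<le> b" and cd: "0 \<le> c" "c \<le> d"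
    and \<theta>: "a < b \<Longrightarrow> \<theta> \<in> borel_measurable (F a)" "bounded_on_space M \<theta>"
    and \<theta>': "c < d \<Longrightarrow> \<theta>' \<in> borel_measurable (F c)" "bounded_on_space M \<theta>'"
  shows "(\<integral>\<omega>. (\<theta> \<omega> *v (W b \<omega> - W a \<omega>)) \<bullet> (\<theta>' \<omega> *v (W d \<omega> - W c \<omega>)) \<partial>M)
    = max 0 (min b d - max a c) * (\<integral>\<omega>. \<theta> \<omega> \<bullet> \<theta>' \<omega> \<partial>M)"
proof (cases "a = b \<or> c = d")
  case True
  then show ?thesis by (auto simp: max_def min_def)
next
  case False
  then have lt: "a < b" "c < d" using ab cd by auto
  show ?thesis
  proof (cases "a \<le> c")
    case True
    show ?thesis by (rule two_increments_ordered[OF ab(1) lt True \<theta>(1)[OF lt(1)] \<theta>(2) \<theta>'(1)[OF lt(2)] \<theta>'(2)])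
  next
    case False
    then have "c \<le> a" by simp
    from two_increments_ordered[OF cd(1) lt(2,1) this \<theta>'(1)[OF lt(2)] \<theta>'(2) \<theta>(1)[OF lt(1)] \<theta>(2)]
    show ?thesis by (simp add: inner_commute min.commute max.commute)
  qed
qed

end

section \<open>Time and chance as a product space, and the inner product of processes\<close>

definition time_measure :: "real \<Rightarrow> real measure" where
  "time_measure T = restrict_space lborel {0..T}"

lemma space_time_measure [simp]: "space (time_measure T) = {0..T}"
  by (simp add: time_measure_def space_restrict_space)

lemma sets_time_measure: "sets (time_measure T) = sets (restrict_space borel {0..T})"
  by (simp add: time_measure_def sets_restrict_space)

lemma finite_measure_time_measure: "finite_measure (time_measure T)"
  by (rule finite_measureI)
     (simp add: time_measure_def space_restrict_space emeasure_restrict_space emeasure_lborel_Icc_eq)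

lemma integral_time_measure:
  fixes f :: "real \<Rightarrow> 'b::euclidean_space"
  assumes "t \<le> T"
  shows "(\<integral>s. indicator {0..t} s *\<^sub>R f s \<partial>time_measure T) = (LINT s:{0..t}|lborel. f s)"
proof -
  have "(\<integral>s. indicator {0..t} s *\<^sub>R f s \<partial>time_measure T)
      = (\<integral>s. indicator {0..T} s *\<^sub>R (indicator {0..t} s *\<^sub>R f s) \<partial>lborel)"
    unfolding time_measure_def by (subst integral_restrict_space) auto
  also have "\<dots> = (LINT s:{0..t}|lborel. f s)"
    unfolding set_lebesgue_integral_def
    by (intro Bochner_Integration.integral_cong) (use assms in \<open>auto split: split_indicator\<close>)
  finally show ?thesis .
qed

lemma integrable_time_measure:
  fixes f :: "real \<Rightarrow> 'b::euclidean_space"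
  shows "integrable (time_measure T) f \<longleftrightarrow> set_integrable lborel {0..T} f"
  unfolding time_measure_def set_integrable_def by (subst integrable_restrict_space) auto

text \<open>For \<open>t = T\<close> the inner product of processes on time and chance; the running
  upper limit lets the same expression serve as drift and bracket term of the product formula. Time
  is the outer integral because adaptedness is exploited at one time after another.\<close>

definition ip :: "'w measure \<Rightarrow> real \<Rightarrow> (real \<Rightarrow> 'w \<Rightarrow> 'a::euclidean_space) \<Rightarrow> (real \<Rightarrow> 'w \<Rightarrow> 'a) \<Rightarrow> real" where
  "ip M t f g = (LINT s:{0..t}|lborel. (\<integral>\<omega>. f s \<omega> \<bullet> g s \<omega> \<partial>M))"

definition pnorm :: "'w measure \<Rightarrow> real \<Rightarrow> (real \<Rightarrow> 'w \<Rightarrow> 'a::euclidean_space) \<Rightarrow> real" where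
  "pnorm M T f = l2n (time_measure T \<Otimes>\<^sub>M M) (\<lambda>(s, \<omega>). f s \<omega>)"

definition pL2 :: "'w measure \<Rightarrow> real \<Rightarrow> (real \<Rightarrow> 'w \<Rightarrow> 'a::euclidean_space) set" where
  "pL2 M T = {f. (\<lambda>(s, \<omega>). f s \<omega>) \<in> L2_rv (time_measure T \<Otimes>\<^sub>M M) (time_measure T \<Otimes>\<^sub>M M)}"

text \<open>Joint measurability and adaptedness at each single time. Progressive processes belong to
  this class, martingale arguments test at fixed times and ask for no more, and delaying a process
  visibly preserves it.\<close>

definition adL2 ::
  "'w measure \<Rightarrow> (real \<Rightarrow> 'w measure) \<Rightarrow> real \<Rightarrow> (real \<Rightarrow> 'w \<Rightarrow> 'a::euclidean_space) set" where
  "adL2 M F T = {f \<in> pL2 M T. \<forall>t\<in>{0..T}. f t \<in> borel_measurable (F t)}"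

sublocale brownian_setting \<subseteq> tm: finite_measure "time_measure T"
  by (rule finite_measure_time_measure)

sublocale brownian_setting \<subseteq> pr: pair_sigma_finite "time_measure T" M
  by unfold_locales

sublocale brownian_setting \<subseteq> pfin: finite_measure "time_measure T \<Otimes>\<^sub>M M"
  by (rule finite_measure_pair_measure) unfold_locales

context brownian_setting
begin

abbreviation "tm \<equiv> time_measure T"
abbreviation "PM \<equiv> time_measure T \<Otimes>\<^sub>M M"

lemma pL2I: "(\<lambda>(s, \<omega>). f s \<omega>) \<in> L2_rv PM PM \<Longrightarrow> f \<in> pL2 M T"
  by (simp add: pL2_def)

lemma pL2D: "f \<in> pL2 M T \<Longrightarrow> (\<lambda>(s, \<omega>). f s \<omega>) \<in> L2_rv PM PM"
  by (simp add: pL2_def)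

lemma adL2D:
  assumes "f \<in> adL2 M F T"
  shows "f \<in> pL2 M T" "t \<in> {0..T} \<Longrightarrow> f t \<in> borel_measurable (F t)"
  using assms by (auto simp: adL2_def)

lemma pL2_measurable: "f \<in> pL2 M T \<Longrightarrow> (\<lambda>(s, \<omega>). f s \<omega>) \<in> borel_measurable PM"
  by (drule pL2D) (rule L2_rvD)

lemma pL2_section_measurable:
  assumes "f \<in> pL2 M T" "t \<in> {0..T}"
  shows "f t \<in> borel_measurable M"
  using measurable_Pair2[OF pL2_measurable[OF assms(1)]] assms(2) by simp

lemma pL2_AE_L2:
  fixes f :: "real \<Rightarrow> 'w \<Rightarrow> 'b::euclidean_space"
  assumes "f \<in> pL2 M T"
  shows "AE s in tm. f s \<in> L2_rv M M"
proof -
  have "AE s in tm. integrable M (\<lambda>\<omega>. (norm (f s \<omega>))\<^sup>2)"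
    using pr.AE_integrable_fst'[OF L2_rvD(2)[OF pL2D[OF assms]]] by simp
  then show ?thesis using AE_space
    by eventually_elim (use pL2_section_measurable[OF assms] in \<open>simp add: L2_rv_def\<close>)
qed

lemma pL2_add: "f \<in> pL2 M T \<Longrightarrow> g \<in> pL2 M T \<Longrightarrow> (\<lambda>s \<omega>. f s \<omega> + g s \<omega>) \<in> pL2 M T"
  by (intro pL2I) (use L2_rv_add[OF pL2D pL2D, of f g] in \<open>simp add: case_prod_beta'\<close>)

lemma pL2_diff: "f \<in> pL2 M T \<Longrightarrow> g \<in> pL2 M T \<Longrightarrow> (\<lambda>s \<omega>. f s \<omega> - g s \<omega>) \<in> pL2 M T"
  by (intro pL2I) (use L2_rv_diff[OF pL2D pL2D, of f g] in \<open>simp add: case_prod_beta'\<close>)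

lemma pL2_scaleR: "f \<in> pL2 M T \<Longrightarrow> (\<lambda>s \<omega>. c *\<^sub>R f s \<omega>) \<in> pL2 M T"
  by (intro pL2I) (use L2_rv_scaleR[OF pL2D, of f c] in \<open>simp add: case_prod_beta'\<close>)

lemma pL2_uminus: "f \<in> pL2 M T \<Longrightarrow> (\<lambda>s \<omega>. - f s \<omega>) \<in> pL2 M T"
  by (intro pL2I) (use L2_rv_uminus[OF pL2D, of f] in \<open>simp add: case_prod_beta'\<close>)

lemma pL2_const_time:
  fixes \<zeta> :: "'w \<Rightarrow> 'b::euclidean_space"
  assumes "\<zeta> \<in> L2_rv M M"
  shows "(\<lambda>s. \<zeta>) \<in> pL2 M T"
proof (rule pL2I, rule L2_rv_if_nn_integral)
  note L2_rvD(1)[OF assms, measurable]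
  show "(\<lambda>(s, \<omega>). \<zeta> \<omega>) \<in> borel_measurable PM" by measurable
  have "(\<integral>\<^sup>+z. ennreal ((norm (\<zeta> (snd z)))\<^sup>2) \<partial>PM) = (\<integral>\<^sup>+s. (\<integral>\<^sup>+\<omega>. ennreal ((norm (\<zeta> \<omega>))\<^sup>2) \<partial>M) \<partial>tm)"
    by (subst nn_integral_fst[symmetric]) auto
  also have "\<dots> < \<infinity>"
    using tm.emeasure_finite[of "{0..T}", unfolded top.not_eq_extremum]
    by (simp add: nn_integral_norm_sq[OF assms] ennreal_mult_less_top)
  finally show "(\<integral>\<^sup>+z. ennreal ((norm (case z of (s, \<omega>) \<Rightarrow> \<zeta> \<omega>))\<^sup>2) \<partial>PM) < \<infinity>"
    by (simp add: case_prod_beta')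
qed

lemma pL2_restrict:
  assumes "f \<in> pL2 M T"
  shows "(\<lambda>(s, \<omega>). indicator {0..t} s *\<^sub>R f s \<omega>) \<in> L2_rv PM PM"
proof (rule L2_rv_norm_le[OF _ pL2D[OF assms]])
  have "(\<lambda>z. indicator {0..t} (fst z) *\<^sub>R (\<lambda>(s, \<omega>). f s \<omega>) z) \<in> borel_measurable PM"
  proof (rule borel_measurable_scaleR[OF _ pL2_measurable[OF assms]])
    have "(\<lambda>s. indicator {0..t} s :: real) \<in> borel_measurable tm"
      unfolding time_measure_def by (rule measurable_restrict_space1) auto
    then show "(\<lambda>z. indicator {0..t} (fst z) :: real) \<in> borel_measurable PM" by measurable
  qed
  then show "(\<lambda>(s, \<omega>). indicator {0..t} s *\<^sub>R f s \<omega>) \<in> borel_measurable PM"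
    by (simp add: case_prod_beta')
qed (auto intro!: AE_I2 split: split_indicator)

lemma ip_eq:
  assumes f: "f \<in> pL2 M T" and g: "g \<in> pL2 M T" and t: "t \<le> T"
  shows "ip M t f g = (\<integral>z. (\<lambda>(s, \<omega>). indicator {0..t} s *\<^sub>R f s \<omega>) z \<bullet> (\<lambda>(s, \<omega>). g s \<omega>) z \<partial>PM)"
proof -
  let ?h = "\<lambda>z. (\<lambda>(s, \<omega>). indicator {0..t} s *\<^sub>R f s \<omega>) z \<bullet> (\<lambda>(s, \<omega>). g s \<omega>) z"
  have "integrable PM ?h" by (rule L2_inner_integrable[OF pL2_restrict[OF f] pL2D[OF g]])
  from pr.integral_fst'[OF this]
  have "(\<integral>z. ?h z \<partial>PM) = (\<integral>s. (\<integral>\<omega>. ?h (s, \<omega>) \<partial>M) \<partial>tm)" by simp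
  also have "\<dots> = (\<integral>s. indicator {0..t} s *\<^sub>R (\<integral>\<omega>. f s \<omega> \<bullet> g s \<omega> \<partial>M) \<partial>tm)" by simp
  also have "\<dots> = ip M t f g" unfolding ip_def by (rule integral_time_measure[OF t])
  finally show ?thesis by simp
qed

lemma ip_integrable:
  assumes "f \<in> pL2 M T" "g \<in> pL2 M T"
  shows "set_integrable lborel {0..T} (\<lambda>s. \<integral>\<omega>. f s \<omega> \<bullet> g s \<omega> \<partial>M)"
  using pr.integrable_fst'[OF L2_inner_integrable[OF pL2D[OF assms(1)] pL2D[OF assms(2)]]]
  by (simp add: integrable_time_measure)

lemma ip_commute: "ip M t f g = ip M t g f"
  by (simp add: ip_def inner_commute)

lemma ip_cong_AE_left:
  assumes "f \<in> pL2 M T" "f' \<in> pL2 M T" "g \<in> pL2 M T" "t \<le> T" "AE z in PM. f (fst z) (snd z) = f' (fst z) (snd z)"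
  shows "ip M t f g = ip M t f' g"
proof -
  have "integrable PM (\<lambda>z. (\<lambda>(s, \<omega>). indicator {0..t} s *\<^sub>R f s \<omega>) z \<bullet> (\<lambda>(s, \<omega>). g s \<omega>) z)"
    by (rule L2_inner_integrable[OF pL2_restrict[OF assms(1)] pL2D[OF assms(3)]])
  moreover have "integrable PM (\<lambda>z. (\<lambda>(s, \<omega>). indicator {0..t} s *\<^sub>R f' s \<omega>) z \<bullet> (\<lambda>(s, \<omega>). g s \<omega>) z)"
    by (rule L2_inner_integrable[OF pL2_restrict[OF assms(2)] pL2D[OF assms(3)]])
  ultimately show ?thesis
    unfolding ip_eq[OF assms(1,3,4)] ip_eq[OF assms(2,3,4)]
    by (intro integral_cong_AE) (use assms(5) in \<open>auto simp: case_prod_beta' dest: borel_measurable_integrable\<close>)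
qed

lemma ip_add_left:
  assumes "f \<in> pL2 M T" "f' \<in> pL2 M T" "g \<in> pL2 M T" "t \<le> T"
  shows "ip M t (\<lambda>s \<omega>. f s \<omega> + f' s \<omega>) g = ip M t f g + ip M t f' g"
proof -
  have "integrable PM (\<lambda>z. (\<lambda>(s, \<omega>). indicator {0..t} s *\<^sub>R f s \<omega>) z \<bullet> (\<lambda>(s, \<omega>). g s \<omega>) z)"
    by (rule L2_inner_integrable[OF pL2_restrict[OF assms(1)] pL2D[OF assms(3)]])
  moreover have "integrable PM (\<lambda>z. (\<lambda>(s, \<omega>). indicator {0..t} s *\<^sub>R f' s \<omega>) z \<bullet> (\<lambda>(s, \<omega>). g s \<omega>) z)"
    by (rule L2_inner_integrable[OF pL2_restrict[OF assms(2)] pL2D[OF assms(3)]])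
  ultimately show ?thesis
    unfolding ip_eq[OF assms(1,3,4)] ip_eq[OF assms(2,3,4)] ip_eq[OF pL2_add[OF assms(1,2)] assms(3,4)]
    by (subst Bochner_Integration.integral_add[symmetric])
       (auto simp: case_prod_beta' scaleR_add_right inner_add_left)
qed

lemma ip_scaleR_left: "ip M t (\<lambda>s \<omega>. c *\<^sub>R f s \<omega>) g = c * ip M t f g"
  by (simp add: ip_def set_lebesgue_integral_def mult.left_commute)

lemma ip_uminus_left: "ip M t (\<lambda>s \<omega>. - f s \<omega>) g = - ip M t f g"
  using ip_scaleR_left[of t "-1" f g] by simp

lemma ip_diff_left:
  assumes "f \<in> pL2 M T" "f' \<in> pL2 M T" "g \<in> pL2 M T" "t \<le> T"
  shows "ip M t (\<lambda>s \<omega>. f s \<omega> - f' s \<omega>) g = ip M t f g - ip M t f' g"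
  using ip_add_left[OF assms(1) pL2_uminus[OF assms(2)] assms(3,4)] ip_uminus_left[of t f' g] by simp

lemma ip_add_right:
  assumes "f \<in> pL2 M T" "g \<in> pL2 M T" "g' \<in> pL2 M T" "t \<le> T"
  shows "ip M t f (\<lambda>s \<omega>. g s \<omega> + g' s \<omega>) = ip M t f g + ip M t f g'"
  using ip_add_left[OF assms(2,3,1,4)] by (simp add: ip_commute)

lemma ip_diff_right:
  assumes "f \<in> pL2 M T" "g \<in> pL2 M T" "g' \<in> pL2 M T" "t \<le> T"
  shows "ip M t f (\<lambda>s \<omega>. g s \<omega> - g' s \<omega>) = ip M t f g - ip M t f g'"
  using ip_diff_left[OF assms(2,3,1,4)] by (simp add: ip_commute)

lemma ip_uminus_right: "ip M t f (\<lambda>s \<omega>. - g s \<omega>) = - ip M t f g"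
  using ip_uminus_left[of t g f] by (simp add: ip_commute)

lemma ip_scaleR_right: "ip M t f (\<lambda>s \<omega>. c *\<^sub>R g s \<omega>) = c * ip M t f g"
  using ip_scaleR_left[of t c g f] by (simp add: ip_commute)

lemma pnorm_nonneg [simp]: "0 \<le> pnorm M T f"
  by (simp add: pnorm_def)

lemma ip_Cauchy_Schwarz:
  assumes "f \<in> pL2 M T" "g \<in> pL2 M T" "t \<le> T"
  shows "\<bar>ip M t f g\<bar> \<le> pnorm M T f * pnorm M T g"
proof -
  have "\<bar>ip M t f g\<bar> \<le> l2n PM (\<lambda>(s, \<omega>). indicator {0..t} s *\<^sub>R f s \<omega>) * pnorm M T g"
    unfolding ip_eq[OF assms] pnorm_def
    by (rule L2_Cauchy_Schwarz[OF pL2_restrict[OF assms(1)] pL2D[OF assms(2)]])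
  also have "l2n PM (\<lambda>(s, \<omega>). indicator {0..t} s *\<^sub>R f s \<omega>) \<le> pnorm M T f"
    unfolding pnorm_def
    by (rule l2n_mono[OF pL2D[OF assms(1)]]) (auto intro!: AE_I2 split: split_indicator)
  finally show ?thesis by (simp add: mult_right_mono)
qed

lemma ip_self:
  assumes "f \<in> pL2 M T"
  shows "ip M T f f = (pnorm M T f)\<^sup>2"
proof -
  have "ip M T f f = (\<integral>z. (norm ((\<lambda>(s, \<omega>). f s \<omega>) z))\<^sup>2 \<partial>PM)"
    unfolding ip_eq[OF assms assms order.refl]
    by (intro Bochner_Integration.integral_cong refl)
       (auto simp: space_pair_measure power2_norm_eq_inner split: split_indicator)
  then show ?thesis by (simp add: pnorm_def l2n_sq)
qed

lemma pnorm_triangle: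
  assumes "f \<in> pL2 M T" "g \<in> pL2 M T"
  shows "pnorm M T (\<lambda>s \<omega>. f s \<omega> + g s \<omega>) \<le> pnorm M T f + pnorm M T g"
  using l2n_add[OF pL2D[OF assms(1)] pL2D[OF assms(2)]] by (simp add: pnorm_def case_prod_beta')

lemma H2_sq_eq:
  fixes Z :: "real \<Rightarrow> 'w \<Rightarrow> 'b::euclidean_space"
  assumes "(\<lambda>(s, \<omega>). Z s \<omega>) \<in> borel_measurable PM"
  shows "H2_sq M T Z = (\<integral>\<^sup>+z. ennreal ((norm ((\<lambda>(s, \<omega>). Z s \<omega>) z))\<^sup>2) \<partial>PM)"
proof -
  have "H2_sq M T Z = (\<integral>\<^sup>+\<omega>. (\<integral>\<^sup>+s. ennreal ((norm (Z s \<omega>))\<^sup>2) \<partial>tm) \<partial>M)"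
    unfolding H2_sq_def time_measure_def
    by (intro nn_integral_cong, subst nn_integral_restrict_space) (auto simp: mult.commute)
  also have "\<dots> = (\<integral>\<^sup>+z. ennreal ((norm ((\<lambda>(s, \<omega>). Z s \<omega>) z))\<^sup>2) \<partial>PM)"
    using pr.nn_integral_snd[of "\<lambda>z. ennreal ((norm ((\<lambda>(s, \<omega>). Z s \<omega>) z))\<^sup>2)"] assms by simp
  finally show ?thesis .
qed

lemma H2_norm_eq:
  assumes "(\<lambda>(s, \<omega>). Z s \<omega>) \<in> borel_measurable PM"
  shows "H2_norm M T Z = pnorm M T Z"
  unfolding H2_norm_def pnorm_def l2n_def H2_sq_eq[OF assms]
  by (subst integral_eq_nn_integral) (use assms in auto)

section \<open>Progressive measurability\<close>

lemma space_Prog: "space (Prog M F T) = {0..T} \<times> space M"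
  by (simp add: Prog_def space_measure_of_conv)

text \<open>The defining sets of \<open>Prog\<close> have measurable traces on all initial strips,
  so restricting to a strip is measurable. The strip up to \<open>T\<close> yields joint
  measurability, and the last time of the strip up to \<open>t\<close> yields adaptedness.\<close>

lemma measurable_ident_Prog:
  assumes "t \<in> {0..T}"
  shows "(\<lambda>z. z) \<in> restrict_space borel {0..t} \<Otimes>\<^sub>M F t \<rightarrow>\<^sub>M Prog M F T"
  unfolding Prog_def
proof (rule measurable_measure_of)
  have sp: "space (restrict_space borel {0..t} \<Otimes>\<^sub>M F t) = {0..t} \<times> space M"
    by (simp add: space_pair_measure space_restrict_space)
  show "(\<lambda>z. z) \<in> space (restrict_space borel {0..t} \<Otimes>\<^sub>M F t) \<rightarrow> {0..T} \<times> space M"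
    unfolding sp using assms by auto
  fix A assume "A \<in> {A. A \<subseteq> {0..T} \<times> space M \<and>
         (\<forall>t\<in>{0..T}. A \<inter> ({0..t} \<times> space M) \<in> sets (restrict_space borel {0..t} \<Otimes>\<^sub>M F t))}"
  then show "(\<lambda>z. z) -` A \<inter> space (restrict_space borel {0..t} \<Otimes>\<^sub>M F t) \<in> sets (restrict_space borel {0..t} \<Otimes>\<^sub>M F t)"
    unfolding sp using assms by simp
qed auto

lemma Prog_measurableI:
  fixes f :: "real \<times> 'w \<Rightarrow> 'b::topological_space"
  assumes "\<And>t. t \<in> {0..T} \<Longrightarrow> f \<in> borel_measurable (restrict_space borel {0..t} \<Otimes>\<^sub>M F t)"
  shows "f \<in> borel_measurable (Prog M F T)"
proof (rule measurableI)
  fix B :: "'b set" assume B: "B \<in> sets borel"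
  have "(f -` B \<inter> {0..T} \<times> space M) \<inter> ({0..t} \<times> space M) \<in> sets (restrict_space borel {0..t} \<Otimes>\<^sub>M F t)"
    if t: "t \<in> {0..T}" for t
  proof -
    have "(f -` B \<inter> {0..T} \<times> space M) \<inter> ({0..t} \<times> space M) = f -` B \<inter> space (restrict_space borel {0..t} \<Otimes>\<^sub>M F t)"
      using t by (auto simp: space_pair_measure space_restrict_space)
    then show ?thesis using measurable_sets[OF assms[OF t] B] by simp
  qed
  then have "f -` B \<inter> {0..T} \<times> space M \<in> sets (Prog M F T)"
    unfolding Prog_def by (subst sets_measure_of) (auto intro!: sigma_sets.Basic)
  then show "f -` B \<inter> space (Prog M F T) \<in> sets (Prog M F T)" by (simp add: space_Prog)
qed simp

lemma measurable_ident_F: "(\<lambda>\<omega>. \<omega>) \<in> M \<rightarrow>\<^sub>M F t"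
  by (rule measurable_F_M[of _ t]) simp

lemma measurable_Prog_PM:
  assumes "f \<in> Prog M F T \<rightarrow>\<^sub>M K"
  shows "f \<in> PM \<rightarrow>\<^sub>M K"
proof -
  have "(\<lambda>z. (fst z, snd z)) \<in> PM \<rightarrow>\<^sub>M restrict_space borel {0..T} \<Otimes>\<^sub>M F T"
  proof (rule measurable_Pair)
    show "fst \<in> PM \<rightarrow>\<^sub>M restrict_space borel {0..T}"
      using measurable_fst[of tm M] measurable_cong_sets[OF refl sets_time_measure[of T], of PM] by blast
    show "snd \<in> PM \<rightarrow>\<^sub>M F T"
      using measurable_compose[OF measurable_snd measurable_ident_F[of T], of tm] by simp
  qed
  from measurable_compose[OF measurable_compose[OF this measurable_ident_Prog] assms] T_pos
  show ?thesis by simp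
qed

lemma measurable_Prog_section:
  assumes "f \<in> Prog M F T \<rightarrow>\<^sub>M K" "t \<in> {0..T}"
  shows "(\<lambda>\<omega>. f (t, \<omega>)) \<in> F t \<rightarrow>\<^sub>M K"
proof -
  have "(\<lambda>\<omega>. (t, \<omega>)) \<in> F t \<rightarrow>\<^sub>M restrict_space borel {0..t} \<Otimes>\<^sub>M F t"
    using assms(2) by (intro measurable_Pair) (auto simp: space_restrict_space)
  from measurable_compose[OF measurable_compose[OF this measurable_ident_Prog[OF assms(2)]] assms(1)]
  show ?thesis by simp
qed

lemma H2_adL2:
  assumes "Z \<in> H2 M F T"
  shows "Z \<in> adL2 M F T"
proof -
  have Z: "(\<lambda>(s, \<omega>). Z s \<omega>) \<in> borel_measurable (Prog M F T)" "H2_sq M T Z < \<infinity>"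
    using assms by (auto simp: H2_def)
  note m = measurable_Prog_PM[OF Z(1)]
  have "(\<lambda>(s, \<omega>). Z s \<omega>) \<in> L2_rv PM PM"
    by (rule L2_rv_if_nn_integral[OF m]) (use Z(2) in \<open>simp add: H2_sq_eq[OF m]\<close>)
  then show ?thesis
    using measurable_Prog_section[OF Z(1)] by (auto simp: adL2_def pL2_def)
qed

lemma H2I:
  assumes "(\<lambda>(s, \<omega>). Z s \<omega>) \<in> borel_measurable (Prog M F T)" "Z \<in> pL2 M T"
  shows "Z \<in> H2 M F T"
  using assms nn_integral_norm_sq[OF pL2D[OF assms(2)]]
  by (simp add: H2_def H2_sq_eq[OF measurable_Prog_PM[OF assms(1)]])

end

text \<open>The overlap is written with endpoints clipped at \<open>t\<close>, the form in which the
  covariance of two clipped increments produces it.\<close>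

lemma LINT_two_indicators:
  fixes t u v u' v' :: real
  assumes "0 \<le> u" "0 \<le> u'"
  shows "(LINT s:{0..t}|lborel. indicator {u<..v} s * indicator {u'<..v'} s)
    = max 0 (min (min v t) (min v' t) - max (min u t) (min u' t))"
    "set_integrable lborel {0..t} (\<lambda>s. indicator {u<..v} s * indicator {u'<..v'} s :: real)"
proof -
  let ?I = "{max u u'<..min (min v v') t}"
  have *: "indicator {0..t} s *\<^sub>R (indicator {u<..v} s * indicator {u'<..v'} s) = (indicator ?I s :: real)" for s
    using assms by (auto split: split_indicator)
  have fin: "emeasure lborel ?I < \<infinity>" by (cases "max u u' \<le> min (min v v') t") auto
  show "set_integrable lborel {0..t} (\<lambda>s. indicator {u<..v} s * indicator {u'<..v'} s :: real)"
    unfolding set_integrable_def * using fin by (intro integrable_real_indicator) auto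
  have "(LINT s:{0..t}|lborel. indicator {u<..v} s * indicator {u'<..v'} s) = measure lborel ?I"
    unfolding set_lebesgue_integral_def * by simp
  also have "\<dots> = max 0 (min (min v v') t - max u u')"
    by (cases "max u u' \<le> min (min v v') t") auto
  also have "\<dots> = max 0 (min (min v t) (min v' t) - max (min u t) (min u' t))"
    by (auto simp: max_def min_def)
  finally show "(LINT s:{0..t}|lborel. indicator {u<..v} s * indicator {u'<..v'} s)
    = max 0 (min (min v t) (min v' t) - max (min u t) (min u' t))" .
qed

lemma integral_double_sum:
  fixes f :: "nat \<Rightarrow> nat \<Rightarrow> 'x \<Rightarrow> real"
  assumes "\<And>i j. i < n \<Longrightarrow> j < n' \<Longrightarrow> integrable N (f i j)"
  shows "(\<integral>x. (\<Sum>i<n. \<Sum>j<n'. f i j x) \<partial>N) = (\<Sum>i<n. \<Sum>j<n'. \<integral>x. f i j x \<partial>N)"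
proof -
  have "(\<integral>x. (\<Sum>i<n. \<Sum>j<n'. f i j x) \<partial>N) = (\<Sum>i<n. \<integral>x. (\<Sum>j<n'. f i j x) \<partial>N)"
    using assms by (intro Bochner_Integration.integral_sum Bochner_Integration.integrable_sum) auto
  also have "\<dots> = (\<Sum>i<n. \<Sum>j<n'. \<integral>x. f i j x \<partial>N)"
    using assms by (intro sum.cong refl Bochner_Integration.integral_sum) auto
  finally show ?thesis .
qed

lemma inner_sum_sum: "(\<Sum>i\<in>A. f i) \<bullet> (\<Sum>j\<in>B. g j) = (\<Sum>i\<in>A. \<Sum>j\<in>B. f i \<bullet> g j)"
  by (subst inner_sum_left) (simp only: inner_sum_right)

context brownian_setting
begin

section \<open>Simple integrals and their limits\<close>

lemma simple_integrandD:
  assumes "simple_integrand M F T n s \<theta>"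
  shows "i < n \<Longrightarrow> s i < s (Suc i)" "i \<le> n \<Longrightarrow> 0 \<le> s i" "i \<le> n \<Longrightarrow> s i \<le> T"
    "i < n \<Longrightarrow> \<theta> i \<in> borel_measurable (F (s i))" "i < n \<Longrightarrow> bounded_on_space M (\<theta> i)"
    "i < n \<Longrightarrow> \<theta> i \<in> L2_rv M M"
proof -
  have *: "0 \<le> s 0" "s n \<le> T" "\<And>i. i < n \<Longrightarrow> s i < s (Suc i)"
    "\<And>i. i < n \<Longrightarrow> \<theta> i \<in> borel_measurable (F (s i))" "\<And>i. i < n \<Longrightarrow> bounded_on_space M (\<theta> i)"
    using assms by (auto simp: simple_integrand_def bounded_on_space_def)
  have mono: "s i \<le> s j" if "i \<le> j" "j \<le> n" for i j
    using that
  proof (induction j rule: dec_induct)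
    case (step k)
    then show ?case using *(3)[of k] by simp
  qed simp
  show "i < n \<Longrightarrow> s i < s (Suc i)" "i < n \<Longrightarrow> \<theta> i \<in> borel_measurable (F (s i))" "i < n \<Longrightarrow> bounded_on_space M (\<theta> i)"
    by (fact *)+
  show "i \<le> n \<Longrightarrow> 0 \<le> s i" using mono[of 0 i] *(1) by auto
  show "i \<le> n \<Longrightarrow> s i \<le> T" using mono[of i n] *(2) by auto
  show "i < n \<Longrightarrow> \<theta> i \<in> L2_rv M M" using *(4,5) by (intro bounded_L2 measurable_F_M)
qed

lemma simple_term_L2:
  assumes "simple_integrand M F T n s \<theta>" "i < n" "0 \<le> t"
  shows "(\<lambda>\<omega>. \<theta> i \<omega> *v (W (min (s (Suc i)) t) \<omega> - W (min (s i) t) \<omega>)) \<in> L2_rv M M"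
  using simple_integrandD[OF assms(1), of i] simple_integrandD(2)[OF assms(1), of "Suc i"] assms(2,3)
  by (intro increment_mult_L2) (auto intro: measurable_F_M)

lemma simple_ito_L2:
  assumes "simple_integrand M F T n s \<theta>" "0 \<le> t"
  shows "simple_ito W n s \<theta> t \<in> L2_rv M M"
proof -
  have "(\<lambda>\<omega>. \<Sum>i<n. \<theta> i \<omega> *v (W (min (s (Suc i)) t) \<omega> - W (min (s i) t) \<omega>)) \<in> L2_rv M M"
    by (intro L2_rv_sum simple_term_L2[OF assms(1) _ assms(2)]) auto
  then show ?thesis by (simp add: simple_ito_def[abs_def])
qed

lemma simple_process_pL2:
  assumes "simple_integrand M F T n s \<theta>"
  shows "simple_process n s \<theta> \<in> pL2 M T"
proof -
  have "(\<lambda>r \<omega>. indicator {s i<..s (Suc i)} r *\<^sub>R \<theta> i \<omega>) \<in> pL2 M T" if "i < n" for i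
  proof (rule pL2I, rule L2_rv_norm_le[OF _ pL2D[OF pL2_const_time[OF simple_integrandD(6)[OF assms that]]]])
    have "(\<lambda>r. indicator {s i<..s (Suc i)} r :: real) \<in> borel_measurable tm"
      unfolding time_measure_def by (rule measurable_restrict_space1) auto
    then show "(\<lambda>(r, \<omega>). indicator {s i<..s (Suc i)} r *\<^sub>R \<theta> i \<omega>) \<in> borel_measurable PM"
      using L2_rvD(1)[OF simple_integrandD(6)[OF assms that]] by measurable
  qed (auto intro!: AE_I2 split: split_indicator)
  then have "(\<lambda>z. \<Sum>i<n. (\<lambda>(r, \<omega>). indicator {s i<..s (Suc i)} r *\<^sub>R \<theta> i \<omega>) z) \<in> L2_rv PM PM"
    by (intro L2_rv_sum) (auto dest: pL2D)
  then show ?thesis by (intro pL2I) (simp add: simple_process_def case_prod_beta')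
qed

text \<open>Polarised from the outset and for two unrelated partitions, since the product formula
  pairs different integrals. After expansion each pair of steps contributes the overlap of its
  intervals on either side, so no common refinement is formed.\<close>

lemma simple_isometry:
  assumes 1: "simple_integrand M F T n s \<theta>" and 2: "simple_integrand M F T n' s' \<theta>'" and t: "0 \<le> t"
  shows "(\<integral>\<omega>. simple_ito W n s \<theta> t \<omega> \<bullet> simple_ito W n' s' \<theta>' t \<omega> \<partial>M)
    = ip M t (simple_process n s \<theta>) (simple_process n' s' \<theta>')"
proof -
  have "(\<integral>\<omega>. simple_ito W n s \<theta> t \<omega> \<bullet> simple_ito W n' s' \<theta>' t \<omega> \<partial>M)
    = (\<Sum>i<n. \<Sum>j<n'. (\<integral>\<omega>. (\<theta> i \<omega> *v (W (min (s (Suc i)) t) \<omega> - W (min (s i) t) \<omega>)) \<bullet>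
        (\<theta>' j \<omega> *v (W (min (s' (Suc j)) t) \<omega> - W (min (s' j) t) \<omega>)) \<partial>M))"
    unfolding simple_ito_def inner_sum_sum
    by (intro integral_double_sum L2_inner_integrable simple_term_L2[OF 1 _ t] simple_term_L2[OF 2 _ t])
  also have "\<dots> = (\<Sum>i<n. \<Sum>j<n'. max 0 (min (min (s (Suc i)) t) (min (s' (Suc j)) t) - max (min (s i) t) (min (s' j) t))
      * (\<integral>\<omega>. \<theta> i \<omega> \<bullet> \<theta>' j \<omega> \<partial>M))"
  proof (intro sum.cong refl two_increments)
    fix i j assume "i \<in> {..<n}" "j \<in> {..<n'}"
    then have ij: "i < n" "j < n'" by auto
    note d = simple_integrandD[OF 1, of i] simple_integrandD[OF 2, of j]
    show "0 \<le> min (s i) t" "min (s i) t \<le> min (s (Suc i)) t" "0 \<le> min (s' j) t" "min (s' j) t \<le> min (s' (Suc j)) t"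
      "bounded_on_space M (\<theta> i)" "bounded_on_space M (\<theta>' j)"
      using d ij t by auto
    show "\<theta> i \<in> borel_measurable (F (min (s i) t))" if "min (s i) t < min (s (Suc i)) t"
      using d ij that by (simp add: min_def split: if_splits)
    show "\<theta>' j \<in> borel_measurable (F (min (s' j) t))" if "min (s' j) t < min (s' (Suc j)) t"
      using d ij that by (simp add: min_def split: if_splits)
  qed
  also have "\<dots> = (\<Sum>i<n. \<Sum>j<n'. (LINT r:{0..t}|lborel. indicator {s i<..s (Suc i)} r * indicator {s' j<..s' (Suc j)} r
      * (\<integral>\<omega>. \<theta> i \<omega> \<bullet> \<theta>' j \<omega> \<partial>M)))"
  proof (intro sum.cong refl)
    fix i j assume "i \<in> {..<n}" "j \<in> {..<n'}"
    then have "0 \<le> s i" "0 \<le> s' j" using simple_integrandD(2)[OF 1, of i] simple_integrandD(2)[OF 2, of j] by auto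
    note LINT_two_indicators(1)[OF this, of t "s (Suc i)" "s' (Suc j)", symmetric]
    then show "max 0 (min (min (s (Suc i)) t) (min (s' (Suc j)) t) - max (min (s i) t) (min (s' j) t)) * (\<integral>\<omega>. \<theta> i \<omega> \<bullet> \<theta>' j \<omega> \<partial>M)
      = (LINT r:{0..t}|lborel. indicator {s i<..s (Suc i)} r * indicator {s' j<..s' (Suc j)} r * (\<integral>\<omega>. \<theta> i \<omega> \<bullet> \<theta>' j \<omega> \<partial>M))"
      by (simp only: set_integral_mult_left)
  qed
  also have "\<dots> = (LINT r:{0..t}|lborel. (\<Sum>i<n. \<Sum>j<n'. indicator {s i<..s (Suc i)} r * indicator {s' j<..s' (Suc j)} r
      * (\<integral>\<omega>. \<theta> i \<omega> \<bullet> \<theta>' j \<omega> \<partial>M)))"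
  proof -
    have i: "set_integrable lborel {0..t} (\<lambda>r. indicator {s i<..s (Suc i)} r * indicator {s' j<..s' (Suc j)} r
      * (\<integral>\<omega>. \<theta> i \<omega> \<bullet> \<theta>' j \<omega> \<partial>M))" if "i < n" "j < n'" for i j
      using simple_integrandD(2)[OF 1, of i] simple_integrandD(2)[OF 2, of j] that
      by (intro set_integrable_mult_left LINT_two_indicators(2)) auto
    show ?thesis
      unfolding set_lebesgue_integral_def scaleR_sum_right
      by (intro integral_double_sum[symmetric]) (use i in \<open>simp add: set_integrable_def\<close>)
  qed
  also have "\<dots> = ip M t (simple_process n s \<theta>) (simple_process n' s' \<theta>')"
    unfolding ip_def
  proof (intro set_lebesgue_integral_cong ballI refl allI impI)
    fix r
    have i: "integrable M (\<lambda>\<omega>. \<theta> i \<omega> \<bullet> \<theta>' j \<omega>)" if "i < n" "j < n'" for i j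
      by (intro L2_inner_integrable simple_integrandD(6)[OF 1] simple_integrandD(6)[OF 2] that)
    have "(\<integral>\<omega>. simple_process n s \<theta> r \<omega> \<bullet> simple_process n' s' \<theta>' r \<omega> \<partial>M)
      = (\<integral>\<omega>. (\<Sum>i<n. \<Sum>j<n'. indicator {s i<..s (Suc i)} r * indicator {s' j<..s' (Suc j)} r * (\<theta> i \<omega> \<bullet> \<theta>' j \<omega>)) \<partial>M)"
      by (simp only: simple_process_def inner_sum_sum inner_scaleR_left inner_scaleR_right mult_ac)
    also have "\<dots> = (\<Sum>i<n. \<Sum>j<n'. indicator {s i<..s (Suc i)} r * indicator {s' j<..s' (Suc j)} r * (\<integral>\<omega>. \<theta> i \<omega> \<bullet> \<theta>' j \<omega> \<partial>M))"
      using i by (subst integral_double_sum) (simp_all only: integral_mult_right_zero integrable_mult_right)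
    finally show "(\<Sum>i<n. \<Sum>j<n'. indicator {s i<..s (Suc i)} r * indicator {s' j<..s' (Suc j)} r * (\<integral>\<omega>. \<theta> i \<omega> \<bullet> \<theta>' j \<omega> \<partial>M))
      = (\<integral>\<omega>. simple_process n s \<theta> r \<omega> \<bullet> simple_process n' s' \<theta>' r \<omega> \<partial>M)" by (rule sym)
  qed simp
  finally show ?thesis .
qed

lemma simple_martingale:
  assumes 1: "simple_integrand M F T n s \<theta>" and uv: "0 \<le> u" "u \<le> v"
    and \<zeta>: "\<zeta> \<in> borel_measurable (F u)" "\<zeta> \<in> L2_rv M M"
  shows "(\<integral>\<omega>. \<zeta> \<omega> \<bullet> (simple_ito W n s \<theta> v \<omega> - simple_ito W n s \<theta> u \<omega>) \<partial>M) = 0"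
proof -
  \<comment> \<open>Clipping the grid to \<open>[u, v]\<close> turns the difference of the two
    stopped integrals into a sum of increments with unchanged coefficients.\<close>
  define a where "a i = min (max (s i) u) v" for i
  have clip: "W (min (s (Suc i)) v) \<omega> - W (min (s i) v) \<omega> - (W (min (s (Suc i)) u) \<omega> - W (min (s i) u) \<omega>)
      = W (a (Suc i)) \<omega> - W (a i) \<omega>" if "i < n" for i \<omega>
    using simple_integrandD(1)[OF 1 that] uv by (auto simp: a_def min_def max_def)
  have a: "0 \<le> a i" "a i \<le> a (Suc i)" if "i < n" for i
    using simple_integrandD(1,2)[OF 1, of i] uv that by (auto simp: a_def min_def max_def)
  have "(\<integral>\<omega>. \<zeta> \<omega> \<bullet> (simple_ito W n s \<theta> v \<omega> - simple_ito W n s \<theta> u \<omega>) \<partial>M)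
    = (\<integral>\<omega>. (\<Sum>i<n. \<zeta> \<omega> \<bullet> (\<theta> i \<omega> *v (W (a (Suc i)) \<omega> - W (a i) \<omega>))) \<partial>M)"
    unfolding simple_ito_def sum_subtractf[symmetric] inner_sum_right matrix_vector_mult_diff_distrib[symmetric]
    by (simp add: clip)
  also have "\<dots> = (\<Sum>i<n. (\<integral>\<omega>. \<zeta> \<omega> \<bullet> (\<theta> i \<omega> *v (W (a (Suc i)) \<omega> - W (a i) \<omega>)) \<partial>M))"
  proof (rule Bochner_Integration.integral_sum)
    fix i assume "i \<in> {..<n}"
    then have i: "i < n" by simp
    show "integrable M (\<lambda>\<omega>. \<zeta> \<omega> \<bullet> (\<theta> i \<omega> *v (W (a (Suc i)) \<omega> - W (a i) \<omega>)))"
      using a[OF i] simple_integrandD[OF 1, of i] i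
      by (intro L2_inner_integrable \<zeta> increment_mult_L2) (auto intro: measurable_F_M)
  qed
  also have "\<dots> = (\<Sum>i<n. 0)"
  proof (intro sum.cong refl)
    fix i assume "i \<in> {..<n}"
    then have i: "i < n" by simp
    show "(\<integral>\<omega>. \<zeta> \<omega> \<bullet> (\<theta> i \<omega> *v (W (a (Suc i)) \<omega> - W (a i) \<omega>)) \<partial>M) = 0"
    proof (cases "a i = a (Suc i)")
      case False
      then have lt: "a i < a (Suc i)" using a[OF i] by simp
      \<comment> \<open>A step that survives clipping begins neither before its own grid point nor
        before \<open>u\<close>, so its coefficient and \<open>\<zeta>\<close> are known by
        then.\<close>
      then have "s i \<le> a i" "u \<le> a i"
        using uv simple_integrandD(1)[OF 1 i] by (auto simp: a_def min_def max_def split: if_splits)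
      then show ?thesis
        using a[OF i] simple_integrandD(4,5)[OF 1 i] \<zeta>
        by (intro increment_orthogonal) (auto intro: measurable_F_mono)
    qed simp
  qed
  finally show ?thesis by simp
qed

lemma tendsto_l2n_if_nn_integral:
  fixes f :: "nat \<Rightarrow> 'x \<Rightarrow> 'b::euclidean_space"
  assumes "\<And>j. f j \<in> borel_measurable N" "(\<lambda>j. \<integral>\<^sup>+x. ennreal ((norm (f j x))\<^sup>2) \<partial>N) \<longlonglongrightarrow> 0"
  shows "(\<lambda>j. l2n N (f j)) \<longlonglongrightarrow> 0"
proof -
  have "(\<lambda>j. sqrt (enn2real (\<integral>\<^sup>+x. ennreal ((norm (f j x))\<^sup>2) \<partial>N))) \<longlonglongrightarrow> sqrt 0"
    by (intro tendsto_real_sqrt tendsto_enn2real) (use assms(2) in simp_all)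
  moreover have "l2n N (f j) = sqrt (enn2real (\<integral>\<^sup>+x. ennreal ((norm (f j x))\<^sup>2) \<partial>N))" for j
    unfolding l2n_def using assms(1)[of j] by (subst integral_eq_nn_integral) auto
  ultimately show ?thesis by simp
qed

lemma L2_rv_limit:
  fixes f :: "nat \<Rightarrow> 'x \<Rightarrow> 'b::euclidean_space"
  assumes "\<And>j. f j \<in> L2_rv N N" "g \<in> borel_measurable N"
    and "(\<lambda>j. \<integral>\<^sup>+x. ennreal ((norm (f j x - g x))\<^sup>2) \<partial>N) \<longlonglongrightarrow> 0"
  shows "g \<in> L2_rv N N"
proof -
  have "eventually (\<lambda>j. (\<integral>\<^sup>+x. ennreal ((norm (f j x - g x))\<^sup>2) \<partial>N) < \<infinity>) sequentially"
    by (rule order_tendstoD(2)[OF assms(3)]) simp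
  then obtain j where "(\<integral>\<^sup>+x. ennreal ((norm (f j x - g x))\<^sup>2) \<partial>N) < \<infinity>"
    by (auto simp: eventually_sequentially)
  then have "(\<lambda>x. f j x - g x) \<in> L2_rv N N"
    using L2_rvD(1)[OF assms(1)] assms(2) by (intro L2_rv_if_nn_integral) auto
  from L2_rv_diff[OF assms(1)[of j] this] show ?thesis by simp
qed

text \<open>Translates the definition from extended nonnegative integrals to real norms.
  Square-integrability of \<open>J t\<close> comes from a simple integral at finite
  distance.\<close>

lemma ito_integral_approx:
  assumes "has_ito_integral M F W T Z J"
  shows "\<exists>n s \<theta>. (\<forall>j. simple_integrand M F T (n j) (s j) (\<theta> j))
    \<and> (\<lambda>j. pnorm M T (\<lambda>t \<omega>. simple_process (n j) (s j) (\<theta> j) t \<omega> - Z t \<omega>)) \<longlonglongrightarrow> 0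
    \<and> (\<forall>t\<in>{0..T}. J t \<in> L2_rv M M)
    \<and> (\<forall>t\<in>{0..T}. (\<lambda>j. l2n M (\<lambda>\<omega>. simple_ito W (n j) (s j) (\<theta> j) t \<omega> - J t \<omega>)) \<longlonglongrightarrow> 0)"
proof -
  obtain n s \<theta> where a: "\<And>j. simple_integrand M F T (n j) (s j) (\<theta> j)"
    "(\<lambda>j. H2_sq M T (\<lambda>t \<omega>. simple_process (n j) (s j) (\<theta> j) t \<omega> - Z t \<omega>)) \<longlonglongrightarrow> 0"
    "\<And>t. t \<in> {0..T} \<Longrightarrow> (\<lambda>j. \<integral>\<^sup>+\<omega>. ennreal ((norm (simple_ito W (n j) (s j) (\<theta> j) t \<omega> - J t \<omega>))\<^sup>2) \<partial>M) \<longlonglongrightarrow> 0"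
    and Z: "Z \<in> H2 M F T" and J: "\<And>t. t \<in> {0..T} \<Longrightarrow> J t \<in> borel_measurable (F t)"
    using assms unfolding has_ito_integral_def continuous_adapted_def by blast
  note Zp = adL2D(1)[OF H2_adL2[OF Z]]
  have m: "(\<lambda>(t, \<omega>). simple_process (n j) (s j) (\<theta> j) t \<omega> - Z t \<omega>) \<in> borel_measurable PM" for j
    by (rule pL2_measurable[OF pL2_diff[OF simple_process_pL2[OF a(1)] Zp]])
  have 1: "(\<lambda>j. pnorm M T (\<lambda>t \<omega>. simple_process (n j) (s j) (\<theta> j) t \<omega> - Z t \<omega>)) \<longlonglongrightarrow> 0"
    unfolding pnorm_def by (rule tendsto_l2n_if_nn_integral[OF m]) (use a(2) in \<open>simp add: H2_sq_eq[OF m]\<close>)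
  have 2: "J t \<in> L2_rv M M" if "t \<in> {0..T}" for t
    by (rule L2_rv_limit[OF simple_ito_L2[OF a(1)] measurable_F_M[OF J[OF that]] a(3)[OF that]]) (use that in auto)
  have 3: "(\<lambda>j. l2n M (\<lambda>\<omega>. simple_ito W (n j) (s j) (\<theta> j) t \<omega> - J t \<omega>)) \<longlonglongrightarrow> 0" if "t \<in> {0..T}" for t
    by (rule tendsto_l2n_if_nn_integral[OF _ a(3)[OF that]])
       (intro borel_measurable_diff L2_rvD(1)[OF 2[OF that]] L2_rvD(1)[OF simple_ito_L2[OF a(1)]], use that in auto)
  show ?thesis using a(1) 1 2 3 by blast
qed

lemma ito_isometry:
  assumes g: "has_ito_integral M F W T g J" and h: "has_ito_integral M F W T h K" and t: "t \<in> {0..T}"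
  shows "(\<integral>\<omega>. J t \<omega> \<bullet> K t \<omega> \<partial>M) = ip M t g h"
proof -
  obtain n s \<theta> where 1: "\<And>j. simple_integrand M F T (n j) (s j) (\<theta> j)"
    "(\<lambda>j. pnorm M T (\<lambda>t \<omega>. simple_process (n j) (s j) (\<theta> j) t \<omega> - g t \<omega>)) \<longlonglongrightarrow> 0"
    "\<And>t. t \<in> {0..T} \<Longrightarrow> J t \<in> L2_rv M M"
    "\<And>t. t \<in> {0..T} \<Longrightarrow> (\<lambda>j. l2n M (\<lambda>\<omega>. simple_ito W (n j) (s j) (\<theta> j) t \<omega> - J t \<omega>)) \<longlonglongrightarrow> 0"
    using ito_integral_approx[OF g] by blast
  obtain n' s' \<theta>' where 2: "\<And>j. simple_integrand M F T (n' j) (s' j) (\<theta>' j)"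
    "(\<lambda>j. pnorm M T (\<lambda>t \<omega>. simple_process (n' j) (s' j) (\<theta>' j) t \<omega> - h t \<omega>)) \<longlonglongrightarrow> 0"
    "\<And>t. t \<in> {0..T} \<Longrightarrow> K t \<in> L2_rv M M"
    "\<And>t. t \<in> {0..T} \<Longrightarrow> (\<lambda>j. l2n M (\<lambda>\<omega>. simple_ito W (n' j) (s' j) (\<theta>' j) t \<omega> - K t \<omega>)) \<longlonglongrightarrow> 0"
    using ito_integral_approx[OF h] by blast
  have t0: "0 \<le> t" "t \<le> T" using t by auto
  have gh: "g \<in> pL2 M T" "h \<in> pL2 M T"
    using g h by (auto simp: has_ito_integral_def intro: adL2D(1)[OF H2_adL2])
  have l1: "(\<lambda>j. \<integral>\<omega>. simple_ito W (n j) (s j) (\<theta> j) t \<omega> \<bullet> simple_ito W (n' j) (s' j) (\<theta>' j) t \<omega> \<partial>M)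
      \<longlonglongrightarrow> (\<integral>\<omega>. J t \<omega> \<bullet> K t \<omega> \<partial>M)"
    by (intro L2_inner_tendsto simple_ito_L2[OF 1(1)] simple_ito_L2[OF 2(1)] 1(3,4) 2(3,4) t t0)
  let ?p = "\<lambda>j. simple_process (n j) (s j) (\<theta> j)" and ?q = "\<lambda>j. simple_process (n' j) (s' j) (\<theta>' j)"
  note pq = simple_process_pL2[OF 1(1)] simple_process_pL2[OF 2(1)]
  have l2: "(\<lambda>j. ip M t (?p j) (?q j)) \<longlonglongrightarrow> ip M t g h"
    unfolding ip_eq[OF gh t0(2)] ip_eq[OF pq t0(2)]
  proof (rule L2_inner_tendsto[OF pL2_restrict[OF pq(1)] pL2D[OF pq(2)] pL2_restrict[OF gh(1)] pL2D[OF gh(2)]])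
    show "(\<lambda>j. l2n PM (\<lambda>x. (case x of (s, \<omega>) \<Rightarrow> ?q j s \<omega>) - (case x of (s, \<omega>) \<Rightarrow> h s \<omega>))) \<longlonglongrightarrow> 0"
      using 2(2) by (simp add: pnorm_def case_prod_beta')
    show "(\<lambda>j. l2n PM (\<lambda>x. (case x of (s, \<omega>) \<Rightarrow> indicator {0..t} s *\<^sub>R ?p j s \<omega>)
        - (case x of (s, \<omega>) \<Rightarrow> indicator {0..t} s *\<^sub>R g s \<omega>))) \<longlonglongrightarrow> 0"
    proof (rule tendsto_sandwich[OF always_eventually always_eventually tendsto_const 1(2)]; intro allI)
      fix j
      show "l2n PM (\<lambda>x. (case x of (s, \<omega>) \<Rightarrow> indicator {0..t} s *\<^sub>R ?p j s \<omega>)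
        - (case x of (s, \<omega>) \<Rightarrow> indicator {0..t} s *\<^sub>R g s \<omega>)) \<le> pnorm M T (\<lambda>t \<omega>. ?p j t \<omega> - g t \<omega>)"
        unfolding pnorm_def
        by (rule l2n_mono[OF pL2D[OF pL2_diff[OF pq(1) gh(1)]]]) (auto intro!: AE_I2 split: split_indicator)
    qed simp
  qed
  show ?thesis
    using l1 l2 unfolding simple_isometry[OF 1(1) 2(1) t0(1)] by (rule LIMSEQ_unique)
qed

lemma ito_L2:
  assumes "has_ito_integral M F W T g J" "t \<in> {0..T}"
  shows "J t \<in> L2_rv M M"
  using ito_integral_approx[OF assms(1)] assms(2) by blast

lemma ito_martingale:
  assumes g: "has_ito_integral M F W T g J" and uv: "0 \<le> u" "u \<le> v" "v \<le> T"
    and \<zeta>: "\<zeta> \<in> borel_measurable (F u)" "\<zeta> \<in> L2_rv M M"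
  shows "(\<integral>\<omega>. \<zeta> \<omega> \<bullet> (J v \<omega> - J u \<omega>) \<partial>M) = 0"
proof -
  obtain n s \<theta> where 1: "\<And>j. simple_integrand M F T (n j) (s j) (\<theta> j)"
    "\<And>t. t \<in> {0..T} \<Longrightarrow> J t \<in> L2_rv M M"
    "\<And>t. t \<in> {0..T} \<Longrightarrow> (\<lambda>j. l2n M (\<lambda>\<omega>. simple_ito W (n j) (s j) (\<theta> j) t \<omega> - J t \<omega>)) \<longlonglongrightarrow> 0"
    using ito_integral_approx[OF g] by blast
  have t: "u \<in> {0..T}" "v \<in> {0..T}" "0 \<le> v" using uv by auto
  have lim: "(\<lambda>j. \<integral>\<omega>. \<zeta> \<omega> \<bullet> simple_ito W (n j) (s j) (\<theta> j) t \<omega> \<partial>M) \<longlonglongrightarrow> (\<integral>\<omega>. \<zeta> \<omega> \<bullet> J t \<omega> \<partial>M)"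
    if "t \<in> {0..T}" for t
    by (rule L2_inner_tendsto[OF \<zeta>(2) simple_ito_L2[OF 1(1)] \<zeta>(2) 1(2)[OF that] _ 1(3)[OF that]])
       (use that in \<open>auto simp: l2n_def\<close>)
  have "(\<integral>\<omega>. \<zeta> \<omega> \<bullet> simple_ito W (n j) (s j) (\<theta> j) v \<omega> \<partial>M) - (\<integral>\<omega>. \<zeta> \<omega> \<bullet> simple_ito W (n j) (s j) (\<theta> j) u \<omega> \<partial>M) = 0" for j
    using simple_martingale[OF 1(1) uv(1,2) \<zeta>] L2_inner_integrable[OF \<zeta>(2) simple_ito_L2[OF 1(1)]] uv t
    by (simp add: inner_diff_right)
  then have "(\<lambda>j. 0 :: real) \<longlonglongrightarrow> (\<integral>\<omega>. \<zeta> \<omega> \<bullet> J v \<omega> \<partial>M) - (\<integral>\<omega>. \<zeta> \<omega> \<bullet> J u \<omega> \<partial>M)"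
    using tendsto_diff[OF lim[OF t(2)] lim[OF t(1)]] by simp
  then have "(\<integral>\<omega>. \<zeta> \<omega> \<bullet> J v \<omega> \<partial>M) - (\<integral>\<omega>. \<zeta> \<omega> \<bullet> J u \<omega> \<partial>M) = 0"
    by (rule LIMSEQ_unique) simp
  then show ?thesis
    using L2_inner_integrable[OF \<zeta>(2) 1(2)[OF t(1)]] L2_inner_integrable[OF \<zeta>(2) 1(2)[OF t(2)]]
    by (simp add: inner_diff_right)
qed

text \<open>The definition leaves the value at 0 implicit; the isometry over an interval of length 0
  determines it.\<close>

lemma ito_zero:
  assumes "has_ito_integral M F W T g J"
  shows "AE \<omega> in M. J 0 \<omega> = 0"
proof -
  have 0: "0 \<in> {0..T}" using T_pos by simp
  note J = ito_L2[OF assms 0]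
  have "ip M 0 g g = 0"
    unfolding ip_def set_lebesgue_integral_def
    by (rule integral_eq_zero_AE, rule eventually_mono[OF AE_lborel_singleton[of 0]]) auto
  then have "(\<integral>\<omega>. J 0 \<omega> \<bullet> J 0 \<omega> \<partial>M) = 0" using ito_isometry[OF assms assms 0] by simp
  then have "AE \<omega> in M. J 0 \<omega> \<bullet> J 0 \<omega> = 0"
    by (subst (asm) integral_nonneg_eq_0_iff_AE[OF L2_inner_integrable[OF J J]]) auto
  then show ?thesis by eventually_elim simp
qed

end

section \<open>The Ito product formula in expectation\<close>

definition prim :: "(real \<Rightarrow> 'w \<Rightarrow> 'a::euclidean_space) \<Rightarrow> real \<Rightarrow> 'w \<Rightarrow> 'a" where
  "prim f t \<omega> = (LINT s:{0..t}|lborel. f s \<omega>)"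

lemma integral_inner_left': "integrable M f \<Longrightarrow> (\<integral>x. f x \<bullet> c \<partial>M) = (\<integral>x. f x \<partial>M) \<bullet> (c::'b::euclidean_space)"
  by (rule integral_inner_left)

lemma integral_inner_right': "integrable M f \<Longrightarrow> (\<integral>x. c \<bullet> f x \<partial>M) = c \<bullet> (\<integral>x. f x \<partial>M :: 'b::euclidean_space)"
  by (rule integral_inner_right)

lemma L2_inner_add3:
  fixes a b c d :: "'a \<Rightarrow> 'b::euclidean_space"
  assumes "a \<in> L2_rv N N" "b \<in> L2_rv N N" "c \<in> L2_rv N N" "d \<in> L2_rv N N"
  shows "(\<integral>x. (a x + b x + c x) \<bullet> d x \<partial>N) = (\<integral>x. a x \<bullet> d x \<partial>N) + (\<integral>x. b x \<bullet> d x \<partial>N) + (\<integral>x. c x \<bullet> d x \<partial>N)"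
  using L2_inner_integrable[OF assms(1,4)] L2_inner_integrable[OF assms(2,4)] L2_inner_integrable[OF assms(3,4)]
  by (simp add: inner_add_left)

lemma L2_inner_add3':
  fixes a b c d :: "'a \<Rightarrow> 'b::euclidean_space"
  assumes "a \<in> L2_rv N N" "b \<in> L2_rv N N" "c \<in> L2_rv N N" "d \<in> L2_rv N N"
  shows "(\<integral>x. d x \<bullet> (a x + b x + c x) \<partial>N) = (\<integral>x. d x \<bullet> a x \<partial>N) + (\<integral>x. d x \<bullet> b x \<partial>N) + (\<integral>x. d x \<bullet> c x \<partial>N)"
  using L2_inner_add3[OF assms] by (simp add: inner_commute)

lemma AE_time_measure_neq: "AE s in time_measure T. s \<noteq> r"
  unfolding time_measure_def
  by (subst AE_restrict_space_iff) (simp, rule eventually_mono[OF AE_lborel_singleton[of r]], simp)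

lemma borel_time_measure: "f \<in> borel_measurable borel \<Longrightarrow> f \<in> borel_measurable (time_measure T)"
  unfolding time_measure_def by (rule measurable_restrict_space1) simp

text \<open>Integration by parts for merely integrable derivatives: the product of the two integrals
  is an integral over a square, and Fubini evaluates it on the two triangles separately.\<close>

lemma product_rule_integrals:
  fixes a b :: "real \<Rightarrow> 'b::euclidean_space"
  assumes a: "integrable (time_measure T) a" and b: "integrable (time_measure T) b"
  defines "p \<equiv> \<lambda>f t. \<integral>s. indicator {0..t} s *\<^sub>R f s \<partial>time_measure T"
  shows "p a t \<bullet> p b t = (\<integral>s. indicator {0..t} s * (a s \<bullet> p b s) \<partial>time_measure T)
      + (\<integral>s. indicator {0..t} s * (p a s \<bullet> b s) \<partial>time_measure T)"
proof -
  let ?m = "time_measure T"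
  interpret m: finite_measure ?m by (rule finite_measure_time_measure)
  interpret mm: pair_sigma_finite ?m ?m ..
  note [measurable] = borel_measurable_integrable[OF a] borel_measurable_integrable[OF b]
  have ind[measurable]: "(\<lambda>s. indicator {0..u} s :: real) \<in> borel_measurable ?m" for u
    by (rule borel_time_measure) simp
  have idm[measurable]: "(\<lambda>s. s) \<in> borel_measurable ?m" by (rule borel_time_measure) simp
  have indi: "integrable ?m (\<lambda>s. indicator {0..u} s *\<^sub>R f s)" if "integrable ?m f" for u and f :: "real \<Rightarrow> 'b"
    by (rule Bochner_Integration.integrable_bound[OF that])
       (use borel_measurable_integrable[OF that] in \<open>auto intro!: AE_I2 split: split_indicator\<close>)
  define K where "K s r = (indicator {0..t} s *\<^sub>R a s) \<bullet> (indicator {0..t} r *\<^sub>R b r)" for s r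
  have Km: "(\<lambda>(s, r). K s r) \<in> borel_measurable (?m \<Otimes>\<^sub>M ?m)" unfolding K_def by measurable
  have Ki: "integrable (?m \<Otimes>\<^sub>M ?m) (\<lambda>(s, r). K s r)"
  proof (rule Bochner_Integration.integrable_bound[OF _ Km])
    show "integrable (?m \<Otimes>\<^sub>M ?m) (\<lambda>(s, r). norm (a s) * norm (b r))"
    proof (rule mm.Fubini_integrable)
      show "integrable ?m (\<lambda>x. \<integral>y. norm (case (x, y) of (s, r) \<Rightarrow> norm (a s) * norm (b r)) \<partial>?m)"
        using a by simp
      show "AE x in ?m. integrable ?m (\<lambda>y. case (x, y) of (s, r) \<Rightarrow> norm (a s) * norm (b r))"
        using b by simp
    qed measurable
    have "\<bar>K s r\<bar> \<le> norm (a s) * norm (b r)" for s r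
      using Cauchy_Schwarz_ineq2[of "a s" "b r"] by (auto simp: K_def split: split_indicator)
    then show "AE z in ?m \<Otimes>\<^sub>M ?m. norm (case z of (s, r) \<Rightarrow> K s r)
        \<le> norm (case z of (s, r) \<Rightarrow> norm (a s) * norm (b r))"
      by (auto intro!: AE_I2)
  qed
  have le[measurable]: "{z \<in> space (?m \<Otimes>\<^sub>M ?m). snd z \<le> fst z} \<in> sets (?m \<Otimes>\<^sub>M ?m)"
    by measurable
  \<comment> \<open>The diagonal goes to the first triangle; the second is thereby smaller than the
    stated integral by a single point for each \<open>r\<close>, which is null.\<close>
  let ?K1 = "\<lambda>s r. if r \<le> s then K s r else 0" and ?K2 = "\<lambda>s r. if r \<le> s then 0 else K s r"
  have Ki1: "integrable (?m \<Otimes>\<^sub>M ?m) (case_prod ?K1)"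
    by (rule Bochner_Integration.integrable_bound[OF Ki])
       (use Km le in \<open>auto simp: case_prod_beta' intro!: AE_I2 measurable_If\<close>)
  have Ki2: "integrable (?m \<Otimes>\<^sub>M ?m) (case_prod ?K2)"
    by (rule Bochner_Integration.integrable_bound[OF Ki])
       (use Km le in \<open>auto simp: case_prod_beta' intro!: AE_I2 measurable_If\<close>)
  have "p a t \<bullet> p b t = (\<integral>s. (\<integral>r. K s r \<partial>?m) \<partial>?m)"
    unfolding K_def p_def integral_inner_right'[OF indi[OF b]] integral_inner_left'[OF indi[OF a]] ..
  also have "\<dots> = (\<integral>z. (\<lambda>(s, r). K s r) z \<partial>(?m \<Otimes>\<^sub>M ?m))"
    using mm.integral_fst[OF Ki] by simp
  also have "\<dots> = (\<integral>z. case_prod ?K1 z + case_prod ?K2 z \<partial>(?m \<Otimes>\<^sub>M ?m))"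
    by (intro Bochner_Integration.integral_cong) auto
  also have "\<dots> = (\<integral>s. (\<integral>r. ?K1 s r \<partial>?m) \<partial>?m) + (\<integral>r. (\<integral>s. ?K2 s r \<partial>?m) \<partial>?m)"
    using mm.integral_fst[OF Ki1] mm.integral_snd[OF Ki2] Ki1 Ki2 by simp
  also have "(\<integral>s. (\<integral>r. ?K1 s r \<partial>?m) \<partial>?m) = (\<integral>s. indicator {0..t} s * (a s \<bullet> p b s) \<partial>?m)"
  proof (intro Bochner_Integration.integral_cong refl)
    fix s
    have "(\<integral>r. ?K1 s r \<partial>?m) = (\<integral>r. (indicator {0..t} s *\<^sub>R a s) \<bullet> (indicator {0..s} r *\<^sub>R b r) \<partial>?m)"
      by (intro Bochner_Integration.integral_cong refl) (auto simp: K_def split: split_indicator)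
    also have "\<dots> = (indicator {0..t} s *\<^sub>R a s) \<bullet> p b s"
      unfolding p_def by (rule integral_inner_right'[OF indi[OF b]])
    finally show "(\<integral>r. ?K1 s r \<partial>?m) = indicator {0..t} s * (a s \<bullet> p b s)" by simp
  qed
  also have "(\<integral>r. (\<integral>s. ?K2 s r \<partial>?m) \<partial>?m) = (\<integral>s. indicator {0..t} s * (p a s \<bullet> b s) \<partial>?m)"
  proof (intro Bochner_Integration.integral_cong refl)
    fix r
    have "(\<integral>s. ?K2 s r \<partial>?m) = (\<integral>s. (indicator {0..r} s *\<^sub>R a s) \<bullet> (indicator {0..t} r *\<^sub>R b r) \<partial>?m)"
    proof (rule integral_cong_AE)
      have "(\<lambda>s. if r \<le> s then 0 else K s r) \<in> borel_measurable ?m"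
        unfolding K_def by (intro measurable_If) measurable
      then show "(\<lambda>s. ?K2 s r) \<in> borel_measurable ?m" by simp
      show "(\<lambda>s. (indicator {0..r} s *\<^sub>R a s) \<bullet> (indicator {0..t} r *\<^sub>R b r)) \<in> borel_measurable ?m"
        by measurable
      show "AE s in ?m. ?K2 s r = (indicator {0..r} s *\<^sub>R a s) \<bullet> (indicator {0..t} r *\<^sub>R b r)"
        using AE_time_measure_neq[of r T] AE_space
        by eventually_elim (auto simp: K_def split: split_indicator)
    qed
    also have "\<dots> = p a r \<bullet> (indicator {0..t} r *\<^sub>R b r)"
      unfolding p_def by (rule integral_inner_left'[OF indi[OF a]])
    finally show "(\<integral>s. ?K2 s r \<partial>?m) = indicator {0..t} r * (p a r \<bullet> b r)" by simp
  qed
  finally show ?thesis .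
qed

context brownian_setting
begin

section \<open>Time integrals of processes\<close>

lemma AE_PM_snd:
  assumes "AE \<omega> in M. P \<omega>"
  shows "AE z in PM. P (snd z)"
proof -
  from assms obtain N where N: "N \<in> null_sets M" "{\<omega>\<in>space M. \<not> P \<omega>} \<subseteq> N"
    by (auto elim: AE_E simp: null_sets_def)
  have "{0..T} \<in> sets tm" using sets.top[of tm] by simp
  then have "{0..T} \<times> N \<in> null_sets PM"
    using N(1) by (auto simp: null_sets_def emeasure_pair_measure_Times)
  then show ?thesis
    by (rule AE_I') (use N(2) in \<open>auto simp: space_pair_measure\<close>)
qed

lemma AE_PM_fst:
  assumes "AE s in tm. P s"
  shows "AE z in PM. P (fst z)"
proof -
  from assms obtain N where N: "N \<in> null_sets tm" "{s\<in>space tm. \<not> P s} \<subseteq> N"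
    by (auto elim: AE_E simp: null_sets_def)
  have "N \<times> space M \<in> null_sets PM"
    using N(1) by (auto simp: null_sets_def emeasure_pair_measure_Times)
  then show ?thesis
    by (rule AE_I') (use N(2) in \<open>auto simp: space_pair_measure\<close>)
qed

lemma prim_eq: "t \<le> T \<Longrightarrow> prim f t \<omega> = (\<integral>s. indicator {0..t} s *\<^sub>R f s \<omega> \<partial>tm)"
  unfolding prim_def by (rule integral_time_measure[symmetric])

lemma pL2_AE_path:
  fixes f :: "real \<Rightarrow> 'w \<Rightarrow> 'b::euclidean_space"
  assumes "f \<in> pL2 M T"
  shows "AE \<omega> in M. (\<lambda>s. f s \<omega>) \<in> L2_rv tm tm"
proof -
  have "AE \<omega> in M. integrable tm (\<lambda>s. (norm (f s \<omega>))\<^sup>2)"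
    by (rule pr.AE_integrable_snd) (use L2_rvD(2)[OF pL2D[OF assms]] in \<open>simp add: case_prod_beta'\<close>)
  then show ?thesis using AE_space
    by eventually_elim (use measurable_Pair1[OF pL2_measurable[OF assms]] in \<open>simp add: L2_rv_def\<close>)
qed

lemma prim_measurable:
  fixes f :: "real \<Rightarrow> 'w \<Rightarrow> 'b::euclidean_space"
  assumes "f \<in> pL2 M T"
  shows "(\<lambda>(t, \<omega>). prim f t \<omega>) \<in> borel_measurable PM"
proof -
  have f: "(\<lambda>x. f (snd x) (snd (fst x))) \<in> borel_measurable (PM \<Otimes>\<^sub>M tm)"
    using measurable_compose[OF _ pL2_measurable[OF assms], of "\<lambda>x. (snd x, snd (fst x))" "PM \<Otimes>\<^sub>M tm"] by simp
  have idm[measurable]: "(\<lambda>s. s) \<in> borel_measurable tm" by (rule borel_time_measure) simp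
  have f1: "(\<lambda>x :: (real \<times> 'w) \<times> real. fst (fst x)) \<in> borel_measurable (PM \<Otimes>\<^sub>M tm)"
    by (rule measurable_compose[OF _ idm]) measurable
  have f2: "(\<lambda>x :: (real \<times> 'w) \<times> real. snd x) \<in> borel_measurable (PM \<Otimes>\<^sub>M tm)"
    by (rule measurable_compose[OF _ idm]) measurable
  have ind: "(\<lambda>x :: (real \<times> 'w) \<times> real. if 0 \<le> snd x \<and> snd x \<le> fst (fst x) then 1 else 0 :: real) \<in> borel_measurable (PM \<Otimes>\<^sub>M tm)"
    using f1 f2 by measurable
  have "(\<lambda>x. (if 0 \<le> snd x \<and> snd x \<le> fst (fst x) then 1 else 0) *\<^sub>R f (snd x) (snd (fst x))) \<in> borel_measurable (PM \<Otimes>\<^sub>M tm)"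
    by (rule borel_measurable_scaleR[OF ind f])
  then have "(\<lambda>(z, s). indicator {0..fst z} s *\<^sub>R f s (snd z)) \<in> borel_measurable (PM \<Otimes>\<^sub>M tm)"
    by (simp add: case_prod_beta' indicator_def of_bool_def)
  then have "(\<lambda>z. \<integral>s. indicator {0..fst z} s *\<^sub>R f s (snd z) \<partial>tm) \<in> borel_measurable PM"
    by (rule tm.borel_measurable_lebesgue_integral)
  then show ?thesis
    by (rule measurable_cong[THEN iffD1, rotated]) (auto simp: space_pair_measure prim_eq)
qed

text \<open>Cauchy-Schwarz in time gives one square-integrable variable that bounds the whole path
  of the primitive. Square-integrability of primitives and the supremum estimate both rest on
  it.\<close>

lemma prim_bound:
  fixes f :: "real \<Rightarrow> 'w \<Rightarrow> 'b::euclidean_space"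
  assumes f: "f \<in> pL2 M T"
  defines "B \<equiv> \<lambda>\<omega>. sqrt T * l2n tm (\<lambda>s. f s \<omega>)"
  shows "B \<in> L2_rv M M" "AE \<omega> in M. \<forall>t\<in>{0..T}. norm (prim f t \<omega>) \<le> B \<omega>"
    "l2n M B = sqrt T * pnorm M T f"
proof -
  have i: "integrable PM (\<lambda>(s, \<omega>). (norm (f s \<omega>))\<^sup>2)"
    using L2_rvD(2)[OF pL2D[OF f]] by (simp add: case_prod_beta')
  have B2: "(B \<omega>)\<^sup>2 = T * (\<integral>s. (norm (f s \<omega>))\<^sup>2 \<partial>tm)" for \<omega>
    using T_pos by (simp add: B_def power_mult_distrib l2n_sq)
  have Bi: "integrable M (\<lambda>\<omega>. (B \<omega>)\<^sup>2)"
    unfolding B2 using pr.integrable_snd[OF i] by simp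
  have "(\<lambda>\<omega>. sqrt ((B \<omega>)\<^sup>2)) \<in> borel_measurable M"
    using borel_measurable_integrable[OF Bi] by measurable
  moreover have "sqrt ((B \<omega>)\<^sup>2) = B \<omega>" for \<omega> using T_pos by (simp add: B_def)
  ultimately have "B \<in> borel_measurable M" by simp
  then show "B \<in> L2_rv M M" using Bi by (simp add: L2_rv_def)
  have "(l2n M B)\<^sup>2 = (sqrt T * pnorm M T f)\<^sup>2"
    using pr.integral_snd[OF i] T_pos
    by (simp add: l2n_sq B2 pnorm_def power_mult_distrib case_prod_beta')
  then show "l2n M B = sqrt T * pnorm M T f"
    using T_pos by (simp add: power2_eq_iff_nonneg)
  show "AE \<omega> in M. \<forall>t\<in>{0..T}. norm (prim f t \<omega>) \<le> B \<omega>"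
    using pL2_AE_path[OF f]
  proof eventually_elim
    case (elim \<omega>)
    show ?case
    proof
      fix t assume t: "t \<in> {0..T}"
      have fi: "integrable tm (\<lambda>s. norm (f s \<omega>))"
        using tm.L2_rv_integrable[OF elim] by simp
      have "norm (prim f t \<omega>) \<le> (\<integral>s. norm (indicator {0..t} s *\<^sub>R f s \<omega>) \<partial>tm)"
        using t by (subst prim_eq) (simp, rule integral_norm_bound)
      also have "\<dots> \<le> (\<integral>s. norm (f s \<omega>) \<partial>tm)"
      proof (rule integral_mono[OF _ fi])
        have "(\<lambda>s. indicator {0..t} s :: real) \<in> borel_measurable tm"
          by (rule borel_time_measure) simp
        then show "integrable tm (\<lambda>s. norm (indicator {0..t} s *\<^sub>R f s \<omega>))"
          by (intro Bochner_Integration.integrable_bound[OF fi])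
             (use L2_rvD(1)[OF elim] in \<open>auto intro!: AE_I2 split: split_indicator\<close>)
      qed (auto split: split_indicator)
      also have "\<dots> \<le> l2n tm (\<lambda>s. norm (f s \<omega>)) * l2n tm (\<lambda>_. 1 :: real)"
        using L2_Cauchy_Schwarz[OF L2_rv_norm[OF elim] tm.L2_rv_const[of "1::real"]] by simp
      also have "l2n tm (\<lambda>_. 1 :: real) = sqrt T"
        using T_pos by (simp add: l2n_def measure_def time_measure_def space_restrict_space emeasure_restrict_space)
      finally show "norm (prim f t \<omega>) \<le> B \<omega>" by (simp add: B_def l2n_def mult.commute)
    qed
  qed
qed

lemma prim_pL2:
  fixes f :: "real \<Rightarrow> 'w \<Rightarrow> 'b::euclidean_space"
  assumes f: "f \<in> pL2 M T"
  shows "prim f \<in> pL2 M T" "t \<in> {0..T} \<Longrightarrow> prim f t \<in> L2_rv M M"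
proof -
  note b = prim_bound[OF f]
  show "prim f \<in> pL2 M T"
  proof (rule pL2I, rule L2_rv_norm_le[OF prim_measurable[OF f] pL2D[OF pL2_const_time[OF b(1)]]])
    show "AE z in PM. norm (case z of (s, \<omega>) \<Rightarrow> prim f s \<omega>) \<le> norm (case z of (s, \<omega>) \<Rightarrow> sqrt T * l2n tm (\<lambda>s. f s \<omega>))"
      using AE_PM_snd[OF b(2)] AE_space
      by eventually_elim (auto simp: space_pair_measure split: prod.splits)
  qed
  show "prim f t \<in> L2_rv M M" if t: "t \<in> {0..T}"
  proof (rule L2_rv_norm_le[OF _ b(1)])
    show "prim f t \<in> borel_measurable M"
      using measurable_Pair2[OF prim_measurable[OF f]] t by simp
    show "AE \<omega> in M. norm (prim f t \<omega>) \<le> norm (sqrt T * l2n tm (\<lambda>s. f s \<omega>))"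
      using b(2) by eventually_elim (use t in auto)
  qed
qed

lemma prim_inner_const:
  assumes f: "f \<in> pL2 M T" and \<zeta>: "\<zeta> \<in> L2_rv M M" and t: "t \<in> {0..T}"
  shows "(\<integral>\<omega>. prim f t \<omega> \<bullet> \<zeta> \<omega> \<partial>M) = ip M t f (\<lambda>_. \<zeta>)"
proof -
  let ?h = "\<lambda>s \<omega>. (indicator {0..t} s *\<^sub>R f s \<omega>) \<bullet> \<zeta> \<omega>"
  have i: "integrable PM (case_prod ?h)"
    using L2_inner_integrable[OF pL2_restrict[OF f, of t] pL2D[OF pL2_const_time[OF \<zeta>]]]
    by (simp add: case_prod_beta')
  have "(\<integral>\<omega>. prim f t \<omega> \<bullet> \<zeta> \<omega> \<partial>M) = (\<integral>\<omega>. (\<integral>s. ?h s \<omega> \<partial>tm) \<partial>M)"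
  proof (rule integral_cong_AE)
    show "(\<lambda>\<omega>. prim f t \<omega> \<bullet> \<zeta> \<omega>) \<in> borel_measurable M"
      using L2_rvD(1)[OF prim_pL2(2)[OF f t]] L2_rvD(1)[OF \<zeta>] by measurable
    show "(\<lambda>\<omega>. \<integral>s. ?h s \<omega> \<partial>tm) \<in> borel_measurable M"
      using pr.integrable_snd[OF i] by (rule borel_measurable_integrable)
    show "AE \<omega> in M. prim f t \<omega> \<bullet> \<zeta> \<omega> = (\<integral>s. ?h s \<omega> \<partial>tm)"
      using pL2_AE_path[OF f]
    proof eventually_elim
      case (elim \<omega>)
      have "(\<lambda>s. indicator {0..t} s :: real) \<in> borel_measurable tm"
        by (rule borel_time_measure) simp
      then have "integrable tm (\<lambda>s. indicator {0..t} s *\<^sub>R f s \<omega>)"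
        by (intro Bochner_Integration.integrable_bound[OF tm.L2_rv_integrable[OF elim]])
           (use L2_rvD(1)[OF elim] in \<open>auto intro!: AE_I2 split: split_indicator\<close>)
      from integral_inner_left'[OF this, of "\<zeta> \<omega>"] show ?case using t by (simp add: prim_eq)
    qed
  qed
  also have "\<dots> = (\<integral>z. case_prod ?h z \<partial>PM)" by (rule pr.integral_snd[OF i])
  also have "\<dots> = ip M t f (\<lambda>_. \<zeta>)"
    using t by (subst ip_eq[OF f pL2_const_time[OF \<zeta>]]) (auto simp: case_prod_beta')
  finally show ?thesis .
qed

lemma prim_product:
  assumes f: "f \<in> pL2 M T" and h: "h \<in> pL2 M T" and t: "t \<in> {0..T}"
  shows "(\<integral>\<omega>. prim f t \<omega> \<bullet> prim h t \<omega> \<partial>M) = ip M t f (prim h) + ip M t (prim f) h"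
proof -
  let ?a = "\<lambda>s \<omega>. (indicator {0..t} s *\<^sub>R f s \<omega>) \<bullet> prim h s \<omega>"
  let ?b = "\<lambda>s \<omega>. (indicator {0..t} s *\<^sub>R prim f s \<omega>) \<bullet> h s \<omega>"
  have a: "integrable PM (case_prod ?a)"
    using L2_inner_integrable[OF pL2_restrict[OF f, of t] pL2D[OF prim_pL2(1)[OF h]]]
    by (simp add: case_prod_beta')
  have b: "integrable PM (case_prod ?b)"
    using L2_inner_integrable[OF pL2_restrict[OF prim_pL2(1)[OF f], of t] pL2D[OF h]]
    by (simp add: case_prod_beta')
  have "(\<integral>\<omega>. prim f t \<omega> \<bullet> prim h t \<omega> \<partial>M) = (\<integral>\<omega>. (\<integral>s. ?a s \<omega> \<partial>tm) + (\<integral>s. ?b s \<omega> \<partial>tm) \<partial>M)"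
  proof (rule integral_cong_AE)
    show "(\<lambda>\<omega>. prim f t \<omega> \<bullet> prim h t \<omega>) \<in> borel_measurable M"
      using L2_rvD(1)[OF prim_pL2(2)[OF f t]] L2_rvD(1)[OF prim_pL2(2)[OF h t]] by measurable
    show "(\<lambda>\<omega>. (\<integral>s. ?a s \<omega> \<partial>tm) + (\<integral>s. ?b s \<omega> \<partial>tm)) \<in> borel_measurable M"
      using pr.integrable_snd[OF a] pr.integrable_snd[OF b]
      by (intro borel_measurable_add) (auto dest: borel_measurable_integrable)
    show "AE \<omega> in M. prim f t \<omega> \<bullet> prim h t \<omega> = (\<integral>s. ?a s \<omega> \<partial>tm) + (\<integral>s. ?b s \<omega> \<partial>tm)"
      using pL2_AE_path[OF f] pL2_AE_path[OF h]
    proof eventually_elim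
      case (elim \<omega>)
      have c: "(\<integral>s. indicator {0..t} s * (f s \<omega> \<bullet> (\<integral>r. indicator {0..s} r *\<^sub>R h r \<omega> \<partial>tm)) \<partial>tm) = (\<integral>s. ?a s \<omega> \<partial>tm)"
        "(\<integral>s. indicator {0..t} s * ((\<integral>r. indicator {0..s} r *\<^sub>R f r \<omega> \<partial>tm) \<bullet> h s \<omega>) \<partial>tm) = (\<integral>s. ?b s \<omega> \<partial>tm)"
        by (intro Bochner_Integration.integral_cong refl; simp add: prim_eq)+
      show ?case
        using product_rule_integrals[OF tm.L2_rv_integrable[OF elim(1)] tm.L2_rv_integrable[OF elim(2)], of t] t
        unfolding c by (simp add: prim_eq)
    qed
  qed
  also have "\<dots> = (\<integral>z. case_prod ?a z \<partial>PM) + (\<integral>z. case_prod ?b z \<partial>PM)"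
    using pr.integrable_snd[OF a] pr.integrable_snd[OF b] pr.integral_snd[OF a] pr.integral_snd[OF b] by simp
  also have "(\<integral>z. case_prod ?a z \<partial>PM) = ip M t f (prim h)"
    using t by (subst ip_eq[OF f prim_pL2(1)[OF h]]) (auto simp: case_prod_beta')
  also have "(\<integral>z. case_prod ?b z \<partial>PM) = ip M t (prim f) h"
    using t by (subst ip_eq[OF prim_pL2(1)[OF f] h]) (auto simp: case_prod_beta')
  finally show ?thesis .
qed

lemma continuous_adapted_Prog:
  fixes X :: "real \<Rightarrow> 'w \<Rightarrow> 'b::euclidean_space"
  assumes "continuous_adapted M F T X"
  shows "(\<lambda>(s, \<omega>). X s \<omega>) \<in> borel_measurable (Prog M F T)"
proof (rule Prog_measurableI)
  fix t assume t: "t \<in> {0..T}"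
  let ?N = "restrict_space borel {0..t} \<Otimes>\<^sub>M F t"
  \<comment> \<open>Times are rounded up to the grid of mesh \<open>1 / Suc n\<close> and cut at
    \<open>t\<close>. The cut keeps each sampled value measurable for \<open>F t\<close>, and the
    rounding index ranges over a countable set.\<close>
  define q where "q n s = max 0 (min t (real_of_int \<lceil>s * real (Suc n)\<rceil> / real (Suc n)))" for n s
  show "(\<lambda>(s, \<omega>). X s \<omega>) \<in> borel_measurable ?N"
  proof (rule borel_measurable_LIMSEQ_metric[where f = "\<lambda>n z. X (q n (fst z)) (snd z)"])
    fix n
    have "(\<lambda>s :: real. \<lceil>s * real (Suc n)\<rceil>) \<in> restrict_space borel {0..t} \<rightarrow>\<^sub>M count_space UNIV"
      by (rule measurable_restrict_space1) measurable
    then have c: "(\<lambda>z. \<lceil>fst z * real (Suc n)\<rceil>) \<in> ?N \<rightarrow>\<^sub>M count_space UNIV"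
      by (rule measurable_compose[OF measurable_fst])
    have "(\<lambda>z. X (max 0 (min t (real_of_int i / real (Suc n)))) (snd z)) \<in> borel_measurable ?N" for i
    proof (rule measurable_compose[OF measurable_snd])
      let ?u = "max 0 (min t (real_of_int i / real (Suc n)))"
      have u: "?u \<in> {0..T}" "?u \<le> t" using t by auto
      show "X ?u \<in> borel_measurable (F t)"
        by (rule measurable_F_mono[OF u(2)]) (use assms u(1) in \<open>simp add: continuous_adapted_def\<close>)
    qed
    from measurable_compose_countable[OF this c]
    show "(\<lambda>z. X (q n (fst z)) (snd z)) \<in> borel_measurable ?N" by (simp add: q_def)
  next
    fix z assume "z \<in> space ?N"
    then obtain s \<omega> where z: "z = (s, \<omega>)" "s \<in> {0..t}" "\<omega> \<in> space M"
      by (auto simp: space_pair_measure space_restrict_space)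
    have "(\<lambda>n. q n s) \<longlonglongrightarrow> s"
    proof (rule tendsto_sandwich[OF always_eventually always_eventually tendsto_const]; (intro allI)?)
      show "s \<le> q n s" for n
      proof -
        have "s \<le> real_of_int \<lceil>s * real (Suc n)\<rceil> / real (Suc n)"
          using le_of_int_ceiling[of "s * real (Suc n)"] by (subst pos_le_divide_eq) auto
        then show ?thesis using z(2) unfolding q_def by auto
      qed
      show "q n s \<le> s + 1 / real (Suc n)" for n
      proof -
        have "real_of_int \<lceil>s * real (Suc n)\<rceil> \<le> s * real (Suc n) + 1" by linarith
        then have "real_of_int \<lceil>s * real (Suc n)\<rceil> / real (Suc n) \<le> (s * real (Suc n) + 1) / real (Suc n)"
          by (rule divide_right_mono) simp
        also have "\<dots> = s + 1 / real (Suc n)" by (simp add: add_divide_distrib del: of_nat_Suc)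
        finally have "real_of_int \<lceil>s * real (Suc n)\<rceil> / real (Suc n) \<le> s + 1 / real (Suc n)" .
        moreover have "0 \<le> s + 1 / real (Suc n)" using z(2) by auto
        ultimately show ?thesis unfolding q_def by linarith
      qed
      show "(\<lambda>n. s + 1 / real (Suc n)) \<longlonglongrightarrow> s"
        using tendsto_add[OF tendsto_const[of s] LIMSEQ_inverse_real_of_nat] by (simp add: inverse_eq_divide)
    qed
    moreover have "q n s \<in> {0..T}" for n using t by (auto simp: q_def)
    moreover have "continuous_on {0..T} (\<lambda>s. X s \<omega>)" using assms z(3) by (simp add: continuous_adapted_def)
    ultimately have "(\<lambda>n. X (q n s) \<omega>) \<longlonglongrightarrow> X s \<omega>"
      using z(2) t by (intro continuous_on_tendsto_compose[where f = "\<lambda>s. X s \<omega>"]) auto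
    then show "(\<lambda>n. X (q n (fst z)) (snd z)) \<longlonglongrightarrow> (case z of (s, \<omega>) \<Rightarrow> X s \<omega>)" by (simp add: z)
  qed
qed

lemma S2_adL2:
  fixes X :: "real \<Rightarrow> 'w \<Rightarrow> 'b::euclidean_space"
  assumes "X \<in> S2 M F T"
  shows "X \<in> H2 M F T" "X \<in> adL2 M F T" "t \<in> {0..T} \<Longrightarrow> X t \<in> L2_rv M M"
    "t \<in> {0..T} \<Longrightarrow> X t \<in> borel_measurable (F t)"
proof -
  have ca: "continuous_adapted M F T X" and fin: "S2_sq M T X < \<infinity>" using assms by (auto simp: S2_def)
  note P = continuous_adapted_Prog[OF ca]
  show m: "X t \<in> borel_measurable (F t)" if "t \<in> {0..T}" for t
    using ca that by (simp add: continuous_adapted_def)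
  have le: "(\<integral>\<^sup>+\<omega>. ennreal ((norm (X t \<omega>))\<^sup>2) \<partial>M) \<le> S2_sq M T X" if "t \<in> {0..T}" for t
    unfolding S2_sq_def by (intro nn_integral_mono SUP_upper that)
  show "X t \<in> L2_rv M M" if "t \<in> {0..T}" for t
    by (rule L2_rv_if_nn_integral[OF measurable_F_M[OF m[OF that]]]) (use le[OF that] fin in auto)
  have "(\<integral>\<^sup>+z. ennreal ((norm ((\<lambda>(s, \<omega>). X s \<omega>) z))\<^sup>2) \<partial>PM)
      = (\<integral>\<^sup>+s. (\<integral>\<^sup>+\<omega>. ennreal ((norm (X s \<omega>))\<^sup>2) \<partial>M) \<partial>tm)"
    using measurable_Prog_PM[OF P] by (subst nn_integral_fst[symmetric]) auto
  also have "\<dots> \<le> (\<integral>\<^sup>+s. S2_sq M T X \<partial>tm)" using le by (intro nn_integral_mono) auto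
  also have "\<dots> < \<infinity>"
    using fin tm.emeasure_finite[of "{0..T}", unfolded top.not_eq_extremum] by (simp add: ennreal_mult_less_top)
  finally have pL: "X \<in> pL2 M T"
    by (intro pL2I L2_rv_if_nn_integral measurable_Prog_PM[OF P])
  show "X \<in> H2 M F T" by (rule H2I[OF P pL])
  then show "X \<in> adL2 M F T" by (rule H2_adL2)
qed

lemma ito_pL2:
  assumes g: "has_ito_integral M F W T g J"
  shows "J \<in> pL2 M T" "J \<in> adL2 M F T"
proof -
  have ca: "continuous_adapted M F T J" and gH: "g \<in> H2 M F T" using g by (auto simp: has_ito_integral_def)
  note gp = adL2D(1)[OF H2_adL2[OF gH]]
  note P = measurable_Prog_PM[OF continuous_adapted_Prog[OF ca]]
  have "(\<integral>\<^sup>+\<omega>. ennreal ((norm (J t \<omega>))\<^sup>2) \<partial>M) \<le> ennreal ((pnorm M T g)\<^sup>2)" if t: "t \<in> {0..T}" for t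
  proof -
    have "(l2n M (J t))\<^sup>2 = ip M t g g"
      using ito_isometry[OF g g t] by (simp add: l2n_sq power2_norm_eq_inner)
    also have "\<dots> \<le> (pnorm M T g)\<^sup>2"
      using ip_Cauchy_Schwarz[OF gp gp, of t] t by (simp add: power2_eq_square)
    finally show ?thesis using nn_integral_norm_sq[OF ito_L2[OF g t]] by (simp add: ennreal_leI)
  qed
  then have le: "(\<integral>\<^sup>+s. (\<integral>\<^sup>+\<omega>. ennreal ((norm (J s \<omega>))\<^sup>2) \<partial>M) \<partial>tm) \<le> (\<integral>\<^sup>+s. ennreal ((pnorm M T g)\<^sup>2) \<partial>tm)"
    by (intro nn_integral_mono) auto
  have "(\<integral>\<^sup>+z. ennreal ((norm ((\<lambda>(s, \<omega>). J s \<omega>) z))\<^sup>2) \<partial>PM)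
      = (\<integral>\<^sup>+s. (\<integral>\<^sup>+\<omega>. ennreal ((norm (J s \<omega>))\<^sup>2) \<partial>M) \<partial>tm)"
    using P by (subst nn_integral_fst[symmetric]) auto
  also note le
  also have "(\<integral>\<^sup>+s. ennreal ((pnorm M T g)\<^sup>2) \<partial>tm) < \<infinity>"
    using tm.emeasure_finite[of "{0..T}", unfolded top.not_eq_extremum] by (simp add: ennreal_mult_less_top)
  finally show "J \<in> pL2 M T" by (intro pL2I L2_rv_if_nn_integral P)
  then show "J \<in> adL2 M F T" using ca by (simp add: adL2_def continuous_adapted_def)
qed

text \<open>For \<open>s \<le> t\<close> the value \<open>f s\<close> is orthogonal to
  \<open>K t - K s\<close>, so under the time integral the final value of the martingale may be
  replaced by its running value. Here adaptedness of the drift enters the product formula.\<close>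

lemma prim_martingale:
  assumes f: "f \<in> adL2 M F T" and h: "has_ito_integral M F W T h K" and t: "t \<in> {0..T}"
  shows "(\<integral>\<omega>. prim f t \<omega> \<bullet> K t \<omega> \<partial>M) = ip M t f K"
proof -
  note fp = adL2D(1)[OF f] and Kt = ito_L2[OF h t]
  have "AE s in tm. (\<integral>\<omega>. f s \<omega> \<bullet> K t \<omega> \<partial>M) = (\<integral>\<omega>. f s \<omega> \<bullet> K s \<omega> \<partial>M) \<or> t < s"
    using pL2_AE_L2[OF fp] AE_space
  proof eventually_elim
    case (elim s)
    show ?case
    proof (cases "t < s")
      case False
      then have "(\<integral>\<omega>. f s \<omega> \<bullet> (K t \<omega> - K s \<omega>) \<partial>M) = 0"
        using elim t by (intro ito_martingale[OF h]) (auto intro: adL2D(2)[OF f])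
      moreover have "K s \<in> L2_rv M M" using ito_L2[OF h] elim by auto
      ultimately show ?thesis
        using L2_inner_integrable[OF elim(1) Kt] L2_inner_integrable[OF elim(1), of "K s"]
        by (simp add: inner_diff_right)
    qed simp
  qed
  then have ae: "AE s in tm. indicator {0..t} s *\<^sub>R (\<integral>\<omega>. f s \<omega> \<bullet> K t \<omega> \<partial>M) = indicator {0..t} s *\<^sub>R (\<integral>\<omega>. f s \<omega> \<bullet> K s \<omega> \<partial>M)"
    by eventually_elim (auto split: split_indicator)
  have "ip M t f (\<lambda>_. K t) = ip M t f K"
  proof -
    have tT: "t \<le> T" using t by simp
    have m: "(\<lambda>s. indicator {0..t} s *\<^sub>R (\<integral>\<omega>. f s \<omega> \<bullet> g s \<omega> \<partial>M)) \<in> borel_measurable tm" if "g \<in> pL2 M T" for g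
    proof -
      have "(\<lambda>s. \<integral>\<omega>. f s \<omega> \<bullet> g s \<omega> \<partial>M) \<in> borel_measurable tm"
        using ip_integrable[OF fp that] unfolding integrable_time_measure[symmetric] by (rule borel_measurable_integrable)
      moreover have "(\<lambda>s. indicator {0..t} s :: real) \<in> borel_measurable tm" by (rule borel_time_measure) simp
      ultimately show ?thesis by measurable
    qed
    show ?thesis
      unfolding ip_def integral_time_measure[OF tT, symmetric]
      by (rule integral_cong_AE[OF m[OF pL2_const_time[OF Kt]] m[OF ito_pL2(1)[OF h]] ae])
  qed
  then show ?thesis using prim_inner_const[OF fp Kt t] by simp
qed

text \<open>Strengthens \<open>ito_differential\<close>: process and drift are square-integrable
  over time and chance, and the start is square-integrable and known at time 0. All products in the
  expansion below are then integrable.\<close>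

definition itoproc ::
  "(real \<Rightarrow> 'w \<Rightarrow> real^'n) \<Rightarrow> (real \<Rightarrow> 'w \<Rightarrow> real^'n) \<Rightarrow> (real \<Rightarrow> 'w \<Rightarrow> real^'m^'n) \<Rightarrow> bool" where
  "itoproc X f g \<longleftrightarrow> X \<in> pL2 M T \<and> f \<in> adL2 M F T \<and> X 0 \<in> L2_rv M M \<and> X 0 \<in> borel_measurable (F 0) \<and>
     (\<exists>J. has_ito_integral M F W T g J \<and>
        (AE \<omega> in M. \<forall>t\<in>{0..T}. X t \<omega> = X 0 \<omega> + prim f t \<omega> + J t \<omega>))"

lemma itoproc_diffusion_pL2: "itoproc X f g \<Longrightarrow> g \<in> pL2 M T"
  by (auto simp: itoproc_def has_ito_integral_def intro: adL2D(1)[OF H2_adL2])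

lemma itoproc_L2:
  assumes "itoproc X f g" "t \<in> {0..T}"
  shows "X t \<in> L2_rv M M"
proof -
  obtain J where *: "X \<in> pL2 M T" "f \<in> adL2 M F T" "X 0 \<in> L2_rv M M" "has_ito_integral M F W T g J"
    "AE \<omega> in M. \<forall>t\<in>{0..T}. X t \<omega> = X 0 \<omega> + prim f t \<omega> + J t \<omega>"
    using assms(1) by (auto simp: itoproc_def)
  have "(\<lambda>\<omega>. X 0 \<omega> + prim f t \<omega> + J t \<omega>) \<in> L2_rv M M"
    by (intro L2_rv_add * prim_pL2(2)[OF adL2D(1)[OF *(2)] assms(2)] ito_L2[OF *(4) assms(2)])
  then show ?thesis
    by (rule L2_rv_cong_AE[OF _ pL2_section_measurable[OF *(1) assms(2)]])
       (rule eventually_mono[OF *(5)], rule sym, erule bspec, rule assms(2))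
qed

text \<open>Write both processes as start plus primitive plus martingale and multiply out. Start
  against martingale vanishes, primitive against martingale becomes drift against running
  martingale, and martingale against martingale is the isometry. Collecting the terms with the same
  drift restores the full processes.\<close>

theorem ito_product:
  assumes X: "itoproc X f g" and Y: "itoproc Y h k" and t: "t \<in> {0..T}"
  shows "(\<integral>\<omega>. X t \<omega> \<bullet> Y t \<omega> \<partial>M)
    = (\<integral>\<omega>. X 0 \<omega> \<bullet> Y 0 \<omega> \<partial>M) + ip M t f Y + ip M t X h + ip M t g k"
proof -
  obtain J where X': "X \<in> pL2 M T" "f \<in> adL2 M F T" "X 0 \<in> L2_rv M M" "X 0 \<in> borel_measurable (F 0)"
    "has_ito_integral M F W T g J" "AE \<omega> in M. \<forall>t\<in>{0..T}. X t \<omega> = X 0 \<omega> + prim f t \<omega> + J t \<omega>"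
    using X by (auto simp: itoproc_def)
  obtain K where Y': "Y \<in> pL2 M T" "h \<in> adL2 M F T" "Y 0 \<in> L2_rv M M" "Y 0 \<in> borel_measurable (F 0)"
    "has_ito_integral M F W T k K" "AE \<omega> in M. \<forall>t\<in>{0..T}. Y t \<omega> = Y 0 \<omega> + prim h t \<omega> + K t \<omega>"
    using Y by (auto simp: itoproc_def)
  note fp = adL2D(1)[OF X'(2)] and hp = adL2D(1)[OF Y'(2)]
  note U = prim_pL2[OF fp] and V = prim_pL2[OF hp] and J = ito_L2[OF X'(5)] and K = ito_L2[OF Y'(5)]
  have tT: "t \<le> T" using t by simp
  have start: "(\<integral>\<omega>. \<zeta> \<omega> \<bullet> J t \<omega> \<partial>M) = 0" if "has_ito_integral M F W T g J" "\<zeta> \<in> L2_rv M M" "\<zeta> \<in> borel_measurable (F 0)"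
    for \<zeta> g and J :: "real \<Rightarrow> 'w \<Rightarrow> real^'b"
  proof -
    have 0: "0 \<in> {0..T}" using T_pos by simp
    have "(\<integral>\<omega>. \<zeta> \<omega> \<bullet> J t \<omega> \<partial>M) = (\<integral>\<omega>. \<zeta> \<omega> \<bullet> (J t \<omega> - J 0 \<omega>) \<partial>M)"
      using ito_zero[OF that(1)] L2_rvD(1)[OF that(2)] L2_rvD(1)[OF ito_L2[OF that(1) t]] L2_rvD(1)[OF ito_L2[OF that(1) 0]]
      by (intro integral_cong_AE) (auto elim: eventually_mono)
    also have "\<dots> = 0" by (rule ito_martingale[OF that(1) _ _ _ that(3,2)]) (use t in auto)
    finally show ?thesis .
  qed
  have "(\<integral>\<omega>. X t \<omega> \<bullet> Y t \<omega> \<partial>M) = (\<integral>\<omega>. (X 0 \<omega> + prim f t \<omega> + J t \<omega>) \<bullet> (Y 0 \<omega> + prim h t \<omega> + K t \<omega>) \<partial>M)"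
  proof (rule integral_cong_AE)
    show "(\<lambda>\<omega>. X t \<omega> \<bullet> Y t \<omega>) \<in> borel_measurable M"
      by (intro borel_measurable_inner pL2_section_measurable[OF X'(1) t] pL2_section_measurable[OF Y'(1) t])
    show "(\<lambda>\<omega>. (X 0 \<omega> + prim f t \<omega> + J t \<omega>) \<bullet> (Y 0 \<omega> + prim h t \<omega> + K t \<omega>)) \<in> borel_measurable M"
      by (intro borel_measurable_inner borel_measurable_add L2_rvD(1)[of _ M M] X'(3) Y'(3) U(2) V(2) J K t)
    show "AE \<omega> in M. X t \<omega> \<bullet> Y t \<omega> = (X 0 \<omega> + prim f t \<omega> + J t \<omega>) \<bullet> (Y 0 \<omega> + prim h t \<omega> + K t \<omega>)"
      using X'(6) Y'(6)
    proof eventually_elim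
      case (elim \<omega>)
      show ?case unfolding elim(1)[rule_format, OF t] elim(2)[rule_format, OF t] ..
    qed
  qed
  also have "\<dots> = (\<integral>\<omega>. X 0 \<omega> \<bullet> Y 0 \<omega> \<partial>M) + (\<integral>\<omega>. X 0 \<omega> \<bullet> prim h t \<omega> \<partial>M) + (\<integral>\<omega>. X 0 \<omega> \<bullet> K t \<omega> \<partial>M)
    + (\<integral>\<omega>. prim f t \<omega> \<bullet> Y 0 \<omega> \<partial>M) + (\<integral>\<omega>. prim f t \<omega> \<bullet> prim h t \<omega> \<partial>M) + (\<integral>\<omega>. prim f t \<omega> \<bullet> K t \<omega> \<partial>M)
    + (\<integral>\<omega>. J t \<omega> \<bullet> Y 0 \<omega> \<partial>M) + (\<integral>\<omega>. J t \<omega> \<bullet> prim h t \<omega> \<partial>M) + (\<integral>\<omega>. J t \<omega> \<bullet> K t \<omega> \<partial>M)"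
    unfolding L2_inner_add3[OF X'(3) U(2)[OF t] J[OF t] L2_rv_add[OF L2_rv_add[OF Y'(3) V(2)[OF t]] K[OF t]]]
      L2_inner_add3'[OF Y'(3) V(2)[OF t] K[OF t] X'(3)] L2_inner_add3'[OF Y'(3) V(2)[OF t] K[OF t] U(2)[OF t]]
      L2_inner_add3'[OF Y'(3) V(2)[OF t] K[OF t] J[OF t]] by simp
  also have "(\<integral>\<omega>. X 0 \<omega> \<bullet> K t \<omega> \<partial>M) = 0" by (rule start[OF Y'(5) X'(3,4)])
  also have "(\<integral>\<omega>. J t \<omega> \<bullet> Y 0 \<omega> \<partial>M) = 0" using start[OF X'(5) Y'(3,4)] by (simp add: inner_commute)
  also have "(\<integral>\<omega>. X 0 \<omega> \<bullet> prim h t \<omega> \<partial>M) = ip M t h (\<lambda>_. X 0)"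
    using prim_inner_const[OF hp X'(3) t] by (simp add: inner_commute)
  also have "(\<integral>\<omega>. prim f t \<omega> \<bullet> Y 0 \<omega> \<partial>M) = ip M t f (\<lambda>_. Y 0)" by (rule prim_inner_const[OF fp Y'(3) t])
  also have "(\<integral>\<omega>. prim f t \<omega> \<bullet> prim h t \<omega> \<partial>M) = ip M t f (prim h) + ip M t (prim f) h" by (rule prim_product[OF fp hp t])
  also have "(\<integral>\<omega>. prim f t \<omega> \<bullet> K t \<omega> \<partial>M) = ip M t f K" by (rule prim_martingale[OF X'(2) Y'(5) t])
  also have "(\<integral>\<omega>. J t \<omega> \<bullet> prim h t \<omega> \<partial>M) = ip M t h J"
    using prim_martingale[OF Y'(2) X'(5) t] by (simp add: inner_commute)
  also have "(\<integral>\<omega>. J t \<omega> \<bullet> K t \<omega> \<partial>M) = ip M t g k" by (rule ito_isometry[OF X'(5) Y'(5) t])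
  finally have 1: "(\<integral>\<omega>. X t \<omega> \<bullet> Y t \<omega> \<partial>M) = (\<integral>\<omega>. X 0 \<omega> \<bullet> Y 0 \<omega> \<partial>M) + ip M t h (\<lambda>_. X 0)
    + ip M t f (\<lambda>_. Y 0) + (ip M t f (prim h) + ip M t (prim f) h) + ip M t f K + ip M t h J + ip M t g k"
    by simp
  have c: "(\<lambda>_. X 0) \<in> pL2 M T" "(\<lambda>_. Y 0) \<in> pL2 M T" using X'(3) Y'(3) by (auto intro: pL2_const_time)
  note Jp = ito_pL2(1)[OF X'(5)] and Kp = ito_pL2(1)[OF Y'(5)]
  have path: "AE z in PM. A (fst z) (snd z) = B (fst z) (snd z)"
    if "AE \<omega> in M. \<forall>t\<in>{0..T}. A t \<omega> = B t \<omega>" for A B :: "real \<Rightarrow> 'w \<Rightarrow> real^'b"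
    using AE_PM_snd[OF that] AE_space
  proof eventually_elim
    case (elim z)
    show ?case by (rule elim(1)[rule_format]) (use elim(2) in \<open>auto simp: space_pair_measure\<close>)
  qed
  \<comment> \<open>Almost every path satisfies the decomposition at all times, so it holds almost
    everywhere in time and chance and may be substituted under the time integral.\<close>
  have YY: "ip M t f Y = ip M t f (\<lambda>s \<omega>. Y 0 \<omega> + prim h s \<omega> + K s \<omega>)"
    unfolding ip_commute[of t f]
    by (rule ip_cong_AE_left[OF Y'(1) pL2_add[OF pL2_add[OF c(2) V(1)] Kp] fp tT])
       (rule path[OF Y'(6)])
  have XX: "ip M t X h = ip M t (\<lambda>s \<omega>. X 0 \<omega> + prim f s \<omega> + J s \<omega>) h"
    by (rule ip_cong_AE_left[OF X'(1) pL2_add[OF pL2_add[OF c(1) U(1)] Jp] hp tT])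
       (rule path[OF X'(6)])
  have "ip M t f Y = ip M t f (\<lambda>_. Y 0) + ip M t f (prim h) + ip M t f K"
    unfolding YY using tT
    by (simp add: ip_add_right[OF fp pL2_add[OF c(2) V(1)] Kp] ip_add_right[OF fp c(2) V(1)])
  moreover have "ip M t X h = ip M t h (\<lambda>_. X 0) + ip M t (prim f) h + ip M t h J"
    unfolding XX using tT
    by (simp add: ip_add_left[OF pL2_add[OF c(1) U(1)] Jp hp] ip_add_left[OF c(1) U(1) hp] ip_commute[of t h])
  ultimately show ?thesis using 1 by simp
qed

text \<open>Bilinearity and four uses of the product formula; a stochastic integral of the
  difference of the integrands is never constructed.\<close>

theorem ito_product_diff:
  assumes X: "itoproc X f g" "itoproc X' f' g'" and Y: "itoproc Y h k" "itoproc Y' h' k'" and t: "t \<in> {0..T}"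
  shows "(\<integral>\<omega>. (X t \<omega> - X' t \<omega>) \<bullet> (Y t \<omega> - Y' t \<omega>) \<partial>M)
    = (\<integral>\<omega>. (X 0 \<omega> - X' 0 \<omega>) \<bullet> (Y 0 \<omega> - Y' 0 \<omega>) \<partial>M)
      + ip M t (\<lambda>s \<omega>. f s \<omega> - f' s \<omega>) (\<lambda>s \<omega>. Y s \<omega> - Y' s \<omega>)
      + ip M t (\<lambda>s \<omega>. X s \<omega> - X' s \<omega>) (\<lambda>s \<omega>. h s \<omega> - h' s \<omega>)
      + ip M t (\<lambda>s \<omega>. g s \<omega> - g' s \<omega>) (\<lambda>s \<omega>. k s \<omega> - k' s \<omega>)"
proof -
  have 0: "0 \<in> {0..T}" and tT: "t \<le> T" using T_pos t by auto
  have E: "(\<integral>\<omega>. (a \<omega> - a' \<omega>) \<bullet> (b \<omega> - b' \<omega>) \<partial>M) = (\<integral>\<omega>. a \<omega> \<bullet> b \<omega> \<partial>M) - (\<integral>\<omega>. a \<omega> \<bullet> b' \<omega> \<partial>M)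
      - (\<integral>\<omega>. a' \<omega> \<bullet> b \<omega> \<partial>M) + (\<integral>\<omega>. a' \<omega> \<bullet> b' \<omega> \<partial>M)"
    if "a \<in> L2_rv M M" "a' \<in> L2_rv M M" "b \<in> L2_rv M M" "b' \<in> L2_rv M M"
    for a a' b b' :: "'w \<Rightarrow> real^'b"
    using that by (simp add: inner_diff_left inner_diff_right L2_inner_integrable)
  have I: "ip M t (\<lambda>s \<omega>. a s \<omega> - a' s \<omega>) (\<lambda>s \<omega>. b s \<omega> - b' s \<omega>) = ip M t a b - ip M t a b' - ip M t a' b + ip M t a' b'"
    if "a \<in> pL2 M T" "a' \<in> pL2 M T" "b \<in> pL2 M T" "b' \<in> pL2 M T"
    for a a' b b' :: "real \<Rightarrow> 'w \<Rightarrow> 'e::euclidean_space"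
    using that tT by (simp add: ip_diff_left ip_diff_right pL2_diff)
  have p: "X \<in> pL2 M T" "X' \<in> pL2 M T" "Y \<in> pL2 M T" "Y' \<in> pL2 M T"
    "f \<in> pL2 M T" "f' \<in> pL2 M T" "h \<in> pL2 M T" "h' \<in> pL2 M T"
    using X Y by (auto simp: itoproc_def intro: adL2D(1))
  note q = itoproc_diffusion_pL2[OF X(1)] itoproc_diffusion_pL2[OF X(2)] itoproc_diffusion_pL2[OF Y(1)] itoproc_diffusion_pL2[OF Y(2)]
  note Lt = itoproc_L2[OF X(1) t] itoproc_L2[OF X(2) t] itoproc_L2[OF Y(1) t] itoproc_L2[OF Y(2) t]
  note L0 = itoproc_L2[OF X(1) 0] itoproc_L2[OF X(2) 0] itoproc_L2[OF Y(1) 0] itoproc_L2[OF Y(2) 0]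
  show ?thesis
    unfolding E[OF Lt] E[OF L0] I[OF p(5,6,3,4)] I[OF p(1,2,7,8)] I[OF q]
      ito_product[OF X(1) Y(1) t] ito_product[OF X(1) Y(2) t] ito_product[OF X(2) Y(1) t] ito_product[OF X(2) Y(2) t]
    by simp
qed

end

section \<open>Averaging in time\<close>

text \<open>The window \<open>(t - h, t]\<close> looks into the past, so averaging anticipates
  nothing. Integration against \<open>time_measure\<close> makes the function count as 0 before time
  0.\<close>

definition tavg :: "real \<Rightarrow> real \<Rightarrow> (real \<Rightarrow> 'b::euclidean_space) \<Rightarrow> real \<Rightarrow> 'b" where
  "tavg T h u t = (1 / h) *\<^sub>R (\<integral>s. indicator {t - h<..t} s *\<^sub>R u s \<partial>time_measure T)"

locale time_interval =
  fixes T :: real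
  assumes T_pos': "0 < T"
begin

abbreviation "tm \<equiv> time_measure T"

sublocale finite_measure tm by (rule finite_measure_time_measure)

sublocale tt: pair_sigma_finite tm tm by unfold_locales

lemma tm_ident [measurable]: "(\<lambda>s. s) \<in> borel_measurable tm"
  by (rule borel_time_measure) simp

lemma ind2_measurable [measurable]:
  "(\<lambda>(t, s). indicator {t - h<..t} s :: real) \<in> borel_measurable (tm \<Otimes>\<^sub>M tm)"
proof -
  have "(\<lambda>x :: real \<times> real. if fst x - h < snd x \<and> snd x \<le> fst x then 1 else 0 :: real) \<in> borel_measurable (tm \<Otimes>\<^sub>M tm)"
    by measurable
  then show ?thesis by (simp add: indicator_def case_prod_beta' of_bool_def)
qed

lemma Int_tm_sets: "A \<in> sets borel \<Longrightarrow> A \<inter> {0..T} \<in> sets tm"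
  unfolding sets_time_measure sets_restrict_space by (rule image_eqI[of _ _ A]) auto

lemma tm_sets_borel: "A \<in> sets tm \<Longrightarrow> A \<in> sets borel"
  unfolding sets_time_measure sets_restrict_space by (erule imageE) auto

lemma Int_tm_integrable: "A \<in> sets borel \<Longrightarrow> integrable tm (indicator (A \<inter> {0..T}) :: real \<Rightarrow> real)"
  using emeasure_finite[of "A \<inter> {0..T}", unfolded top.not_eq_extremum]
  by (intro integrable_real_indicator Int_tm_sets) auto

lemma emeasure_tm_le:
  assumes "A \<in> sets borel"
  shows "emeasure tm (A \<inter> {0..T}) \<le> emeasure lborel A"
  unfolding time_measure_def
  using assms by (subst emeasure_restrict_space) (auto intro!: emeasure_mono)

lemma integrable_ind:
  fixes u :: "real \<Rightarrow> 'b::euclidean_space"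
  assumes "integrable tm u"
  shows "integrable tm (\<lambda>s. indicator {a<..b} s *\<^sub>R u s)"
  by (rule Bochner_Integration.integrable_bound[OF assms])
     (use borel_measurable_integrable[OF assms] in \<open>auto intro!: AE_I2 split: split_indicator\<close>)

lemma tavg_measurable:
  fixes u :: "real \<Rightarrow> 'b::euclidean_space"
  assumes "u \<in> borel_measurable tm"
  shows "tavg T h u \<in> borel_measurable tm"
proof -
  have "(\<lambda>(t, s). indicator {t - h<..t} s *\<^sub>R u s) \<in> borel_measurable (tm \<Otimes>\<^sub>M tm)"
    using borel_measurable_scaleR[OF ind2_measurable[of h] measurable_compose[OF measurable_snd assms]]
    by (simp add: case_prod_beta')
  then have "(\<lambda>t. \<integral>s. indicator {t - h<..t} s *\<^sub>R u s \<partial>tm) \<in> borel_measurable tm"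
    by (rule borel_measurable_lebesgue_integral)
  then show ?thesis unfolding tavg_def[abs_def] by measurable
qed

lemma tavg_add:
  fixes u v :: "real \<Rightarrow> 'b::euclidean_space"
  assumes "integrable tm u" "integrable tm v"
  shows "tavg T h (\<lambda>s. u s + v s) t = tavg T h u t + tavg T h v t"
  using integrable_ind[OF assms(1)] integrable_ind[OF assms(2)]
  by (simp add: tavg_def scaleR_add_right)

lemma tavg_diff:
  fixes u v :: "real \<Rightarrow> 'b::euclidean_space"
  assumes "integrable tm u" "integrable tm v"
  shows "tavg T h (\<lambda>s. u s - v s) t = tavg T h u t - tavg T h v t"
  using integrable_ind[OF assms(1)] integrable_ind[OF assms(2)]
  by (simp add: tavg_def scaleR_diff_right)

text \<open>Cauchy-Schwarz on each window bounds the squared average by \<open>1 / h\<close> times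
  the integral of the square over the window. After exchanging integrals each \<open>s\<close> is
  met by windows whose right ends fill a set of length at most \<open>h\<close>.\<close>

lemma tavg_contraction:
  fixes u :: "real \<Rightarrow> 'b::euclidean_space"
  assumes u: "u \<in> L2_rv tm tm" and h: "0 < h"
  shows "tavg T h u \<in> L2_rv tm tm" "l2n tm (tavg T h u) \<le> l2n tm u"
proof -
  note um = L2_rvD(1)[OF u]
  have pw: "ennreal ((norm (tavg T h u t))\<^sup>2)
      \<le> ennreal (1 / h) * (\<integral>\<^sup>+s. ennreal (indicator {t - h<..t} s * (norm (u s))\<^sup>2) \<partial>tm)" for t
  proof -
    let ?w = "\<lambda>s. indicator {t - h<..t} s *\<^sub>R u s" and ?i = "\<lambda>s. indicator {t - h<..t} s :: real"
    have w: "?w \<in> L2_rv tm tm"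
      by (rule L2_rv_norm_le[OF _ u]) (use um in \<open>auto intro!: AE_I2 split: split_indicator\<close>)
    have i: "?i \<in> L2_rv tm tm"
      by (rule L2_rv_norm_le[OF _ L2_rv_const[of "1 :: real"]]) (auto intro!: AE_I2 split: split_indicator)
    have "norm (\<integral>s. ?w s \<partial>tm) \<le> (\<integral>s. norm (?w s) \<partial>tm)" by (rule integral_norm_bound)
    also have "\<dots> = (\<integral>s. ?i s \<bullet> norm (?w s) \<partial>tm)"
      by (intro Bochner_Integration.integral_cong refl) (auto split: split_indicator)
    also have "\<dots> \<le> l2n tm ?i * l2n tm (\<lambda>s. norm (?w s))"
      using L2_Cauchy_Schwarz[OF i L2_rv_norm[OF w]] by linarith
    finally have "(norm (\<integral>s. ?w s \<partial>tm))\<^sup>2 \<le> (l2n tm ?i * l2n tm (\<lambda>s. norm (?w s)))\<^sup>2"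
      by (rule power_mono) simp
    also have "\<dots> = (l2n tm ?i)\<^sup>2 * (l2n tm ?w)\<^sup>2"
      by (simp add: power_mult_distrib l2n_def)
    also have "(l2n tm ?i)\<^sup>2 \<le> h"
    proof -
      have "ennreal ((l2n tm ?i)\<^sup>2) = (\<integral>\<^sup>+s. indicator ({t - h<..t} \<inter> {0..T}) s \<partial>tm)"
        unfolding nn_integral_norm_sq[OF i, symmetric]
        by (intro nn_integral_cong) (auto split: split_indicator)
      also have "\<dots> = emeasure tm ({t - h<..t} \<inter> {0..T})"
        by (rule nn_integral_indicator[OF Int_tm_sets]) simp
      also have "\<dots> \<le> ennreal h" using emeasure_tm_le[of "{t - h<..t}"] h by simp
      finally show ?thesis using h by (simp add: ennreal_le_iff)
    qed
    finally have "(norm (\<integral>s. ?w s \<partial>tm))\<^sup>2 \<le> h * (l2n tm ?w)\<^sup>2" by (simp add: mult_right_mono)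
    then have "(norm (tavg T h u t))\<^sup>2 \<le> (1 / h)\<^sup>2 * (h * (l2n tm ?w)\<^sup>2)"
      using h unfolding tavg_def by (simp add: power_divide divide_right_mono)
    also have "\<dots> = (1 / h) * (l2n tm ?w)\<^sup>2" using h by (simp add: power2_eq_square)
    finally have "ennreal ((norm (tavg T h u t))\<^sup>2) \<le> ennreal (1 / h) * ennreal ((l2n tm ?w)\<^sup>2)"
      using h by (simp add: ennreal_mult'[symmetric] ennreal_leI)
    also have "ennreal ((l2n tm ?w)\<^sup>2) = (\<integral>\<^sup>+s. ennreal (?i s * (norm (u s))\<^sup>2) \<partial>tm)"
      unfolding nn_integral_norm_sq[OF w, symmetric]
      by (intro nn_integral_cong) (auto split: split_indicator)
    finally show ?thesis .
  qed
  have m2: "(\<lambda>(t, s). ennreal (indicator {t - h<..t} s * (norm (u s))\<^sup>2)) \<in> borel_measurable (tm \<Otimes>\<^sub>M tm)"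
    using borel_measurable_times[OF ind2_measurable[of h], of "\<lambda>z. (norm (u (snd z)))\<^sup>2"] um
    by (simp add: case_prod_beta')
  have ms: "(\<lambda>t. \<integral>\<^sup>+s. ennreal (indicator {t - h<..t} s * (norm (u s))\<^sup>2) \<partial>tm) \<in> borel_measurable tm"
    by (rule borel_measurable_nn_integral[OF m2])
  have "(\<integral>\<^sup>+t. ennreal ((norm (tavg T h u t))\<^sup>2) \<partial>tm)
      \<le> (\<integral>\<^sup>+t. ennreal (1 / h) * (\<integral>\<^sup>+s. ennreal (indicator {t - h<..t} s * (norm (u s))\<^sup>2) \<partial>tm) \<partial>tm)"
    by (rule nn_integral_mono) (rule pw)
  also have "\<dots> = ennreal (1 / h) * (\<integral>\<^sup>+t. (\<integral>\<^sup>+s. ennreal (indicator {t - h<..t} s * (norm (u s))\<^sup>2) \<partial>tm) \<partial>tm)"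
    by (rule nn_integral_cmult[OF ms])
  also have "(\<integral>\<^sup>+t. (\<integral>\<^sup>+s. ennreal (indicator {t - h<..t} s * (norm (u s))\<^sup>2) \<partial>tm) \<partial>tm)
      = (\<integral>\<^sup>+s. (\<integral>\<^sup>+t. ennreal (indicator {t - h<..t} s * (norm (u s))\<^sup>2) \<partial>tm) \<partial>tm)"
    using tt.Fubini'[OF m2] by simp
  also have "\<dots> \<le> (\<integral>\<^sup>+s. ennreal h * ennreal ((norm (u s))\<^sup>2) \<partial>tm)"
  proof (rule nn_integral_mono)
    fix s
    have "(\<integral>\<^sup>+t. ennreal (indicator {t - h<..t} s * (norm (u s))\<^sup>2) \<partial>tm)
        = (\<integral>\<^sup>+t. ennreal ((norm (u s))\<^sup>2) * indicator ({s..<s + h} \<inter> {0..T}) t \<partial>tm)"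
      by (intro nn_integral_cong) (auto split: split_indicator)
    also have "\<dots> = ennreal ((norm (u s))\<^sup>2) * emeasure tm ({s..<s + h} \<inter> {0..T})"
      by (rule nn_integral_cmult_indicator[OF Int_tm_sets]) simp
    also have "\<dots> \<le> ennreal ((norm (u s))\<^sup>2) * ennreal h"
      using emeasure_tm_le[of "{s..<s + h}"] h by (intro mult_left_mono) auto
    finally show "(\<integral>\<^sup>+t. ennreal (indicator {t - h<..t} s * (norm (u s))\<^sup>2) \<partial>tm) \<le> ennreal h * ennreal ((norm (u s))\<^sup>2)"
      by (simp add: mult.commute)
  qed
  also have "(\<integral>\<^sup>+s. ennreal h * ennreal ((norm (u s))\<^sup>2) \<partial>tm) = ennreal h * ennreal ((l2n tm u)\<^sup>2)"
    using um by (subst nn_integral_cmult) (auto simp: nn_integral_norm_sq[OF u])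
  also have "ennreal (1 / h) * (ennreal h * ennreal ((l2n tm u)\<^sup>2)) = ennreal ((l2n tm u)\<^sup>2)"
    using h by (simp add: mult.assoc[symmetric] ennreal_mult'[symmetric])
  finally have le: "(\<integral>\<^sup>+t. ennreal ((norm (tavg T h u t))\<^sup>2) \<partial>tm) \<le> ennreal ((l2n tm u)\<^sup>2)"
    using h by (simp add: mult_left_mono)
  show L: "tavg T h u \<in> L2_rv tm tm"
    by (rule L2_rv_if_nn_integral[OF tavg_measurable[OF um]])
       (rule le_less_trans[OF le], simp)
  have "(l2n tm (tavg T h u))\<^sup>2 \<le> (l2n tm u)\<^sup>2"
    using le unfolding nn_integral_norm_sq[OF L] by (simp add: ennreal_le_iff)
  then show "l2n tm (tavg T h u) \<le> l2n tm u" by (rule power2_le_imp_le) simp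
qed

text \<open>The averages converge in mean square as the window \<open>1 / Suc n\<close> shrinks. As
  a predicate this can be carried through a monotone class argument.\<close>

definition tconv :: "(real \<Rightarrow> 'b::euclidean_space) \<Rightarrow> bool" where
  "tconv u \<longleftrightarrow> u \<in> L2_rv tm tm \<and> (\<lambda>n. l2n tm (\<lambda>t. tavg T (1 / Suc n) u t - u t)) \<longlonglongrightarrow> 0"

lemma tavg_diff_le:
  fixes u :: "real \<Rightarrow> 'b::euclidean_space"
  assumes "u \<in> L2_rv tm tm" "0 < h"
  shows "l2n tm (\<lambda>t. tavg T h u t - u t) \<le> 2 * l2n tm u"
  using l2n_add[OF tavg_contraction(1)[OF assms] L2_rv_uminus[OF assms(1)]] tavg_contraction(2)[OF assms]
  by (simp add: l2n_uminus)

lemma tavg_diff_L2: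
  fixes u :: "real \<Rightarrow> 'b::euclidean_space"
  assumes "u \<in> L2_rv tm tm" "0 < h"
  shows "(\<lambda>t. tavg T h u t - u t) \<in> L2_rv tm tm"
  by (intro L2_rv_diff tavg_contraction(1) assms)

lemma tconv_add:
  fixes u v :: "real \<Rightarrow> 'b::euclidean_space"
  assumes "tconv u" "tconv v"
  shows "tconv (\<lambda>t. u t + v t)"
proof -
  have u: "u \<in> L2_rv tm tm" "(\<lambda>n. l2n tm (\<lambda>t. tavg T (1 / Suc n) u t - u t)) \<longlonglongrightarrow> 0"
    and v: "v \<in> L2_rv tm tm" "(\<lambda>n. l2n tm (\<lambda>t. tavg T (1 / Suc n) v t - v t)) \<longlonglongrightarrow> 0"
    using assms by (auto simp: tconv_def)
  have "l2n tm (\<lambda>t. tavg T (1 / Suc n) (\<lambda>t. u t + v t) t - (u t + v t))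
      \<le> l2n tm (\<lambda>t. tavg T (1 / Suc n) u t - u t) + l2n tm (\<lambda>t. tavg T (1 / Suc n) v t - v t)" for n
    using l2n_add[OF tavg_diff_L2[OF u(1), of "1 / Suc n"] tavg_diff_L2[OF v(1), of "1 / Suc n"]]
      tavg_add[OF L2_rv_integrable[OF u(1)] L2_rv_integrable[OF v(1)]]
    by (simp add: algebra_simps)
  note le = this
  have lim: "(\<lambda>n. l2n tm (\<lambda>t. tavg T (1 / Suc n) u t - u t) + l2n tm (\<lambda>t. tavg T (1 / Suc n) v t - v t)) \<longlonglongrightarrow> 0"
    using tendsto_add[OF u(2) v(2)] by simp
  have "(\<lambda>n. l2n tm (\<lambda>t. tavg T (1 / Suc n) (\<lambda>t. u t + v t) t - (u t + v t))) \<longlonglongrightarrow> 0"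
    by (rule Lim_null_comparison[OF always_eventually lim])
       (intro allI, simp only: real_norm_def abs_of_nonneg[OF l2n_nonneg], rule le)
  then show ?thesis using L2_rv_add[OF u(1) v(1)] by (simp add: tconv_def)
qed

text \<open>By contraction an error in the function costs at most twice its size, uniformly in the
  window. Of the four quarters of \<open>e\<close>, two pay for this error and one for the averages
  of \<open>v k\<close>.\<close>

lemma tconv_limit:
  fixes u :: "real \<Rightarrow> 'b::euclidean_space"
  assumes "\<And>k. tconv (v k)" "u \<in> L2_rv tm tm" "(\<lambda>k. l2n tm (\<lambda>t. v k t - u t)) \<longlonglongrightarrow> 0"
  shows "tconv u"
  unfolding tconv_def
proof (intro conjI assms(2) LIMSEQ_I)
  fix e :: real assume "0 < e"
  then have "eventually (\<lambda>k. l2n tm (\<lambda>t. v k t - u t) < e / 4) sequentially"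
    by (intro order_tendstoD(2)[OF assms(3)]) simp
  then obtain k where k: "l2n tm (\<lambda>t. v k t - u t) < e / 4" by (auto simp: eventually_sequentially)
  have vk: "v k \<in> L2_rv tm tm" "(\<lambda>n. l2n tm (\<lambda>t. tavg T (1 / Suc n) (v k) t - v k t)) \<longlonglongrightarrow> 0"
    using assms(1)[of k] by (auto simp: tconv_def)
  have d: "(\<lambda>t. u t - v k t) \<in> L2_rv tm tm" by (intro L2_rv_diff assms(2) vk)
  have "eventually (\<lambda>n. l2n tm (\<lambda>t. tavg T (1 / Suc n) (v k) t - v k t) < e / 4) sequentially"
    using \<open>0 < e\<close> by (intro order_tendstoD(2)[OF vk(2)]) simp
  then obtain N where N: "\<And>n. n \<ge> N \<Longrightarrow> l2n tm (\<lambda>t. tavg T (1 / Suc n) (v k) t - v k t) < e / 4"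
    by (auto simp: eventually_sequentially)
  have "l2n tm (\<lambda>t. tavg T (1 / Suc n) u t - u t) < e" if "n \<ge> N" for n
  proof -
    have 1: "l2n tm (\<lambda>t. tavg T (1 / Suc n) u t - u t)
      = l2n tm (\<lambda>t. (tavg T (1 / Suc n) (\<lambda>t. u t - v k t) t - (u t - v k t)) + (tavg T (1 / Suc n) (v k) t - v k t))"
      by (intro arg_cong[where f = "l2n tm"] ext)
         (simp add: tavg_diff[OF L2_rv_integrable[OF assms(2)] L2_rv_integrable[OF vk(1)]])
    also have "\<dots> \<le> l2n tm (\<lambda>t. tavg T (1 / Suc n) (\<lambda>t. u t - v k t) t - (u t - v k t))
        + l2n tm (\<lambda>t. tavg T (1 / Suc n) (v k) t - v k t)"
      by (intro l2n_add tavg_diff_L2 d vk) simp_all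
    finally show ?thesis
      using k N[OF that] tavg_diff_le[OF d, of "1 / Suc n"] l2n_minus_commute[of tm u "v k"] \<open>0 < e\<close> by simp
  qed
  then show "\<exists>N. \<forall>n\<ge>N. norm (l2n tm (\<lambda>t. tavg T (1 / Suc n) u t - u t) - 0) < e" by auto
qed

text \<open>Functions that agree on \<open>[0,T]\<close> are at distance 0, so the second one is the
  limit of the constant sequence of the first.\<close>

lemma tconv_cong:
  fixes u v :: "real \<Rightarrow> 'b::euclidean_space"
  assumes "tconv u" "\<And>t. t \<in> {0..T} \<Longrightarrow> u t = v t"
  shows "tconv v"
proof (rule tconv_limit[where v = "\<lambda>_. u"])
  have u: "u \<in> L2_rv tm tm" using assms(1) by (simp add: tconv_def)
  have vm: "v \<in> borel_measurable tm"
    using L2_rvD(1)[OF u] by (rule measurable_cong[THEN iffD1, rotated]) (use assms(2) in auto)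
  show "v \<in> L2_rv tm tm" by (rule L2_rv_cong_AE[OF u vm]) (use assms(2) in \<open>auto intro!: AE_I2\<close>)
  have "l2n tm (\<lambda>t. u t - v t) = l2n tm (\<lambda>t. 0 :: 'b)"
    by (rule l2n_cong_AE) (use assms(2) L2_rvD(1)[OF u] vm in \<open>auto intro!: AE_I2\<close>)
  then show "(\<lambda>k. l2n tm (\<lambda>t. u t - v t)) \<longlonglongrightarrow> 0" by (simp add: l2n_def)
qed (rule assms)

lemma tconv_bounded:
  fixes u :: "real \<Rightarrow> 'b::euclidean_space"
  assumes um: "u \<in> borel_measurable tm" and bd: "\<And>t. norm (u t) \<le> C"
    and lim: "AE t in tm. (\<lambda>n. tavg T (1 / Suc n) u t) \<longlonglongrightarrow> u t"
    and bd': "\<And>n t. norm (tavg T (1 / Suc n) u t) \<le> C"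
  shows "tconv u"
  unfolding tconv_def
proof
  have C: "0 \<le> C" using order_trans[OF norm_ge_zero bd[of 0]] .
  show "u \<in> L2_rv tm tm"
    by (rule L2_rv_norm_le[OF um L2_rv_const[of C]]) (use bd C in \<open>auto intro!: AE_I2\<close>)
  have "(\<lambda>n. \<integral>t. (norm (tavg T (1 / Suc n) u t - u t))\<^sup>2 \<partial>tm) \<longlonglongrightarrow> (\<integral>t. 0 \<partial>tm)"
  proof (rule integral_dominated_convergence[where w = "\<lambda>_. (2 * C)\<^sup>2"])
    show "(\<lambda>t. (norm (tavg T (1 / Suc n) u t - u t))\<^sup>2) \<in> borel_measurable tm" for n
      using tavg_measurable[OF um] um by measurable
    show "AE t in tm. (\<lambda>n. (norm (tavg T (1 / Suc n) u t - u t))\<^sup>2) \<longlonglongrightarrow> 0"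
      using lim
    proof eventually_elim
      case (elim t)
      then have "(\<lambda>n. (norm (tavg T (1 / Suc n) u t - u t))\<^sup>2) \<longlonglongrightarrow> (norm (u t - u t))\<^sup>2"
        by (intro tendsto_intros)
      then show ?case by simp
    qed
    show "AE t in tm. norm ((norm (tavg T (1 / Suc n) u t - u t))\<^sup>2) \<le> (2 * C)\<^sup>2" for n
    proof (rule AE_I2)
      fix t
      have "norm (tavg T (1 / Suc n) u t - u t) \<le> 2 * C"
        using norm_triangle_ineq4[of "tavg T (1 / Suc n) u t" "u t"] bd[of t] bd'[of n t] by linarith
      then have "(norm (tavg T (1 / Suc n) u t - u t))\<^sup>2 \<le> (2 * C)\<^sup>2"
        by (rule power_mono) simp
      then show "norm ((norm (tavg T (1 / Suc n) u t - u t))\<^sup>2) \<le> (2 * C)\<^sup>2"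
        by (simp only: real_norm_def abs_power2)
    qed
  qed auto
  then have "(\<lambda>n. sqrt (\<integral>t. (norm (tavg T (1 / Suc n) u t - u t))\<^sup>2 \<partial>tm)) \<longlonglongrightarrow> sqrt 0"
    by (intro tendsto_real_sqrt) simp
  then show "(\<lambda>n. l2n tm (\<lambda>t. tavg T (1 / Suc n) u t - u t)) \<longlonglongrightarrow> 0"
    by (simp add: l2n_def)
qed

lemma measure_tm_Ioc: "0 \<le> a \<Longrightarrow> a \<le> b \<Longrightarrow> b \<le> T \<Longrightarrow> (\<integral>s. indicator {a<..b} s *\<^sub>R c \<partial>tm) = (b - a) *\<^sub>R (c::'b::euclidean_space)"
proof -
  assume "0 \<le> a" "a \<le> b" "b \<le> T"
  then have "measure tm ({a<..b} \<inter> {0..T}) = b - a"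
    unfolding time_measure_def by (subst measure_restrict_space) (auto simp: Int_absorb2 subset_iff)
  moreover have "integrable tm (indicator ({a<..b} \<inter> {0..T}) :: real \<Rightarrow> real)"
    by (rule Int_tm_integrable) simp
  ultimately have "(\<integral>s. indicator ({a<..b} \<inter> {0..T}) s *\<^sub>R c \<partial>tm) = (b - a) *\<^sub>R c"
    by (simp add: Int_assoc)
  moreover have "(\<integral>s. indicator ({a<..b} \<inter> {0..T}) s *\<^sub>R c \<partial>tm) = (\<integral>s. indicator {a<..b} s *\<^sub>R c \<partial>tm)"
    by (intro Bochner_Integration.integral_cong refl) (auto split: split_indicator)
  ultimately show ?thesis by simp
qed

lemma tavg_norm_le:
  fixes u :: "real \<Rightarrow> 'b::euclidean_space"
  assumes "integrable tm u" "\<And>t. norm (u t) \<le> C" "0 < h"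
  shows "norm (tavg T h u t) \<le> C"
proof -
  have C: "0 \<le> C" using order_trans[OF norm_ge_zero assms(2)[of 0]] .
  have "norm (\<integral>s. indicator {t - h<..t} s *\<^sub>R u s \<partial>tm) \<le> (\<integral>s. norm (indicator {t - h<..t} s *\<^sub>R u s) \<partial>tm)"
    by (rule integral_norm_bound)
  also have "\<dots> \<le> (\<integral>s. C * indicator ({t - h<..t} \<inter> {0..T}) s \<partial>tm)"
  proof (rule integral_mono[OF integrable_norm[OF integrable_ind[OF assms(1)]]])
    show "integrable tm (\<lambda>s. C * indicator ({t - h<..t} \<inter> {0..T}) s)"
      by (intro integrable_mult_right Int_tm_integrable) simp
  qed (use assms(2) C in \<open>auto split: split_indicator\<close>)
  also have "\<dots> = C * measure tm ({t - h<..t} \<inter> {0..T})"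
    by (simp add: Int_absorb1 Int_assoc)
  also have "measure tm ({t - h<..t} \<inter> {0..T}) \<le> h"
    using emeasure_tm_le[of "{t - h<..t}"] assms(3) by (simp add: emeasure_eq_measure)
  finally have "norm (\<integral>s. indicator {t - h<..t} s *\<^sub>R u s \<partial>tm) \<le> C * h"
    using C by (simp add: mult_left_mono)
  then show ?thesis using assms(3) by (simp add: tavg_def field_simps)
qed

lemma tconv_indicator_atMost:
  fixes c :: "'b::euclidean_space"
  shows "tconv (\<lambda>t. indicator {..a} t *\<^sub>R c)"
proof (rule tconv_bounded[where C = "norm c"])
  let ?u = "\<lambda>t. indicator {..a} t *\<^sub>R c"
  have "(\<lambda>t. indicator {..a} t :: real) \<in> borel_measurable tm" by (rule borel_time_measure) simp
  then show um: "?u \<in> borel_measurable tm" by measurable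
  show bd: "norm (?u t) \<le> norm c" for t by (auto split: split_indicator)
  have ui: "integrable tm ?u"
    by (rule integrable_const_bound[where B = "norm c"]) (use um bd in auto)
  show "norm (tavg T (1 / Suc n) ?u t) \<le> norm c" for n t
    by (rule tavg_norm_le[OF ui bd]) simp
  show "AE t in tm. (\<lambda>n. tavg T (1 / Suc n) ?u t) \<longlonglongrightarrow> ?u t"
    using AE_time_measure_neq[of 0 T] AE_time_measure_neq[of a T] AE_space
  proof eventually_elim
    case (elim t)
    then have t: "0 < t" "t \<le> T" "t \<noteq> a" by auto
    \<comment> \<open>A window shorter than \<open>t\<close> stays inside \<open>[0,T]\<close>; if
      the jump lies behind \<open>t\<close>, a window shorter than \<open>t - a\<close> does not
      reach it. On such windows the function is constant.\<close>
    define d where "d = (if a < t then min t (t - a) else t)"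
    have d: "0 < d" using t by (auto simp: d_def)
    then obtain N where N: "1 / real (Suc N) < d" using nat_approx_posE by blast
    have "tavg T (1 / Suc n) ?u t = ?u t" if "n \<ge> N" for n
    proof -
      define h where "h = 1 / real (Suc n)"
      have "h \<le> 1 / real (Suc N)" unfolding h_def using that by (intro divide_left_mono) auto
      then have h: "0 < h" "h < d" using N by (auto simp: h_def)
      have "(\<integral>s. indicator {t - h<..t} s *\<^sub>R ?u s \<partial>tm) = (\<integral>s. indicator {t - h<..t} s *\<^sub>R ?u t \<partial>tm)"
        by (intro Bochner_Integration.integral_cong refl)
           (use h t in \<open>auto simp: d_def split: split_indicator if_splits\<close>)
      also have "\<dots> = h *\<^sub>R ?u t"
        using h t by (subst measure_tm_Ioc) (auto simp: d_def split: if_splits)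
      finally have "tavg T h ?u t = ?u t" using h by (simp add: tavg_def)
      then show ?thesis by (simp add: h_def)
    qed
    then show ?case by (intro tendsto_eventually) (auto simp: eventually_sequentially)
  qed
qed

lemma L2_dominated_convergence:
  fixes v :: "nat \<Rightarrow> 'x \<Rightarrow> 'b::euclidean_space" and w :: "'x \<Rightarrow> real"
  assumes "\<And>k. v k \<in> borel_measurable N" "u \<in> borel_measurable N" "w \<in> L2_rv N N"
    and "\<And>k. AE x in N. norm (v k x - u x) \<le> w x" "AE x in N. (\<lambda>k. v k x) \<longlonglongrightarrow> u x"
  shows "(\<lambda>k. l2n N (\<lambda>x. v k x - u x)) \<longlonglongrightarrow> 0"
proof -
  have "(\<lambda>k. \<integral>x. (norm (v k x - u x))\<^sup>2 \<partial>N) \<longlonglongrightarrow> (\<integral>x. 0 \<partial>N)"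
  proof (rule integral_dominated_convergence[where w = "\<lambda>x. (w x)\<^sup>2"])
    show "(\<lambda>x. (norm (v k x - u x))\<^sup>2) \<in> borel_measurable N" for k
      using assms(1)[of k] assms(2) by measurable
    show "integrable N (\<lambda>x. (w x)\<^sup>2)" using L2_rvD(2)[OF assms(3)] by simp
    show "AE x in N. (\<lambda>k. (norm (v k x - u x))\<^sup>2) \<longlonglongrightarrow> 0"
      using assms(5)
    proof eventually_elim
      case (elim x)
      then have "(\<lambda>k. (norm (v k x - u x))\<^sup>2) \<longlonglongrightarrow> (norm (u x - u x))\<^sup>2"
        by (intro tendsto_intros)
      then show ?case by simp
    qed
    show "AE x in N. norm ((norm (v k x - u x))\<^sup>2) \<le> (w x)\<^sup>2" for k
      using assms(4)[of k] by eventually_elim (auto intro: power_mono)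
  qed auto
  then have "(\<lambda>k. sqrt (\<integral>x. (norm (v k x - u x))\<^sup>2 \<partial>N)) \<longlonglongrightarrow> sqrt 0"
    by (intro tendsto_real_sqrt) simp
  then show ?thesis by (simp add: l2n_def)
qed

lemma tconv_sum:
  fixes u :: "'i \<Rightarrow> real \<Rightarrow> 'b::euclidean_space"
  assumes "\<And>i. i \<in> I \<Longrightarrow> tconv (u i)"
  shows "tconv (\<lambda>t. \<Sum>i\<in>I. u i t)"
proof -
  have "tconv (\<lambda>t. 0 :: 'b)" by (simp add: tconv_def tavg_def l2n_def)
  then show ?thesis using assms
    by (induction I rule: infinite_finite_induct) (auto intro: tconv_add)
qed

text \<open>Half-lines generate the Borel sets and are stable under intersection, so only
  complements and disjoint unions remain.\<close>

lemma tconv_indicator: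
  fixes c :: "'b::euclidean_space"
  assumes "A \<in> sets borel"
  shows "tconv (\<lambda>t. indicator A t *\<^sub>R c)"
proof -
  have "{..a} \<inter> {..b} = {..min a b}" for a b :: real by auto
  then have "Int_stable (range (\<lambda>a :: real. {..a}))" by (auto simp: Int_stable_def)
  moreover have "range (\<lambda>a :: real. {..a}) \<subseteq> Pow UNIV" by simp
  moreover have "A \<in> sigma_sets UNIV (range (\<lambda>a :: real. {..a}))" using assms by (simp add: borel_eq_atMost)
  ultimately show ?thesis
  proof (induction arbitrary: c rule: sigma_sets_induct_disjoint)
    case (basic A)
    then show ?case by (auto intro: tconv_indicator_atMost)
  next
    case empty
    then show ?case by (simp add: tconv_def tavg_def l2n_def)
  next
    case (compl A)
    \<comment> \<open>On \<open>[0,T]\<close> the constant \<open>c\<close> is the half-line up to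
      \<open>T\<close>, so the complement is a difference of two functions already treated.\<close>
    have one: "tconv (\<lambda>t. indicator {..T} t *\<^sub>R c)" by (rule tconv_indicator_atMost)
    have "tconv (\<lambda>t. indicator {..T} t *\<^sub>R c + indicator A t *\<^sub>R (- c))"
      by (intro tconv_add one compl.IH)
    then show ?case by (rule tconv_cong) (auto split: split_indicator)
  next
    case (union A)
    have As: "A i \<in> sets borel" for i using union(2) by (auto simp: borel_eq_atMost)
    have im: "(\<lambda>t. indicator B t *\<^sub>R c) \<in> borel_measurable tm" if "B \<in> sets borel" for B
      by (rule borel_time_measure) (use that in simp)
    show ?case
    proof (rule tconv_limit[where v = "\<lambda>k t. \<Sum>i<k. indicator (A i) t *\<^sub>R c"])
      have eq: "(\<Sum>i<k. indicator (A i) t *\<^sub>R c) = indicator (\<Union>i<k. A i) t *\<^sub>R c" for k t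
        using union(1) by (subst indicator_UN_disjoint) (auto simp: scaleR_sum_left disjoint_family_on_def)
      show "tconv (\<lambda>t. \<Sum>i<k. indicator (A i) t *\<^sub>R c)" for k by (intro tconv_sum union.IH)
      have Um: "(\<Union>i. A i) \<in> sets borel" "(\<Union>i<k. A i) \<in> sets borel" for k using As by auto
      show "(\<lambda>t. indicator (\<Union>i. A i) t *\<^sub>R c) \<in> L2_rv tm tm"
        by (rule L2_rv_norm_le[OF im[OF Um(1)] L2_rv_const[of c]]) (auto intro!: AE_I2 split: split_indicator)
      show "(\<lambda>k. l2n tm (\<lambda>t. (\<Sum>i<k. indicator (A i) t *\<^sub>R c) - indicator (\<Union>i. A i) t *\<^sub>R c)) \<longlonglongrightarrow> 0"
        unfolding eq
      proof (rule L2_dominated_convergence[OF im[OF Um(2)] im[OF Um(1)] L2_rv_const[of "norm c"]])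
        show "AE t in tm. norm (indicator (\<Union>i<k. A i) t *\<^sub>R c - indicator (\<Union>i. A i) t *\<^sub>R c) \<le> norm c" for k
          by (auto intro!: AE_I2 split: split_indicator)
        show "AE t in tm. (\<lambda>k. indicator (\<Union>i<k. A i) t *\<^sub>R c) \<longlonglongrightarrow> indicator (\<Union>i. A i) t *\<^sub>R c"
          by (intro AE_I2 tendsto_scaleR LIMSEQ_indicator_UN tendsto_const)
      qed
    qed
  qed
qed

text \<open>Lebesgue differentiation in mean square. Approximating simple functions are bounded by
  \<open>2 * norm u\<close>, hence their distance to \<open>u\<close> by \<open>3 * norm u\<close>,
  and dominated convergence reduces the claim to finite sums of indicators.\<close>

theorem tconv_L2:
  fixes u :: "real \<Rightarrow> 'b::euclidean_space"
  assumes u: "u \<in> L2_rv tm tm"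
  shows "tconv u"
proof -
  obtain s where s: "\<And>i. simple_function tm (s i)" "\<And>x. x \<in> space tm \<Longrightarrow> (\<lambda>i. s i x) \<longlonglongrightarrow> u x"
    "\<And>i x. x \<in> space tm \<Longrightarrow> dist (s i x) 0 \<le> 2 * dist (u x) 0"
    using borel_measurable_implies_sequence_metric[OF L2_rvD(1)[OF u], of 0] by blast
  have "tconv (s i)" for i
  proof -
    have "tconv (\<lambda>t. \<Sum>y\<in>s i ` space tm. indicator (s i -` {y} \<inter> space tm) t *\<^sub>R y)"
    proof (intro tconv_sum tconv_indicator)
      fix y
      have "s i -` {y} \<inter> space tm \<in> sets tm" using s(1)[of i] by (rule simple_functionD(2))
      then show "s i -` {y} \<inter> space tm \<in> sets borel" by (rule tm_sets_borel)
    qed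
    moreover have "(\<Sum>y\<in>s i ` space tm. indicator (s i -` {y} \<inter> space tm) t *\<^sub>R y) = s i t" if "t \<in> {0..T}" for t
    proof -
      have "(\<Sum>y\<in>s i ` space tm. indicator (s i -` {y} \<inter> space tm) t *\<^sub>R y)
          = (\<Sum>y\<in>s i ` space tm. if y = s i t then y else 0)"
        using that by (intro sum.cong refl) auto
      also have "\<dots> = s i t" using that simple_functionD(1)[OF s(1)[of i]] by simp
      finally show ?thesis .
    qed
    ultimately show ?thesis by (rule tconv_cong)
  qed
  moreover have "(\<lambda>k. l2n tm (\<lambda>t. s k t - u t)) \<longlonglongrightarrow> 0"
  proof (rule L2_dominated_convergence[OF borel_measurable_simple_function[OF s(1)] L2_rvD(1)[OF u]])
    show "(\<lambda>x. 3 * norm (u x)) \<in> L2_rv tm tm" using L2_rv_scaleR[OF L2_rv_norm[OF u], of 3] by simp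
    show "AE x in tm. norm (s k x - u x) \<le> 3 * norm (u x)" for k
    proof (rule AE_I2)
      fix x assume "x \<in> space tm"
      then show "norm (s k x - u x) \<le> 3 * norm (u x)"
        using s(3)[of x k] norm_triangle_ineq4[of "s k x" "u x"] by (simp add: dist_norm)
    qed
    show "AE x in tm. (\<lambda>k. s k x) \<longlonglongrightarrow> u x" by (rule AE_I2) (rule s(2))
  qed
  ultimately show ?thesis using u by (intro tconv_limit[of s u])
qed

end

lemma AE_null: "AE x in N. P x \<Longrightarrow> \<exists>N0\<in>null_sets N. {x\<in>space N. \<not> P x} \<subseteq> N0"
  by (erule AE_E) (auto simp: null_sets_def)

sublocale brownian_setting \<subseteq> ti: time_interval T
  by unfold_locales (rule T_pos)

context brownian_setting
begin

section \<open>Averages of processes\<close>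

definition pavg :: "real \<Rightarrow> (real \<Rightarrow> 'w \<Rightarrow> 'b::euclidean_space) \<Rightarrow> real \<Rightarrow> 'w \<Rightarrow> 'b" where
  "pavg h v t \<omega> = tavg T h (\<lambda>s. v s \<omega>) t"

lemma pavg_measurable:
  fixes v :: "real \<Rightarrow> 'w \<Rightarrow> 'b::euclidean_space"
  assumes "v \<in> pL2 M T"
  shows "(\<lambda>(t, \<omega>). pavg h v t \<omega>) \<in> borel_measurable PM"
proof -
  have f: "(\<lambda>x. v (snd x) (snd (fst x))) \<in> borel_measurable (PM \<Otimes>\<^sub>M tm)"
    using measurable_compose[OF _ pL2_measurable[OF assms], of "\<lambda>x. (snd x, snd (fst x))" "PM \<Otimes>\<^sub>M tm"] by simp
  have "(\<lambda>x :: (real \<times> 'w) \<times> real. (fst (fst x), snd x)) \<in> PM \<Otimes>\<^sub>M tm \<rightarrow>\<^sub>M tm \<Otimes>\<^sub>M tm" by measurable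
  from measurable_compose[OF this ti.ind2_measurable[of h]]
  have ind: "(\<lambda>x :: (real \<times> 'w) \<times> real. indicator {fst (fst x) - h<..fst (fst x)} (snd x) :: real) \<in> borel_measurable (PM \<Otimes>\<^sub>M tm)"
    by simp
  have "(\<lambda>(z, s). indicator {fst z - h<..fst z} s *\<^sub>R v s (snd z)) \<in> borel_measurable (PM \<Otimes>\<^sub>M tm)"
    using borel_measurable_scaleR[OF ind f] by (simp add: case_prod_beta')
  then have "(\<lambda>z. \<integral>s. indicator {fst z - h<..fst z} s *\<^sub>R v s (snd z) \<partial>tm) \<in> borel_measurable PM"
    by (rule tm.borel_measurable_lebesgue_integral)
  then have "(\<lambda>z. (1 / h) *\<^sub>R (\<integral>s. indicator {fst z - h<..fst z} s *\<^sub>R v s (snd z) \<partial>tm)) \<in> borel_measurable PM"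
    by measurable
  then show ?thesis by (simp add: pavg_def tavg_def case_prod_beta')
qed

lemma nn_integral_PM_snd:
  "f \<in> borel_measurable PM \<Longrightarrow> (\<integral>\<^sup>+z. f z \<partial>PM) = (\<integral>\<^sup>+\<omega>. (\<integral>\<^sup>+s. f (s, \<omega>) \<partial>tm) \<partial>M)"
  using pr.nn_integral_snd[of f] by simp

text \<open>Contractions proved path by path, such as those for averages and for delays, pass to
  processes by integration over \<open>\<omega>\<close>.\<close>

lemma pL2_if_path_le:
  fixes f :: "real \<Rightarrow> 'w \<Rightarrow> 'b::euclidean_space" and g :: "real \<Rightarrow> 'w \<Rightarrow> 'c::euclidean_space"
  assumes f: "(\<lambda>(t, \<omega>). f t \<omega>) \<in> borel_measurable PM" and g: "g \<in> pL2 M T"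
    and le: "AE \<omega> in M. (\<integral>\<^sup>+s. ennreal ((norm (f s \<omega>))\<^sup>2) \<partial>tm) \<le> (\<integral>\<^sup>+s. ennreal ((norm (g s \<omega>))\<^sup>2) \<partial>tm)"
  shows "f \<in> pL2 M T"
proof (rule pL2I, rule L2_rv_if_nn_integral[OF f])
  have "(\<integral>\<^sup>+z. ennreal ((norm ((\<lambda>(t, \<omega>). f t \<omega>) z))\<^sup>2) \<partial>PM)
      = (\<integral>\<^sup>+\<omega>. (\<integral>\<^sup>+s. ennreal ((norm (f s \<omega>))\<^sup>2) \<partial>tm) \<partial>M)"
    using f by (subst nn_integral_PM_snd) auto
  also have "\<dots> \<le> (\<integral>\<^sup>+\<omega>. (\<integral>\<^sup>+s. ennreal ((norm (g s \<omega>))\<^sup>2) \<partial>tm) \<partial>M)"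
    by (rule nn_integral_mono_AE[OF le])
  also have "\<dots> = (\<integral>\<^sup>+z. ennreal ((norm ((\<lambda>(t, \<omega>). g t \<omega>) z))\<^sup>2) \<partial>PM)"
    using pL2_measurable[OF g] by (subst nn_integral_PM_snd) auto
  also have "\<dots> < \<infinity>" unfolding nn_integral_norm_sq[OF pL2D[OF g]] by simp
  finally show "(\<integral>\<^sup>+z. ennreal ((norm ((\<lambda>(t, \<omega>). f t \<omega>) z))\<^sup>2) \<partial>PM) < \<infinity>" .
qed

lemma pavg_pL2:
  fixes v :: "real \<Rightarrow> 'w \<Rightarrow> 'b::euclidean_space"
  assumes v: "v \<in> pL2 M T" and h: "0 < h"
  shows "pavg h v \<in> pL2 M T"
proof (rule pL2_if_path_le[OF pavg_measurable[OF v] v])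
  show "AE \<omega> in M. (\<integral>\<^sup>+s. ennreal ((norm (pavg h v s \<omega>))\<^sup>2) \<partial>tm) \<le> (\<integral>\<^sup>+s. ennreal ((norm (v s \<omega>))\<^sup>2) \<partial>tm)"
    using pL2_AE_path[OF v]
  proof eventually_elim
    case (elim \<omega>)
    show ?case
      using ti.tavg_contraction[OF elim h] unfolding pavg_def
      by (simp add: nn_integral_norm_sq[OF elim] nn_integral_norm_sq[OF ti.tavg_contraction(1)[OF elim h]] ennreal_leI power_mono)
  qed
qed

text \<open>Almost every path converges by Lebesgue differentiation, and its error is at most twice
  its norm, so four times the squared norm of the path dominates over
  \<open>\<omega>\<close>.\<close>

lemma pavg_tendsto:
  fixes v :: "real \<Rightarrow> 'w \<Rightarrow> 'b::euclidean_space"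
  assumes v: "v \<in> pL2 M T"
  shows "(\<lambda>n. pnorm M T (\<lambda>t \<omega>. pavg (1 / Suc n) v t \<omega> - v t \<omega>)) \<longlonglongrightarrow> 0"
proof -
  let ?d = "\<lambda>n t \<omega>. pavg (1 / Suc n) v t \<omega> - v t \<omega>"
  have d: "?d n \<in> pL2 M T" for n by (intro pL2_diff pavg_pL2 v) simp
  have i: "integrable PM (\<lambda>(t, \<omega>). (norm (?d n t \<omega>))\<^sup>2)" for n
    using L2_rvD(2)[OF pL2D[OF d]] by (simp add: case_prod_beta')
  have iv: "integrable PM (\<lambda>(t, \<omega>). (norm (v t \<omega>))\<^sup>2)"
    using L2_rvD(2)[OF pL2D[OF v]] by (simp add: case_prod_beta')
  have eq: "(pnorm M T (?d n))\<^sup>2 = (\<integral>\<omega>. (l2n tm (\<lambda>t. ?d n t \<omega>))\<^sup>2 \<partial>M)" for n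
    using pr.integral_snd[OF i] by (simp add: pnorm_def l2n_sq case_prod_beta')
  have "(\<lambda>n. \<integral>\<omega>. (l2n tm (\<lambda>t. ?d n t \<omega>))\<^sup>2 \<partial>M) \<longlonglongrightarrow> (\<integral>\<omega>. 0 \<partial>M)"
  proof (rule integral_dominated_convergence[where w = "\<lambda>\<omega>. 4 * (l2n tm (\<lambda>t. v t \<omega>))\<^sup>2"])
    show "(\<lambda>\<omega>. (l2n tm (\<lambda>t. ?d n t \<omega>))\<^sup>2) \<in> borel_measurable M" for n
      unfolding l2n_sq using pr.integrable_snd[OF i] by (rule borel_measurable_integrable)
    show "integrable M (\<lambda>\<omega>. 4 * (l2n tm (\<lambda>t. v t \<omega>))\<^sup>2)"
      unfolding l2n_sq using pr.integrable_snd[OF iv] by simp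
    show "AE \<omega> in M. (\<lambda>n. (l2n tm (\<lambda>t. ?d n t \<omega>))\<^sup>2) \<longlonglongrightarrow> 0"
      using pL2_AE_path[OF v]
    proof eventually_elim
      case (elim \<omega>)
      have "(\<lambda>n. l2n tm (\<lambda>t. ?d n t \<omega>)) \<longlonglongrightarrow> 0"
        using ti.tconv_L2[OF elim] by (simp add: ti.tconv_def pavg_def)
      then have "(\<lambda>n. (l2n tm (\<lambda>t. ?d n t \<omega>))\<^sup>2) \<longlonglongrightarrow> 0\<^sup>2" by (intro tendsto_intros)
      then show ?case by simp
    qed
    show "AE \<omega> in M. norm ((l2n tm (\<lambda>t. ?d n t \<omega>))\<^sup>2) \<le> 4 * (l2n tm (\<lambda>t. v t \<omega>))\<^sup>2" for n
      using pL2_AE_path[OF v]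
    proof eventually_elim
      case (elim \<omega>)
      have "(l2n tm (\<lambda>t. ?d n t \<omega>))\<^sup>2 \<le> (2 * l2n tm (\<lambda>t. v t \<omega>))\<^sup>2"
        using ti.tavg_diff_le[OF elim, of "1 / Suc n"] by (intro power_mono) (auto simp: pavg_def)
      then show ?case by (simp add: power_mult_distrib)
    qed
  qed auto
  then have "(\<lambda>n. sqrt ((pnorm M T (?d n))\<^sup>2)) \<longlonglongrightarrow> sqrt 0"
    unfolding eq by (intro tendsto_real_sqrt) simp
  then show ?thesis by simp
qed

lemma pavg_L2:
  fixes v :: "real \<Rightarrow> 'w \<Rightarrow> 'b::euclidean_space"
  assumes v: "v \<in> pL2 M T" and h: "0 < h"
  shows "AE \<omega> in M. \<forall>t. norm (pavg h v t \<omega>) \<le> (1 / h) * (sqrt T * l2n tm (\<lambda>s. v s \<omega>))"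
    "t \<in> {0..T} \<Longrightarrow> pavg h v t \<in> L2_rv M M"
proof -
  let ?B = "\<lambda>\<omega>. sqrt T * l2n tm (\<lambda>s. v s \<omega>)"
  show bd: "AE \<omega> in M. \<forall>t. norm (pavg h v t \<omega>) \<le> (1 / h) * ?B \<omega>"
    using pL2_AE_path[OF v]
  proof eventually_elim
    case (elim \<omega>)
    show ?case
    proof
      fix t
      have i: "integrable tm (\<lambda>s. v s \<omega>)" by (rule tm.L2_rv_integrable[OF elim])
      have "norm (\<integral>s. indicator {t - h<..t} s *\<^sub>R v s \<omega> \<partial>tm) \<le> (\<integral>s. norm (indicator {t - h<..t} s *\<^sub>R v s \<omega>) \<partial>tm)"
        by (rule integral_norm_bound)
      also have "\<dots> \<le> (\<integral>s. norm (v s \<omega>) \<partial>tm)"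
        by (rule integral_mono[OF integrable_norm[OF ti.integrable_ind[OF i]] integrable_norm[OF i]])
           (auto split: split_indicator)
      also have "\<dots> \<le> l2n tm (\<lambda>s. norm (v s \<omega>)) * l2n tm (\<lambda>_. 1 :: real)"
        using L2_Cauchy_Schwarz[OF L2_rv_norm[OF elim] tm.L2_rv_const[of "1::real"]] by simp
      also have "l2n tm (\<lambda>_. 1 :: real) = sqrt T"
        using T_pos by (simp add: l2n_def measure_def time_measure_def space_restrict_space emeasure_restrict_space)
      finally have "norm (\<integral>s. indicator {t - h<..t} s *\<^sub>R v s \<omega> \<partial>tm) \<le> ?B \<omega>"
        by (simp add: l2n_def mult.commute)
      then show "norm (pavg h v t \<omega>) \<le> (1 / h) * ?B \<omega>"
        using h by (simp add: pavg_def tavg_def divide_right_mono)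
    qed
  qed
  show "pavg h v t \<in> L2_rv M M" if t: "t \<in> {0..T}"
  proof (rule L2_rv_norm_le[OF _ L2_rv_scaleR[OF prim_bound(1)[OF v], of "1 / h"]])
    show "pavg h v t \<in> borel_measurable M"
      using measurable_Pair2[OF pavg_measurable[OF v, of h]] t by simp
    show "AE \<omega> in M. norm (pavg h v t \<omega>) \<le> norm ((1 / h) *\<^sub>R ?B \<omega>)"
      using bd
    proof eventually_elim
      case (elim \<omega>)
      then have "norm (pavg h v t \<omega>) \<le> (1 / h) * ?B \<omega>" by blast
      also have "\<dots> \<le> norm ((1 / h) *\<^sub>R ?B \<omega>)" by (simp only: real_scaleR_def real_norm_def abs_ge_self)
      finally show ?case .
    qed
  qed
qed

text \<open>A moving window changes only near its two endpoints, so averages are continuous in mean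
  square. Functions of their laws that are continuous for this distance are then continuous in time,
  which is the entry point to measurability of laws.\<close>

lemma pavg_continuous:
  fixes v :: "real \<Rightarrow> 'w \<Rightarrow> 'b::euclidean_space"
  assumes v: "v \<in> pL2 M T" and h: "0 < h" and r: "\<And>i. r i \<in> {0..T}" "t \<in> {0..T}" "r \<longlonglongrightarrow> t"
  shows "(\<lambda>i. l2n M (\<lambda>\<omega>. pavg h v (r i) \<omega> - pavg h v t \<omega>)) \<longlonglongrightarrow> 0"
proof (rule ti.L2_dominated_convergence)
  note L = L2_rvD(1)[OF pavg_L2(2)[OF v h]]
  show "pavg h v (r i) \<in> borel_measurable M" "pavg h v t \<in> borel_measurable M" for i
    using L r by auto
  show "(\<lambda>\<omega>. (2 / h) * (sqrt T * l2n tm (\<lambda>s. v s \<omega>))) \<in> L2_rv M M"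
    using L2_rv_scaleR[OF prim_bound(1)[OF v], of "2 / h"] by simp
  show "AE \<omega> in M. norm (pavg h v (r i) \<omega> - pavg h v t \<omega>) \<le> (2 / h) * (sqrt T * l2n tm (\<lambda>s. v s \<omega>))" for i
    using pavg_L2(1)[OF v h]
  proof eventually_elim
    case (elim \<omega>)
    have "(2 / h) * (sqrt T * l2n tm (\<lambda>s. v s \<omega>)) = 2 * ((1 / h) * (sqrt T * l2n tm (\<lambda>s. v s \<omega>)))" by simp
    then show ?case
      using spec[OF elim, of "r i"] spec[OF elim, of t] norm_triangle_ineq4[of "pavg h v (r i) \<omega>" "pavg h v t \<omega>"]
      by linarith
  qed
  show "AE \<omega> in M. (\<lambda>i. pavg h v (r i) \<omega>) \<longlonglongrightarrow> pavg h v t \<omega>"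
    using pL2_AE_path[OF v]
  proof eventually_elim
    case (elim \<omega>)
    have i: "integrable tm (\<lambda>s. v s \<omega>)" by (rule tm.L2_rv_integrable[OF elim])
    have "(\<lambda>i. \<integral>s. indicator {r i - h<..r i} s *\<^sub>R v s \<omega> \<partial>tm) \<longlonglongrightarrow> (\<integral>s. indicator {t - h<..t} s *\<^sub>R v s \<omega> \<partial>tm)"
    proof (rule integral_dominated_convergence[OF _ _ integrable_norm[OF i]])
      show "AE s in tm. (\<lambda>i. indicator {r i - h<..r i} s *\<^sub>R v s \<omega>) \<longlonglongrightarrow> indicator {t - h<..t} s *\<^sub>R v s \<omega>"
        using AE_time_measure_neq[of t T] AE_time_measure_neq[of "t - h" T]
      proof eventually_elim
        case (elim s)
        have rh: "(\<lambda>i. r i - h) \<longlonglongrightarrow> t - h" by (intro tendsto_intros r)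
        have e: "eventually (\<lambda>i. (s \<le> r i) = (s \<le> t)) sequentially"
        proof (cases "s < t")
          case True
          then show ?thesis using order_tendstoD(1)[OF r(3) True] by (auto elim: eventually_mono)
        next
          case False
          then have "t < s" using elim by simp
          then show ?thesis using order_tendstoD(2)[OF r(3) \<open>t < s\<close>] by (auto elim: eventually_mono)
        qed
        have e': "eventually (\<lambda>i. (r i - h < s) = (t - h < s)) sequentially"
        proof (cases "s < t - h")
          case True
          then show ?thesis using order_tendstoD(1)[OF rh True] by (auto elim: eventually_mono)
        next
          case False
          then have "t - h < s" using elim by simp
          then show ?thesis using order_tendstoD(2)[OF rh \<open>t - h < s\<close>] by (auto elim: eventually_mono)
        qed
        have "eventually (\<lambda>i. indicator {r i - h<..r i} s *\<^sub>R v s \<omega> = indicator {t - h<..t} s *\<^sub>R v s \<omega>) sequentially"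
          using e e' by eventually_elim (simp add: indicator_def)
        then show ?case by (rule tendsto_eventually)
      qed
      show "AE s in tm. norm (indicator {r i - h<..r i} s *\<^sub>R v s \<omega>) \<le> norm (v s \<omega>)" for i
        by (auto intro!: AE_I2 split: split_indicator)
      show "(\<lambda>s. indicator {r i - h<..r i} s *\<^sub>R v s \<omega>) \<in> borel_measurable tm" for i
        by (rule borel_measurable_integrable[OF ti.integrable_ind[OF i]])
      show "(\<lambda>s. indicator {t - h<..t} s *\<^sub>R v s \<omega>) \<in> borel_measurable tm"
        by (rule borel_measurable_integrable[OF ti.integrable_ind[OF i]])
    qed
    then show ?case unfolding pavg_def tavg_def by (intro tendsto_intros)
  qed
qed

section \<open>Measurability of the flow of laws\<close>

text \<open>Transfers measurability questions from the Wasserstein space to real functions.\<close>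

definition law_gap :: "'b::euclidean_space measure set \<Rightarrow> ('w \<Rightarrow> 'b) \<Rightarrow> real" where
  "law_gap U \<zeta> = Inf (insert 1 {l2n M (\<lambda>\<omega>. \<zeta> \<omega> - \<zeta>' \<omega>) | \<zeta>'. \<zeta>' \<in> L2_rv M M \<and> distr M borel \<zeta>' \<notin> U})"

lemma law_gap_bdd: "bdd_below (insert 1 {l2n M (\<lambda>\<omega>. \<zeta> \<omega> - \<zeta>' \<omega>) | \<zeta>'. \<zeta>' \<in> L2_rv M M \<and> distr M borel \<zeta>' \<notin> U})"
  by (rule bdd_belowI[where m = 0]) auto

text \<open>\<open>law_gap U\<close> is the mean-square distance to the variables whose law lies
  outside \<open>U\<close>, hence Lipschitz with constant 1. The cap at 1 keeps the set under the
  infimum nonempty when no such variable exists.\<close>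

lemma law_gap_lipschitz:
  fixes \<zeta> \<theta> :: "'w \<Rightarrow> 'b::euclidean_space"
  assumes "\<zeta> \<in> L2_rv M M" "\<theta> \<in> L2_rv M M"
  shows "\<bar>law_gap U \<zeta> - law_gap U \<theta>\<bar> \<le> l2n M (\<lambda>\<omega>. \<zeta> \<omega> - \<theta> \<omega>)"
proof -
  have le: "law_gap U \<zeta> - l2n M (\<lambda>\<omega>. \<zeta> \<omega> - \<theta> \<omega>) \<le> law_gap U \<theta>"
    if L: "\<zeta> \<in> L2_rv M M" "\<theta> \<in> L2_rv M M" for \<zeta> \<theta> :: "'w \<Rightarrow> 'b"
    unfolding law_gap_def[of U \<theta>]
  proof (rule cInf_greatest)
    fix x assume "x \<in> insert 1 {l2n M (\<lambda>\<omega>. \<theta> \<omega> - \<zeta>' \<omega>) | \<zeta>'. \<zeta>' \<in> L2_rv M M \<and> distr M borel \<zeta>' \<notin> U}"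
    then consider "x = 1" | \<zeta>' where "x = l2n M (\<lambda>\<omega>. \<theta> \<omega> - \<zeta>' \<omega>)" "\<zeta>' \<in> L2_rv M M" "distr M borel \<zeta>' \<notin> U"
      by auto
    then show "law_gap U \<zeta> - l2n M (\<lambda>\<omega>. \<zeta> \<omega> - \<theta> \<omega>) \<le> x"
    proof cases
      case 1
      have "law_gap U \<zeta> \<le> 1" unfolding law_gap_def by (rule cInf_lower[OF _ law_gap_bdd]) simp
      then show ?thesis using 1 l2n_nonneg[of M "\<lambda>\<omega>. \<zeta> \<omega> - \<theta> \<omega>"] by linarith
    next
      case 2
      have "law_gap U \<zeta> \<le> l2n M (\<lambda>\<omega>. \<zeta> \<omega> - \<zeta>' \<omega>)"
        unfolding law_gap_def by (rule cInf_lower[OF _ law_gap_bdd]) (use 2 in auto)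
      then show ?thesis using l2n_triangle[OF L 2(2)] 2(1) by linarith
    qed
  qed simp
  show ?thesis
    using le[OF assms] le[OF assms(2,1)] l2n_minus_commute[of M \<zeta> \<theta>] by (simp add: abs_le_iff)
qed

text \<open>A Wasserstein ball inside \<open>U\<close> keeps variables with laws outside
  \<open>U\<close> away, since mean-square distance dominates \<open>W2\<close>; conversely a
  variable whose own law is outside \<open>U\<close> has gap 0. Membership in an open set thus
  becomes positivity of a real function.\<close>

lemma law_gap_pos_iff:
  fixes \<zeta> :: "'w \<Rightarrow> 'b::euclidean_space"
  assumes U: "openin (Metric_space.mtopology P2 W2) U" and \<zeta>: "\<zeta> \<in> L2_rv M M"
  shows "0 < law_gap U \<zeta> \<longleftrightarrow> law M \<zeta> \<in> U"
proof
  assume "law M \<zeta> \<in> U"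
  then have "distr M borel \<zeta> \<in> U" using \<zeta> by (simp add: law_def)
  then obtain r where r: "r > 0" "\<And>\<nu>. \<nu> \<in> P2 \<Longrightarrow> W2 (distr M borel \<zeta>) \<nu> < r \<Longrightarrow> \<nu> \<in> U"
    using openin_W2_ball[OF U] by blast
  have "min 1 r \<le> law_gap U \<zeta>"
    unfolding law_gap_def
  proof (rule cInf_greatest)
    fix x assume "x \<in> insert 1 {l2n M (\<lambda>\<omega>. \<zeta> \<omega> - \<zeta>' \<omega>) | \<zeta>'. \<zeta>' \<in> L2_rv M M \<and> distr M borel \<zeta>' \<notin> U}"
    then consider "x = 1" | \<zeta>' where "x = l2n M (\<lambda>\<omega>. \<zeta> \<omega> - \<zeta>' \<omega>)" "\<zeta>' \<in> L2_rv M M" "distr M borel \<zeta>' \<notin> U"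
      by auto
    then show "min 1 r \<le> x"
    proof cases
      case 2
      then have "r \<le> W2 (distr M borel \<zeta>) (distr M borel \<zeta>')"
        using r(2)[OF distr_P2[OF 2(2)]] by (meson not_le)
      then show ?thesis using W2_distr_le[OF \<zeta> 2(2)] 2(1) by linarith
    qed simp
  qed simp
  then show "0 < law_gap U \<zeta>" using r(1) by linarith
next
  assume pos: "0 < law_gap U \<zeta>"
  show "law M \<zeta> \<in> U"
  proof (rule ccontr)
    assume "law M \<zeta> \<notin> U"
    then have "distr M borel \<zeta> \<notin> U" using \<zeta> by (simp add: law_def)
    then have "law_gap U \<zeta> \<le> l2n M (\<lambda>\<omega>. \<zeta> \<omega> - \<zeta> \<omega>)"
      unfolding law_gap_def by (intro cInf_lower[OF _ law_gap_bdd]) (use \<zeta> in auto)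
    then show False using pos by (simp add: l2n_def)
  qed
qed

lemma law_P2: "law M \<zeta> \<in> P2"
proof (cases "\<zeta> \<in> L2_rv M M")
  case True
  then show ?thesis by (simp add: law_def distr_P2)
next
  case False
  have "return borel (0 :: 'a :: euclidean_space) \<in> P2"
    by (auto simp: P2_def intro!: prob_space_return)
       (rule integrableI_bounded, auto simp: nn_integral_return)
  then show ?thesis using False by (simp add: law_def)
qed

text \<open>The averages of \<open>v\<close> have gaps that are continuous in time, and along a
  subsequence they converge to \<open>v t\<close> in mean square for almost every \<open>t\<close>.
  On the remaining null set the law is frozen to a fixed member of \<open>P2\<close>.\<close>

lemma law_measurable:
  fixes v :: "real \<Rightarrow> 'w \<Rightarrow> 'b::euclidean_space"
  assumes v: "v \<in> pL2 M T"
  obtains N where "N \<in> null_sets tm"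
    "(\<lambda>t. if t \<in> N then law M (\<lambda>_. 0) else law M (v t)) \<in> tm \<rightarrow>\<^sub>M P2_borel"
proof -
  let ?p = "\<lambda>n. pavg (1 / Suc n) v"
  have p: "?p n \<in> pL2 M T" for n by (rule pavg_pL2[OF v]) simp
  let ?d = "\<lambda>n t \<omega>. ?p n t \<omega> - v t \<omega>"
  have i: "integrable PM (\<lambda>(t, \<omega>). (norm (?d n t \<omega>))\<^sup>2)" for n
    using L2_rvD(2)[OF pL2D[OF pL2_diff[OF p v]]] by (simp add: case_prod_beta')
  have "(\<lambda>n. (pnorm M T (?d n))\<^sup>2) \<longlonglongrightarrow> 0\<^sup>2" by (intro tendsto_intros pavg_tendsto v)
  then have "(\<lambda>n. (pnorm M T (?d n))\<^sup>2) \<longlonglongrightarrow> 0" by (simp only: power_zero_numeral)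
  moreover have "(pnorm M T (?d n))\<^sup>2 = (\<integral>t. norm ((l2n M (?d n t))\<^sup>2) \<partial>tm)" for n
    using pr.integral_fst[OF i] by (simp add: pnorm_def l2n_sq case_prod_beta')
  ultimately have lim: "(\<lambda>n. \<integral>t. norm ((l2n M (?d n t))\<^sup>2) \<partial>tm) \<longlonglongrightarrow> 0" by (simp only:)
  have "integrable tm (\<lambda>t. (l2n M (?d n t))\<^sup>2)" for n
    unfolding l2n_sq using pr.integrable_fst[OF i] by simp
  \<comment> \<open>Convergence over time and chance says that the squared error over
    \<open>\<omega>\<close> tends to 0 in mean over time; a subsequence does so at almost every
    time.\<close>
  from tendsto_L1_AE_subseq[OF this lim]
  obtain r where r: "strict_mono r" "AE t in tm. (\<lambda>n. (l2n M (?d (r n) t))\<^sup>2) \<longlonglongrightarrow> 0" by blast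
  have "AE t in tm. (\<lambda>n. (l2n M (?d (r n) t))\<^sup>2) \<longlonglongrightarrow> 0 \<and> v t \<in> L2_rv M M"
    using r(2) pL2_AE_L2[OF v] by eventually_elim simp
  from AE_null[OF this] obtain N where N: "N \<in> null_sets tm"
    "{t\<in>space tm. \<not> ((\<lambda>n. (l2n M (?d (r n) t))\<^sup>2) \<longlonglongrightarrow> 0 \<and> v t \<in> L2_rv M M)} \<subseteq> N"
    by blast
  have good: "v t \<in> L2_rv M M" "(\<lambda>n. l2n M (?d (r n) t)) \<longlonglongrightarrow> 0" if "t \<in> {0..T}" "t \<notin> N" for t
  proof -
    have *: "(\<lambda>n. (l2n M (?d (r n) t))\<^sup>2) \<longlonglongrightarrow> 0" and "v t \<in> L2_rv M M" using N(2) that by auto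
    then show "v t \<in> L2_rv M M" by simp
    show "(\<lambda>n. l2n M (?d (r n) t)) \<longlonglongrightarrow> 0" using tendsto_real_sqrt[OF *] by simp
  qed
  have Ns: "N \<in> sets tm" using N(1) by auto
  let ?l = "\<lambda>t. if t \<in> N then law M (\<lambda>_. 0) else law M (v t)"
  have "?l \<in> tm \<rightarrow>\<^sub>M P2_borel"
    unfolding P2_borel_def
  proof (rule measurable_measure_of)
    show "{U. openin (Metric_space.mtopology P2 W2) U} \<subseteq> Pow (P2 :: 'b measure set)"
      using Metric_space.openin_mtopology[OF Metric_space_W2] by auto
    show "?l \<in> space tm \<rightarrow> P2" by (auto simp: law_P2)
    fix U :: "'b measure set" assume "U \<in> {U. openin (Metric_space.mtopology P2 W2) U}"
    then have U: "openin (Metric_space.mtopology P2 W2) U" by simp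
    \<comment> \<open>Preimages of \<open>U\<close> become sets where \<open>g\<close> is positive,
      and \<open>g\<close> is a pointwise limit of measurable functions, off \<open>N\<close> by the
      Lipschitz property of the gap.\<close>
    define g where "g t = indicator N t * law_gap U (\<lambda>_. 0) + indicator (- N) t * law_gap U (v t)" for t
    have Nm: "(indicator N :: real \<Rightarrow> real) \<in> borel_measurable tm" using Ns by simp
    have g1: "(\<lambda>t. law_gap U (?p n t)) \<in> borel_measurable tm" for n
    proof -
      have "continuous_on {0..T} (\<lambda>t. law_gap U (?p n t))"
      proof (rule continuous_on_sequentiallyI)
        fix u :: "nat \<Rightarrow> real" and a assume u: "\<forall>k. u k \<in> {0..T}" "a \<in> {0..T}" "u \<longlonglongrightarrow> a"
        have L: "?p n t \<in> L2_rv M M" if "t \<in> {0..T}" for t by (rule pavg_L2(2)[OF v _ that]) simp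
        have "(\<lambda>k. law_gap U (?p n (u k)) - law_gap U (?p n a)) \<longlonglongrightarrow> 0"
        proof (rule Lim_null_comparison[OF always_eventually])
          show "\<forall>k. norm (law_gap U (?p n (u k)) - law_gap U (?p n a)) \<le> l2n M (\<lambda>\<omega>. ?p n (u k) \<omega> - ?p n a \<omega>)"
            using law_gap_lipschitz[OF L L] u by simp
          show "(\<lambda>k. l2n M (\<lambda>\<omega>. ?p n (u k) \<omega> - ?p n a \<omega>)) \<longlonglongrightarrow> 0"
            by (rule pavg_continuous[OF v]) (use u in auto)
        qed
        then show "(\<lambda>k. law_gap U (?p n (u k))) \<longlonglongrightarrow> law_gap U (?p n a)" by (rule LIM_zero_cancel)
      qed
      then have "(\<lambda>t. law_gap U (?p n t)) \<in> borel_measurable (restrict_space borel {0..T})"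
        by (rule borel_measurable_continuous_on_restrict)
      then show ?thesis by (simp cong: measurable_cong_sets add: sets_time_measure)
    qed
    have gm: "g \<in> borel_measurable tm"
    proof (rule borel_measurable_LIMSEQ_metric[where
          f = "\<lambda>n t. indicator N t * law_gap U (\<lambda>_. 0) + (1 - indicator N t) * law_gap U (?p (r n) t)"])
      show "(\<lambda>t. indicator N t * law_gap U (\<lambda>_. 0) + (1 - indicator N t) * law_gap U (?p (r n) t)) \<in> borel_measurable tm" for n
        using Nm g1 by measurable
      fix t assume "t \<in> space tm"
      then have t: "t \<in> {0..T}" by simp
      show "(\<lambda>n. indicator N t * law_gap U (\<lambda>_. 0) + (1 - indicator N t) * law_gap U (?p (r n) t)) \<longlonglongrightarrow> g t"
      proof (cases "t \<in> N")
        case False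
        have L: "?p n t \<in> L2_rv M M" for n by (rule pavg_L2(2)[OF v _ t]) simp
        have "(\<lambda>n. law_gap U (?p (r n) t) - law_gap U (v t)) \<longlonglongrightarrow> 0"
        proof (rule Lim_null_comparison[OF always_eventually])
          show "\<forall>n. norm (law_gap U (?p (r n) t) - law_gap U (v t)) \<le> l2n M (?d (r n) t)"
            using law_gap_lipschitz[OF L good(1)[OF t False]] by simp
        qed (rule good(2)[OF t False])
        then show ?thesis using False by (simp add: g_def LIM_zero_cancel)
      qed (simp add: g_def)
    qed
    have "?l -` U \<inter> space tm = {t \<in> space tm. 0 < g t}"
    proof (intro set_eqI iffI)
      fix t assume "t \<in> ?l -` U \<inter> space tm"
      then show "t \<in> {t \<in> space tm. 0 < g t}"
        using law_gap_pos_iff[OF U L2_rv_zero] law_gap_pos_iff[OF U good(1), of t] by (auto simp: g_def split: if_splits)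
    next
      fix t assume "t \<in> {t \<in> space tm. 0 < g t}"
      then show "t \<in> ?l -` U \<inter> space tm"
        using law_gap_pos_iff[OF U L2_rv_zero] law_gap_pos_iff[OF U good(1), of t]
        by (cases "t \<in> N") (auto simp: g_def)
    qed
    also have "\<dots> \<in> sets tm" using gm by measurable
    finally show "?l -` U \<inter> space tm \<in> sets tm" .
  qed
  with N(1) show ?thesis by (rule that)
qed

section \<open>Approximation by absolutely continuous processes\<close>

lemma prim_0 [simp]: "prim f 0 \<omega> = 0"
  unfolding prim_def set_lebesgue_integral_def
  by (rule integral_eq_zero_AE, rule eventually_mono[OF AE_lborel_singleton[of 0]]) auto

lemma prim_diff:
  fixes f g :: "real \<Rightarrow> 'w \<Rightarrow> 'b::euclidean_space"
  assumes "f \<in> pL2 M T" "g \<in> pL2 M T"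
  shows "AE \<omega> in M. \<forall>t\<in>{0..T}. prim (\<lambda>s \<omega>. f s \<omega> - g s \<omega>) t \<omega> = prim f t \<omega> - prim g t \<omega>"
  using pL2_AE_path[OF assms(1)] pL2_AE_path[OF assms(2)]
proof eventually_elim
  case (elim \<omega>)
  have "set_integrable lborel {0..t} (\<lambda>s. f s \<omega>)" "set_integrable lborel {0..t} (\<lambda>s. g s \<omega>)" if "t \<in> {0..T}" for t
    using tm.L2_rv_integrable[OF elim(1)] tm.L2_rv_integrable[OF elim(2)] that
    unfolding integrable_time_measure by (auto elim: set_integrable_subset)
  then show ?case by (simp add: prim_def set_integral_diff)
qed

text \<open>The delay by \<open>h\<close>. A delayed process is known in time, and its primitive is
  the delayed primitive; hence the derivative of a moving average, \<open>1 / h\<close> times the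
  difference of \<open>v\<close> and its delay, is adapted.\<close>

definition shift :: "real \<Rightarrow> (real \<Rightarrow> 'w \<Rightarrow> 'b::euclidean_space) \<Rightarrow> real \<Rightarrow> 'w \<Rightarrow> 'b" where
  "shift h v s \<omega> = (if h \<le> s then v (s - h) \<omega> else 0)"

lemma prim_shift:
  fixes v :: "real \<Rightarrow> 'w \<Rightarrow> 'b::euclidean_space"
  assumes "0 < h"
  shows "prim (shift h v) t \<omega> = prim v (max 0 (t - h)) \<omega>"
proof (cases "h \<le> t")
  case True
  have "prim (shift h v) t \<omega> = (\<integral>x. indicator {0..t} (h + 1 * x) *\<^sub>R shift h v (h + 1 * x) \<omega> \<partial>lborel)"
    unfolding prim_def set_lebesgue_integral_def by (subst lborel_integral_real_affine[where c = 1 and t = h]) auto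
  also have "\<dots> = prim v (max 0 (t - h)) \<omega>"
    unfolding prim_def set_lebesgue_integral_def
    by (intro Bochner_Integration.integral_cong refl)
       (use True assms in \<open>auto simp: shift_def split: split_indicator\<close>)
  finally show ?thesis .
next
  case False
  then have "indicator {0..t} s *\<^sub>R shift h v s \<omega> = 0" for s
    by (auto simp: shift_def split: split_indicator)
  then have "prim (shift h v) t \<omega> = 0"
    by (simp only: prim_def set_lebesgue_integral_def integral_zero)
  then show ?thesis using False by (simp add: max_def)
qed

lemma shift_adL2:
  fixes v :: "real \<Rightarrow> 'w \<Rightarrow> 'b::euclidean_space"
  assumes v: "v \<in> adL2 M F T" and h: "0 < h"
  shows "shift h v \<in> adL2 M F T"
proof -
  note vp = adL2D(1)[OF v]
  have "(\<lambda>s. max 0 (s - h)) \<in> tm \<rightarrow>\<^sub>M restrict_space lborel {0..T}"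
    by (rule measurable_restrict_space2) (use h in auto)
  then have k: "(\<lambda>s. max 0 (s - h)) \<in> tm \<rightarrow>\<^sub>M tm" by (simp add: time_measure_def)
  have m1: "(\<lambda>z. v (max 0 (fst z - h)) (snd z)) \<in> borel_measurable PM"
    using measurable_compose[OF measurable_Pair[OF measurable_compose[OF measurable_fst k] measurable_snd] pL2_measurable[OF vp]]
    by simp
  have m2: "{z \<in> space PM. h \<le> fst z} \<in> sets PM"
    using measurable_compose[OF measurable_fst ti.tm_ident, of M] by measurable
  have "(\<lambda>z. if h \<le> fst z then v (max 0 (fst z - h)) (snd z) else 0) \<in> borel_measurable PM"
    by (rule measurable_If[OF m1 _ m2]) simp
  moreover have "(\<lambda>z. if h \<le> fst z then v (max 0 (fst z - h)) (snd z) else 0) = (\<lambda>(s, \<omega>). shift h v s \<omega>)"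
    by (auto simp: fun_eq_iff shift_def)
  ultimately have m: "(\<lambda>(s, \<omega>). shift h v s \<omega>) \<in> borel_measurable PM" by simp
  have "shift h v \<in> pL2 M T"
  proof (rule pL2_if_path_le[OF m vp], rule AE_I2)
    fix \<omega> assume w: "\<omega> \<in> space M"
    let ?\<phi> = "\<lambda>r. ennreal ((norm (v r \<omega>))\<^sup>2) * indicator {0..T} r"
    have "(\<lambda>r. v r \<omega>) \<in> borel_measurable tm"
      using measurable_Pair1[OF pL2_measurable[OF vp] w] by simp
    then have "(\<lambda>r. ennreal ((norm (v r \<omega>))\<^sup>2)) \<in> borel_measurable tm"
      by measurable
    then have \<phi>: "?\<phi> \<in> borel_measurable borel"
      unfolding time_measure_def by (subst (asm) borel_measurable_restrict_space_iff_ennreal) auto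
    have "(\<integral>\<^sup>+s. ennreal ((norm (shift h v s \<omega>))\<^sup>2) \<partial>tm)
        = (\<integral>\<^sup>+s. ennreal ((norm (shift h v s \<omega>))\<^sup>2) * indicator {0..T} s \<partial>lborel)"
      unfolding time_measure_def by (subst nn_integral_restrict_space) auto
    also have "\<dots> \<le> (\<integral>\<^sup>+s. ?\<phi> (- h + 1 * s) \<partial>lborel)"
      by (intro nn_integral_mono) (use h in \<open>auto simp: shift_def split: split_indicator\<close>)
    also have "\<dots> = (\<integral>\<^sup>+s. ?\<phi> s \<partial>lborel)"
      using nn_integral_real_affine[OF \<phi>, of 1 "- h"] by simp
    also have "\<dots> = (\<integral>\<^sup>+s. ennreal ((norm (v s \<omega>))\<^sup>2) \<partial>tm)"
      unfolding time_measure_def by (subst nn_integral_restrict_space) auto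
    finally show "(\<integral>\<^sup>+s. ennreal ((norm (shift h v s \<omega>))\<^sup>2) \<partial>tm) \<le> (\<integral>\<^sup>+s. ennreal ((norm (v s \<omega>))\<^sup>2) \<partial>tm)" .
  qed
  moreover have "shift h v t \<in> borel_measurable (F t)" if t: "t \<in> {0..T}" for t
  proof (cases "h \<le> t")
    case True
    have "v (t - h) \<in> borel_measurable (F t)"
      by (rule measurable_F_mono[OF _ adL2D(2)[OF v]]) (use True t h in auto)
    then show ?thesis using True by (simp add: shift_def[abs_def])
  qed (simp add: shift_def[abs_def])
  ultimately show ?thesis by (simp add: adL2_def)
qed

text \<open>The average is a difference quotient of the primitive; clipping \<open>t - h\<close> at
  0 matches the convention that the process is 0 before time 0.\<close>

lemma pavg_prim:
  fixes v :: "real \<Rightarrow> 'w \<Rightarrow> 'b::euclidean_space"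
  assumes v: "v \<in> pL2 M T" and h: "0 < h"
  shows "AE \<omega> in M. \<forall>t\<in>{0..T}. pavg h v t \<omega> = (1 / h) *\<^sub>R (prim v t \<omega> - prim v (max 0 (t - h)) \<omega>)"
  using pL2_AE_path[OF v]
proof eventually_elim
  case (elim \<omega>)
  show ?case
  proof
    fix t assume t: "t \<in> {0..T}"
    have i: "integrable tm (\<lambda>s. v s \<omega>)" by (rule tm.L2_rv_integrable[OF elim])
    have j: "integrable tm (\<lambda>s. indicator {0..u} s *\<^sub>R v s \<omega>)" for u
      by (rule Bochner_Integration.integrable_bound[OF i])
         (use borel_time_measure[of "indicator {0..u} :: real \<Rightarrow> real"] borel_measurable_integrable[OF i]
           in \<open>auto intro!: AE_I2 borel_measurable_scaleR split: split_indicator\<close>)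
    have "prim v t \<omega> - prim v (max 0 (t - h)) \<omega>
        = (\<integral>s. indicator {0..t} s *\<^sub>R v s \<omega> - indicator {0..max 0 (t - h)} s *\<^sub>R v s \<omega> \<partial>tm)"
      using t h T_pos by (subst (1 2) prim_eq) (auto simp: Bochner_Integration.integral_diff[OF j j])
    also have "\<dots> = (\<integral>s. indicator {t - h<..t} s *\<^sub>R v s \<omega> \<partial>tm)"
    proof (rule integral_cong_AE)
      show "(\<lambda>s. indicator {0..t} s *\<^sub>R v s \<omega> - indicator {0..max 0 (t - h)} s *\<^sub>R v s \<omega>) \<in> borel_measurable tm"
        by (intro borel_measurable_diff borel_measurable_integrable[OF j])
      show "(\<lambda>s. indicator {t - h<..t} s *\<^sub>R v s \<omega>) \<in> borel_measurable tm"
        by (rule borel_measurable_integrable[OF ti.integrable_ind[OF i]])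
      show "AE s in tm. indicator {0..t} s *\<^sub>R v s \<omega> - indicator {0..max 0 (t - h)} s *\<^sub>R v s \<omega> = indicator {t - h<..t} s *\<^sub>R v s \<omega>"
        using AE_time_measure_neq[of 0 T] AE_space
        by eventually_elim (use h in \<open>auto split: split_indicator\<close>)
    qed
    finally show "pavg h v t \<omega> = (1 / h) *\<^sub>R (prim v t \<omega> - prim v (max 0 (t - h)) \<omega>)"
      by (simp add: pavg_def tavg_def)
  qed
qed

lemma has_ito_integral_zero: "has_ito_integral M F W T (\<lambda>_ _. 0 :: real^'m^'n) (\<lambda>_ _. 0)"
proof -
  have "(\<lambda>_ _. 0) \<in> H2 M F T"
    by (rule H2I) (simp_all add: pL2_def case_prod_unfold)
  moreover have "simple_integrand M F T 0 (\<lambda>_. 0) (\<lambda>_ _. 0 :: real^'m^'n)"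
    using T_pos by (simp add: simple_integrand_def)
  ultimately show ?thesis
    unfolding has_ito_integral_def
    by (intro conjI exI[of _ "\<lambda>_. 0"] exI[of _ "\<lambda>_ _. 0"] exI[of _ "\<lambda>_ _ _. 0"])
       (simp_all add: continuous_adapted_def simple_process_def simple_ito_def H2_sq_def)
qed

lemma initial_layer_adL2:
  fixes \<eta> :: "'w \<Rightarrow> 'b::euclidean_space"
  assumes "\<eta> \<in> L2_rv M M" "\<eta> \<in> borel_measurable (F 0)"
  shows "(\<lambda>s \<omega>. indicator {0..h} s *\<^sub>R \<eta> \<omega>) \<in> adL2 M F T"
proof -
  have "(\<lambda>s \<omega>. indicator {0..h} s *\<^sub>R \<eta> \<omega>) \<in> pL2 M T"
    using pL2_restrict[OF pL2_const_time[OF assms(1)], of h] by (simp add: pL2_def)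
  moreover have "(\<lambda>\<omega>. indicator {0..h} t *\<^sub>R \<eta> \<omega>) \<in> borel_measurable (F t)" if "t \<in> {0..T}" for t
    using measurable_F_mono[OF _ assms(2), of t] that by auto
  ultimately show ?thesis by (simp add: adL2_def)
qed

lemma prim_initial_layer:
  fixes \<eta> :: "'w \<Rightarrow> 'b::euclidean_space"
  assumes "0 < h" "0 \<le> t"
  shows "prim (\<lambda>s \<omega>. indicator {0..h} s *\<^sub>R \<eta> \<omega>) t \<omega> = min t h *\<^sub>R \<eta> \<omega>"
proof -
  have "prim (\<lambda>s \<omega>. indicator {0..h} s *\<^sub>R \<eta> \<omega>) t \<omega> = (\<integral>s. indicator {0..min t h} s *\<^sub>R \<eta> \<omega> \<partial>lborel)"
    unfolding prim_def set_lebesgue_integral_def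
    by (intro Bochner_Integration.integral_cong refl) (auto split: split_indicator)
  also have "\<dots> = min t h *\<^sub>R \<eta> \<omega>"
    using assms by simp
  finally show ?thesis .
qed

text \<open>A moving average of \<open>\<alpha>\<close> starts at 0, whereas the test process has to
  start at \<open>\<eta>\<close> like the fast variable. A layer of width \<open>h\<close> in which
  \<open>\<eta>\<close> fades linearly repairs this; it is bounded by \<open>norm \<eta>\<close> and
  ends at \<open>h\<close>, so it is small in mean square.\<close>

theorem test_process:
  fixes \<alpha> :: "real \<Rightarrow> 'w \<Rightarrow> real^'n"
  assumes \<alpha>: "\<alpha> \<in> adL2 M F T" and \<eta>: "\<eta> \<in> L2_rv M M" "\<eta> \<in> borel_measurable (F 0)" and e: "0 < e"
  obtains a a' where "itoproc a a' (\<lambda>_ _. 0)" "\<And>\<omega>. a 0 \<omega> = \<eta> \<omega>" "pnorm M T (\<lambda>s \<omega>. a s \<omega> - \<alpha> s \<omega>) < e"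
proof -
  note \<alpha>p = adL2D(1)[OF \<alpha>]
  \<comment> \<open>The fading layer for the window \<open>1 / Suc n\<close>: weight 1 at time 0 and
    weight 0 from \<open>1 / Suc n\<close> on.\<close>
  let ?c = "\<lambda>n s \<omega>. (1 - min s (1 / real (Suc n)) / (1 / real (Suc n))) *\<^sub>R \<eta> \<omega>"
  have cm: "(\<lambda>(s, \<omega>). ?c n s \<omega>) \<in> borel_measurable PM" for n
    using measurable_compose[OF measurable_fst ti.tm_ident, of M] measurable_compose[OF measurable_snd L2_rvD(1)[OF \<eta>(1)], of tm]
    by (simp add: case_prod_beta')
  have c1: "\<bar>1 - min s (1 / real (Suc n)) / (1 / real (Suc n))\<bar> \<le> 1" if "0 \<le> s" for s n
    using that by (auto simp: min_def field_simps)
  have cp: "?c n \<in> pL2 M T" for n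
  proof (rule pL2I, rule L2_rv_norm_le[OF cm pL2D[OF pL2_const_time[OF \<eta>(1)]]], rule AE_I2)
    fix z assume "z \<in> space PM"
    then show "norm (case z of (s, \<omega>) \<Rightarrow> ?c n s \<omega>) \<le> norm (case z of (s, \<omega>) \<Rightarrow> \<eta> \<omega>)"
      using mult_right_mono[OF c1 norm_ge_zero, of "fst z" n "\<eta> (snd z)"] by (auto simp: space_pair_measure)
  qed
  have "(\<lambda>n. l2n PM (\<lambda>z. (\<lambda>(s, \<omega>). ?c n s \<omega>) z - (0 :: real^'n))) \<longlonglongrightarrow> 0"
  proof (rule ti.L2_dominated_convergence[OF cm _ L2_rv_norm[OF pL2D[OF pL2_const_time[OF \<eta>(1)]]]])
    show "AE z in PM. norm ((\<lambda>(s, \<omega>). ?c n s \<omega>) z - 0) \<le> norm (case z of (s, \<omega>) \<Rightarrow> \<eta> \<omega>)" for n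
    proof (rule AE_I2)
      fix z assume "z \<in> space PM"
      then show "norm ((\<lambda>(s, \<omega>). ?c n s \<omega>) z - 0) \<le> norm (case z of (s, \<omega>) \<Rightarrow> \<eta> \<omega>)"
        using mult_right_mono[OF c1 norm_ge_zero, of "fst z" n "\<eta> (snd z)"] by (auto simp: space_pair_measure)
    qed
    show "AE z in PM. (\<lambda>n. (\<lambda>(s, \<omega>). ?c n s \<omega>) z) \<longlonglongrightarrow> 0"
      using AE_PM_fst[OF AE_time_measure_neq[of 0 T]] AE_space
    proof eventually_elim
      case (elim z)
      then have z: "0 < fst z" by (auto simp: space_pair_measure)
      then obtain N where N: "1 / real (Suc N) < fst z" using nat_approx_posE by blast
      have "(\<lambda>(s, \<omega>). ?c n s \<omega>) z = 0" if "n \<ge> N" for n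
      proof -
        have "1 / real (Suc n) \<le> 1 / real (Suc N)" using that by (intro divide_left_mono) auto
        then have "min (fst z) (1 / real (Suc n)) = 1 / real (Suc n)" using N by simp
        then show ?thesis by (simp add: case_prod_beta')
      qed
      then show ?case by (intro tendsto_eventually) (auto simp: eventually_sequentially)
    qed
  qed simp
  then have lim_c: "(\<lambda>n. pnorm M T (?c n)) \<longlonglongrightarrow> 0" by (simp add: pnorm_def)
  have "eventually (\<lambda>n. pnorm M T (\<lambda>t \<omega>. pavg (1 / Suc n) \<alpha> t \<omega> - \<alpha> t \<omega>) < e / 2 \<and> pnorm M T (?c n) < e / 2) sequentially"
    by (intro eventually_conj order_tendstoD(2)[OF pavg_tendsto[OF \<alpha>p]] order_tendstoD(2)[OF lim_c]) (use e in simp_all)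
  then obtain n where n: "pnorm M T (\<lambda>t \<omega>. pavg (1 / Suc n) \<alpha> t \<omega> - \<alpha> t \<omega>) < e / 2" "pnorm M T (?c n) < e / 2"
    by (auto simp: eventually_sequentially)
  define h where "h = 1 / real (Suc n)"
  have h: "0 < h" by (simp add: h_def)
  \<comment> \<open>The derivative of the moving average plus that of the layer. The process is
    defined from this drift, so its Ito representation is exact; its identification with average
    plus layer holds only almost surely.\<close>
  define a' where "a' s \<omega> = (1 / h) *\<^sub>R ((\<alpha> s \<omega> - shift h \<alpha> s \<omega>) - indicator {0..h} s *\<^sub>R \<eta> \<omega>)" for s \<omega>
  define a where "a t \<omega> = \<eta> \<omega> + prim a' t \<omega>" for t \<omega>
  note sh = shift_adL2[OF \<alpha> h] and il = initial_layer_adL2[OF \<eta>, of h]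
  note shp = adL2D(1)[OF sh] and ilp = adL2D(1)[OF il]
  have a'p: "a' \<in> pL2 M T"
    unfolding a'_def[abs_def] by (intro pL2_scaleR pL2_diff \<alpha>p shp ilp)
  have a'ad: "a' \<in> adL2 M F T"
    unfolding adL2_def using a'p
    by (auto simp: a'_def[abs_def] intro!: borel_measurable_scaleR borel_measurable_diff adL2D(2)[OF \<alpha>] adL2D(2)[OF sh] adL2D(2)[OF il])
  have ap: "a \<in> pL2 M T"
    unfolding a_def[abs_def] by (intro pL2_add pL2_const_time \<eta> prim_pL2(1)[OF a'p])
  have a0: "a 0 = \<eta>" by (simp add: a_def fun_eq_iff)
  have ito: "itoproc a a' (\<lambda>_ _. 0)"
    unfolding itoproc_def using has_ito_integral_zero ap a'ad \<eta>
    by (auto simp: a0 intro!: exI[of _ "\<lambda>_ _. 0"]) (simp add: a_def)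
  have "AE \<omega> in M. \<forall>t\<in>{0..T}. a t \<omega> - \<alpha> t \<omega> = (pavg h \<alpha> t \<omega> - \<alpha> t \<omega>) + ?c n t \<omega>"
    using prim_diff[OF pL2_diff[OF \<alpha>p shp] ilp] prim_diff[OF \<alpha>p shp] pavg_prim[OF \<alpha>p h]
  proof eventually_elim
    case (elim \<omega>)
    show ?case
    proof
      fix t assume t: "t \<in> {0..T}"
      have "prim a' t \<omega> = (1 / h) *\<^sub>R prim (\<lambda>s \<omega>. (\<alpha> s \<omega> - shift h \<alpha> s \<omega>) - indicator {0..h} s *\<^sub>R \<eta> \<omega>) t \<omega>"
        unfolding prim_def a'_def by (rule set_integral_scaleR_right)
      also have "\<dots> = (1 / h) *\<^sub>R (prim \<alpha> t \<omega> - prim \<alpha> (max 0 (t - h)) \<omega>) - (min t h / h) *\<^sub>R \<eta> \<omega>"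
        using bspec[OF elim(1) t] bspec[OF elim(2) t] t
        by (simp add: prim_shift[OF h] prim_initial_layer[OF h] scaleR_diff_right)
      also have "\<dots> = pavg h \<alpha> t \<omega> - (min t h / h) *\<^sub>R \<eta> \<omega>" using bspec[OF elim(3) t] by simp
      finally show "a t \<omega> - \<alpha> t \<omega> = (pavg h \<alpha> t \<omega> - \<alpha> t \<omega>) + ?c n t \<omega>"
        by (simp add: a_def h_def scaleR_diff_left)
    qed
  qed
  from AE_PM_snd[OF this]
  have "AE z in PM. (\<lambda>(s, \<omega>). a s \<omega> - \<alpha> s \<omega>) z = (\<lambda>(s, \<omega>). (pavg h \<alpha> s \<omega> - \<alpha> s \<omega>) + ?c n s \<omega>) z"
    using AE_space
  proof eventually_elim
    case (elim z)
    then show ?case using bspec[OF elim(1), of "fst z"] by (auto simp: space_pair_measure)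
  qed
  then have "pnorm M T (\<lambda>s \<omega>. a s \<omega> - \<alpha> s \<omega>) = pnorm M T (\<lambda>s \<omega>. (pavg h \<alpha> s \<omega> - \<alpha> s \<omega>) + ?c n s \<omega>)"
    unfolding pnorm_def
    by (rule l2n_cong_AE[OF pL2_measurable[OF pL2_diff[OF ap \<alpha>p]]
          pL2_measurable[OF pL2_add[OF pL2_diff[OF pavg_pL2[OF \<alpha>p h] \<alpha>p] cp]]])
  also have "\<dots> \<le> pnorm M T (\<lambda>s \<omega>. pavg h \<alpha> s \<omega> - \<alpha> s \<omega>) + pnorm M T (?c n)"
    by (rule pnorm_triangle[OF pL2_diff[OF pavg_pL2[OF \<alpha>p h] \<alpha>p] cp])
  also have "\<dots> < e" using n by (simp add: h_def)
  finally show ?thesis using ito a0 by (intro that[of a a']) auto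
qed

end

section \<open>A maximal inequality\<close>

text \<open>Pathwise form of Doob's inequality: \<open>2 S\<^sub>n x\<^sub>n - S\<^sub>n\<^sup>2\<close> dominates the discrete integral of the
  running maximum \<open>S\<close> against \<open>x\<close>.\<close>

lemma pathwise_Doob:
  fixes x :: "nat \<Rightarrow> real"
  assumes "0 \<le> x 0"
  defines "S \<equiv> \<lambda>n. Max (x ` {..n})"
  shows "2 * (\<Sum>k<n. S k * (x (Suc k) - x k)) \<le> 2 * S n * x n - (S n)\<^sup>2"
proof (induction n)
  case 0
  then show ?case by (simp add: S_def power2_eq_square)
next
  case (Suc n)
  have S: "S (Suc n) = max (x (Suc n)) (S n)"
    unfolding S_def by (simp add: atMost_Suc)
  \<comment> \<open>At a new maximum the two sides differ by the square of
    \<open>x (Suc n) - S n\<close>; otherwise \<open>S\<close> does not move and they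
    coincide.\<close>
  have "2 * S (Suc n) * x (Suc n) - (S (Suc n))\<^sup>2 \<ge> 2 * S n * x (Suc n) - (S n)\<^sup>2"
  proof (cases "S n \<le> x (Suc n)")
    case True
    then have "S (Suc n) = x (Suc n)" using S by simp
    then show ?thesis using zero_le_power2[of "x (Suc n) - S n"] by (simp add: power2_eq_square algebra_simps)
  qed (use S in simp)
  then show ?case using Suc.IH by (simp add: algebra_simps)
qed

context brownian_setting
begin

text \<open>Testing the martingale with \<open>S k *\<^sub>R sgn (K (\<tau> k))\<close> shows that
  \<open>S k\<close> against the increment of the norm has nonnegative mean, since the norm lies
  above its tangent. The pathwise inequality leaves \<open>E S^2 \<le> 2 E (S x)\<close>, and
  Cauchy-Schwarz gives the factor 2.\<close>

lemma Doob_grid: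
  fixes K :: "real \<Rightarrow> 'w \<Rightarrow> 'b::euclidean_space"
  assumes L2: "\<And>t. t \<in> {0..T} \<Longrightarrow> K t \<in> L2_rv M M"
    and adapted: "\<And>t. t \<in> {0..T} \<Longrightarrow> K t \<in> borel_measurable (F t)"
    and mart: "\<And>u v \<zeta>. 0 \<le> u \<Longrightarrow> u \<le> v \<Longrightarrow> v \<le> T \<Longrightarrow> \<zeta> \<in> borel_measurable (F u) \<Longrightarrow> \<zeta> \<in> L2_rv M M
      \<Longrightarrow> (\<integral>\<omega>. \<zeta> \<omega> \<bullet> (K v \<omega> - K u \<omega>) \<partial>M) = 0"
    and \<tau>: "\<And>k. k \<le> n \<Longrightarrow> \<tau> k \<in> {0..T}" "\<And>k. k < n \<Longrightarrow> \<tau> k \<le> \<tau> (Suc k)"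
  defines "S \<equiv> \<lambda>n \<omega>. Max ((\<lambda>k. norm (K (\<tau> k) \<omega>)) ` {..n})"
  shows "S n \<in> L2_rv M M" "l2n M (S n) \<le> 2 * l2n M (K (\<tau> n))"
proof -
  define x where "x k \<omega> = norm (K (\<tau> k) \<omega>)" for k \<omega>
  have xm: "x k \<in> borel_measurable (F (\<tau> n'))" if "k \<le> n'" "n' \<le> n" for k n'
  proof -
    have "\<tau> k \<le> \<tau> n'" using that(1)
    proof (induction n' rule: dec_induct)
      case (step m) then show ?case using \<tau>(2)[of m] that by fastforce
    qed simp
    then have "K (\<tau> k) \<in> borel_measurable (F (\<tau> n'))"
      by (rule measurable_F_mono[OF _ adapted[OF \<tau>(1)]]) (use that in simp)
    then show ?thesis unfolding x_def[abs_def] by measurable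
  qed
  have xL: "x k \<in> L2_rv M M" if "k \<le> n" for k
    unfolding x_def[abs_def] by (intro L2_rv_norm L2 \<tau> that)
  have Smax: "S (Suc k) \<omega> = max (x (Suc k) \<omega>) (S k \<omega>)" for k \<omega>
    unfolding S_def x_def by (simp add: atMost_Suc)
  have S0: "S 0 \<omega> = x 0 \<omega>" for \<omega> by (simp add: S_def x_def)
  have Spos: "0 \<le> S k \<omega>" for k \<omega>
    by (induction k) (auto simp: S0 Smax x_def)
  have Sm: "S k \<in> borel_measurable (F (\<tau> k)) \<and> S k \<in> L2_rv M M" if "k \<le> n" for k
    using that
  proof (induction k)
    case 0
    have "S 0 = x 0" by (simp add: S0 fun_eq_iff)
    then show ?case using xm[of 0 0] xL[of 0] by simp
  next
    case (Suc k)
    have eq: "S (Suc k) = (\<lambda>\<omega>. max (x (Suc k) \<omega>) (S k \<omega>))" by (simp add: Smax fun_eq_iff)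
    have m: "S (Suc k) \<in> borel_measurable (F (\<tau> (Suc k)))"
      unfolding eq using Suc \<tau>(2)[of k]
      by (intro borel_measurable_max xm) (auto intro: measurable_F_mono)
    moreover have "S (Suc k) \<in> L2_rv M M"
    proof (rule L2_rv_norm_le[OF measurable_F_M[OF m] L2_rv_add[OF xL[OF Suc.prems]]])
      show "S k \<in> L2_rv M M" using Suc by simp
      show "AE \<omega> in M. norm (S (Suc k) \<omega>) \<le> norm (x (Suc k) \<omega> + S k \<omega>)"
      proof (rule AE_I2)
        fix \<omega>
        have "0 \<le> x (Suc k) \<omega>" by (simp add: x_def)
        then show "norm (S (Suc k) \<omega>) \<le> norm (x (Suc k) \<omega> + S k \<omega>)"
          using Spos[of k \<omega>] by (auto simp: Smax max_def)
      qed
    qed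
    ultimately show ?case by simp
  qed
  show SL: "S n \<in> L2_rv M M" using Sm by simp
  have incr: "0 \<le> (\<integral>\<omega>. S k \<omega> * (x (Suc k) \<omega> - x k \<omega>) \<partial>M)"
    and incr_int: "integrable M (\<lambda>\<omega>. S k \<omega> * (x (Suc k) \<omega> - x k \<omega>))" if k: "k < n" for k
  proof -
    have kk: "\<tau> k \<in> {0..T}" "\<tau> (Suc k) \<in> {0..T}" "\<tau> k \<le> \<tau> (Suc k)" using \<tau> k by auto
    define \<zeta> where "\<zeta> \<omega> = S k \<omega> *\<^sub>R sgn (K (\<tau> k) \<omega>)" for \<omega>
    have "(\<lambda>\<omega>. sgn (K (\<tau> k) \<omega>)) \<in> borel_measurable (F (\<tau> k))"
      unfolding sgn_div_norm using adapted[OF kk(1)] by measurable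
    then have \<zeta>m: "\<zeta> \<in> borel_measurable (F (\<tau> k))"
      unfolding \<zeta>_def[abs_def] using Sm[of k] k by (intro borel_measurable_scaleR) auto
    have \<zeta>L: "\<zeta> \<in> L2_rv M M"
    proof (rule L2_rv_norm_le[OF measurable_F_M[OF \<zeta>m]])
      show "S k \<in> L2_rv M M" using Sm[of k] k by simp
      show "AE \<omega> in M. norm (\<zeta> \<omega>) \<le> norm (S k \<omega>)"
        by (intro AE_I2) (auto simp: \<zeta>_def norm_sgn)
    qed
    have d: "(\<lambda>\<omega>. K (\<tau> (Suc k)) \<omega> - K (\<tau> k) \<omega>) \<in> L2_rv M M" by (intro L2_rv_diff L2 kk)
    show i: "integrable M (\<lambda>\<omega>. S k \<omega> * (x (Suc k) \<omega> - x k \<omega>))"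
      using L2_inner_integrable[OF conjunct2[OF Sm] L2_rv_diff[OF xL xL], of k "Suc k" k] k by simp
    have "0 = (\<integral>\<omega>. \<zeta> \<omega> \<bullet> (K (\<tau> (Suc k)) \<omega> - K (\<tau> k) \<omega>) \<partial>M)"
      using mart[OF _ kk(3) _ \<zeta>m \<zeta>L] kk by simp
    also have "\<dots> \<le> (\<integral>\<omega>. S k \<omega> * (x (Suc k) \<omega> - x k \<omega>) \<partial>M)"
    proof (rule integral_mono[OF L2_inner_integrable[OF \<zeta>L d] i])
      fix \<omega>
      have "sgn (K (\<tau> k) \<omega>) \<bullet> K (\<tau> k) \<omega> = x k \<omega>"
        by (cases "K (\<tau> k) \<omega> = 0") (simp_all add: sgn_div_norm x_def dot_square_norm power2_eq_square)
      moreover have "sgn (K (\<tau> k) \<omega>) \<bullet> K (\<tau> (Suc k)) \<omega> \<le> x (Suc k) \<omega>"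
        using norm_cauchy_schwarz[of "sgn (K (\<tau> k) \<omega>)" "K (\<tau> (Suc k)) \<omega>"] by (auto simp: norm_sgn x_def split: if_splits)
      ultimately have "sgn (K (\<tau> k) \<omega>) \<bullet> (K (\<tau> (Suc k)) \<omega> - K (\<tau> k) \<omega>) \<le> x (Suc k) \<omega> - x k \<omega>"
        by (simp add: inner_diff_right)
      then show "\<zeta> \<omega> \<bullet> (K (\<tau> (Suc k)) \<omega> - K (\<tau> k) \<omega>) \<le> S k \<omega> * (x (Suc k) \<omega> - x k \<omega>)"
        using Spos[of k \<omega>] by (simp add: \<zeta>_def mult_left_mono)
    qed
    finally show "0 \<le> (\<integral>\<omega>. S k \<omega> * (x (Suc k) \<omega> - x k \<omega>) \<partial>M)" .
  qed
  have Sx: "integrable M (\<lambda>\<omega>. S n \<omega> * x n \<omega>)"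
    using L2_inner_integrable[OF SL xL[of n]] by simp
  have S2: "integrable M (\<lambda>\<omega>. (S n \<omega>)\<^sup>2)" using L2_rvD(2)[OF SL] by simp
  have "0 \<le> (\<integral>\<omega>. 2 * (\<Sum>k<n. S k \<omega> * (x (Suc k) \<omega> - x k \<omega>)) \<partial>M)"
  proof -
    have "(\<integral>\<omega>. (\<Sum>k<n. S k \<omega> * (x (Suc k) \<omega> - x k \<omega>)) \<partial>M)
        = (\<Sum>k<n. (\<integral>\<omega>. S k \<omega> * (x (Suc k) \<omega> - x k \<omega>) \<partial>M))"
      using incr_int by (intro Bochner_Integration.integral_sum) auto
    moreover have "0 \<le> (\<Sum>k<n. (\<integral>\<omega>. S k \<omega> * (x (Suc k) \<omega> - x k \<omega>) \<partial>M))"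
      using incr by (intro sum_nonneg) auto
    ultimately show ?thesis by simp
  qed
  also have "\<dots> \<le> (\<integral>\<omega>. 2 * (S n \<omega> * x n \<omega>) - (S n \<omega>)\<^sup>2 \<partial>M)"
  proof (rule integral_mono)
    show "integrable M (\<lambda>\<omega>. 2 * (\<Sum>k<n. S k \<omega> * (x (Suc k) \<omega> - x k \<omega>)))"
      using incr_int by (intro integrable_mult_right Bochner_Integration.integrable_sum) auto
    show "integrable M (\<lambda>\<omega>. 2 * (S n \<omega> * x n \<omega>) - (S n \<omega>)\<^sup>2)" using Sx S2 by simp
    show "2 * (\<Sum>k<n. S k \<omega> * (x (Suc k) \<omega> - x k \<omega>)) \<le> 2 * (S n \<omega> * x n \<omega>) - (S n \<omega>)\<^sup>2" for \<omega>
      using pathwise_Doob[of "\<lambda>k. x k \<omega>" n] by (simp add: S_def x_def mult.assoc)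
  qed
  also have "\<dots> = 2 * (\<integral>\<omega>. S n \<omega> \<bullet> x n \<omega> \<partial>M) - (l2n M (S n))\<^sup>2"
    using Sx S2 by (simp add: l2n_sq)
  also have "\<dots> \<le> 2 * (l2n M (S n) * l2n M (x n)) - (l2n M (S n))\<^sup>2"
    using L2_Cauchy_Schwarz[OF SL xL[of n]] by auto
  finally have "l2n M (S n) * l2n M (S n) \<le> l2n M (S n) * (2 * l2n M (x n))"
    by (simp add: power2_eq_square)
  then have "l2n M (S n) \<le> 2 * l2n M (x n)"
    using l2n_nonneg[of M "S n"] l2n_nonneg[of M "x n"]
    by (cases "l2n M (S n) = 0") (simp_all add: mult_le_cancel_left)
  then show "l2n M (S n) \<le> 2 * l2n M (K (\<tau> n))" by (simp add: x_def[abs_def] l2n_def)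
qed

text \<open>\<open>V\<close> is a measurable majorant of the squared supremum, the lower limit of
  squared maxima over uniform grids. Continuity of paths makes it dominate at all times, and Fatou
  preserves the bound with \<open>4 = 2^2\<close>.\<close>

lemma Doob_maximal:
  fixes K :: "real \<Rightarrow> 'w \<Rightarrow> 'b::euclidean_space"
  assumes L2: "\<And>t. t \<in> {0..T} \<Longrightarrow> K t \<in> L2_rv M M"
    and ca: "continuous_adapted M F T K"
    and mart: "\<And>u v \<zeta>. 0 \<le> u \<Longrightarrow> u \<le> v \<Longrightarrow> v \<le> T \<Longrightarrow> \<zeta> \<in> borel_measurable (F u) \<Longrightarrow> \<zeta> \<in> L2_rv M M
      \<Longrightarrow> (\<integral>\<omega>. \<zeta> \<omega> \<bullet> (K v \<omega> - K u \<omega>) \<partial>M) = 0"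
  obtains V where "V \<in> borel_measurable M" "\<And>t \<omega>. t \<in> {0..T} \<Longrightarrow> \<omega> \<in> space M \<Longrightarrow> ennreal ((norm (K t \<omega>))\<^sup>2) \<le> V \<omega>"
    "(\<integral>\<^sup>+\<omega>. V \<omega> \<partial>M) \<le> ennreal (4 * (l2n M (K T))\<^sup>2)"
proof -
  have adapted: "\<And>t. t \<in> {0..T} \<Longrightarrow> K t \<in> borel_measurable (F t)" using ca by (simp add: continuous_adapted_def)
  define \<tau> where "\<tau> n k = T * real k / real (Suc n)" for n k :: nat
  have \<tau>: "\<tau> n k \<in> {0..T}" "\<tau> n k \<le> \<tau> n (Suc k)" if "k \<le> Suc n" for n k
  proof -
    have "T * real k \<le> T * real (Suc n)" using T_pos that by (intro mult_left_mono) auto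
    then show "\<tau> n k \<in> {0..T}" "\<tau> n k \<le> \<tau> n (Suc k)"
      using T_pos unfolding \<tau>_def by (auto simp: field_simps)
  qed
  have \<tau>T: "\<tau> n (Suc n) = T" for n by (simp add: \<tau>_def)
  define S where "S n \<omega> = Max ((\<lambda>k. norm (K (\<tau> n k) \<omega>)) ` {..Suc n})" for n \<omega>
  have S: "S n \<in> L2_rv M M" "l2n M (S n) \<le> 2 * l2n M (K T)" for n
  proof -
    have a: "k \<le> Suc n \<Longrightarrow> \<tau> n k \<in> {0..T}" "k < Suc n \<Longrightarrow> \<tau> n k \<le> \<tau> n (Suc k)" for k
      using \<tau>[of k n] by auto
    note D = Doob_grid[where n = "Suc n" and \<tau> = "\<tau> n", OF L2 adapted mart a]
    show "S n \<in> L2_rv M M" unfolding S_def[abs_def] by (rule D(1))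
    show "l2n M (S n) \<le> 2 * l2n M (K T)" unfolding S_def[abs_def] using D(2) unfolding \<tau>T .
  qed
  define V where "V \<omega> = liminf (\<lambda>n. ennreal ((S n \<omega>)\<^sup>2))" for \<omega>
  have Sm: "(\<lambda>\<omega>. ennreal ((S n \<omega>)\<^sup>2)) \<in> borel_measurable M" for n
    using L2_rvD(1)[OF S(1)] by measurable
  have "(\<integral>\<^sup>+\<omega>. V \<omega> \<partial>M) \<le> liminf (\<lambda>n. (\<integral>\<^sup>+\<omega>. ennreal ((S n \<omega>)\<^sup>2) \<partial>M))"
    unfolding V_def by (rule nn_integral_liminf[OF Sm])
  also have "\<dots> \<le> liminf (\<lambda>n. ennreal (4 * (l2n M (K T))\<^sup>2))"
  proof (rule Liminf_mono[OF always_eventually], rule allI)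
    fix n
    have "(l2n M (S n))\<^sup>2 \<le> (2 * l2n M (K T))\<^sup>2" by (intro power_mono S) simp
    then show "(\<integral>\<^sup>+\<omega>. ennreal ((S n \<omega>)\<^sup>2) \<partial>M) \<le> ennreal (4 * (l2n M (K T))\<^sup>2)"
      using nn_integral_norm_sq[OF S(1)[of n]] by (simp add: ennreal_leI power_mult_distrib)
  qed
  also have "\<dots> = ennreal (4 * (l2n M (K T))\<^sup>2)" by (simp add: Liminf_const)
  finally have int: "(\<integral>\<^sup>+\<omega>. V \<omega> \<partial>M) \<le> ennreal (4 * (l2n M (K T))\<^sup>2)" .
  have le: "ennreal ((norm (K t \<omega>))\<^sup>2) \<le> V \<omega>" if t: "t \<in> {0..T}" and w: "\<omega> \<in> space M" for t \<omega>
  proof -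
    \<comment> \<open>The index of the last grid point that is not after \<open>t\<close>.\<close>
    define k where "k n = nat \<lfloor>t * real (Suc n) / T\<rfloor>" for n
    have kb: "real (k n) \<le> t * real (Suc n) / T" "t * real (Suc n) / T - 1 \<le> real (k n)" for n
      using t T_pos by (auto simp: k_def of_nat_nat divide_nonneg_nonneg)
    have kn: "k n \<le> Suc n" for n
    proof -
      have "t * real (Suc n) \<le> T * real (Suc n)" using t by (intro mult_right_mono) auto
      then have "t * real (Suc n) / T \<le> real (Suc n)"
        using T_pos by (simp add: pos_divide_le_eq mult.commute del: of_nat_Suc)
      then have "real (k n) \<le> real (Suc n)" using kb(1)[of n] by linarith
      then show ?thesis by simp
    qed
    have "(\<lambda>n. \<tau> n (k n)) \<longlonglongrightarrow> t"
    proof (rule tendsto_sandwich[OF always_eventually always_eventually _ tendsto_const]; (intro allI)?)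
      show "\<tau> n (k n) \<le> t" for n
      proof -
        have "T * real (k n) \<le> T * (t * real (Suc n) / T)" using kb(1)[of n] T_pos by (intro mult_left_mono) auto
        then show ?thesis using T_pos unfolding \<tau>_def by (subst pos_divide_le_eq) auto
      qed
      show "t - T / real (Suc n) \<le> \<tau> n (k n)" for n
      proof -
        have "T * (t * real (Suc n) / T - 1) \<le> T * real (k n)" using kb(2)[of n] T_pos by (intro mult_left_mono) auto
        then have "t * real (Suc n) - T \<le> T * real (k n)" using T_pos by (simp add: right_diff_distrib)
        then have "(t * real (Suc n) - T) / real (Suc n) \<le> \<tau> n (k n)" unfolding \<tau>_def by (rule divide_right_mono) simp
        then show ?thesis by (simp add: diff_divide_distrib del: of_nat_Suc)
      qed
      have "(\<lambda>n. t - T * inverse (real (Suc n))) \<longlonglongrightarrow> t - T * 0"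
        by (intro tendsto_intros LIMSEQ_inverse_real_of_nat)
      then show "(\<lambda>n. t - T / real (Suc n)) \<longlonglongrightarrow> t" by (simp add: divide_inverse)
    qed
    moreover have "continuous_on {0..T} (\<lambda>t. K t \<omega>)" using ca w by (simp add: continuous_adapted_def)
    ultimately have "(\<lambda>n. K (\<tau> n (k n)) \<omega>) \<longlonglongrightarrow> K t \<omega>"
      using t \<tau>(1)[OF kn] by (intro continuous_on_tendsto_compose[where f = "\<lambda>t. K t \<omega>"]) auto
    then have "(\<lambda>n. ennreal ((norm (K (\<tau> n (k n)) \<omega>))\<^sup>2)) \<longlonglongrightarrow> ennreal ((norm (K t \<omega>))\<^sup>2)"
      by (intro tendsto_ennrealI tendsto_intros)
    then have "ennreal ((norm (K t \<omega>))\<^sup>2) = liminf (\<lambda>n. ennreal ((norm (K (\<tau> n (k n)) \<omega>))\<^sup>2))"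
      by (intro lim_imp_Liminf[symmetric]) auto
    also have "\<dots> \<le> V \<omega>"
      unfolding V_def
    proof (rule Liminf_mono[OF always_eventually], rule allI)
      fix n
      have "norm (K (\<tau> n (k n)) \<omega>) \<le> S n \<omega>"
        unfolding S_def using kn[of n] by (intro Max_ge) auto
      then show "ennreal ((norm (K (\<tau> n (k n)) \<omega>))\<^sup>2) \<le> ennreal ((S n \<omega>)\<^sup>2)"
        by (intro ennreal_leI power_mono) auto
    qed
    finally show ?thesis .
  qed
  show ?thesis
    by (rule that[OF _ le int]) (auto simp: V_def[abs_def] intro!: borel_measurable_liminf Sm)
qed

text \<open>One factor 2 separates drift from martingale, \<open>T\<close> is Cauchy-Schwarz in
  time, and \<open>8 = 2 * 4\<close> is the maximal inequality. The supremum is only ever compared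
  with measurable functions above it.\<close>

theorem S2_estimate:
  assumes X: "itoproc X f g" "itoproc X' f' g'" and 0: "AE \<omega> in M. X 0 \<omega> = X' 0 \<omega>"
  shows "S2_sq M T (\<lambda>t \<omega>. X t \<omega> - X' t \<omega>)
    \<le> ennreal (2 * T * (pnorm M T (\<lambda>s \<omega>. f s \<omega> - f' s \<omega>))\<^sup>2 + 8 * (pnorm M T (\<lambda>s \<omega>. g s \<omega> - g' s \<omega>))\<^sup>2)"
proof -
  obtain J where J: "f \<in> adL2 M F T" "has_ito_integral M F W T g J"
    "AE \<omega> in M. \<forall>t\<in>{0..T}. X t \<omega> = X 0 \<omega> + prim f t \<omega> + J t \<omega>"
    using X(1) by (auto simp: itoproc_def)
  obtain J' where J': "f' \<in> adL2 M F T" "has_ito_integral M F W T g' J'"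
    "AE \<omega> in M. \<forall>t\<in>{0..T}. X' t \<omega> = X' 0 \<omega> + prim f' t \<omega> + J' t \<omega>"
    using X(2) by (auto simp: itoproc_def)
  note fp = adL2D(1)[OF J(1)] adL2D(1)[OF J'(1)]
  note gp = itoproc_diffusion_pL2[OF X(1)] itoproc_diffusion_pL2[OF X(2)]
  let ?\<Delta>f = "\<lambda>s \<omega>. f s \<omega> - f' s \<omega>" and ?\<Delta>g = "\<lambda>s \<omega>. g s \<omega> - g' s \<omega>"
  define K where "K t \<omega> = J t \<omega> - J' t \<omega>" for t \<omega>
  have KL: "K t \<in> L2_rv M M" if "t \<in> {0..T}" for t
    unfolding K_def[abs_def] by (intro L2_rv_diff ito_L2[OF J(2)] ito_L2[OF J'(2)] that)
  have ca: "continuous_adapted M F T K"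
    using J(2) J'(2) unfolding has_ito_integral_def continuous_adapted_def K_def[abs_def]
    by (auto intro!: continuous_on_diff borel_measurable_diff)
  have mart: "(\<integral>\<omega>. \<zeta> \<omega> \<bullet> (K v \<omega> - K u \<omega>) \<partial>M) = 0"
    if "0 \<le> u" "u \<le> v" "v \<le> T" "\<zeta> \<in> borel_measurable (F u)" "\<zeta> \<in> L2_rv M M" for u v \<zeta>
  proof -
    have uv: "u \<in> {0..T}" "v \<in> {0..T}" using that by auto
    have "(\<integral>\<omega>. \<zeta> \<omega> \<bullet> (K v \<omega> - K u \<omega>) \<partial>M)
      = (\<integral>\<omega>. \<zeta> \<omega> \<bullet> (J v \<omega> - J u \<omega>) - \<zeta> \<omega> \<bullet> (J' v \<omega> - J' u \<omega>) \<partial>M)"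
      by (intro Bochner_Integration.integral_cong refl) (simp add: K_def inner_diff_right)
    also have "\<dots> = 0"
      using L2_inner_integrable[OF that(5) L2_rv_diff[OF ito_L2[OF J(2) uv(2)] ito_L2[OF J(2) uv(1)]]]
        L2_inner_integrable[OF that(5) L2_rv_diff[OF ito_L2[OF J'(2) uv(2)] ito_L2[OF J'(2) uv(1)]]]
        ito_martingale[OF J(2) that] ito_martingale[OF J'(2) that] by simp
    finally show ?thesis .
  qed
  obtain V where V: "V \<in> borel_measurable M" "\<And>t \<omega>. t \<in> {0..T} \<Longrightarrow> \<omega> \<in> space M \<Longrightarrow> ennreal ((norm (K t \<omega>))\<^sup>2) \<le> V \<omega>"
    "(\<integral>\<^sup>+\<omega>. V \<omega> \<partial>M) \<le> ennreal (4 * (l2n M (K T))\<^sup>2)"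
    by (rule Doob_maximal[OF KL ca mart]) auto
  have T: "T \<in> {0..T}" using T_pos by simp
  have KT: "(l2n M (K T))\<^sup>2 = (pnorm M T ?\<Delta>g)\<^sup>2"
  proof -
    note L = ito_L2[OF J(2) T] ito_L2[OF J'(2) T]
    have "(l2n M (K T))\<^sup>2 = (\<integral>\<omega>. J T \<omega> \<bullet> J T \<omega> \<partial>M) - 2 * (\<integral>\<omega>. J T \<omega> \<bullet> J' T \<omega> \<partial>M) + (\<integral>\<omega>. J' T \<omega> \<bullet> J' T \<omega> \<partial>M)"
      using integral_norm_add_sq[OF L, of "-1"] by (simp add: l2n_sq K_def power2_norm_eq_inner)
    also have "\<dots> = ip M T ?\<Delta>g ?\<Delta>g"
      using gp unfolding ito_isometry[OF J(2) J(2) T] ito_isometry[OF J(2) J'(2) T] ito_isometry[OF J'(2) J'(2) T]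
      by (simp add: ip_diff_left ip_diff_right pL2_diff ip_commute[of T g' g])
    also have "\<dots> = (pnorm M T ?\<Delta>g)\<^sup>2" by (rule ip_self[OF pL2_diff[OF gp]])
    finally show ?thesis .
  qed
  define B where "B \<omega> = sqrt T * l2n tm (\<lambda>s. ?\<Delta>f s \<omega>)" for \<omega>
  have B: "B \<in> L2_rv M M" "AE \<omega> in M. \<forall>t\<in>{0..T}. norm (prim ?\<Delta>f t \<omega>) \<le> B \<omega>" "l2n M B = sqrt T * pnorm M T ?\<Delta>f"
    unfolding B_def[abs_def] by (rule prim_bound[OF pL2_diff[OF fp]])+
  have "S2_sq M T (\<lambda>t \<omega>. X t \<omega> - X' t \<omega>) \<le> (\<integral>\<^sup>+\<omega>. ennreal (2 * (B \<omega>)\<^sup>2) + 2 * V \<omega> \<partial>M)"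
    unfolding S2_sq_def
  proof (rule nn_integral_mono_AE)
    show "AE \<omega> in M. (SUP t\<in>{0..T}. ennreal ((norm (X t \<omega> - X' t \<omega>))\<^sup>2)) \<le> ennreal (2 * (B \<omega>)\<^sup>2) + 2 * V \<omega>"
      using J(3) J'(3) prim_diff[OF fp] B(2) 0 AE_space
    proof eventually_elim
      case (elim \<omega>)
      show ?case
      proof (rule SUP_least)
        fix t assume t: "t \<in> {0..T}"
        have "X t \<omega> - X' t \<omega> = prim ?\<Delta>f t \<omega> + K t \<omega>"
          using bspec[OF elim(1) t] bspec[OF elim(2) t] bspec[OF elim(3) t] elim(5) by (simp add: K_def)
        then have "(norm (X t \<omega> - X' t \<omega>))\<^sup>2 \<le> 2 * (norm (prim ?\<Delta>f t \<omega>))\<^sup>2 + 2 * (norm (K t \<omega>))\<^sup>2"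
          by (simp add: norm_add_sq_le)
        also have "\<dots> \<le> 2 * (B \<omega>)\<^sup>2 + 2 * (norm (K t \<omega>))\<^sup>2"
          using bspec[OF elim(4) t] by (simp add: power_mono)
        finally have "ennreal ((norm (X t \<omega> - X' t \<omega>))\<^sup>2) \<le> ennreal (2 * (B \<omega>)\<^sup>2) + ennreal (2 * (norm (K t \<omega>))\<^sup>2)"
          by (simp add: ennreal_plus[symmetric] ennreal_leI del: ennreal_plus)
        also have "ennreal (2 * (norm (K t \<omega>))\<^sup>2) = 2 * ennreal ((norm (K t \<omega>))\<^sup>2)"
          by (simp add: ennreal_mult)
        also have "\<dots> \<le> 2 * V \<omega>" using V(2)[OF t elim(6)] by (rule mult_left_mono) simp
        finally show "ennreal ((norm (X t \<omega> - X' t \<omega>))\<^sup>2) \<le> ennreal (2 * (B \<omega>)\<^sup>2) + 2 * V \<omega>"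
          by (simp add: add_left_mono)
      qed
    qed
  qed
  also have "\<dots> = (\<integral>\<^sup>+\<omega>. ennreal (2 * (B \<omega>)\<^sup>2) \<partial>M) + 2 * (\<integral>\<^sup>+\<omega>. V \<omega> \<partial>M)"
    using L2_rvD(1)[OF B(1)] V(1) by (simp add: nn_integral_add nn_integral_cmult)
  also have "(\<integral>\<^sup>+\<omega>. ennreal (2 * (B \<omega>)\<^sup>2) \<partial>M) = 2 * ennreal ((l2n M B)\<^sup>2)"
    using nn_integral_norm_sq[OF B(1)] L2_rvD(1)[OF B(1)] by (simp add: ennreal_mult nn_integral_cmult)
  also have "\<dots> = ennreal (2 * T * (pnorm M T ?\<Delta>f)\<^sup>2)"
    using T_pos unfolding B(3) by (simp add: power_mult_distrib ennreal_mult'' ennreal_mult mult.assoc)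
  also have "ennreal (2 * T * (pnorm M T ?\<Delta>f)\<^sup>2) + 2 * (\<integral>\<^sup>+\<omega>. V \<omega> \<partial>M)
      \<le> ennreal (2 * T * (pnorm M T ?\<Delta>f)\<^sup>2) + 2 * ennreal (4 * (pnorm M T ?\<Delta>g)\<^sup>2)"
    using V(3) unfolding KT by (intro add_left_mono mult_left_mono) auto
  also have "\<dots> = ennreal (2 * T * (pnorm M T ?\<Delta>f)\<^sup>2 + 8 * (pnorm M T ?\<Delta>g)\<^sup>2)"
  proof -
    have "2 * ennreal (4 * (pnorm M T ?\<Delta>g)\<^sup>2) = ennreal (8 * (pnorm M T ?\<Delta>g)\<^sup>2)"
      using ennreal_mult[of 2 "4 * (pnorm M T ?\<Delta>g)\<^sup>2"] by simp
    then show ?thesis using T_pos by (simp add: ennreal_plus)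
  qed
  finally show ?thesis .
qed

section \<open>Coefficients along processes\<close>

text \<open>Where \<open>\<zeta>\<close> is not square-integrable, \<open>law\<close> is the Dirac
  mass at 0 with \<open>norm2\<close> equal to 0, so the bound also covers the exceptional
  times.\<close>

lemma norm2_law_le:
  fixes \<zeta> :: "'w \<Rightarrow> 'b::euclidean_space"
  assumes "\<zeta> \<in> borel_measurable M"
  shows "norm2 (law M \<zeta>) \<le> l2n M \<zeta>"
proof (cases "\<zeta> \<in> L2_rv M M")
  case True
  then show ?thesis using assms by (simp add: norm2_def law_def l2n_def integral_distr)
next
  case False
  then show ?thesis by (simp add: norm2_def law_def integral_return)
qed

lemma norm2_law_zero [simp]: "norm2 (law M (\<lambda>_. 0 :: 'b::euclidean_space)) = 0"
  by (simp add: norm2_def law_def integral_distr integral_return)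

lemma W2_law_le:
  fixes \<zeta> \<zeta>' :: "'w \<Rightarrow> 'b::euclidean_space"
  assumes "\<zeta> \<in> L2_rv M M" "\<zeta>' \<in> L2_rv M M"
  shows "W2 (law M \<zeta>) (law M \<zeta>') \<le> l2n M (\<lambda>\<omega>. \<zeta> \<omega> - \<zeta>' \<omega>)"
  using W2_distr_le[OF assms] assms by (simp add: law_def)

lemma l2n_time:
  fixes v :: "real \<Rightarrow> 'w \<Rightarrow> 'b::euclidean_space"
  assumes "v \<in> pL2 M T"
  shows "(\<lambda>s. l2n M (v s)) \<in> L2_rv tm tm" "l2n tm (\<lambda>s. l2n M (v s)) = pnorm M T v"
proof -
  have i: "integrable PM (\<lambda>(s, \<omega>). (norm (v s \<omega>))\<^sup>2)"
    using L2_rvD(2)[OF pL2D[OF assms]] by (simp add: case_prod_beta')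
  have j: "integrable tm (\<lambda>s. (l2n M (v s))\<^sup>2)"
    unfolding l2n_sq using pr.integrable_fst[OF i] by simp
  have "(\<lambda>s. sqrt ((l2n M (v s))\<^sup>2)) \<in> borel_measurable tm"
    using borel_measurable_integrable[OF j] by measurable
  then show "(\<lambda>s. l2n M (v s)) \<in> L2_rv tm tm" using j by (simp add: L2_rvI)
  have "(l2n tm (\<lambda>s. l2n M (v s)))\<^sup>2 = (pnorm M T v)\<^sup>2"
    using pr.integral_fst[OF i] by (simp add: l2n_sq[of tm] pnorm_def l2n_sq[of PM] l2n_sq[of M] case_prod_beta')
  then show "l2n tm (\<lambda>s. l2n M (v s)) = pnorm M T v" by (simp add: power2_eq_iff_nonneg)
qed

lemma l2n_process_pL2:
  fixes v :: "real \<Rightarrow> 'w \<Rightarrow> 'b::euclidean_space"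
  assumes "v \<in> pL2 M T"
  shows "(\<lambda>s \<omega>. l2n M (v s)) \<in> pL2 M T"
proof (rule pL2I, rule L2_rv_if_nn_integral)
  note l = l2n_time(1)[OF assms]
  show m: "(\<lambda>(s, \<omega>). l2n M (v s)) \<in> borel_measurable PM"
    using measurable_compose[OF measurable_fst L2_rvD(1)[OF l], of M] by (simp add: case_prod_beta')
  have "(\<integral>\<^sup>+z. ennreal ((norm ((\<lambda>(s, \<omega>). l2n M (v s)) z))\<^sup>2) \<partial>PM) = (\<integral>\<^sup>+s. ennreal ((norm (l2n M (v s)))\<^sup>2) \<partial>tm)"
    using m by (subst nn_integral_fst[symmetric]) (auto simp: emeasure_space_1)
  then show "(\<integral>\<^sup>+z. ennreal ((norm ((\<lambda>(s, \<omega>). l2n M (v s)) z))\<^sup>2) \<partial>PM) < \<infinity>"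
    unfolding nn_integral_norm_sq[OF l] by simp
qed

lemma pL2_norm: "v \<in> pL2 M T \<Longrightarrow> (\<lambda>s \<omega>. norm (v s \<omega>)) \<in> pL2 M T"
  by (intro pL2I) (use L2_rv_norm[OF pL2D, of v] in \<open>simp add: case_prod_beta'\<close>)

lemma measurable_fst_Prog: "fst \<in> Prog M F T \<rightarrow>\<^sub>M tm"
  unfolding time_measure_def
proof (rule measurable_restrict_space2)
  show "fst \<in> space (Prog M F T) \<rightarrow> {0..T}" by (auto simp: space_Prog)
  have "fst \<in> borel_measurable (Prog M F T)"
    by (rule Prog_measurableI) (rule measurable_compose[OF measurable_fst], rule measurable_restrict_space1, simp)
  then show "fst \<in> Prog M F T \<rightarrow>\<^sub>M lborel" by simp
qed

lemma H2_dominated: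
  fixes f :: "real \<Rightarrow> 'w \<Rightarrow> 'b::euclidean_space"
  assumes f: "(\<lambda>z. f (fst z) (snd z)) \<in> borel_measurable (Prog M F T)"
    and g: "g \<in> pL2 M T" and le: "\<And>t \<omega>. t \<in> {0..T} \<Longrightarrow> \<omega> \<in> space M \<Longrightarrow> norm (f t \<omega>) \<le> norm (g t \<omega> :: real)"
  shows "f \<in> H2 M F T"
proof (rule H2I)
  show m: "(\<lambda>(s, \<omega>). f s \<omega>) \<in> borel_measurable (Prog M F T)" using f by (simp add: case_prod_beta')
  show "f \<in> pL2 M T"
    by (rule pL2I, rule L2_rv_norm_le[OF measurable_Prog_PM[OF m] pL2D[OF g]])
       (use le in \<open>auto intro!: AE_I2 simp: space_pair_measure\<close>)
qed

lemma H2_uminus: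
  assumes "v \<in> H2 M F T"
  shows "(\<lambda>t \<omega>. - v t \<omega>) \<in> H2 M F T"
proof (rule H2I)
  show "(\<lambda>(t, \<omega>). - v t \<omega>) \<in> borel_measurable (Prog M F T)"
    using assms by (simp add: H2_def case_prod_beta')
  show "(\<lambda>t \<omega>. - v t \<omega>) \<in> pL2 M T" by (rule pL2_uminus[OF adL2D(1)[OF H2_adL2[OF assms]]])
qed

text \<open>With the laws frozen on a null set of times, the composed coefficient is progressive,
  and linear growth makes it square-integrable. It differs from the coefficient only on a null set
  of times, the same for every \<open>\<omega>\<close>.\<close>

lemma forward_version:
  fixes h :: "('w, 'd::finite, 'k::finite, 'e::euclidean_space) forward_coeff"
  assumes hm: "forward_measurable M F T h"
    and growth: "\<And>t \<omega> x a \<mu> \<nu>. t \<in> {0..T} \<Longrightarrow> \<omega> \<in> space M \<Longrightarrow> \<mu> \<in> P2 \<Longrightarrow> \<nu> \<in> P2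
      \<Longrightarrow> norm (h t \<omega> x \<mu> a \<nu>) \<le> K * (1 + norm x + norm2 \<mu> + norm a + norm2 \<nu>)"
    and X: "X \<in> H2 M F T" and A: "A \<in> H2 M F T" and K: "0 < K"
  obtains N f where "N \<in> null_sets tm" "f \<in> H2 M F T" "\<And>t \<omega>. t \<in> {0..T} - N \<Longrightarrow> f t \<omega> = along_XA M h X A t \<omega>"
proof -
  note Xp = adL2D(1)[OF H2_adL2[OF X]] and Ap = adL2D(1)[OF H2_adL2[OF A]]
  obtain N1 where N1: "N1 \<in> null_sets tm" "(\<lambda>t. if t \<in> N1 then law M (\<lambda>_. 0) else law M (X t)) \<in> tm \<rightarrow>\<^sub>M P2_borel"
    by (rule law_measurable[OF Xp])
  obtain N2 where N2: "N2 \<in> null_sets tm" "(\<lambda>t. if t \<in> N2 then law M (\<lambda>_. 0) else law M (A t)) \<in> tm \<rightarrow>\<^sub>M P2_borel"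
    by (rule law_measurable[OF Ap])
  let ?l1 = "\<lambda>t. if t \<in> N1 then law M (\<lambda>_. 0) else law M (X t)"
  let ?l2 = "\<lambda>t. if t \<in> N2 then law M (\<lambda>_. 0) else law M (A t)"
  define f where "f t \<omega> = h t \<omega> (X t \<omega>) (?l1 t) (A t \<omega>) (?l2 t)" for t \<omega>
  have XP: "(\<lambda>z. X (fst z) (snd z)) \<in> borel_measurable (Prog M F T)" "(\<lambda>z. A (fst z) (snd z)) \<in> borel_measurable (Prog M F T)"
    using X A by (simp_all add: H2_def case_prod_beta')
  have "(\<lambda>z. (z, X (fst z) (snd z), ?l1 (fst z), A (fst z) (snd z), ?l2 (fst z)))
      \<in> Prog M F T \<rightarrow>\<^sub>M Prog M F T \<Otimes>\<^sub>M borel \<Otimes>\<^sub>M P2_borel \<Otimes>\<^sub>M borel \<Otimes>\<^sub>M P2_borel"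
    by (intro measurable_Pair measurable_ident_sets[OF refl] XP measurable_compose[OF measurable_fst_Prog N1(2)] measurable_compose[OF measurable_fst_Prog N2(2)])
  from measurable_compose[OF this hm[unfolded forward_measurable_def]]
  have fm: "(\<lambda>z. f (fst z) (snd z)) \<in> borel_measurable (Prog M F T)"
    by (simp add: f_def case_prod_beta')
  let ?g = "\<lambda>t \<omega>. K *\<^sub>R (1 + norm (X t \<omega>) + l2n M (X t) + norm (A t \<omega>) + l2n M (A t))"
  have g: "?g \<in> pL2 M T"
    by (intro pL2_scaleR pL2_add pL2_norm l2n_process_pL2 Xp Ap pL2_const_time L2_rv_const)
  have le: "norm (f t \<omega>) \<le> norm (?g t \<omega>)" if t: "t \<in> {0..T}" and w: "\<omega> \<in> space M" for t \<omega>
  proof -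
    have n: "norm2 (?l1 t) \<le> l2n M (X t)" "norm2 (?l2 t) \<le> l2n M (A t)"
      using norm2_law_le[OF pL2_section_measurable[OF Xp t]] norm2_law_le[OF pL2_section_measurable[OF Ap t]]
      by auto
    have "norm (f t \<omega>) \<le> K * (1 + norm (X t \<omega>) + norm2 (?l1 t) + norm (A t \<omega>) + norm2 (?l2 t))"
      unfolding f_def by (rule growth[OF t w]) (auto simp: law_P2)
    also have "\<dots> \<le> K * (1 + norm (X t \<omega>) + l2n M (X t) + norm (A t \<omega>) + l2n M (A t))"
      using n K by (intro mult_left_mono) auto
    finally show ?thesis by simp
  qed
  have fH: "f \<in> H2 M F T" by (rule H2_dominated[OF fm g le])
  show ?thesis
    by (rule that[OF null_sets.Un[OF N1(1) N2(1)] fH]) (simp add: f_def along_XA_def)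
qed

lemma H2_Pair:
  assumes "f \<in> H2 M F T" "g \<in> H2 M F T"
  shows "(\<lambda>t \<omega>. (f t \<omega>, g t \<omega>)) \<in> H2 M F T"
proof -
  have fP: "(\<lambda>z. f (fst z) (snd z)) \<in> borel_measurable (Prog M F T)" "(\<lambda>z. g (fst z) (snd z)) \<in> borel_measurable (Prog M F T)"
    using assms by (simp_all add: H2_def case_prod_beta')
  note p = adL2D(1)[OF H2_adL2[OF assms(1)]] adL2D(1)[OF H2_adL2[OF assms(2)]]
  have le: "norm (a, b) \<le> norm a + norm b" for a :: 'a and b :: 'b
    using norm_Pair_le by blast
  show ?thesis
  proof (rule H2_dominated[where g = "\<lambda>t \<omega>. norm (f t \<omega>) + norm (g t \<omega>)"])
    show "(\<lambda>z. (f (fst z) (snd z), g (fst z) (snd z))) \<in> borel_measurable (Prog M F T)"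
      by (rule borel_measurable_Pair[OF fP])
    show "(\<lambda>t \<omega>. norm (f t \<omega>) + norm (g t \<omega>)) \<in> pL2 M T" by (intro pL2_add pL2_norm p)
  qed (use le in auto)
qed

text \<open>As for the forward coefficients, with the four components bundled into one process,
  since the joint law is what enters.\<close>

lemma backward_version:
  fixes h :: "('d::finite, 'k::finite, 'n::finite, 'e::euclidean_space) backward_coeff"
  assumes hm: "backward_measurable T h"
    and growth: "\<And>t x y z a \<pi>. t \<in> {0..T} \<Longrightarrow> \<pi> \<in> P2
      \<Longrightarrow> norm (h t x y z a \<pi>) \<le> K * (1 + norm x + norm y + norm z + norm a + norm2 \<pi>)"
    and X: "X \<in> H2 M F T" and Y: "Y \<in> H2 M F T" and Z: "Z \<in> H2 M F T" and A: "A \<in> H2 M F T" and K: "0 < K"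
  obtains N f where "N \<in> null_sets tm" "f \<in> H2 M F T" "\<And>t \<omega>. t \<in> {0..T} - N \<Longrightarrow> f t \<omega> = along_XYZA M h X Y Z A t \<omega>"
proof -
  let ?V = "\<lambda>t \<omega>. (X t \<omega>, Y t \<omega>, Z t \<omega>, A t \<omega>)"
  have V: "?V \<in> H2 M F T" by (intro H2_Pair X Y Z A)
  note p = adL2D(1)[OF H2_adL2]
  obtain N where N: "N \<in> null_sets tm" "(\<lambda>t. if t \<in> N then law M (\<lambda>_. 0) else law M (?V t)) \<in> tm \<rightarrow>\<^sub>M P2_borel"
    by (rule law_measurable[OF p[OF V]])
  let ?l = "\<lambda>t. if t \<in> N then law M (\<lambda>_. 0) else law M (?V t)"
  define f where "f t \<omega> = h t (X t \<omega>) (Y t \<omega>) (Z t \<omega>) (A t \<omega>) (?l t)" for t \<omega>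
  have P: "(\<lambda>z. v (fst z) (snd z)) \<in> borel_measurable (Prog M F T)" if "v \<in> H2 M F T" for v :: "real \<Rightarrow> 'w \<Rightarrow> 'f::euclidean_space"
    using that by (simp add: H2_def case_prod_beta')
  have fst': "fst \<in> Prog M F T \<rightarrow>\<^sub>M restrict_space borel {0..T}"
    using measurable_fst_Prog by (simp cong: measurable_cong_sets add: sets_time_measure)
  have "(\<lambda>z. (fst z, X (fst z) (snd z), Y (fst z) (snd z), Z (fst z) (snd z), A (fst z) (snd z), ?l (fst z)))
      \<in> Prog M F T \<rightarrow>\<^sub>M restrict_space borel {0..T} \<Otimes>\<^sub>M borel \<Otimes>\<^sub>M borel \<Otimes>\<^sub>M borel \<Otimes>\<^sub>M borel \<Otimes>\<^sub>M P2_borel"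
    by (intro measurable_Pair fst' P X Y Z A measurable_compose[OF measurable_fst_Prog N(2)])
  from measurable_compose[OF this hm[unfolded backward_measurable_def]]
  have fm: "(\<lambda>z. f (fst z) (snd z)) \<in> borel_measurable (Prog M F T)"
    by (simp add: f_def case_prod_beta')
  let ?g = "\<lambda>t \<omega>. K *\<^sub>R (1 + norm (X t \<omega>) + norm (Y t \<omega>) + norm (Z t \<omega>) + norm (A t \<omega>) + l2n M (?V t))"
  have g: "?g \<in> pL2 M T"
    by (intro pL2_scaleR pL2_add pL2_norm l2n_process_pL2 p X Y Z A V pL2_const_time L2_rv_const)
  have le: "norm (f t \<omega>) \<le> norm (?g t \<omega>)" if t: "t \<in> {0..T}" and w: "\<omega> \<in> space M" for t \<omega>
  proof -
    have n: "norm2 (?l t) \<le> l2n M (?V t)"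
      using norm2_law_le[OF pL2_section_measurable[OF p[OF V] t]] by auto
    have "norm (f t \<omega>) \<le> K * (1 + norm (X t \<omega>) + norm (Y t \<omega>) + norm (Z t \<omega>) + norm (A t \<omega>) + norm2 (?l t))"
      unfolding f_def by (rule growth[OF t]) (auto simp: law_P2)
    also have "\<dots> \<le> K * (1 + norm (X t \<omega>) + norm (Y t \<omega>) + norm (Z t \<omega>) + norm (A t \<omega>) + l2n M (?V t))"
      using n K by (intro mult_left_mono) auto
    finally show ?thesis by simp
  qed
  have fH: "f \<in> H2 M F T" by (rule H2_dominated[OF fm g le])
  show ?thesis by (rule that[OF N(1) fH]) (simp add: f_def along_XYZA_def)
qed

text \<open>Changing the drift on a null set of times affects no time integral, so the drift may be
  exchanged for its progressive, square-integrable version.\<close>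

lemma itoproc_if_differential:
  assumes d: "ito_differential M F W T X f g"
    and X: "X \<in> pL2 M T" "X 0 \<in> L2_rv M M" "X 0 \<in> borel_measurable (F 0)" and f': "f' \<in> H2 M F T"
    and N: "N \<in> null_sets tm" and eq: "\<And>t \<omega>. t \<in> {0..T} - N \<Longrightarrow> f' t \<omega> = f t \<omega>"
  shows "itoproc X f' g"
proof -
  obtain J where J: "has_ito_integral M F W T g J"
    "AE \<omega> in M. \<forall>t\<in>{0..T}. X t \<omega> = X 0 \<omega> + (LINT s:{0..t}|lborel. f s \<omega>) + J t \<omega>"
    and fi: "AE \<omega> in M. set_integrable lborel {0..T} (\<lambda>s. f s \<omega>)"
    using d by (auto simp: ito_differential_def)
  have "AE \<omega> in M. \<forall>t\<in>{0..T}. X t \<omega> = X 0 \<omega> + prim f' t \<omega> + J t \<omega>"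
    using J(2) fi pL2_AE_path[OF adL2D(1)[OF H2_adL2[OF f']]]
  proof eventually_elim
    case (elim \<omega>)
    show ?case
    proof
      fix t assume t: "t \<in> {0..T}"
      have fm: "(\<lambda>s. f s \<omega>) \<in> borel_measurable tm"
        using elim(2) unfolding integrable_time_measure[symmetric] by (rule borel_measurable_integrable)
      have im: "(\<lambda>s. indicator {0..t} s :: real) \<in> borel_measurable tm" by (rule borel_time_measure) simp
      have tT: "t \<le> T" using t by simp
      have "(LINT s:{0..t}|lborel. f s \<omega>) = prim f' t \<omega>"
        unfolding prim_def integral_time_measure[OF tT, symmetric]
      proof (rule integral_cong_AE)
        show "(\<lambda>s. indicator {0..t} s *\<^sub>R f s \<omega>) \<in> borel_measurable tm" using im fm by measurable
        show "(\<lambda>s. indicator {0..t} s *\<^sub>R f' s \<omega>) \<in> borel_measurable tm" using im L2_rvD(1)[OF elim(3)] by measurable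
        show "AE s in tm. indicator {0..t} s *\<^sub>R f s \<omega> = indicator {0..t} s *\<^sub>R f' s \<omega>"
          using AE_not_in[OF N] AE_space by eventually_elim (simp add: eq)
      qed
      then show "X t \<omega> = X 0 \<omega> + prim f' t \<omega> + J t \<omega>" using bspec[OF elim(1) t] by simp
    qed
  qed
  then show ?thesis
    unfolding itoproc_def using J(1) X H2_adL2[OF f'] by (auto intro: adL2D(1))
qed

lemma itoproc_if_S2:
  assumes d: "ito_differential M F W T X f g" and X: "X \<in> S2 M F T" and f': "f' \<in> H2 M F T"
    and N: "N \<in> null_sets tm" and eq: "\<And>t \<omega>. t \<in> {0..T} - N \<Longrightarrow> f' t \<omega> = f t \<omega>"
  shows "itoproc X f' g"
proof -
  have 0: "0 \<in> {0..T}" using T_pos by simp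
  show ?thesis
    by (rule itoproc_if_differential[OF d adL2D(1)[OF S2_adL2(2)[OF X]] S2_adL2(3,4)[OF X 0] f' N eq])
qed

end

section \<open>Stability estimates\<close>

lemma integral_time_measure_Icc:
  fixes f :: "real \<Rightarrow> real"
  assumes "0 \<le> u" "v \<le> T"
  shows "(\<integral>s. indicator {u..v} s * f s \<partial>time_measure T) = (\<integral>s. f s * indicator {u..v} s \<partial>lborel)"
proof -
  have "(\<integral>s. indicator {u..v} s * f s \<partial>time_measure T)
      = (\<integral>s. indicator {0..T} s *\<^sub>R (indicator {u..v} s * f s) \<partial>lborel)"
    unfolding time_measure_def by (subst integral_restrict_space) auto
  also have "\<dots> = (\<integral>s. f s * indicator {u..v} s \<partial>lborel)"
    by (intro Bochner_Integration.integral_cong) (use assms in \<open>auto split: split_indicator\<close>)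
  finally show ?thesis .
qed

lemma integral_exp_Icc:
  assumes "k \<noteq> 0" "0 \<le> u" "u \<le> v" "v \<le> T"
  shows "(\<integral>s. indicator {u..v} s * exp (k * (s - r)) \<partial>time_measure T) = (exp (k * (v - r)) - exp (k * (u - r))) / k"
proof -
  have "(\<integral>s. exp (k * (s - r)) * indicator {u..v} s \<partial>lborel) = exp (k * (v - r)) / k - exp (k * (u - r)) / k"
  proof (rule integral_FTC_Icc_real[OF assms(3)])
    show "((\<lambda>s. exp (k * (s - r)) / k) has_real_derivative exp (k * (s - r))) (at s)" for s
      using assms(1) by (auto intro!: derivative_eq_intros)
  qed (intro continuous_intros)
  then show ?thesis using integral_time_measure_Icc[OF assms(2,4)] by (simp add: diff_divide_distrib)
qed

context brownian_setting
begin

lemma integrable_indicator_tm: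
  fixes f :: "real \<Rightarrow> real"
  assumes "integrable tm f" "J \<in> sets borel"
  shows "integrable tm (\<lambda>s. indicator J s * f s)"
proof (rule Bochner_Integration.integrable_bound[OF assms(1)])
  show "(\<lambda>s. indicator J s * f s) \<in> borel_measurable tm"
    using borel_measurable_integrable[OF assms(1)] borel_time_measure[OF borel_measurable_indicator[OF assms(2)]]
    by (intro borel_measurable_times)
qed (auto split: split_indicator)

lemmas integrable_Icc_tm = integrable_indicator_tm[OF _ borel_closed[OF closed_atLeastAtMost]]

text \<open>A weight \<open>w\<close> that absorbs half of itself under the kernel \<open>c 1\<^bsub>J t\<^esub>\<close> yields a Gronwall bound;
  exponentials growing forward or backward in time are such weights.\<close>

lemma weighted_Gronwall:
  fixes u w :: "real \<Rightarrow> real"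
  assumes u: "integrable tm u" "\<And>s. s \<in> {0..T} \<Longrightarrow> 0 \<le> u s"
    and w: "integrable tm w" "\<And>s. s \<in> {0..T} \<Longrightarrow> 1 \<le> w s" and J: "\<And>s. J s \<in> sets borel"
    and cw: "\<And>s. s \<in> {0..T} \<Longrightarrow> c * (\<integral>r. indicator (J s) r * w r \<partial>tm) \<le> w s / 2"
    and uR: "\<And>s. s \<in> {0..T} \<Longrightarrow> u s \<le> R + c * (\<integral>r. indicator (J s) r * u r \<partial>tm)"
    and c: "0 \<le> c" and R: "0 \<le> R" and t: "t \<in> {0..T}"
  shows "u t \<le> 2 * R * w t"
proof -
  note iJ = integrable_indicator_tm[OF _ J]
  have bd: "u s / w s \<le> R + c * (\<integral>r. u r \<partial>tm)" if s: "s \<in> {0..T}" for s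
  proof -
    have "(\<integral>r. indicator (J s) r * u r \<partial>tm) \<le> (\<integral>r. u r \<partial>tm)"
      by (rule integral_mono[OF iJ[OF u(1)] u(1)]) (use u(2) in \<open>auto split: split_indicator\<close>)
    then have "u s \<le> R + c * (\<integral>r. u r \<partial>tm)"
      using uR[OF s] mult_left_mono[OF _ c] by fastforce
    moreover have "u s / w s \<le> u s / 1" using u(2)[OF s] w(2)[OF s] by (intro divide_left_mono) auto
    ultimately show ?thesis by simp
  qed
  \<comment> \<open>The crude bound just proved makes this supremum finite, so that
    \<open>m \<le> R + m / 2\<close> can be solved for \<open>m\<close>.\<close>
  define m where "m = (SUP s\<in>{0..T}. u s / w s)"
  have bdd: "bdd_above ((\<lambda>s. u s / w s) ` {0..T})" by (rule bdd_aboveI2[OF bd])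
  have um: "u s \<le> m * w s" if s: "s \<in> {0..T}" for s
  proof -
    have "u s / w s \<le> m" unfolding m_def by (rule cSUP_upper[OF s bdd])
    then show ?thesis using w(2)[OF s] by (simp add: divide_le_eq)
  qed
  have m0: "0 \<le> m"
    using order_trans[OF u(2)[OF t] um[OF t]] w(2)[OF t] by (auto simp: zero_le_mult_iff)
  have "m \<le> R + m / 2"
    unfolding m_def
  proof (rule cSUP_least)
    fix s assume s: "s \<in> {0..T}"
    have "(\<integral>r. indicator (J s) r * u r \<partial>tm) \<le> (\<integral>r. m * (indicator (J s) r * w r) \<partial>tm)"
      by (rule integral_mono[OF iJ[OF u(1)] integrable_mult_right[OF iJ[OF w(1)]]])
         (use um in \<open>auto split: split_indicator\<close>)
    also have "\<dots> = m * (\<integral>r. indicator (J s) r * w r \<partial>tm)" by simp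
    finally have "c * (\<integral>r. indicator (J s) r * u r \<partial>tm) \<le> c * (m * (\<integral>r. indicator (J s) r * w r \<partial>tm))"
      by (rule mult_left_mono[OF _ c])
    also have "\<dots> \<le> m * (w s / 2)" using mult_left_mono[OF cw[OF s] m0] by (simp add: ac_simps)
    finally have "u s \<le> R * 1 + m / 2 * w s" using uR[OF s] by simp
    also have "\<dots> \<le> R * w s + m / 2 * w s" using mult_left_mono[OF w(2)[OF s] R] by simp
    finally show "u s / w s \<le> R + Sup ((\<lambda>s. u s / w s) ` {0..T}) / 2"
      using w(2)[OF s] unfolding m_def[symmetric] by (simp add: divide_le_eq distrib_right)
  qed (use t in auto)
  then have "m * w t \<le> 2 * R * w t" using w(2)[OF t] by (intro mult_right_mono) auto
  then show ?thesis using um[OF t] by simp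
qed

lemma integrable_exp_tm: "integrable tm (\<lambda>s. exp (k * (s - r)))"
proof (rule tm.integrable_const_bound[where B = "exp (\<bar>k\<bar> * (T + \<bar>r\<bar>))"])
  show "AE s in tm. norm (exp (k * (s - r))) \<le> exp (\<bar>k\<bar> * (T + \<bar>r\<bar>))"
  proof (rule AE_I2)
    fix s assume "s \<in> space tm"
    then have "\<bar>s - r\<bar> \<le> T + \<bar>r\<bar>" by auto
    then have "\<bar>k\<bar> * \<bar>s - r\<bar> \<le> \<bar>k\<bar> * (T + \<bar>r\<bar>)" by (intro mult_left_mono) auto
    moreover have "k * (s - r) \<le> \<bar>k\<bar> * \<bar>s - r\<bar>" by (metis abs_ge_self abs_mult)
    ultimately show "norm (exp (k * (s - r))) \<le> exp (\<bar>k\<bar> * (T + \<bar>r\<bar>))" by simp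
  qed
qed (intro borel_time_measure, measurable)

lemma Gronwall_forward:
  fixes u :: "real \<Rightarrow> real"
  assumes u: "integrable tm u" "\<And>s. s \<in> {0..T} \<Longrightarrow> 0 \<le> u s"
    and uR: "\<And>s. s \<in> {0..T} \<Longrightarrow> u s \<le> R + c * (\<integral>r. indicator {0..s} r * u r \<partial>tm)"
    and c: "0 < c" and R: "0 \<le> R" and t: "t \<in> {0..T}"
  shows "u t \<le> 2 * R * exp (2 * c * T)"
proof -
  \<comment> \<open>With rate \<open>2 * c\<close>, integrating \<open>c\<close> times the weight
    returns at most half of it. The difference \<open>t - 0\<close> matches the shape of
    \<open>integral_exp_Icc\<close>.\<close>
  have "u t \<le> 2 * R * exp (2 * c * (t - 0))"
  proof (rule weighted_Gronwall[OF u, where J = "\<lambda>s. {0..s}"])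
    show "integrable tm (\<lambda>s. exp (2 * c * (s - 0)))" by (rule integrable_exp_tm)
    show "c * (\<integral>r. indicator {0..s} r * exp (2 * c * (r - 0)) \<partial>tm) \<le> exp (2 * c * (s - 0)) / 2"
      if "s \<in> {0..T}" for s
      using that c by (subst integral_exp_Icc) (auto simp: field_simps)
  qed (use c R t uR in auto)
  also have "\<dots> \<le> 2 * R * exp (2 * c * T)" using t c R by (intro mult_left_mono) auto
  finally show ?thesis .
qed

lemma Gronwall_backward:
  fixes u :: "real \<Rightarrow> real"
  assumes u: "integrable tm u" "\<And>s. s \<in> {0..T} \<Longrightarrow> 0 \<le> u s"
    and uR: "\<And>s. s \<in> {0..T} \<Longrightarrow> u s \<le> R + c * (\<integral>r. indicator {s..T} r * u r \<partial>tm)"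
    and c: "0 < c" and R: "0 \<le> R" and t: "t \<in> {0..T}"
  shows "u t \<le> 2 * R * exp (2 * c * T)"
proof -
  have "u t \<le> 2 * R * exp (- (2 * c) * (t - T))"
  proof (rule weighted_Gronwall[OF u, where J = "\<lambda>s. {s..T}"])
    show "integrable tm (\<lambda>s. exp (- (2 * c) * (s - T)))" by (rule integrable_exp_tm)
    show "c * (\<integral>r. indicator {s..T} r * exp (- (2 * c) * (r - T)) \<partial>tm) \<le> exp (- (2 * c) * (s - T)) / 2"
      if "s \<in> {0..T}" for s
      using that c by (subst integral_exp_Icc) (auto simp: field_simps)
    show "1 \<le> exp (- (2 * c) * (s - T))" if "s \<in> {0..T}" for s
      using that c by (auto simp: mult_nonneg_nonpos)
  qed (use c R t uR in auto)
  also have "\<dots> \<le> 2 * R * exp (2 * c * T)"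
  proof -
    have "- (2 * c) * (t - T) \<le> 2 * c * T" using t c by (simp add: algebra_simps)
    then show ?thesis using R by (intro mult_left_mono) auto
  qed
  finally show ?thesis .
qed

lemma ip_tm: "t \<le> T \<Longrightarrow> ip M t f g = (\<integral>s. indicator {0..t} s * (\<integral>\<omega>. f s \<omega> \<bullet> g s \<omega> \<partial>M) \<partial>tm)"
  unfolding ip_def by (subst integral_time_measure[symmetric]) auto

lemma ip_integrable_tm: "f \<in> pL2 M T \<Longrightarrow> g \<in> pL2 M T \<Longrightarrow> integrable tm (\<lambda>s. \<integral>\<omega>. f s \<omega> \<bullet> g s \<omega> \<partial>M)"
  using ip_integrable by (simp add: integrable_time_measure)

text \<open>Backward estimates integrate from \<open>t\<close> to \<open>T\<close>; the endpoint
  \<open>t\<close> shared by both intervals is null.\<close>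

lemma ip_tail:
  assumes fg: "f \<in> pL2 M T" "g \<in> pL2 M T" and t: "t \<in> {0..T}"
  shows "ip M T f g - ip M t f g = (\<integral>s. indicator {t..T} s * (\<integral>\<omega>. f s \<omega> \<bullet> g s \<omega> \<partial>M) \<partial>tm)"
proof -
  have tT: "t \<le> T" using t by simp
  note i = integrable_Icc_tm[OF ip_integrable_tm[OF fg]]
  have "ip M T f g - ip M t f g
      = (\<integral>s. indicator {0..T} s * (\<integral>\<omega>. f s \<omega> \<bullet> g s \<omega> \<partial>M) - indicator {0..t} s * (\<integral>\<omega>. f s \<omega> \<bullet> g s \<omega> \<partial>M) \<partial>tm)"
    unfolding ip_tm[OF order_refl] ip_tm[OF tT] by (rule Bochner_Integration.integral_diff[OF i i, symmetric])
  also have "\<dots> = (\<integral>s. indicator {t..T} s * (\<integral>\<omega>. f s \<omega> \<bullet> g s \<omega> \<partial>M) \<partial>tm)"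
  proof (rule integral_cong_AE)
    show "AE s in tm. indicator {0..T} s * (\<integral>\<omega>. f s \<omega> \<bullet> g s \<omega> \<partial>M) - indicator {0..t} s * (\<integral>\<omega>. f s \<omega> \<bullet> g s \<omega> \<partial>M)
        = indicator {t..T} s * (\<integral>\<omega>. f s \<omega> \<bullet> g s \<omega> \<partial>M)"
      using AE_time_measure_neq[where r = t] AE_space
      by eventually_elim (use t in \<open>auto split: split_indicator\<close>)
  qed (use i in \<open>auto intro!: borel_measurable_diff borel_measurable_integrable\<close>)
  finally show ?thesis .
qed

text \<open>One deliberately coarse constant for all stability estimates:
  \<open>1 + 2 * L + 2 * L\<^sup>2\<close> is the Gronwall rate left by Young's inequality, and the
  prefactor majorises the shapes listed in \<open>stab_ge\<close>.\<close>

definition stab :: "real \<Rightarrow> real" where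
  "stab L = 6 * (1 + T) * (2 + 2 * L + 2 * L\<^sup>2) * exp (2 * (1 + 2 * L + 2 * L\<^sup>2) * T)"

lemma stab_ge:
  assumes "0 \<le> L"
  shows "6 * exp (2 * (1 + 2 * L + 2 * L\<^sup>2) * T) \<le> stab L"
    "6 * T * exp (2 * (1 + 2 * L + 2 * L\<^sup>2) * T) \<le> stab L"
    "2 + 4 * (1 + 2 * L + 2 * L\<^sup>2) * T * exp (2 * (1 + 2 * L + 2 * L\<^sup>2) * T) \<le> stab L" "1 \<le> stab L"
proof -
  define c where "c = 1 + 2 * L + 2 * L\<^sup>2"
  have c: "1 \<le> c" using assms by (simp add: c_def)
  define e where "e = exp (2 * c * T)"
  have e: "1 \<le> e" using c T_pos by (simp add: e_def)
  have s: "stab L = 6 * (1 + T) * (1 + c) * e" by (simp add: stab_def c_def e_def)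
  have Tc: "0 \<le> T * c" "0 \<le> T" using T_pos c by auto
  have "6 \<le> 6 * (1 + T) * (1 + c)" "6 * T \<le> 6 * (1 + T) * (1 + c)" "2 + 4 * c * T \<le> 6 * (1 + T) * (1 + c)"
    using Tc c by (simp_all add: algebra_simps)
  from this[THEN mult_right_mono, of e]
  have *: "6 * e \<le> stab L" "6 * T * e \<le> stab L" "(2 + 4 * c * T) * e \<le> stab L" using e unfolding s by auto
  show "6 * exp (2 * (1 + 2 * L + 2 * L\<^sup>2) * T) \<le> stab L" "6 * T * exp (2 * (1 + 2 * L + 2 * L\<^sup>2) * T) \<le> stab L"
    using * by (simp_all add: c_def e_def)
  show "2 + 4 * (1 + 2 * L + 2 * L\<^sup>2) * T * exp (2 * (1 + 2 * L + 2 * L\<^sup>2) * T) \<le> stab L"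
    using *(3) e unfolding e_def[symmetric] c_def[symmetric] by (simp add: distrib_right)
  show "1 \<le> stab L" using *(1) e by simp
qed

text \<open>As \<open>stab L\<close> is at least 1, a constant below it is also below its square, so
  no square roots of constants have to be carried along.\<close>

lemma le_stab_if_square_le:
  assumes "x\<^sup>2 \<le> k * y\<^sup>2" "k \<le> stab L" "0 \<le> L" "0 \<le> y"
  shows "x \<le> stab L * y"
proof (rule power2_le_imp_le)
  have "stab L * 1 \<le> stab L * stab L" using stab_ge(4)[OF assms(3)] by (intro mult_left_mono) auto
  then have "k \<le> (stab L)\<^sup>2" using assms(2) by (simp add: power2_eq_square)
  then have "k * y\<^sup>2 \<le> (stab L)\<^sup>2 * y\<^sup>2" by (intro mult_right_mono) auto
  then show "x\<^sup>2 \<le> (stab L * y)\<^sup>2" using assms(1) by (simp add: power_mult_distrib)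
  show "0 \<le> stab L * y" using stab_ge(4)[OF assms(3)] assms(4) by simp
qed

lemma pnorm_sq_le:
  fixes v :: "real \<Rightarrow> 'w \<Rightarrow> 'b::euclidean_space"
  assumes v: "v \<in> pL2 M T" and le: "\<And>t. t \<in> {0..T} \<Longrightarrow> (l2n M (v t))\<^sup>2 \<le> B"
  shows "(pnorm M T v)\<^sup>2 \<le> T * B"
proof -
  have "(pnorm M T v)\<^sup>2 = (\<integral>s. (l2n M (v s))\<^sup>2 \<partial>tm)"
    unfolding l2n_time(2)[OF v, symmetric] l2n_sq[of tm] by simp
  also have "\<dots> \<le> (\<integral>s. B \<partial>tm)"
    using L2_rvD(2)[OF l2n_time(1)[OF v]] le by (intro integral_mono) auto
  also have "\<dots> = measure tm {0..T} * B" by simp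
  also have "measure tm {0..T} = T"
    unfolding time_measure_def using T_pos by (subst measure_restrict_space) auto
  finally show ?thesis .
qed

lemma itoproc_diff_pL2:
  assumes "itoproc X f g" "itoproc X' f' g'"
  shows "(\<lambda>s \<omega>. X s \<omega> - X' s \<omega>) \<in> pL2 M T" "(\<lambda>s \<omega>. f s \<omega> - f' s \<omega>) \<in> pL2 M T"
    "(\<lambda>s \<omega>. g s \<omega> - g' s \<omega>) \<in> pL2 M T"
proof -
  have "X \<in> pL2 M T" "X' \<in> pL2 M T" "f \<in> pL2 M T" "f' \<in> pL2 M T"
    using assms by (auto simp: itoproc_def adL2D(1))
  then show "(\<lambda>s \<omega>. X s \<omega> - X' s \<omega>) \<in> pL2 M T" "(\<lambda>s \<omega>. f s \<omega> - f' s \<omega>) \<in> pL2 M T"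
    "(\<lambda>s \<omega>. g s \<omega> - g' s \<omega>) \<in> pL2 M T"
    using itoproc_diffusion_pL2[OF assms(1)] itoproc_diffusion_pL2[OF assms(2)] by (simp_all add: pL2_diff)
qed

text \<open>Energy estimate: the product formula for the difference with itself gives twice the
  drift pairing plus the squared diffusion. Young's inequality turns this into the Gronwall rate
  times the squared difference plus \<open>3 * (r s)\<^sup>2\<close>, one part from the drift and
  two from the diffusion. The source \<open>r\<close> collects what is not proportional to the
  difference.\<close>

theorem forward_stability:
  assumes X: "itoproc X f g" "itoproc X' f' g'" and 0: "AE \<omega> in M. X 0 \<omega> = X' 0 \<omega>"
    and L: "0 \<le> L" and r: "r \<in> L2_rv tm tm"
    and f: "AE s in tm. l2n M (\<lambda>\<omega>. f s \<omega> - f' s \<omega>) \<le> L * l2n M (\<lambda>\<omega>. X s \<omega> - X' s \<omega>) + r s"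
    and g: "AE s in tm. l2n M (\<lambda>\<omega>. g s \<omega> - g' s \<omega>) \<le> L * l2n M (\<lambda>\<omega>. X s \<omega> - X' s \<omega>) + r s"
  shows "t \<in> {0..T} \<Longrightarrow> l2n M (\<lambda>\<omega>. X t \<omega> - X' t \<omega>) \<le> stab L * l2n tm r"
    "pnorm M T (\<lambda>s \<omega>. X s \<omega> - X' s \<omega>) \<le> stab L * l2n tm r"
proof -
  let ?x = "\<lambda>s \<omega>. X s \<omega> - X' s \<omega>" and ?f = "\<lambda>s \<omega>. f s \<omega> - f' s \<omega>" and ?g = "\<lambda>s \<omega>. g s \<omega> - g' s \<omega>"
  note p = itoproc_diff_pL2[OF X]
  define c where "c = 1 + 2 * L + 2 * L\<^sup>2"
  have c: "0 < c" using L by (simp add: c_def add_pos_nonneg)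
  define u where "u s = (l2n M (?x s))\<^sup>2" for s
  have ui: "integrable tm u" using L2_rvD(2)[OF l2n_time(1)[OF p(1)]] by (simp add: u_def[abs_def])
  have ri: "integrable tm (\<lambda>s. (r s)\<^sup>2)" using L2_rvD(2)[OF r] by simp
  have uR: "u t \<le> 3 * (l2n tm r)\<^sup>2 + c * (\<integral>s. indicator {0..t} s * u s \<partial>tm)" if t: "t \<in> {0..T}" for t
  proof -
    have tT: "t \<le> T" using t by simp
    note i = integrable_Icc_tm[OF ip_integrable_tm[OF p(2,1)]] integrable_Icc_tm[OF ip_integrable_tm[OF p(3,3)]]
    have "(\<integral>\<omega>. ?x 0 \<omega> \<bullet> ?x 0 \<omega> \<partial>M) = (\<integral>\<omega>. 0 \<partial>M)"
      using itoproc_L2[OF X(1), of 0] itoproc_L2[OF X(2), of 0] T_pos 0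
      by (intro integral_cong_AE) (auto intro!: borel_measurable_inner borel_measurable_diff dest: L2_rvD(1))
    then have "u t = 2 * ip M t ?f ?x + ip M t ?g ?g"
      using ito_product_diff[OF X X t] ip_commute[of t ?f ?x]
      by (simp add: u_def l2n_sq power2_norm_eq_inner)
    also have "\<dots> = (\<integral>s. 2 * (indicator {0..t} s * (\<integral>\<omega>. ?f s \<omega> \<bullet> ?x s \<omega> \<partial>M))
        + indicator {0..t} s * (\<integral>\<omega>. ?g s \<omega> \<bullet> ?g s \<omega> \<partial>M) \<partial>tm)"
      unfolding ip_tm[OF tT] using i by simp
    also have "\<dots> \<le> (\<integral>s. c * (indicator {0..t} s * u s) + 3 * (r s)\<^sup>2 \<partial>tm)"
    proof (rule integral_mono_AE)
      show "AE s in tm. 2 * (indicator {0..t} s * (\<integral>\<omega>. ?f s \<omega> \<bullet> ?x s \<omega> \<partial>M))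
          + indicator {0..t} s * (\<integral>\<omega>. ?g s \<omega> \<bullet> ?g s \<omega> \<partial>M) \<le> c * (indicator {0..t} s * u s) + 3 * (r s)\<^sup>2"
        using f g pL2_AE_L2[OF p(1)] pL2_AE_L2[OF p(2)]
      proof eventually_elim
        case (elim s)
        let ?a = "l2n M (?f s)" and ?b = "l2n M (?g s)" and ?y = "l2n M (?x s)"
        have "(\<integral>\<omega>. ?f s \<omega> \<bullet> ?x s \<omega> \<partial>M) \<le> ?a * ?y" using L2_Cauchy_Schwarz[OF elim(4,3)] by simp
        also have "\<dots> \<le> (L * ?y + r s) * ?y" by (rule mult_right_mono[OF elim(1)]) simp
        finally have 1: "2 * (\<integral>\<omega>. ?f s \<omega> \<bullet> ?x s \<omega> \<partial>M) \<le> (2 * L + 1) * ?y\<^sup>2 + (r s)\<^sup>2"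
          using sum_squares_bound[of "r s" ?y] by (simp add: algebra_simps power2_eq_square)
        have "(\<integral>\<omega>. ?g s \<omega> \<bullet> ?g s \<omega> \<partial>M) = ?b\<^sup>2" by (simp add: l2n_sq power2_norm_eq_inner)
        also have "\<dots> \<le> (L * ?y + r s)\<^sup>2" by (rule power_mono[OF elim(2)]) simp
        also have "\<dots> \<le> 2 * L\<^sup>2 * ?y\<^sup>2 + 2 * (r s)\<^sup>2"
          using norm_add_sq_le[of "L * ?y" "r s"] by (simp add: power_mult_distrib)
        finally have "2 * (\<integral>\<omega>. ?f s \<omega> \<bullet> ?x s \<omega> \<partial>M) + (\<integral>\<omega>. ?g s \<omega> \<bullet> ?g s \<omega> \<partial>M) \<le> c * u s + 3 * (r s)\<^sup>2"
          using 1 unfolding c_def u_def by (simp add: algebra_simps)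
        then show ?case by (auto split: split_indicator)
      qed
    qed (use i integrable_Icc_tm[OF ui] ri in auto)
    also have "\<dots> = c * (\<integral>s. indicator {0..t} s * u s \<partial>tm) + 3 * (l2n tm r)\<^sup>2"
      using integrable_Icc_tm[OF ui] ri by (simp add: l2n_sq)
    finally show ?thesis by simp
  qed
  have B: "(l2n M (?x t))\<^sup>2 \<le> 6 * exp (2 * c * T) * (l2n tm r)\<^sup>2" if t: "t \<in> {0..T}" for t
  proof -
    have "u t \<le> 2 * (3 * (l2n tm r)\<^sup>2) * exp (2 * c * T)"
      by (rule Gronwall_forward[OF ui _ uR c _ t]) (auto simp: u_def)
    then show ?thesis by (simp add: u_def ac_simps)
  qed
  show "l2n M (?x t) \<le> stab L * l2n tm r" if "t \<in> {0..T}"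
    by (rule le_stab_if_square_le[OF B[OF that] stab_ge(1)[OF L, folded c_def] L]) simp
  have "(pnorm M T ?x)\<^sup>2 \<le> 6 * T * exp (2 * c * T) * (l2n tm r)\<^sup>2"
    using pnorm_sq_le[OF p(1) B] by (simp add: ac_simps)
  then show "pnorm M T ?x \<le> stab L * l2n tm r"
    by (rule le_stab_if_square_le[OF _ stab_ge(2)[OF L, folded c_def] L]) simp
qed

text \<open>Read from the terminal time, the energy identity puts the squared diffusion on the
  favourable side. Half of it absorbs the dependence of the drift on the diffusion; the other half
  gives the second estimate at \<open>t = 0\<close>.\<close>

theorem backward_stability:
  assumes Y: "itoproc Y f g" "itoproc Y' f' g'" and L: "0 \<le> L" and r: "r \<in> L2_rv tm tm"
    and f: "AE s in tm. l2n M (\<lambda>\<omega>. f s \<omega> - f' s \<omega>)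
      \<le> L * (l2n M (\<lambda>\<omega>. Y s \<omega> - Y' s \<omega>) + l2n M (\<lambda>\<omega>. g s \<omega> - g' s \<omega>)) + r s"
  defines "R \<equiv> l2n M (\<lambda>\<omega>. Y T \<omega> - Y' T \<omega>) + l2n tm r"
  shows "pnorm M T (\<lambda>s \<omega>. Y s \<omega> - Y' s \<omega>) \<le> stab L * R" "pnorm M T (\<lambda>s \<omega>. g s \<omega> - g' s \<omega>) \<le> stab L * R"
proof -
  let ?y = "\<lambda>s \<omega>. Y s \<omega> - Y' s \<omega>" and ?f = "\<lambda>s \<omega>. f s \<omega> - f' s \<omega>" and ?g = "\<lambda>s \<omega>. g s \<omega> - g' s \<omega>"
  note p = itoproc_diff_pL2[OF Y]
  have TT: "T \<in> {0..T}" "0 \<in> {0..T}" using T_pos by auto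
  define c where "c = 1 + 2 * L + 2 * L\<^sup>2"
  have c: "0 < c" using L by (simp add: c_def add_pos_nonneg)
  define u where "u s = (l2n M (?y s))\<^sup>2" for s
  define z where "z s = (\<integral>\<omega>. ?g s \<omega> \<bullet> ?g s \<omega> \<partial>M)" for s
  have z: "z s = (l2n M (?g s))\<^sup>2" for s by (simp add: z_def l2n_sq power2_norm_eq_inner)
  have ui: "integrable tm u" using L2_rvD(2)[OF l2n_time(1)[OF p(1)]] by (simp add: u_def[abs_def])
  have ri: "integrable tm (\<lambda>s. (r s)\<^sup>2)" using L2_rvD(2)[OF r] by simp
  have zi: "integrable tm z" unfolding z_def by (rule ip_integrable_tm[OF p(3,3)])
  define R2 where "R2 = u T + (l2n tm r)\<^sup>2"
  have R0: "0 \<le> R" by (simp add: R_def)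
  have "u T + (l2n tm r)\<^sup>2 \<le> R\<^sup>2" by (simp add: R_def u_def power2_sum)
  then have R2: "0 \<le> R2" "R2 \<le> R\<^sup>2" by (auto simp: R2_def u_def)
  have main: "u t + (\<integral>s. indicator {t..T} s * z s \<partial>tm) / 2 \<le> R2 + c * (\<integral>s. indicator {t..T} s * u s \<partial>tm)"
    if t: "t \<in> {0..T}" for t
  proof -
    note i = integrable_Icc_tm[OF ip_integrable_tm[OF p(2,1)]] integrable_Icc_tm[OF zi] integrable_Icc_tm[OF ui]
    have E: "u s = u 0 + 2 * ip M s ?f ?y + ip M s ?g ?g" if "s \<in> {0..T}" for s
      using ito_product_diff[OF Y Y that] ip_commute[of s ?f ?y] by (simp add: u_def l2n_sq power2_norm_eq_inner)
    have "u t + (\<integral>s. indicator {t..T} s * z s \<partial>tm) / 2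
        = u T - 2 * (\<integral>s. indicator {t..T} s * (\<integral>\<omega>. ?f s \<omega> \<bullet> ?y s \<omega> \<partial>M) \<partial>tm) - (\<integral>s. indicator {t..T} s * z s \<partial>tm) / 2"
      using E[OF t] E[OF TT(1)] ip_tail[OF p(2,1) t] ip_tail[OF p(3,3) t, folded z_def] by simp
    also have "\<dots> = u T + (\<integral>s. - 2 * (indicator {t..T} s * (\<integral>\<omega>. ?f s \<omega> \<bullet> ?y s \<omega> \<partial>M)) - indicator {t..T} s * z s / 2 \<partial>tm)"
      using i by simp
    also have "\<dots> \<le> u T + (\<integral>s. c * (indicator {t..T} s * u s) + (r s)\<^sup>2 \<partial>tm)"
    proof (rule add_left_mono, rule integral_mono_AE)
      show "AE s in tm. - 2 * (indicator {t..T} s * (\<integral>\<omega>. ?f s \<omega> \<bullet> ?y s \<omega> \<partial>M)) - indicator {t..T} s * z s / 2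
          \<le> c * (indicator {t..T} s * u s) + (r s)\<^sup>2"
        using f pL2_AE_L2[OF p(1)] pL2_AE_L2[OF p(2)]
      proof eventually_elim
        case (elim s)
        let ?a = "l2n M (?f s)" and ?b = "l2n M (?g s)" and ?n = "l2n M (?y s)"
        have "- (\<integral>\<omega>. ?f s \<omega> \<bullet> ?y s \<omega> \<partial>M) \<le> ?a * ?n" using L2_Cauchy_Schwarz[OF elim(3,2)] by simp
        also have "\<dots> \<le> (L * (?n + ?b) + r s) * ?n" by (rule mult_right_mono[OF elim(1)]) simp
        finally have "- (\<integral>\<omega>. ?f s \<omega> \<bullet> ?y s \<omega> \<partial>M) \<le> L * ?n\<^sup>2 + L * ?b * ?n + r s * ?n"
          by (simp add: algebra_simps power2_eq_square)
        moreover have "2 * (r s * ?n) \<le> (r s)\<^sup>2 + ?n\<^sup>2" using sum_squares_bound[of "r s" ?n] by simp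
        \<comment> \<open>The weights in Young's inequality leave exactly the half of the squared
          diffusion that is available.\<close>
        moreover have "2 * (L * ?b * ?n) \<le> ?b\<^sup>2 / 2 + 2 * L\<^sup>2 * ?n\<^sup>2"
          using sum_squares_bound[of ?b "2 * L * ?n"] by (simp add: power_mult_distrib field_simps)
        ultimately have "- 2 * (\<integral>\<omega>. ?f s \<omega> \<bullet> ?y s \<omega> \<partial>M) - z s / 2 \<le> c * u s + (r s)\<^sup>2"
          unfolding c_def u_def z by (simp add: algebra_simps)
        then show ?case by (auto split: split_indicator)
      qed
    qed (use i ri in auto)
    also have "\<dots> = R2 + c * (\<integral>s. indicator {t..T} s * u s \<partial>tm)" using i ri by (simp add: R2_def l2n_sq)
    finally show ?thesis .
  qed
  have znn: "0 \<le> (\<integral>s. indicator {t..T} s * z s \<partial>tm)" for t by (intro integral_nonneg_AE AE_I2) (simp add: z)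
  have B: "(l2n M (?y t))\<^sup>2 \<le> 2 * R2 * exp (2 * c * T)" if t: "t \<in> {0..T}" for t
  proof -
    have uR: "u s \<le> R2 + c * (\<integral>r. indicator {s..T} r * u r \<partial>tm)" if "s \<in> {0..T}" for s
      using main[OF that] znn[of s] by simp
    have "u t \<le> 2 * R2 * exp (2 * c * T)" by (rule Gronwall_backward[OF ui _ uR c R2(1) t]) (auto simp: u_def)
    then show ?thesis by (simp add: u_def)
  qed
  have Yp: "(pnorm M T ?y)\<^sup>2 \<le> T * (2 * R2 * exp (2 * c * T))" by (rule pnorm_sq_le[OF p(1) B])
  also have "\<dots> \<le> 6 * T * exp (2 * c * T) * R\<^sup>2"
  proof -
    have "T * exp (2 * c * T) * (2 * R2) \<le> T * exp (2 * c * T) * (6 * R\<^sup>2)"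
      using R2 T_pos by (intro mult_left_mono) auto
    then show ?thesis by (simp add: ac_simps)
  qed
  finally show "pnorm M T ?y \<le> stab L * R" by (rule le_stab_if_square_le[OF _ stab_ge(2)[OF L, folded c_def] L R0])
  have full: "(\<integral>s. indicator {0..T} s * h s \<partial>tm) = (\<integral>s. h s \<partial>tm)" for h :: "real \<Rightarrow> real"
    by (intro Bochner_Integration.integral_cong) auto
  have "(pnorm M T ?g)\<^sup>2 = (\<integral>s. z s \<partial>tm)" "(pnorm M T ?y)\<^sup>2 = (\<integral>s. u s \<partial>tm)"
    unfolding l2n_time(2)[OF p(3), symmetric] l2n_time(2)[OF p(1), symmetric] l2n_sq[of tm] by (simp_all add: z u_def)
  moreover have "0 \<le> u 0" by (simp add: u_def)
  ultimately have "(pnorm M T ?g)\<^sup>2 \<le> 2 * R2 + 2 * c * (pnorm M T ?y)\<^sup>2"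
    using main[OF TT(2)] unfolding full by simp
  also have "\<dots> \<le> 2 * R2 + 2 * c * (T * (2 * R2 * exp (2 * c * T)))" using mult_left_mono[OF Yp, of "2 * c"] c by simp
  also have "\<dots> = (2 + 4 * c * T * exp (2 * c * T)) * R2" by (simp add: algebra_simps)
  also have "\<dots> \<le> (2 + 4 * c * T * exp (2 * c * T)) * R\<^sup>2" using R2 c T_pos by (intro mult_left_mono) auto
  finally show "pnorm M T ?g \<le> stab L * R" by (rule le_stab_if_square_le[OF _ stab_ge(3)[OF L, folded c_def] L R0])
qed

end

section \<open>Comparison of two solutions\<close>

lemma trace_mult_transpose: "trace (A ** transpose B) = A \<bullet> (B :: real^'m^'n)"
  by (simp add: trace_def matrix_matrix_mult_def transpose_def inner_vec_def)

text \<open>Lipschitz bounds for coefficients consist of a random part \<open>h\<close> and a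
  deterministic Wasserstein part \<open>c\<close>; on a probability space the constant has norm
  \<open>c\<close>.\<close>

lemma (in finite_measure) l2n_le_affine:
  fixes f :: "'a \<Rightarrow> 'b::euclidean_space" and h :: "'a \<Rightarrow> real"
  assumes M: "prob_space M" and h: "h \<in> L2_rv M M" and K: "0 \<le> K" "0 \<le> c"
    and le: "\<And>x. x \<in> space M \<Longrightarrow> norm (f x) \<le> K * (h x + c)"
  shows "l2n M f \<le> K * (l2n M h + c)"
proof -
  interpret prob_space M by (rule M)
  have hc: "(\<lambda>x. h x + c) \<in> L2_rv M M" by (intro L2_rv_add h L2_rv_const)
  have "l2n M f \<le> l2n M (\<lambda>x. K *\<^sub>R (h x + c))"
    by (rule l2n_mono[OF L2_rv_scaleR[OF hc]]) (use le in \<open>auto intro!: AE_I2 order_trans[OF _ abs_ge_self]\<close>)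
  also have "\<dots> = K * l2n M (\<lambda>x. h x + c)" using K by (simp only: l2n_scaleR abs_of_nonneg)
  also have "\<dots> \<le> K * (l2n M h + l2n M (\<lambda>_. c))"
    by (intro mult_left_mono l2n_add h L2_rv_const K)
  also have "l2n M (\<lambda>_. c) = c" using K by (simp add: l2n_def prob_space)
  finally show ?thesis .
qed

lemma (in brownian_setting) pnorm_le_of_l2n:
  fixes f :: "real \<Rightarrow> 'w \<Rightarrow> 'b::euclidean_space" and h :: "real \<Rightarrow> real"
  assumes "f \<in> pL2 M T" "h \<in> L2_rv tm tm" "AE s in tm. l2n M (f s) \<le> h s"
  shows "pnorm M T f \<le> l2n tm h"
  unfolding l2n_time(2)[OF assms(1), symmetric]
proof (rule l2n_mono[OF assms(2)])
  show "AE s in tm. norm (l2n M (f s)) \<le> norm (h s)"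
    using assms(3) by eventually_elim (simp add: order_trans[OF _ abs_ge_self])
qed

text \<open>The assumptions with one constant \<open>K\<close>, with the joint bounds on
  \<open>\<Phi>\<close>, \<open>\<Psi>\<close> and \<open>\<phi>\<close> separated and the trace
  written as an inner product of matrices; \<open>lam\<close> is the monotonicity constant.\<close>

locale monotone_system = brownian_setting M G W F T
  for M G :: "'w measure" and W :: "real \<Rightarrow> 'w \<Rightarrow> real^'m" and F :: "real \<Rightarrow> 'w measure" and T :: real +
  fixes b :: "('w, 'd::finite, 'k::finite, real^'d) forward_coeff"
    and \<sigma> :: "('w, 'd, 'k, real^'m^'d) forward_coeff"
    and \<Phi> :: "('d, 'k, 'm, real^'d) backward_coeff"
    and \<Psi> :: "('d, 'k, 'm, real^'k) backward_coeff"
    and \<phi> :: "real^'d \<Rightarrow> (real^'d) measure \<Rightarrow> real^'d"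
    and K lam :: real
  assumes K: "0 < K" and lam: "0 < lam"
    and measurable_coeffs: "forward_measurable M F T b" "backward_measurable T \<Phi>" "backward_measurable T \<Psi>"
    and growth_b: "\<And>t \<omega> x a \<mu> \<nu>. t \<in> {0..T} \<Longrightarrow> \<omega> \<in> space M \<Longrightarrow> \<mu> \<in> P2 \<Longrightarrow> \<nu> \<in> P2
      \<Longrightarrow> norm (b t \<omega> x \<mu> a \<nu>) \<le> K * (1 + norm x + norm2 \<mu> + norm a + norm2 \<nu>)"
    and growth_\<Phi>: "\<And>t x y z a \<pi>. t \<in> {0..T} \<Longrightarrow> \<pi> \<in> P2
      \<Longrightarrow> norm (\<Phi> t x y z a \<pi>) \<le> K * (1 + norm x + norm y + norm z + norm a + norm2 \<pi>)"
    and growth_\<Psi>: "\<And>t x y z a \<pi>. t \<in> {0..T} \<Longrightarrow> \<pi> \<in> P2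
      \<Longrightarrow> norm (\<Psi> t x y z a \<pi>) \<le> K * (1 + norm x + norm y + norm z + norm a + norm2 \<pi>)"
    and lip_b: "forward_lipschitz M T K b" and lip_\<sigma>: "forward_lipschitz M T K \<sigma>"
    and lip_\<Phi>: "\<And>t x x' y y' z z' a a' \<pi> \<pi>'. t \<in> {0..T} \<Longrightarrow> \<pi> \<in> P2 \<Longrightarrow> \<pi>' \<in> P2
      \<Longrightarrow> norm (\<Phi> t x y z a \<pi> - \<Phi> t x' y' z' a' \<pi>')
        \<le> K * (norm (x - x') + norm (y - y') + norm (z - z') + norm (a - a') + W2 \<pi> \<pi>')"
    and lip_\<Psi>: "\<And>t x x' y y' z z' a a' \<pi> \<pi>'. t \<in> {0..T} \<Longrightarrow> \<pi> \<in> P2 \<Longrightarrow> \<pi>' \<in> P2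
      \<Longrightarrow> norm (\<Psi> t x y z a \<pi> - \<Psi> t x' y' z' a' \<pi>')
        \<le> K * (norm (x - x') + norm (y - y') + norm (z - z') + norm (a - a') + W2 \<pi> \<pi>')"
    and lip_\<phi>: "\<And>x x' \<mu> \<mu>'. \<mu> \<in> P2 \<Longrightarrow> \<mu>' \<in> P2 \<Longrightarrow> norm (\<phi> x \<mu> - \<phi> x' \<mu>') \<le> K * (norm (x - x') + W2 \<mu> \<mu>')"
    and monotone: "\<And>t \<zeta>\<^sub>1 \<zeta>\<^sub>1' \<upsilon> \<upsilon>' \<theta> \<theta>' \<zeta> \<zeta>'. t \<in> {0..T} \<Longrightarrow> \<zeta>\<^sub>1 \<in> L2_rv M M \<Longrightarrow> \<zeta>\<^sub>1' \<in> L2_rv M M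
      \<Longrightarrow> \<upsilon> \<in> L2_rv M M \<Longrightarrow> \<upsilon>' \<in> L2_rv M M \<Longrightarrow> \<theta> \<in> L2_rv M M \<Longrightarrow> \<theta>' \<in> L2_rv M M
      \<Longrightarrow> \<zeta> \<in> L2_rv M M \<Longrightarrow> \<zeta>' \<in> L2_rv M M \<Longrightarrow>
        (\<integral>\<omega>. (b t \<omega> (\<zeta>\<^sub>1 \<omega>) (law M \<zeta>\<^sub>1) (\<theta> \<omega>) (law M \<theta>) - b t \<omega> (\<zeta>\<^sub>1' \<omega>) (law M \<zeta>\<^sub>1') (\<theta>' \<omega>) (law M \<theta>'))
          \<bullet> (\<upsilon> \<omega> - \<upsilon>' \<omega>) \<partial>M)
      + (\<integral>\<omega>. (\<sigma> t \<omega> (\<zeta>\<^sub>1 \<omega>) (law M \<zeta>\<^sub>1) (\<theta> \<omega>) (law M \<theta>) - \<sigma> t \<omega> (\<zeta>\<^sub>1' \<omega>) (law M \<zeta>\<^sub>1') (\<theta>' \<omega>) (law M \<theta>'))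
          \<bullet> (\<zeta> \<omega> - \<zeta>' \<omega>) \<partial>M)
      - (\<integral>\<omega>. (\<Phi> t (\<zeta>\<^sub>1 \<omega>) (\<upsilon> \<omega>) (\<zeta> \<omega>) (\<theta> \<omega>) (law M (\<lambda>\<omega>. (\<zeta>\<^sub>1 \<omega>, \<upsilon> \<omega>, \<zeta> \<omega>, \<theta> \<omega>)))
          - \<Phi> t (\<zeta>\<^sub>1' \<omega>) (\<upsilon>' \<omega>) (\<zeta>' \<omega>) (\<theta>' \<omega>) (law M (\<lambda>\<omega>. (\<zeta>\<^sub>1' \<omega>, \<upsilon>' \<omega>, \<zeta>' \<omega>, \<theta>' \<omega>)))) \<bullet> (\<zeta>\<^sub>1 \<omega> - \<zeta>\<^sub>1' \<omega>) \<partial>M)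
      - (\<integral>\<omega>. (\<Psi> t (\<zeta>\<^sub>1 \<omega>) (\<upsilon> \<omega>) (\<zeta> \<omega>) (\<theta> \<omega>) (law M (\<lambda>\<omega>. (\<zeta>\<^sub>1 \<omega>, \<upsilon> \<omega>, \<zeta> \<omega>, \<theta> \<omega>)))
          - \<Psi> t (\<zeta>\<^sub>1' \<omega>) (\<upsilon>' \<omega>) (\<zeta>' \<omega>) (\<theta>' \<omega>) (law M (\<lambda>\<omega>. (\<zeta>\<^sub>1' \<omega>, \<upsilon>' \<omega>, \<zeta>' \<omega>, \<theta>' \<omega>)))) \<bullet> (\<theta> \<omega> - \<theta>' \<omega>) \<partial>M)
      \<le> - lam * (l2n M (\<lambda>\<omega>. \<theta> \<omega> - \<theta>' \<omega>))\<^sup>2"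
    and terminal: "terminal_monotonicity M \<phi>"
begin

text \<open>The factor 2 counts every difference twice, once pointwise and once through the distance
  of the laws.\<close>

lemma forward_along_lipschitz:
  fixes h :: "('w, 'd, 'k, 'e::euclidean_space) forward_coeff"
  assumes h: "forward_lipschitz M T K h" and t: "t \<in> {0..T}"
    and L2: "X t \<in> L2_rv M M" "X' t \<in> L2_rv M M" "A t \<in> L2_rv M M" "A' t \<in> L2_rv M M"
  shows "l2n M (\<lambda>\<omega>. along_XA M h X A t \<omega> - along_XA M h X' A' t \<omega>)
    \<le> 2 * K * (l2n M (\<lambda>\<omega>. X t \<omega> - X' t \<omega>) + l2n M (\<lambda>\<omega>. A t \<omega> - A' t \<omega>))"
proof -
  let ?x = "\<lambda>\<omega>. X t \<omega> - X' t \<omega>" and ?a = "\<lambda>\<omega>. A t \<omega> - A' t \<omega>"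
  note d = L2_rv_diff[OF L2(1,2)] L2_rv_diff[OF L2(3,4)]
  have "l2n M (\<lambda>\<omega>. along_XA M h X A t \<omega> - along_XA M h X' A' t \<omega>)
      \<le> K * (l2n M (\<lambda>\<omega>. norm (?x \<omega>) + norm (?a \<omega>)) + (l2n M ?x + l2n M ?a))"
  proof (rule l2n_le_affine[OF prob_space_axioms])
    fix \<omega> assume w: "\<omega> \<in> space M"
    have "norm (along_XA M h X A t \<omega> - along_XA M h X' A' t \<omega>)
        \<le> K * (norm (?x \<omega>) + W2 (law M (X t)) (law M (X' t)) + norm (?a \<omega>) + W2 (law M (A t)) (law M (A' t)))"
      unfolding along_XA_def
      by (rule bspec[OF bspec[OF h[unfolded forward_lipschitz_def] t] w, rule_format]) (rule law_P2)+
    also have "\<dots> \<le> K * (norm (?x \<omega>) + norm (?a \<omega>) + (l2n M ?x + l2n M ?a))"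
      using W2_law_le[OF L2(1,2)] W2_law_le[OF L2(3,4)] K by (intro mult_left_mono) auto
    finally show "norm (along_XA M h X A t \<omega> - along_XA M h X' A' t \<omega>)
        \<le> K * (norm (?x \<omega>) + norm (?a \<omega>) + (l2n M ?x + l2n M ?a))" .
  qed (use K in \<open>auto intro!: L2_rv_add L2_rv_norm d\<close>)
  also have "\<dots> \<le> K * ((l2n M ?x + l2n M ?a) + (l2n M ?x + l2n M ?a))"
    using l2n_add[OF L2_rv_norm[OF d(1)] L2_rv_norm[OF d(2)]] K
    by (intro mult_left_mono add_right_mono) (auto simp: l2n_def)
  finally show ?thesis by (simp add: algebra_simps)
qed

lemma backward_along_lipschitz:
  fixes h :: "('d, 'k, 'm, 'e::euclidean_space) backward_coeff"
  assumes h: "\<And>x x' y y' z z' a a' \<pi> \<pi>'. \<pi> \<in> P2 \<Longrightarrow> \<pi>' \<in> P2 \<Longrightarrow> norm (h t x y z a \<pi> - h t x' y' z' a' \<pi>')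
        \<le> K * (norm (x - x') + norm (y - y') + norm (z - z') + norm (a - a') + W2 \<pi> \<pi>')"
    and L2: "X t \<in> L2_rv M M" "X' t \<in> L2_rv M M" "Y t \<in> L2_rv M M" "Y' t \<in> L2_rv M M"
      "Z t \<in> L2_rv M M" "Z' t \<in> L2_rv M M" "A t \<in> L2_rv M M" "A' t \<in> L2_rv M M"
  shows "l2n M (\<lambda>\<omega>. along_XYZA M h X Y Z A t \<omega> - along_XYZA M h X' Y' Z' A' t \<omega>)
    \<le> 2 * K * (l2n M (\<lambda>\<omega>. X t \<omega> - X' t \<omega>) + l2n M (\<lambda>\<omega>. Y t \<omega> - Y' t \<omega>)
        + l2n M (\<lambda>\<omega>. Z t \<omega> - Z' t \<omega>) + l2n M (\<lambda>\<omega>. A t \<omega> - A' t \<omega>))"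
proof -
  let ?x = "\<lambda>\<omega>. X t \<omega> - X' t \<omega>" and ?y = "\<lambda>\<omega>. Y t \<omega> - Y' t \<omega>"
    and ?z = "\<lambda>\<omega>. Z t \<omega> - Z' t \<omega>" and ?a = "\<lambda>\<omega>. A t \<omega> - A' t \<omega>"
  let ?V = "\<lambda>\<omega>. (X t \<omega>, Y t \<omega>, Z t \<omega>, A t \<omega>)" and ?V' = "\<lambda>\<omega>. (X' t \<omega>, Y' t \<omega>, Z' t \<omega>, A' t \<omega>)"
  let ?n = "\<lambda>\<omega>. norm (?x \<omega>) + norm (?y \<omega>) + norm (?z \<omega>) + norm (?a \<omega>)"
  note d = L2_rv_diff[OF L2(1,2)] L2_rv_diff[OF L2(3,4)] L2_rv_diff[OF L2(5,6)] L2_rv_diff[OF L2(7,8)]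
  note n = d[THEN L2_rv_norm]
  have nL: "?n \<in> L2_rv M M" by (intro L2_rv_add n)
  have tuple: "norm (x, y, z, a) \<le> norm x + norm y + norm z + norm a"
    for x :: "real^'d" and y :: "real^'d" and z :: "real^'m^'d" and a :: "real^'k"
    using norm_Pair_le[of x "(y, z, a)"] norm_Pair_le[of y "(z, a)"] norm_Pair_le[of z a] by linarith
  have V: "(\<lambda>\<omega>. (x \<omega>, y \<omega>, z \<omega>, a \<omega>)) \<in> L2_rv M M"
    if L: "x \<in> L2_rv M M" "y \<in> L2_rv M M" "z \<in> L2_rv M M" "a \<in> L2_rv M M"
    for x y :: "'w \<Rightarrow> real^'d" and z :: "'w \<Rightarrow> real^'m^'d" and a :: "'w \<Rightarrow> real^'k"
  proof (rule L2_rv_norm_le)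
    show "(\<lambda>\<omega>. norm (x \<omega>) + norm (y \<omega>) + norm (z \<omega>) + norm (a \<omega>)) \<in> L2_rv M M"
      by (intro L2_rv_add L2_rv_norm L)
    show "(\<lambda>\<omega>. (x \<omega>, y \<omega>, z \<omega>, a \<omega>)) \<in> borel_measurable M"
      by (rule borel_measurable_Pair[OF L2_rvD(1)[OF L(1)] borel_measurable_Pair[OF L2_rvD(1)[OF L(2)]
            borel_measurable_Pair[OF L2_rvD(1)[OF L(3)] L2_rvD(1)[OF L(4)]]]])
    show "AE \<omega> in M. norm (x \<omega>, y \<omega>, z \<omega>, a \<omega>) \<le> norm (norm (x \<omega>) + norm (y \<omega>) + norm (z \<omega>) + norm (a \<omega>))"
      by (rule AE_I2, rule order_trans[OF tuple]) simp
  qed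
  note VL = V[OF L2(1,3,5,7)] V[OF L2(2,4,6,8)]
  \<comment> \<open>The norm of a tuple is at most the sum of the component norms, so the distance
    of the joint laws is bounded by the same \<open>?n\<close> as the pointwise part.\<close>
  have "W2 (law M ?V) (law M ?V') \<le> l2n M (\<lambda>\<omega>. ?V \<omega> - ?V' \<omega>)" by (rule W2_law_le[OF VL])
  also have "\<dots> \<le> l2n M ?n" 
  proof (rule l2n_mono[OF nL AE_I2])
    show "norm (?V \<omega> - ?V' \<omega>) \<le> norm (?n \<omega>)" for \<omega>
      using tuple[of "?x \<omega>" "?y \<omega>" "?z \<omega>" "?a \<omega>"] by simp
  qed
  finally have W: "W2 (law M ?V) (law M ?V') \<le> l2n M ?n" .
  have "l2n M (\<lambda>\<omega>. along_XYZA M h X Y Z A t \<omega> - along_XYZA M h X' Y' Z' A' t \<omega>) \<le> K * (l2n M ?n + l2n M ?n)"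
  proof (rule l2n_le_affine[OF prob_space_axioms nL])
    fix \<omega>
    have "norm (along_XYZA M h X Y Z A t \<omega> - along_XYZA M h X' Y' Z' A' t \<omega>)
        \<le> K * (?n \<omega> + W2 (law M ?V) (law M ?V'))"
      unfolding along_XYZA_def by (rule h) (rule law_P2)+
    also have "\<dots> \<le> K * (?n \<omega> + l2n M ?n)" using W K by (intro mult_left_mono) auto
    finally show "norm (along_XYZA M h X Y Z A t \<omega> - along_XYZA M h X' Y' Z' A' t \<omega>) \<le> K * (?n \<omega> + l2n M ?n)" .
  qed (use K in auto)
  moreover have "l2n M ?n \<le> l2n M ?x + l2n M ?y + l2n M ?z + l2n M ?a"
    using l2n_add[OF L2_rv_add[OF L2_rv_add[OF n(1,2)] n(3)] n(4)] l2n_add[OF L2_rv_add[OF n(1,2)] n(3)] l2n_add[OF n(1,2)]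
    by (simp add: l2n_def)
  then have "K * (l2n M ?n + l2n M ?n) \<le> K * (2 * (l2n M ?x + l2n M ?y + l2n M ?z + l2n M ?a))"
    using K by (intro mult_left_mono) auto
  ultimately show ?thesis by (simp add: ac_simps)
qed

text \<open>Along a solution the coefficients need not be progressive at the null set of times where the law of
  the solution is replaced by a Dirac mass; \<open>f\<close>, \<open>p\<close>, \<open>q\<close> are progressive versions of them.\<close>

definition solution where
  "solution \<xi> A X Y Z f p q \<longleftrightarrow> A \<in> H2 M F T \<and> X \<in> S2 M F T \<and> Y \<in> S2 M F T \<and>
     itoproc X f (along_XA M \<sigma> X A) \<and> itoproc Y (\<lambda>t \<omega>. - p t \<omega>) Z \<and> p \<in> H2 M F T \<and> q \<in> H2 M F T \<and>
     (AE s in tm. \<forall>\<omega>. f s \<omega> = along_XA M b X A s \<omega> \<and> p s \<omega> = along_XYZA M \<Phi> X Y Z A s \<omega> \<and>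
        q s \<omega> = along_XYZA M \<Psi> X Y Z A s \<omega>) \<and>
     (AE \<omega> in M. X 0 \<omega> = \<xi> \<omega>) \<and> (AE \<omega> in M. Y T \<omega> = \<phi> (X T \<omega>) (law M (X T)))"

text \<open>The identity for \<open>q\<close> off a null set is exported along with its almost
  everywhere form: it transfers to \<open>q\<close> both the equation for \<open>Ybar\<close> and
  the vanishing of \<open>\<Psi>\<close> along the limit.\<close>

lemma solution_ex:
  assumes u: "uncoupled_system M F W T b \<sigma> \<Phi> \<phi> \<xi> A X Y Z" and A: "A \<in> H2 M F T"
  obtains N f p q where "solution \<xi> A X Y Z f p q" "N \<in> null_sets tm"
    "\<And>t \<omega>. t \<in> {0..T} - N \<Longrightarrow> q t \<omega> = along_XYZA M \<Psi> X Y Z A t \<omega>"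
proof -
  have S: "X \<in> S2 M F T" "Y \<in> S2 M F T" "Z \<in> H2 M F T"
    "ito_differential M F W T X (along_XA M b X A) (along_XA M \<sigma> X A)"
    "ito_differential M F W T Y (\<lambda>t \<omega>. - along_XYZA M \<Phi> X Y Z A t \<omega>) Z"
    "AE \<omega> in M. X 0 \<omega> = \<xi> \<omega>" "AE \<omega> in M. Y T \<omega> = \<phi> (X T \<omega>) (law M (X T))"
    using u by (auto simp: uncoupled_system_def)
  note H = S2_adL2(1)[OF S(1)] S2_adL2(1)[OF S(2)] S(3) A
  obtain N1 f where f: "N1 \<in> null_sets tm" "f \<in> H2 M F T" "\<And>t \<omega>. t \<in> {0..T} - N1 \<Longrightarrow> f t \<omega> = along_XA M b X A t \<omega>"
    by (rule forward_version[OF measurable_coeffs(1) growth_b H(1,4) K]) blast+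
  obtain N2 p where p: "N2 \<in> null_sets tm" "p \<in> H2 M F T" "\<And>t \<omega>. t \<in> {0..T} - N2 \<Longrightarrow> p t \<omega> = along_XYZA M \<Phi> X Y Z A t \<omega>"
    by (rule backward_version[OF measurable_coeffs(2) growth_\<Phi> H K]) blast+
  obtain N3 q where q: "N3 \<in> null_sets tm" "q \<in> H2 M F T" "\<And>t \<omega>. t \<in> {0..T} - N3 \<Longrightarrow> q t \<omega> = along_XYZA M \<Psi> X Y Z A t \<omega>"
    by (rule backward_version[OF measurable_coeffs(3) growth_\<Psi> H K]) blast+
  have "itoproc Y (\<lambda>t \<omega>. - p t \<omega>) Z"
    by (rule itoproc_if_S2[OF S(5,2) H2_uminus[OF p(2)] p(1)]) (simp add: p(3))
  moreover have "itoproc X f (along_XA M \<sigma> X A)" by (rule itoproc_if_S2[OF S(4,1) f(2,1,3)])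
  moreover have "AE s in tm. \<forall>\<omega>. f s \<omega> = along_XA M b X A s \<omega> \<and> p s \<omega> = along_XYZA M \<Phi> X Y Z A s \<omega> \<and>
        q s \<omega> = along_XYZA M \<Psi> X Y Z A s \<omega>"
    using AE_not_in[OF f(1)] AE_not_in[OF p(1)] AE_not_in[OF q(1)] AE_space
    by eventually_elim (simp add: f(3) p(3) q(3))
  ultimately have "solution \<xi> A X Y Z f p q"
    unfolding solution_def using S A p(2) q(2) by blast
  then show ?thesis using q(1,3) by (rule that)
qed

end

context monotone_system
begin

text \<open>Factors relating the differences to the control difference. \<open>cX\<close> is forward
  stability with the control as source; in \<open>cY\<close> the terminal value contributes
  \<open>2 * K * cX\<close> and the source \<open>2 * K * (cX + 1)\<close>; \<open>c\<Psi>\<close>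
  adds the four components, \<open>Y\<close> and \<open>Z\<close> sharing \<open>cY\<close>.\<close>

definition cX :: real where "cX = stab (2 * K) * (2 * K)"
definition cY :: real where "cY = stab (2 * K) * (2 * K * cX + 2 * K * (cX + 1))"
definition c\<Psi> :: real where "c\<Psi> = 2 * K * (cX + 2 * cY + 1)"

lemma const_nonneg: "0 \<le> cX" "0 \<le> cY" "0 \<le> c\<Psi>"
proof -
  have "0 \<le> stab (2 * K)" using stab_ge(4)[of "2 * K"] K by simp
  then show "0 \<le> cX" using K by (simp add: cX_def)
  then show "0 \<le> cY" using K \<open>0 \<le> stab (2 * K)\<close> by (simp add: cY_def)
  then show "0 \<le> c\<Psi>" using K \<open>0 \<le> cX\<close> by (simp add: c\<Psi>_def)
qed

context
  fixes \<xi> A A' X X' Y Y' Z Z' f f' p p' q q'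
  assumes S: "solution \<xi> A X Y Z f p q" and S': "solution \<xi> A' X' Y' Z' f' p' q'"
begin

abbreviation (input) "dX \<equiv> \<lambda>s \<omega>. X s \<omega> - X' s \<omega>"
abbreviation (input) "dY \<equiv> \<lambda>s \<omega>. Y s \<omega> - Y' s \<omega>"
abbreviation (input) "dZ \<equiv> \<lambda>s \<omega>. Z s \<omega> - Z' s \<omega>"
abbreviation (input) "dA \<equiv> \<lambda>s \<omega>. A s \<omega> - A' s \<omega>"
abbreviation (input) "df \<equiv> \<lambda>s \<omega>. f s \<omega> - f' s \<omega>"
abbreviation (input) "dp \<equiv> \<lambda>s \<omega>. p s \<omega> - p' s \<omega>"
abbreviation (input) "dq \<equiv> \<lambda>s \<omega>. q s \<omega> - q' s \<omega>"
abbreviation (input) "dg \<equiv> \<lambda>s \<omega>. along_XA M \<sigma> X A s \<omega> - along_XA M \<sigma> X' A' s \<omega>"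

lemma ito:
  "itoproc X f (along_XA M \<sigma> X A)" "itoproc X' f' (along_XA M \<sigma> X' A')"
  "itoproc Y (\<lambda>t \<omega>. - p t \<omega>) Z" "itoproc Y' (\<lambda>t \<omega>. - p' t \<omega>) Z'"
  using S S' unfolding solution_def by blast+

lemma diff_pL2: "dX \<in> pL2 M T" "dY \<in> pL2 M T" "dZ \<in> pL2 M T" "dA \<in> pL2 M T" "df \<in> pL2 M T"
  "dp \<in> pL2 M T" "dq \<in> pL2 M T" "dg \<in> pL2 M T"
proof -
  have "A \<in> H2 M F T" "A' \<in> H2 M F T" "p \<in> H2 M F T" "p' \<in> H2 M F T" "q \<in> H2 M F T" "q' \<in> H2 M F T"
    using S S' unfolding solution_def by blast+
  note H = this[THEN H2_adL2, THEN adL2D(1)]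
  show "dX \<in> pL2 M T" "df \<in> pL2 M T" "dg \<in> pL2 M T" by (rule itoproc_diff_pL2[OF ito(1,2)])+
  show "dY \<in> pL2 M T" "dZ \<in> pL2 M T" by (rule itoproc_diff_pL2[OF ito(3,4)])+
  show "dA \<in> pL2 M T" "dp \<in> pL2 M T" "dq \<in> pL2 M T" by (intro pL2_diff H)+
qed

lemma AE_sections:
  "AE s in tm. X s \<in> L2_rv M M \<and> X' s \<in> L2_rv M M \<and> Y s \<in> L2_rv M M \<and> Y' s \<in> L2_rv M M
     \<and> Z s \<in> L2_rv M M \<and> Z' s \<in> L2_rv M M \<and> A s \<in> L2_rv M M \<and> A' s \<in> L2_rv M M"
proof -
  have "A \<in> pL2 M T" "A' \<in> pL2 M T" "X \<in> pL2 M T" "X' \<in> pL2 M T" "Y \<in> pL2 M T" "Y' \<in> pL2 M T"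
    using S S' H2_adL2 S2_adL2(2) adL2D(1) unfolding solution_def by blast+
  note L = this[THEN pL2_AE_L2] itoproc_diffusion_pL2[OF ito(3), THEN pL2_AE_L2]
    itoproc_diffusion_pL2[OF ito(4), THEN pL2_AE_L2]
  show ?thesis using L by eventually_elim blast
qed

lemma AE_coefficients:
  "AE s in tm. \<forall>\<omega>. df s \<omega> = along_XA M b X A s \<omega> - along_XA M b X' A' s \<omega>
     \<and> dp s \<omega> = along_XYZA M \<Phi> X Y Z A s \<omega> - along_XYZA M \<Phi> X' Y' Z' A' s \<omega>
     \<and> dq s \<omega> = along_XYZA M \<Psi> X Y Z A s \<omega> - along_XYZA M \<Psi> X' Y' Z' A' s \<omega>"
proof -
  have "AE s in tm. \<forall>\<omega>. f s \<omega> = along_XA M b X A s \<omega> \<and> p s \<omega> = along_XYZA M \<Phi> X Y Z A s \<omega> \<and>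
        q s \<omega> = along_XYZA M \<Psi> X Y Z A s \<omega>"
    "AE s in tm. \<forall>\<omega>. f' s \<omega> = along_XA M b X' A' s \<omega> \<and> p' s \<omega> = along_XYZA M \<Phi> X' Y' Z' A' s \<omega> \<and>
        q' s \<omega> = along_XYZA M \<Psi> X' Y' Z' A' s \<omega>"
    using S S' unfolding solution_def by blast+
  then show ?thesis by eventually_elim auto
qed

lemma AE_lipschitz:
  "AE s in tm. l2n M (df s) \<le> 2 * K * (l2n M (dX s) + l2n M (dA s))"
  "AE s in tm. l2n M (dg s) \<le> 2 * K * (l2n M (dX s) + l2n M (dA s))"
  "AE s in tm. l2n M (dp s) \<le> 2 * K * (l2n M (dX s) + l2n M (dY s) + l2n M (dZ s) + l2n M (dA s))"
  "AE s in tm. l2n M (dq s) \<le> 2 * K * (l2n M (dX s) + l2n M (dY s) + l2n M (dZ s) + l2n M (dA s))"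
proof -
  show "AE s in tm. l2n M (df s) \<le> 2 * K * (l2n M (dX s) + l2n M (dA s))"
    using AE_sections AE_coefficients AE_space
  proof eventually_elim
    case (elim s)
    then show ?case using forward_along_lipschitz[OF lip_b, of s X X' A A'] by simp
  qed
  show "AE s in tm. l2n M (dg s) \<le> 2 * K * (l2n M (dX s) + l2n M (dA s))"
    using AE_sections AE_space
  proof eventually_elim
    case (elim s)
    then show ?case using forward_along_lipschitz[OF lip_\<sigma>, of s X X' A A'] by simp
  qed
  show "AE s in tm. l2n M (dp s) \<le> 2 * K * (l2n M (dX s) + l2n M (dY s) + l2n M (dZ s) + l2n M (dA s))"
    using AE_sections AE_coefficients AE_space
  proof eventually_elim
    case (elim s)
    have s: "s \<in> {0..T}" using elim(3) by simp
    show ?case using backward_along_lipschitz[where h = \<Phi> and t = s, OF lip_\<Phi>[OF s], of X X' Y Y' Z Z' A A'] elim(1,2) by simp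
  qed
  show "AE s in tm. l2n M (dq s) \<le> 2 * K * (l2n M (dX s) + l2n M (dY s) + l2n M (dZ s) + l2n M (dA s))"
    using AE_sections AE_coefficients AE_space
  proof eventually_elim
    case (elim s)
    have s: "s \<in> {0..T}" using elim(3) by simp
    show ?case using backward_along_lipschitz[where h = \<Psi> and t = s, OF lip_\<Psi>[OF s], of X X' Y Y' Z Z' A A'] elim(1,2) by simp
  qed
qed

lemma AE_start: "AE \<omega> in M. X 0 \<omega> = X' 0 \<omega>"
proof -
  have "AE \<omega> in M. X 0 \<omega> = \<xi> \<omega>" "AE \<omega> in M. X' 0 \<omega> = \<xi> \<omega>" using S S' unfolding solution_def by blast+
  then show ?thesis by eventually_elim simp
qed

lemma X_bound:
  "l2n M (dX T) \<le> cX * pnorm M T dA" "pnorm M T dX \<le> cX * pnorm M T dA"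
proof -
  note a = l2n_time[OF diff_pL2(4)]
  let ?r = "\<lambda>s. (2 * K) *\<^sub>R l2n M (dA s)"
  have r: "?r \<in> L2_rv tm tm" by (rule L2_rv_scaleR[OF a(1)])
  have rn: "l2n tm ?r = 2 * K * pnorm M T dA" unfolding l2n_scaleR a(2) using K by simp
  have L: "0 \<le> 2 * K" using K by simp
  have "AE s in tm. l2n M (df s) \<le> 2 * K * l2n M (dX s) + ?r s"
    using AE_lipschitz(1) by eventually_elim (simp add: algebra_simps)
  moreover have "AE s in tm. l2n M (dg s) \<le> 2 * K * l2n M (dX s) + ?r s"
    using AE_lipschitz(2) by eventually_elim (simp add: algebra_simps)
  ultimately have *: "t \<in> {0..T} \<Longrightarrow> l2n M (dX t) \<le> stab (2 * K) * l2n tm ?r"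
      "pnorm M T dX \<le> stab (2 * K) * l2n tm ?r" for t
    using forward_stability[OF ito(1,2) AE_start L r] by blast+
  show "l2n M (dX T) \<le> cX * pnorm M T dA" "pnorm M T dX \<le> cX * pnorm M T dA"
    using *(1)[of T] *(2) T_pos unfolding rn cX_def by (simp_all add: ac_simps)
qed

lemma terminal_bound: "l2n M (dY T) \<le> 2 * K * l2n M (dX T)"
proof -
  have TT: "T \<in> {0..T}" using T_pos by simp
  note XT = itoproc_L2[OF ito(1) TT] itoproc_L2[OF ito(2) TT]
  note d = L2_rv_diff[OF XT]
  have "AE \<omega> in M. Y T \<omega> = \<phi> (X T \<omega>) (law M (X T))" "AE \<omega> in M. Y' T \<omega> = \<phi> (X' T \<omega>) (law M (X' T))"
    using S S' unfolding solution_def by blast+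
  then have "AE \<omega> in M. norm (dY T \<omega>) \<le> norm (K *\<^sub>R (norm (dX T \<omega>) + l2n M (dX T)))"
  proof eventually_elim
    case (elim \<omega>)
    have "norm (dY T \<omega>) \<le> K * (norm (dX T \<omega>) + W2 (law M (X T)) (law M (X' T)))"
      unfolding elim by (rule lip_\<phi>) (rule law_P2)+
    also have "\<dots> \<le> K * (norm (dX T \<omega>) + l2n M (dX T))"
      using W2_law_le[OF XT] K by (intro mult_left_mono) auto
    finally show ?case using K by simp
  qed
  then have "l2n M (dY T) \<le> l2n M (\<lambda>\<omega>. K *\<^sub>R (norm (dX T \<omega>) + l2n M (dX T)))"
    by (rule l2n_mono[rotated]) (intro L2_rv_scaleR L2_rv_add L2_rv_norm d L2_rv_const)
  also have "\<dots> \<le> K * (l2n M (dX T) + l2n M (dX T))"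
  proof -
    have "l2n M (\<lambda>\<omega>. norm (dX T \<omega>)) = l2n M (dX T)" by (simp add: l2n_def)
    moreover have "l2n M (\<lambda>\<omega>. K *\<^sub>R (norm (dX T \<omega>) + l2n M (dX T))) \<le> K * (l2n M (\<lambda>\<omega>. norm (dX T \<omega>)) + l2n M (dX T))"
      by (rule l2n_le_affine[OF prob_space_axioms L2_rv_norm[OF d]]) (use K in auto)
    ultimately show ?thesis by simp
  qed
  finally show ?thesis by simp
qed

text \<open>The same function is the source in the backward estimate and the bound for the forward
  coefficients in the supremum estimate.\<close>

lemma XA_bound:
  defines "r \<equiv> \<lambda>s. (2 * K) *\<^sub>R (l2n M (dX s) + l2n M (dA s))"
  shows "r \<in> L2_rv tm tm" "l2n tm r \<le> 2 * K * (cX + 1) * pnorm M T dA"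
proof -
  note x = l2n_time[OF diff_pL2(1)] and a = l2n_time[OF diff_pL2(4)]
  show "r \<in> L2_rv tm tm" unfolding r_def by (intro L2_rv_scaleR L2_rv_add x(1) a(1))
  have "l2n tm r \<le> 2 * K * (pnorm M T dX + pnorm M T dA)"
    unfolding r_def l2n_scaleR using l2n_add[OF x(1) a(1)] x(2) a(2) K by simp
  also have "\<dots> \<le> 2 * K * ((cX + 1) * pnorm M T dA)"
    using X_bound(2) K by (intro mult_left_mono) (auto simp: distrib_right)
  finally show "l2n tm r \<le> 2 * K * (cX + 1) * pnorm M T dA" by simp
qed

lemma YZ_bound: "pnorm M T dY \<le> cY * pnorm M T dA" "pnorm M T dZ \<le> cY * pnorm M T dA"
proof -
  let ?r = "\<lambda>s. (2 * K) *\<^sub>R (l2n M (dX s) + l2n M (dA s))"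
  note r = XA_bound(1) and rn = XA_bound(2)
  have L: "0 \<le> 2 * K" using K by simp
  have minus: "l2n M (\<lambda>\<omega>. - p s \<omega> - - p' s \<omega>) = l2n M (dp s)" for s
    using l2n_minus_commute[of M "p' s" "p s"] by simp
  have "AE s in tm. l2n M (\<lambda>\<omega>. - p s \<omega> - - p' s \<omega>) \<le> 2 * K * (l2n M (dY s) + l2n M (dZ s)) + ?r s"
    unfolding minus using AE_lipschitz(3) by eventually_elim (simp add: algebra_simps)
  from backward_stability[OF ito(3,4) L r this]
  have *: "pnorm M T dY \<le> stab (2 * K) * (l2n M (dY T) + l2n tm ?r)"
    "pnorm M T dZ \<le> stab (2 * K) * (l2n M (dY T) + l2n tm ?r)" by auto
  have "l2n M (dY T) \<le> 2 * K * (cX * pnorm M T dA)"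
    using terminal_bound mult_left_mono[OF X_bound(1) L] by simp
  then have "l2n M (dY T) + l2n tm ?r \<le> (2 * K * cX + 2 * K * (cX + 1)) * pnorm M T dA"
    using rn by (simp add: algebra_simps)
  then have "stab (2 * K) * (l2n M (dY T) + l2n tm ?r) \<le> cY * pnorm M T dA"
    unfolding cY_def mult.assoc[of "stab (2 * K)"]
    using stab_ge(4)[OF L] by (intro mult_left_mono) auto
  then show "pnorm M T dY \<le> cY * pnorm M T dA" "pnorm M T dZ \<le> cY * pnorm M T dA" using * by auto
qed

lemma \<Psi>_bound: "pnorm M T dq \<le> c\<Psi> * pnorm M T dA"
proof -
  note x = l2n_time[OF diff_pL2(1)] and y = l2n_time[OF diff_pL2(2)]
    and z = l2n_time[OF diff_pL2(3)] and a = l2n_time[OF diff_pL2(4)]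
  note xy = L2_rv_add[OF x(1) y(1)] note xyz = L2_rv_add[OF xy z(1)]
  let ?h = "\<lambda>s. l2n M (dX s) + l2n M (dY s) + l2n M (dZ s) + l2n M (dA s)"
  have "pnorm M T dq \<le> l2n tm (\<lambda>s. (2 * K) *\<^sub>R ?h s)"
    by (rule pnorm_le_of_l2n[OF diff_pL2(7) L2_rv_scaleR[OF L2_rv_add[OF xyz a(1)]]])
       (use AE_lipschitz(4) in simp)
  also have "\<dots> = 2 * K * l2n tm ?h" unfolding l2n_scaleR using K by simp
  also have "l2n tm ?h \<le> pnorm M T dX + pnorm M T dY + pnorm M T dZ + pnorm M T dA"
    using l2n_add[OF xyz a(1)] l2n_add[OF xy z(1)] l2n_add[OF x(1) y(1)] x(2) y(2) z(2) a(2) by simp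
  also have "\<dots> \<le> (cX + 2 * cY + 1) * pnorm M T dA"
    using X_bound(2) YZ_bound by (simp add: algebra_simps)
  finally show ?thesis using K by (simp add: c\<Psi>_def mult.assoc)
qed

lemma S2_bound: "S2_norm M T dX \<le> sqrt (2 * T + 8) * (2 * K * (cX + 1)) * pnorm M T dA"
proof -
  define B where "B = 2 * K * (cX + 1) * pnorm M T dA"
  note r = XA_bound(1) and rn = XA_bound(2)[folded B_def]
  have "pnorm M T df \<le> B" "pnorm M T dg \<le> B"
    using pnorm_le_of_l2n[OF diff_pL2(5) r] pnorm_le_of_l2n[OF diff_pL2(8) r] AE_lipschitz(1,2) rn by auto
  then have "(pnorm M T df)\<^sup>2 \<le> B\<^sup>2" "(pnorm M T dg)\<^sup>2 \<le> B\<^sup>2" by (auto intro: power_mono)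
  then have "2 * T * (pnorm M T df)\<^sup>2 + 8 * (pnorm M T dg)\<^sup>2 \<le> 2 * T * B\<^sup>2 + 8 * B\<^sup>2"
    using T_pos by (intro add_mono mult_left_mono) auto
  also have "\<dots> = (2 * T + 8) * B\<^sup>2" by (simp add: algebra_simps)
  finally have "S2_sq M T dX \<le> ennreal ((2 * T + 8) * B\<^sup>2)"
    using S2_estimate[OF ito(1,2) AE_start] by (meson ennreal_leI order_trans)
  then have "S2_norm M T dX \<le> sqrt ((2 * T + 8) * B\<^sup>2)"
    unfolding S2_norm_def using T_pos by (intro real_sqrt_le_mono enn2real_leI) auto
  also have "\<dots> = sqrt (2 * T + 8) * B"
    using K const_nonneg(1) by (simp add: real_sqrt_mult B_def)
  finally show ?thesis by (simp add: B_def ac_simps)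
qed

text \<open>In the product formula for \<open>dX\<close> and \<open>dY\<close> at \<open>T\<close>
  the common start removes the initial term, and terminal monotonicity makes the left-hand side
  nonnegative. The pairings of \<open>b\<close>, \<open>\<sigma>\<close> and \<open>\<Phi>\<close>
  are therefore nonnegative in sum, and the monotonicity inequality leaves only the pairing of
  \<open>\<Psi>\<close> with the control.\<close>

lemma monotone_estimate: "lam * (pnorm M T dA)\<^sup>2 \<le> ip M T dq dA"
proof -
  have TT: "T \<in> {0..T}" using T_pos by simp
  have 0: "0 \<in> {0..T}" using T_pos by simp
  note XT = itoproc_L2[OF ito(1) TT] itoproc_L2[OF ito(2) TT] and YT = itoproc_L2[OF ito(3) TT] itoproc_L2[OF ito(4) TT]
  note X0 = itoproc_L2[OF ito(1) 0] itoproc_L2[OF ito(2) 0] and Y0 = itoproc_L2[OF ito(3) 0] itoproc_L2[OF ito(4) 0]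
  have full: "ip M T u v = (\<integral>s. (\<integral>\<omega>. u s \<omega> \<bullet> v s \<omega> \<partial>M) \<partial>tm)" for u v :: "real \<Rightarrow> 'w \<Rightarrow> 'z::euclidean_space"
    unfolding ip_tm[OF order_refl] by (intro Bochner_Integration.integral_cong) auto
  note i = ip_integrable_tm[OF diff_pL2(5,2)] ip_integrable_tm[OF diff_pL2(8,3)]
    ip_integrable_tm[OF diff_pL2(6,1)] ip_integrable_tm[OF diff_pL2(7,4)]
  have ii: "integrable tm (\<lambda>s. (l2n M (dA s))\<^sup>2)" using L2_rvD(2)[OF l2n_time(1)[OF diff_pL2(4)]] by simp
  have "ip M T df dY + ip M T dg dZ - ip M T dp dX - ip M T dq dA
      = (\<integral>s. (\<integral>\<omega>. df s \<omega> \<bullet> dY s \<omega> \<partial>M) + (\<integral>\<omega>. dg s \<omega> \<bullet> dZ s \<omega> \<partial>M)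
          - (\<integral>\<omega>. dp s \<omega> \<bullet> dX s \<omega> \<partial>M) - (\<integral>\<omega>. dq s \<omega> \<bullet> dA s \<omega> \<partial>M) \<partial>tm)"
    unfolding full using i by simp
  also have "\<dots> \<le> (\<integral>s. - lam * (l2n M (dA s))\<^sup>2 \<partial>tm)"
  proof (rule integral_mono_AE)
    show "AE s in tm. (\<integral>\<omega>. df s \<omega> \<bullet> dY s \<omega> \<partial>M) + (\<integral>\<omega>. dg s \<omega> \<bullet> dZ s \<omega> \<partial>M)
          - (\<integral>\<omega>. dp s \<omega> \<bullet> dX s \<omega> \<partial>M) - (\<integral>\<omega>. dq s \<omega> \<bullet> dA s \<omega> \<partial>M) \<le> - lam * (l2n M (dA s))\<^sup>2"
      using AE_sections AE_coefficients AE_space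
    proof eventually_elim
      case (elim s)
      have s: "s \<in> {0..T}" using elim(3) by simp
      have e: "df s \<omega> = along_XA M b X A s \<omega> - along_XA M b X' A' s \<omega>"
        "dp s \<omega> = along_XYZA M \<Phi> X Y Z A s \<omega> - along_XYZA M \<Phi> X' Y' Z' A' s \<omega>"
        "dq s \<omega> = along_XYZA M \<Psi> X Y Z A s \<omega> - along_XYZA M \<Psi> X' Y' Z' A' s \<omega>" for \<omega>
        using elim(2) by auto
      show ?case
        unfolding e along_XA_def along_XYZA_def by (rule monotone[OF s]) (use elim(1) in auto)
    qed
  qed (use i ii in auto)
  also have "\<dots> = - lam * (pnorm M T dA)\<^sup>2"
    unfolding l2n_time(2)[OF diff_pL2(4), symmetric] l2n_sq[of tm] by simp
  finally have mono: "ip M T df dY + ip M T dg dZ - ip M T dp dX - ip M T dq dA \<le> - lam * (pnorm M T dA)\<^sup>2" .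
  have "(\<integral>\<omega>. dX 0 \<omega> \<bullet> dY 0 \<omega> \<partial>M) = (\<integral>\<omega>. 0 \<partial>M)"
  proof (rule integral_cong_AE)
    show "(\<lambda>\<omega>. dX 0 \<omega> \<bullet> dY 0 \<omega>) \<in> borel_measurable M"
      by (rule borel_measurable_integrable[OF L2_inner_integrable[OF L2_rv_diff[OF X0] L2_rv_diff[OF Y0]]])
    show "AE \<omega> in M. dX 0 \<omega> \<bullet> dY 0 \<omega> = 0" using AE_start by eventually_elim simp
  qed simp
  moreover have "ip M T dX (\<lambda>s \<omega>. - p s \<omega> - - p' s \<omega>) = - ip M T dp dX"
    using ip_uminus_right[of T dX dp] ip_commute[of T dX dp] by (simp add: minus_diff_commute)
  ultimately have "(\<integral>\<omega>. dX T \<omega> \<bullet> dY T \<omega> \<partial>M) = ip M T df dY - ip M T dp dX + ip M T dg dZ"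
    using ito_product_diff[OF ito TT] by simp
  moreover have "0 \<le> (\<integral>\<omega>. dX T \<omega> \<bullet> dY T \<omega> \<partial>M)"
  proof -
    have Y: "AE \<omega> in M. Y T \<omega> = \<phi> (X T \<omega>) (law M (X T))" "AE \<omega> in M. Y' T \<omega> = \<phi> (X' T \<omega>) (law M (X' T))"
      using S S' unfolding solution_def by blast+
    have "0 \<le> (\<integral>\<omega>. (\<phi> (X T \<omega>) (law M (X T)) - \<phi> (X' T \<omega>) (law M (X' T))) \<bullet> dX T \<omega> \<partial>M)"
      using terminal XT by (auto simp: terminal_monotonicity_def)
    also have "\<dots> = (\<integral>\<omega>. dX T \<omega> \<bullet> dY T \<omega> \<partial>M)"
    proof (rule integral_cong_AE)
      \<comment> \<open>The terminal expression inherits measurability from \<open>Y T\<close>, to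
        which it is almost surely equal.\<close>
      have "Y T \<in> borel_measurable (F T)" "Y' T \<in> borel_measurable (F T)"
        using S S' TT S2_adL2(4) unfolding solution_def by blast+
      from F_measurable_AE[OF this(1) Y(1)] F_measurable_AE[OF this(2) Y(2)]
      show "(\<lambda>\<omega>. (\<phi> (X T \<omega>) (law M (X T)) - \<phi> (X' T \<omega>) (law M (X' T))) \<bullet> dX T \<omega>) \<in> borel_measurable M"
        by (intro borel_measurable_inner borel_measurable_diff L2_rvD(1)[OF XT(1)] L2_rvD(1)[OF XT(2)] measurable_F_M)
      show "(\<lambda>\<omega>. dX T \<omega> \<bullet> dY T \<omega>) \<in> borel_measurable M"
        by (rule borel_measurable_integrable[OF L2_inner_integrable[OF L2_rv_diff[OF XT] L2_rv_diff[OF YT]]])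
      show "AE \<omega> in M. (\<phi> (X T \<omega>) (law M (X T)) - \<phi> (X' T \<omega>) (law M (X' T))) \<bullet> dX T \<omega> = dX T \<omega> \<bullet> dY T \<omega>"
        using Y by eventually_elim (simp add: inner_commute)
    qed
    finally show ?thesis .
  qed
  ultimately show ?thesis using mono by simp
qed

end

end

section \<open>The fast variable\<close>

text \<open>For \<open>x\<close> beyond \<open>k\<close> one has
  \<open>(x - k)^2 \<le> x * (x - k) \<le> m\<close>.\<close>

lemma le_add_sqrt_if_square_le:
  fixes x k m :: real
  assumes "x\<^sup>2 \<le> k * x + m" "0 \<le> k" "0 \<le> m"
  shows "x \<le> k + sqrt m"
proof (cases "x \<le> k")
  case False
  have "(x - k)\<^sup>2 \<le> x * (x - k)"
    unfolding power2_eq_square using False assms(2) by (intro mult_right_mono) auto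
  also have "\<dots> \<le> m" using assms(1) by (simp add: power2_eq_square algebra_simps)
  finally have "x - k \<le> sqrt m" by (rule real_le_rsqrt)
  then show ?thesis by simp
qed (use assms(3) in \<open>simp add: add_increasing2\<close>)

context brownian_setting
begin

text \<open>Comparison with the zero process turns stability estimates into a priori bounds.\<close>

lemma itoproc_zero: "itoproc (\<lambda>_ _. 0 :: real^'n) (\<lambda>_ _. 0) (\<lambda>_ _. 0)"
proof -
  have "(\<lambda>_ _. 0 :: real^'n) \<in> pL2 M T" by (rule pL2_const_time) simp
  moreover have "(\<lambda>_ _. 0 :: real^'n) \<in> adL2 M F T" using calculation by (simp add: adL2_def)
  moreover have "prim (\<lambda>_ _. 0 :: real^'n) t \<omega> = 0" for t and \<omega> :: 'w
    by (simp add: prim_def set_lebesgue_integral_def)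
  ultimately show ?thesis
    unfolding itoproc_def by (intro conjI exI[of _ "\<lambda>_ _. 0"] has_ito_integral_zero) simp_all
qed

text \<open>\<open>H2_sq\<close> is an iterated integral, time inside, so agreement off a null set
  of times carries the stationarity condition over to the progressive version
  \<open>q\<close>.\<close>

lemma pnorm_eq_0_if_H2_sq:
  fixes q u :: "real \<Rightarrow> 'w \<Rightarrow> 'b::euclidean_space"
  assumes q: "q \<in> H2 M F T" and N: "N \<in> null_sets tm" and eq: "\<And>t \<omega>. t \<in> {0..T} - N \<Longrightarrow> q t \<omega> = u t \<omega>"
    and 0: "H2_sq M T u = 0"
  shows "pnorm M T q = 0"
proof -
  have "N \<in> null_sets lborel"
    using N unfolding time_measure_def by (subst (asm) null_sets_restrict_space) auto
  then have "AE t in lborel. t \<notin> N" by (rule AE_not_in)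
  then have "(\<integral>\<^sup>+t\<in>{0..T}. ennreal ((norm (q t \<omega>))\<^sup>2) \<partial>lborel) = (\<integral>\<^sup>+t\<in>{0..T}. ennreal ((norm (u t \<omega>))\<^sup>2) \<partial>lborel)" for \<omega>
  proof (intro nn_integral_cong_AE)
    show "AE t in lborel. ennreal ((norm (q t \<omega>))\<^sup>2) * indicator {0..T} t = ennreal ((norm (u t \<omega>))\<^sup>2) * indicator {0..T} t"
      using \<open>AE t in lborel. t \<notin> N\<close> by eventually_elim (auto simp: eq split: split_indicator)
  qed
  then have "H2_sq M T q = 0" using 0 by (simp add: H2_sq_def)
  moreover have "(\<lambda>(s, \<omega>). q s \<omega>) \<in> borel_measurable PM" by (rule pL2_measurable[OF adL2D(1)[OF H2_adL2[OF q]]])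
  ultimately show ?thesis using H2_norm_eq by (metis H2_norm_def enn2real_0 real_sqrt_zero)
qed

end

context monotone_system
begin

context
  fixes \<xi> A A' X X' Y Y' Z Z' f f' p p' q q' Yb Zb
  assumes S: "solution \<xi> A X Y Z f p q" and S': "solution \<xi> A' X' Y' Z' f' p' q'"
    and q'0: "pnorm M T q' = 0"
    and Yb: "itoproc Yb (\<lambda>t \<omega>. - q t \<omega>) Zb" and YbT: "AE \<omega> in M. Yb T \<omega> = 0"
begin

lemma solution_pL2: "q \<in> pL2 M T" "q' \<in> pL2 M T" "A \<in> pL2 M T" "A' \<in> pL2 M T"
  using S S' H2_adL2 adL2D(1) unfolding solution_def by blast+

lemma q_bound: "pnorm M T q \<le> c\<Psi> * pnorm M T (\<lambda>s \<omega>. A s \<omega> - A' s \<omega>)"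
  using pnorm_triangle[OF pL2_diff[OF solution_pL2(1,2)] solution_pL2(2)] \<Psi>_bound[OF S S'] q'0 by simp

text \<open>Backward stability against the zero process with \<open>L = 0\<close>: the drift
  \<open>- q\<close> is a pure source and the terminal value vanishes.\<close>

lemma adjoint_bound:
  "pnorm M T Yb \<le> stab 0 * (c\<Psi> * pnorm M T (\<lambda>s \<omega>. A s \<omega> - A' s \<omega>))"
  "pnorm M T Zb \<le> stab 0 * (c\<Psi> * pnorm M T (\<lambda>s \<omega>. A s \<omega> - A' s \<omega>))"
proof -
  note r = l2n_time[OF solution_pL2(1)]
  have TT: "T \<in> {0..T}" using T_pos by simp
  have "l2n M (Yb T) = l2n M (\<lambda>_. 0 :: real^'k)"
    by (rule l2n_cong_AE[OF L2_rvD(1)[OF itoproc_L2[OF Yb TT]] _ YbT]) simp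
  then have 0: "l2n M (Yb T) = 0" by (simp add: l2n_def)
  have "AE s in tm. l2n M (\<lambda>\<omega>. - q s \<omega> - 0)
      \<le> 0 * (l2n M (\<lambda>\<omega>. Yb s \<omega> - 0) + l2n M (\<lambda>\<omega>. Zb s \<omega> - 0)) + l2n M (q s)"
    by (simp add: l2n_uminus)
  from backward_stability[OF Yb itoproc_zero order_refl r(1) this]
  have "pnorm M T Yb \<le> stab 0 * pnorm M T q" "pnorm M T Zb \<le> stab 0 * pnorm M T q"
    unfolding r(2) by (simp_all add: 0)
  moreover have "stab 0 * pnorm M T q \<le> stab 0 * (c\<Psi> * pnorm M T (\<lambda>s \<omega>. A s \<omega> - A' s \<omega>))"
    using stab_ge(4)[of 0] by (intro mult_left_mono q_bound) auto
  ultimately show "pnorm M T Yb \<le> stab 0 * (c\<Psi> * pnorm M T (\<lambda>s \<omega>. A s \<omega> - A' s \<omega>))"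
    "pnorm M T Zb \<le> stab 0 * (c\<Psi> * pnorm M T (\<lambda>s \<omega>. A s \<omega> - A' s \<omega>))" by auto
qed

text \<open>Testing the fast equation against an absolutely continuous process \<open>a\<close> with the same initial value
  trades the singular drift of \<open>A\<close> for \<open>a'\<close>: the term \<open>- \<parallel>Yb\<parallel>\<^sup>2 / e\<close> absorbs \<open>\<langle>Yb, a'\<rangle>\<close>.\<close>

lemma control_bound:
  fixes \<Gamma> :: "real^'m^'k"
  assumes e: "0 < e" and A: "itoproc (\<lambda>t \<omega>. e *\<^sub>R A t \<omega>) (\<lambda>t \<omega>. - Yb t \<omega>) (\<lambda>t \<omega>. \<beta> *\<^sub>R \<Gamma>)"
    and a: "itoproc a a' (\<lambda>_ _. 0)" and start: "AE \<omega> in M. A 0 \<omega> = a 0 \<omega>"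
  shows "pnorm M T (\<lambda>s \<omega>. A s \<omega> - A' s \<omega>)
    \<le> c\<Psi> * (stab 0 * pnorm M T (\<lambda>_ _. \<Gamma>) * \<bar>\<beta> / e\<bar> + pnorm M T (\<lambda>s \<omega>. a s \<omega> - A' s \<omega>)) / lam
      + sqrt (e * (pnorm M T a')\<^sup>2 / (4 * lam))"
proof -
  have TT: "T \<in> {0..T}" and TT': "T \<le> T" and T0: "0 \<in> {0..T}" using T_pos by auto
  let ?D = "pnorm M T (\<lambda>s \<omega>. A s \<omega> - A' s \<omega>)" and ?\<delta> = "pnorm M T (\<lambda>s \<omega>. a s \<omega> - A' s \<omega>)"
  let ?\<Gamma> = "\<lambda>(_::real) (_::'w). \<Gamma>"
  have pa: "a \<in> pL2 M T" "a' \<in> pL2 M T" "Yb \<in> pL2 M T" using a Yb by (auto simp: itoproc_def adL2D(1))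
  note pq = solution_pL2
  have pZ: "Zb \<in> pL2 M T" by (rule itoproc_diffusion_pL2[OF Yb])
  have p\<Gamma>: "?\<Gamma> \<in> pL2 M T" by (intro pL2_const_time L2_rv_const)
  have z: "(\<integral>\<omega>. Yb T \<omega> \<bullet> v \<omega> \<partial>M) = 0" if "v \<in> L2_rv M M" for v
  proof -
    have "(\<integral>\<omega>. Yb T \<omega> \<bullet> v \<omega> \<partial>M) = (\<integral>\<omega>. 0 \<partial>M)"
    proof (rule integral_cong_AE)
      show "(\<lambda>\<omega>. Yb T \<omega> \<bullet> v \<omega>) \<in> borel_measurable M"
        by (rule borel_measurable_integrable[OF L2_inner_integrable[OF itoproc_L2[OF Yb TT] that]])
      show "AE \<omega> in M. Yb T \<omega> \<bullet> v \<omega> = 0" using YbT by eventually_elim simp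
    qed simp
    then show ?thesis by simp
  qed
  have s0: "(\<integral>\<omega>. Yb 0 \<omega> \<bullet> (e *\<^sub>R A 0 \<omega>) \<partial>M) = e * (\<integral>\<omega>. Yb 0 \<omega> \<bullet> a 0 \<omega> \<partial>M)"
  proof -
    have "(\<integral>\<omega>. Yb 0 \<omega> \<bullet> (e *\<^sub>R A 0 \<omega>) \<partial>M) = (\<integral>\<omega>. e * (Yb 0 \<omega> \<bullet> a 0 \<omega>) \<partial>M)"
    proof (rule integral_cong_AE)
      show "(\<lambda>\<omega>. Yb 0 \<omega> \<bullet> (e *\<^sub>R A 0 \<omega>)) \<in> borel_measurable M"
        by (rule borel_measurable_integrable[OF L2_inner_integrable[OF itoproc_L2[OF Yb T0] itoproc_L2[OF A T0]]])
      show "(\<lambda>\<omega>. e * (Yb 0 \<omega> \<bullet> a 0 \<omega>)) \<in> borel_measurable M"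
        using borel_measurable_integrable[OF L2_inner_integrable[OF itoproc_L2[OF Yb T0] itoproc_L2[OF a T0]]] by simp
      show "AE \<omega> in M. Yb 0 \<omega> \<bullet> (e *\<^sub>R A 0 \<omega>) = e * (Yb 0 \<omega> \<bullet> a 0 \<omega>)" using start by eventually_elim simp
    qed
    then show ?thesis by simp
  qed
  \<comment> \<open>Product formula for \<open>Yb\<close> and \<open>e A\<close>: the terminal value
    of \<open>Yb\<close> makes the left-hand side 0, and the drift \<open>- Yb\<close> of
    \<open>e A\<close> produces the squared norm.\<close>
  have "0 = e * (\<integral>\<omega>. Yb 0 \<omega> \<bullet> a 0 \<omega> \<partial>M) - e * ip M T q A - (pnorm M T Yb)\<^sup>2 + \<beta> * ip M T Zb ?\<Gamma>"
    using ito_product[OF Yb A TT] s0 z[OF itoproc_L2[OF A TT]]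
    by (auto simp: ip_uminus_left ip_uminus_right ip_scaleR_right ip_self[OF pa(3)])
  \<comment> \<open>The process \<open>a\<close> shares the start of \<open>A\<close>, so its
    identity, scaled by \<open>e\<close>, cancels the unknown initial term.\<close>
  moreover have "0 = (\<integral>\<omega>. Yb 0 \<omega> \<bullet> a 0 \<omega> \<partial>M) - ip M T q a + ip M T Yb a'"
    using ito_product[OF Yb a TT] z[OF itoproc_L2[OF a TT]] by (simp add: ip_uminus_left ip_def[of M T Zb])
  then have "0 = e * ((\<integral>\<omega>. Yb 0 \<omega> \<bullet> a 0 \<omega> \<partial>M) - ip M T q a + ip M T Yb a')" by simp
  ultimately have "e * (ip M T q A - ip M T q a) = \<beta> * ip M T Zb ?\<Gamma> - (pnorm M T Yb)\<^sup>2 - e * ip M T Yb a'"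
    by (simp add: algebra_simps)
  then have qA: "ip M T q A - ip M T q a = \<beta> / e * ip M T Zb ?\<Gamma> - (pnorm M T Yb)\<^sup>2 / e - ip M T Yb a'"
    using e by (simp add: field_simps)
  \<comment> \<open>Young's inequality with weight \<open>e\<close> uses up the whole singular
    term.\<close>
  have "- ((pnorm M T Yb)\<^sup>2 / e) - ip M T Yb a' \<le> e * (pnorm M T a')\<^sup>2 / 4"
  proof -
    have "- ip M T Yb a' \<le> pnorm M T Yb * pnorm M T a'" using ip_Cauchy_Schwarz[OF pa(3,2) TT'] by simp
    also have "\<dots> \<le> (pnorm M T Yb)\<^sup>2 / e + e * (pnorm M T a')\<^sup>2 / 4"
      using sum_squares_bound[of "2 * pnorm M T Yb" "e * pnorm M T a'"] e
      by (simp add: field_simps power2_eq_square)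
    finally show ?thesis by simp
  qed
  moreover have "\<beta> / e * ip M T Zb ?\<Gamma> \<le> \<bar>\<beta> / e\<bar> * (stab 0 * (c\<Psi> * ?D) * pnorm M T ?\<Gamma>)"
  proof -
    have "\<bar>ip M T Zb ?\<Gamma>\<bar> \<le> stab 0 * (c\<Psi> * ?D) * pnorm M T ?\<Gamma>"
      by (rule order_trans[OF ip_Cauchy_Schwarz[OF pZ p\<Gamma> TT'] mult_right_mono[OF adjoint_bound(2)]]) simp
    then have "\<bar>\<beta> / e\<bar> * \<bar>ip M T Zb ?\<Gamma>\<bar> \<le> \<bar>\<beta> / e\<bar> * (stab 0 * (c\<Psi> * ?D) * pnorm M T ?\<Gamma>)"
      by (rule mult_left_mono) simp
    moreover have "\<beta> / e * ip M T Zb ?\<Gamma> \<le> \<bar>\<beta> / e\<bar> * \<bar>ip M T Zb ?\<Gamma>\<bar>" by (metis abs_ge_self abs_mult)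
    ultimately show ?thesis by linarith
  qed
  moreover have "ip M T q a - ip M T q A' \<le> c\<Psi> * ?D * ?\<delta>"
  proof -
    have "ip M T q a - ip M T q A' = ip M T q (\<lambda>s \<omega>. a s \<omega> - A' s \<omega>)"
      using ip_diff_right[OF pq(1) pa(1) pq(4) TT'] by simp
    also have "\<dots> \<le> pnorm M T q * ?\<delta>" using ip_Cauchy_Schwarz[OF pq(1) pL2_diff[OF pa(1) pq(4)] TT'] by simp
    also have "\<dots> \<le> c\<Psi> * ?D * ?\<delta>" by (rule mult_right_mono[OF q_bound]) simp
    finally show ?thesis .
  qed
  \<comment> \<open>Since \<open>q'\<close> has norm 0, the pairing from the monotone estimate is
    that of \<open>q\<close> alone; it is then split at \<open>a\<close>.\<close>
  moreover have "ip M T (\<lambda>s \<omega>. q s \<omega> - q' s \<omega>) (\<lambda>s \<omega>. A s \<omega> - A' s \<omega>) = ip M T q A - ip M T q A'"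
  proof -
    have "ip M T q' (\<lambda>s \<omega>. A s \<omega> - A' s \<omega>) = 0"
      using ip_Cauchy_Schwarz[OF pq(2) pL2_diff[OF pq(3,4)] TT'] q'0 by simp
    then show ?thesis
      using ip_diff_left[OF pq(1,2) pL2_diff[OF pq(3,4)] TT'] ip_diff_right[OF pq(1,3,4) TT'] by simp
  qed
  ultimately have "lam * ?D\<^sup>2 \<le> \<bar>\<beta> / e\<bar> * (stab 0 * (c\<Psi> * ?D) * pnorm M T ?\<Gamma>) + c\<Psi> * ?D * ?\<delta> + e * (pnorm M T a')\<^sup>2 / 4"
    using monotone_estimate[OF S S'] qA by linarith
  then have "?D\<^sup>2 \<le> c\<Psi> * (stab 0 * pnorm M T ?\<Gamma> * \<bar>\<beta> / e\<bar> + ?\<delta>) / lam * ?D + e * (pnorm M T a')\<^sup>2 / (4 * lam)"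
    using lam by (simp add: field_simps)
  then show ?thesis
    by (rule le_add_sqrt_if_square_le) (use e lam const_nonneg stab_ge(4)[of 0] in auto)
qed

end

end

section \<open>Assembling the estimates\<close>

lemma (in brownian_setting) pL2_Pair:
  fixes f :: "real \<Rightarrow> 'w \<Rightarrow> 'b::euclidean_space" and g :: "real \<Rightarrow> 'w \<Rightarrow> 'c::euclidean_space"
  assumes "f \<in> pL2 M T" "g \<in> pL2 M T"
  shows "(\<lambda>s \<omega>. (f s \<omega>, g s \<omega>)) \<in> pL2 M T"
    "pnorm M T (\<lambda>s \<omega>. (f s \<omega>, g s \<omega>)) \<le> pnorm M T f + pnorm M T g"
proof -
  have n: "(\<lambda>s \<omega>. norm (f s \<omega>)) \<in> pL2 M T" "(\<lambda>s \<omega>. norm (g s \<omega>)) \<in> pL2 M T"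
    using assms by (auto intro: pL2_norm)
  have s: "(\<lambda>(s, \<omega>). norm (f s \<omega>) + norm (g s \<omega>)) \<in> L2_rv PM PM" by (rule pL2D[OF pL2_add[OF n]])
  have le: "AE z in PM. norm (case z of (s, \<omega>) \<Rightarrow> (f s \<omega>, g s \<omega>)) \<le> norm (case z of (s, \<omega>) \<Rightarrow> norm (f s \<omega>) + norm (g s \<omega>))"
    by (auto intro!: AE_I2 norm_Pair_le[THEN order_trans] simp: split_beta)
  have "(\<lambda>z. (f (fst z) (snd z), g (fst z) (snd z))) \<in> borel_measurable PM"
    using borel_measurable_Pair[OF pL2_measurable[OF assms(1)] pL2_measurable[OF assms(2)]] by (simp add: case_prod_beta')
  then show "(\<lambda>s \<omega>. (f s \<omega>, g s \<omega>)) \<in> pL2 M T"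
    by (intro pL2I L2_rv_norm_le[OF _ s le]) (simp add: case_prod_beta')
  have "pnorm M T (\<lambda>s \<omega>. (f s \<omega>, g s \<omega>)) \<le> pnorm M T (\<lambda>s \<omega>. norm (f s \<omega>) + norm (g s \<omega>))"
    unfolding pnorm_def by (rule l2n_mono[OF s le])
  also have "\<dots> \<le> pnorm M T (\<lambda>s \<omega>. norm (f s \<omega>)) + pnorm M T (\<lambda>s \<omega>. norm (g s \<omega>))"
    by (rule pnorm_triangle[OF n])
  also have "\<dots> = pnorm M T f + pnorm M T g" by (simp add: pnorm_def l2n_def case_prod_beta')
  finally show "pnorm M T (\<lambda>s \<omega>. (f s \<omega>, g s \<omega>)) \<le> pnorm M T f + pnorm M T g" .
qed

context monotone_system
begin

definition c\<beta> :: "real^'m^'k \<Rightarrow> real" where "c\<beta> \<Gamma> = stab 0 * pnorm M T (\<lambda>_ _. \<Gamma>)"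

text \<open>A two-scale solution solves the uncoupled system driven by its own control
  \<open>A\<close>. It and the limit are thus two solutions with the same start
  \<open>\<xi>\<close>, and both error norms are multiples of the control difference
  \<open>D\<close>.\<close>

lemma two_scale_bounds:
  assumes hat: "stationary_solution M F W T b \<sigma> \<Phi> \<Psi> \<phi> \<xi> Xh Yh Zh \<alpha>h"
    and sol: "two_scale_system M F W T b \<sigma> \<Phi> \<Psi> \<phi> \<Gamma> \<xi> \<eta> e \<beta> X Y Z Yb Zb A" and e: "0 < e"
  defines "D \<equiv> pnorm M T (\<lambda>s \<omega>. A s \<omega> - \<alpha>h s \<omega>)"
  shows "itoproc a a' (\<lambda>_ _. 0) \<Longrightarrow> (\<And>\<omega>. a 0 \<omega> = \<eta> \<omega>) \<Longrightarrow>
      D \<le> c\<Psi> * (c\<beta> \<Gamma> * \<bar>\<beta> / e\<bar> + pnorm M T (\<lambda>s \<omega>. a s \<omega> - \<alpha>h s \<omega>)) / lam + sqrt (e * (pnorm M T a')\<^sup>2 / (4 * lam))"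
    "H2_norm M T (\<lambda>t \<omega>. (A t \<omega>, Y t \<omega>, Z t \<omega>, Yb t \<omega>, Zb t \<omega>) - (\<alpha>h t \<omega>, Yh t \<omega>, Zh t \<omega>, 0, 0))
      \<le> (1 + 2 * cY + 2 * (stab 0 * c\<Psi>)) * D"
    "S2_norm M T (\<lambda>t \<omega>. X t \<omega> - Xh t \<omega>) \<le> sqrt (2 * T + 8) * (2 * K * (cX + 1)) * D"
proof -
  have H: "\<alpha>h \<in> H2 M F T" "uncoupled_system M F W T b \<sigma> \<Phi> \<phi> \<xi> \<alpha>h Xh Yh Zh"
    "H2_sq M T (along_XYZA M \<Psi> Xh Yh Zh \<alpha>h) = 0"
    using hat by (auto simp: stationary_solution_def)
  obtain N' f' p' q' where S': "solution \<xi> \<alpha>h Xh Yh Zh f' p' q'" "N' \<in> null_sets tm"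
    "\<And>t \<omega>. t \<in> {0..T} - N' \<Longrightarrow> q' t \<omega> = along_XYZA M \<Psi> Xh Yh Zh \<alpha>h t \<omega>"
    by (rule solution_ex[OF H(2,1)]) blast
  have "q' \<in> H2 M F T" using S'(1) unfolding solution_def by blast
  then have q'0: "pnorm M T q' = 0" by (rule pnorm_eq_0_if_H2_sq[OF _ S'(2,3) H(3)])
  have U: "uncoupled_system M F W T b \<sigma> \<Phi> \<phi> \<xi> A X Y Z" and A: "A \<in> S2 M F T" "Yb \<in> S2 M F T"
    and dYb: "ito_differential M F W T Yb (\<lambda>t \<omega>. - along_XYZA M \<Psi> X Y Z A t \<omega>) Zb"
    and dA: "ito_differential M F W T (\<lambda>t \<omega>. e *\<^sub>R A t \<omega>) (\<lambda>t \<omega>. - Yb t \<omega>) (\<lambda>t \<omega>. \<beta> *\<^sub>R \<Gamma>)"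
    and end0: "AE \<omega> in M. Yb T \<omega> = 0" and A0: "AE \<omega> in M. A 0 \<omega> = \<eta> \<omega>"
    using sol by (auto simp: two_scale_system_def uncoupled_system_def)
  obtain N f p q where S: "solution \<xi> A X Y Z f p q" "N \<in> null_sets tm"
    "\<And>t \<omega>. t \<in> {0..T} - N \<Longrightarrow> q t \<omega> = along_XYZA M \<Psi> X Y Z A t \<omega>"
    by (rule solution_ex[OF U S2_adL2(1)[OF A(1)]]) blast
  have q: "q \<in> H2 M F T" using S(1) unfolding solution_def by blast
  have Yb: "itoproc Yb (\<lambda>t \<omega>. - q t \<omega>) Zb"
    by (rule itoproc_if_S2[OF dYb A(2) H2_uminus[OF q] S(2)]) (simp add: S(3))
  have eA: "itoproc (\<lambda>t \<omega>. e *\<^sub>R A t \<omega>) (\<lambda>t \<omega>. - Yb t \<omega>) (\<lambda>t \<omega>. \<beta> *\<^sub>R \<Gamma>)"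
  proof (rule itoproc_if_differential[OF dA _ _ _ H2_uminus[OF S2_adL2(1)[OF A(2)]]])
    have 0: "0 \<in> {0..T}" using T_pos by simp
    show "(\<lambda>t \<omega>. e *\<^sub>R A t \<omega>) \<in> pL2 M T" by (rule pL2_scaleR[OF adL2D(1)[OF S2_adL2(2)[OF A(1)]]])
    show "(\<lambda>\<omega>. e *\<^sub>R A 0 \<omega>) \<in> L2_rv M M" by (rule L2_rv_scaleR[OF S2_adL2(3)[OF A(1) 0]])
    show "(\<lambda>\<omega>. e *\<^sub>R A 0 \<omega>) \<in> borel_measurable (F 0)" using S2_adL2(4)[OF A(1) 0] by measurable
  qed auto
  note AB = adjoint_bound[OF S(1) S'(1) q'0 Yb end0, folded D_def]
  show "D \<le> c\<Psi> * (c\<beta> \<Gamma> * \<bar>\<beta> / e\<bar> + pnorm M T (\<lambda>s \<omega>. a s \<omega> - \<alpha>h s \<omega>)) / lam + sqrt (e * (pnorm M T a')\<^sup>2 / (4 * lam))"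
    if a: "itoproc a a' (\<lambda>_ _. 0)" "\<And>\<omega>. a 0 \<omega> = \<eta> \<omega>"
    unfolding D_def c\<beta>_def by (rule control_bound[OF S(1) S'(1) q'0 Yb end0 e eA a(1)]) (simp add: a(2) A0)
  show "S2_norm M T (\<lambda>t \<omega>. X t \<omega> - Xh t \<omega>) \<le> sqrt (2 * T + 8) * (2 * K * (cX + 1)) * D"
    unfolding D_def by (rule S2_bound[OF S(1) S'(1)])
  note d = diff_pL2(4,2,3)[OF S(1) S'(1)]
  note y = S2_adL2(2)[OF A(2), THEN adL2D(1)] itoproc_diffusion_pL2[OF Yb]
  note P3 = pL2_Pair[OF y] note P2' = pL2_Pair[OF d(3) P3(1)] note P1' = pL2_Pair[OF d(2) P2'(1)] note P0 = pL2_Pair[OF d(1) P1'(1)]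
  have "H2_norm M T (\<lambda>t \<omega>. (A t \<omega>, Y t \<omega>, Z t \<omega>, Yb t \<omega>, Zb t \<omega>) - (\<alpha>h t \<omega>, Yh t \<omega>, Zh t \<omega>, 0, 0))
      = pnorm M T (\<lambda>t \<omega>. (A t \<omega> - \<alpha>h t \<omega>, Y t \<omega> - Yh t \<omega>, Z t \<omega> - Zh t \<omega>, Yb t \<omega>, Zb t \<omega>))"
    using H2_norm_eq[OF pL2_measurable[OF P0(1)]] by simp
  also have "\<dots> \<le> D + cY * D + cY * D + stab 0 * (c\<Psi> * D) + stab 0 * (c\<Psi> * D)"
    using P0(2) P1'(2) P2'(2) P3(2) AB YZ_bound[OF S(1) S'(1)] unfolding D_def by linarith
  finally show "H2_norm M T (\<lambda>t \<omega>. (A t \<omega>, Y t \<omega>, Z t \<omega>, Yb t \<omega>, Zb t \<omega>) - (\<alpha>h t \<omega>, Yh t \<omega>, Zh t \<omega>, 0, 0))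
      \<le> (1 + 2 * cY + 2 * (stab 0 * c\<Psi>)) * D"
    by (simp add: algebra_simps)
qed

theorem two_scale_convergence:
  assumes \<eta>: "\<eta> \<in> L2_rv M M" "\<eta> \<in> borel_measurable (F 0)" and \<beta>: "\<beta> \<in> o[at_right 0](\<lambda>\<epsilon>. \<epsilon>)"
    and hat: "stationary_solution M F W T b \<sigma> \<Phi> \<Psi> \<phi> \<xi> Xh Yh Zh \<alpha>h"
    and sol: "\<And>\<epsilon>. 0 < \<epsilon> \<Longrightarrow> two_scale_system M F W T b \<sigma> \<Phi> \<Psi> \<phi> \<Gamma> \<xi> \<eta> \<epsilon> (\<beta> \<epsilon>)
                (X \<epsilon>) (Y \<epsilon>) (Z \<epsilon>) (Yb \<epsilon>) (Zb \<epsilon>) (A \<epsilon>)"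
  shows "((\<lambda>\<epsilon>. H2_norm M T (\<lambda>t \<omega>. (A \<epsilon> t \<omega>, Y \<epsilon> t \<omega>, Z \<epsilon> t \<omega>, Yb \<epsilon> t \<omega>, Zb \<epsilon> t \<omega>)
            - (\<alpha>h t \<omega>, Yh t \<omega>, Zh t \<omega>, 0, 0))) \<longlongrightarrow> 0) (at_right 0)"
    "((\<lambda>\<epsilon>. S2_norm M T (\<lambda>t \<omega>. X \<epsilon> t \<omega> - Xh t \<omega>)) \<longlongrightarrow> 0) (at_right 0)"
proof -
  define D where "D \<epsilon> = pnorm M T (\<lambda>s \<omega>. A \<epsilon> s \<omega> - \<alpha>h s \<omega>)" for \<epsilon>
  note bounds = two_scale_bounds[OF hat sol, folded D_def]
  have pos: "\<forall>\<^sub>F \<epsilon> in at_right 0. 0 < (\<epsilon> :: real)" by (rule eventually_at_right_less)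
  have \<alpha>: "\<alpha>h \<in> adL2 M F T" using hat by (auto simp: stationary_solution_def H2_adL2)
  have "((\<lambda>\<epsilon>. \<beta> \<epsilon> / \<epsilon>) \<longlongrightarrow> 0) (at_right 0)" by (rule smalloD_tendsto[OF \<beta>])
  then have \<beta>0: "((\<lambda>\<epsilon>. \<bar>\<beta> \<epsilon> / \<epsilon>\<bar>) \<longlongrightarrow> 0) (at_right 0)" by (rule tendsto_rabs_zero)
  have D0: "(D \<longlongrightarrow> 0) (at_right 0)"
  proof (rule order_tendstoI)
    show "\<forall>\<^sub>F \<epsilon> in at_right 0. r < D \<epsilon>" if "r < 0" for r
      using that by (intro always_eventually) (auto simp: D_def intro: less_le_trans)
    fix r :: real assume r: "0 < r"
    \<comment> \<open>Chosen so that \<open>c\<Psi> * \<delta> / lam\<close> lies strictly below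
      \<open>r\<close>; the summand 1 in the denominator covers \<open>c\<Psi> = 0\<close>.\<close>
    define \<delta> where "\<delta> = lam * r / (c\<Psi> + 1)"
    have c: "0 < c\<Psi> + 1" using const_nonneg(3) by simp
    have \<delta>: "0 < \<delta>" using lam r c by (simp add: \<delta>_def)
    obtain a a' where a: "itoproc a a' (\<lambda>_ _. 0)" "\<And>\<omega>. a 0 \<omega> = \<eta> \<omega>" "pnorm M T (\<lambda>s \<omega>. a s \<omega> - \<alpha>h s \<omega>) < \<delta>"
      by (rule test_process[OF \<alpha> \<eta> \<delta>]) blast
    let ?\<delta>' = "pnorm M T (\<lambda>s \<omega>. a s \<omega> - \<alpha>h s \<omega>)"
    let ?h = "\<lambda>\<epsilon>. c\<Psi> * (c\<beta> \<Gamma> * \<bar>\<beta> \<epsilon> / \<epsilon>\<bar> + ?\<delta>') / lam + sqrt (\<epsilon> * (pnorm M T a')\<^sup>2 / (4 * lam))"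
    \<comment> \<open>The process \<open>a\<close> and its derivative are fixed by now, so the
      square root vanishes with \<open>\<epsilon>\<close> however large \<open>a'\<close>
      is.\<close>
    have "(?h \<longlongrightarrow> c\<Psi> * (c\<beta> \<Gamma> * 0 + ?\<delta>') / lam + sqrt (0 * (pnorm M T a')\<^sup>2 / (4 * lam))) (at_right 0)"
      using lam by (intro tendsto_intros \<beta>0) auto
    moreover have "c\<Psi> * (c\<beta> \<Gamma> * 0 + ?\<delta>') / lam + sqrt (0 * (pnorm M T a')\<^sup>2 / (4 * lam)) < r"
    proof -
      have "c\<Psi> * ?\<delta>' \<le> c\<Psi> * \<delta>" using a(3) const_nonneg(3) by (intro mult_left_mono) auto
      also have "\<dots> < (c\<Psi> + 1) * \<delta>" using \<delta> by simp
      also have "\<dots> = lam * r" using c by (simp add: \<delta>_def)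
      finally show ?thesis using lam by (simp add: divide_less_eq mult.commute)
    qed
    ultimately have "\<forall>\<^sub>F \<epsilon> in at_right 0. ?h \<epsilon> < r" by (rule order_tendstoD(2))
    then show "\<forall>\<^sub>F \<epsilon> in at_right 0. D \<epsilon> < r"
      using pos
    proof eventually_elim
      case (elim \<epsilon>)
      then show ?case using bounds(1)[OF elim(2,2) a(1,2)] by simp
    qed
  qed
  have squeeze: "(g \<longlongrightarrow> 0) (at_right 0)"
    if g: "\<And>\<epsilon>. 0 < \<epsilon> \<Longrightarrow> g \<epsilon> \<le> C * D \<epsilon>" "\<And>\<epsilon>. 0 \<le> g \<epsilon>" for g :: "real \<Rightarrow> real" and C
  proof (rule Lim_null_comparison)
    show "\<forall>\<^sub>F \<epsilon> in at_right 0. norm (g \<epsilon>) \<le> C * D \<epsilon>" using pos by eventually_elim (simp add: g)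
    show "((\<lambda>\<epsilon>. C * D \<epsilon>) \<longlongrightarrow> 0) (at_right 0)" using tendsto_mult_left[OF D0, of C] by simp
  qed
  show "((\<lambda>\<epsilon>. H2_norm M T (\<lambda>t \<omega>. (A \<epsilon> t \<omega>, Y \<epsilon> t \<omega>, Z \<epsilon> t \<omega>, Yb \<epsilon> t \<omega>, Zb \<epsilon> t \<omega>)
            - (\<alpha>h t \<omega>, Yh t \<omega>, Zh t \<omega>, 0, 0))) \<longlongrightarrow> 0) (at_right 0)"
    by (rule squeeze[OF bounds(2)]) (simp_all add: H2_norm_def)
  show "((\<lambda>\<epsilon>. S2_norm M T (\<lambda>t \<omega>. X \<epsilon> t \<omega> - Xh t \<omega>)) \<longlongrightarrow> 0) (at_right 0)"
    by (rule squeeze[OF bounds(3)]) (simp_all add: S2_norm_def)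
qed

end

section \<open>Reduction of the stated assumptions to common constants\<close>

lemma forward_lipschitz_mono:
  fixes h :: "('w, 'd::finite, 'k::finite, 'e::euclidean_space) forward_coeff"
  assumes "forward_lipschitz M T K h" "K \<le> K'"
  shows "forward_lipschitz M T K' h"
  unfolding forward_lipschitz_def
proof (intro ballI allI)
  fix t \<omega> and x x' :: "real^'d" and a a' :: "real^'k" and \<mu> \<mu>' :: "(real^'d) measure" and \<nu> \<nu>' :: "(real^'k) measure"
  assume *: "t \<in> {0..T}" "\<omega> \<in> space M" "\<mu> \<in> P2" "\<mu>' \<in> P2" "\<nu> \<in> P2" "\<nu>' \<in> P2"
  have "norm (h t \<omega> x \<mu> a \<nu> - h t \<omega> x' \<mu>' a' \<nu>') \<le> K * (norm (x - x') + W2 \<mu> \<mu>' + norm (a - a') + W2 \<nu> \<nu>')"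
    by (rule bspec[OF bspec[OF assms(1)[unfolded forward_lipschitz_def] *(1)] *(2), rule_format]) (fact *)+
  also have "\<dots> \<le> K' * (norm (x - x') + W2 \<mu> \<mu>' + norm (a - a') + W2 \<nu> \<nu>')"
    by (rule mult_right_mono[OF assms(2)]) (simp add: W2_nonneg)
  finally show "norm (h t \<omega> x \<mu> a \<nu> - h t \<omega> x' \<mu>' a' \<nu>')
    \<le> K' * (norm (x - x') + W2 \<mu> \<mu>' + norm (a - a') + W2 \<nu> \<nu>')" .
qed

theorem theorem2p10:
  fixes M G :: "'w measure"
    and W :: "real \<Rightarrow> 'w \<Rightarrow> real^'m"
    and F :: "real \<Rightarrow> 'w measure"
    and T :: real
    and b :: "('w, 'd::finite, 'k::finite, real^'d) forward_coeff"
    and \<sigma> :: "('w, 'd, 'k, real^'m^'d) forward_coeff"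
    and \<Phi> :: "('d, 'k, 'm, real^'d) backward_coeff"
    and \<Psi> :: "('d, 'k, 'm, real^'k) backward_coeff"
    and \<phi> :: "real^'d \<Rightarrow> (real^'d) measure \<Rightarrow> real^'d"
    and \<xi> :: "'w \<Rightarrow> real^'d"
    and \<eta> :: "'w \<Rightarrow> real^'k"
    and \<Gamma> :: "real^'m^'k"
    and \<beta> :: "real \<Rightarrow> real"
    and Xhat Yhat :: "real \<Rightarrow> 'w \<Rightarrow> real^'d"
    and Zhat :: "real \<Rightarrow> 'w \<Rightarrow> real^'m^'d"
    and \<alpha>hat :: "real \<Rightarrow> 'w \<Rightarrow> real^'k"
    and X Y :: "real \<Rightarrow> real \<Rightarrow> 'w \<Rightarrow> real^'d"
    and Z :: "real \<Rightarrow> real \<Rightarrow> 'w \<Rightarrow> real^'m^'d"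
    and Ybar A :: "real \<Rightarrow> real \<Rightarrow> 'w \<Rightarrow> real^'k"
    and Zbar :: "real \<Rightarrow> real \<Rightarrow> 'w \<Rightarrow> real^'m^'k"
  assumes setting: "brownian_setting M G W F T"
    and A: "assumption_A M F T b \<sigma>"
    and C: "assumption_C M T b \<sigma> \<Phi> \<Psi> \<phi>"
    and D: "assumption_D M G F W T b \<sigma> \<Phi> \<Psi> \<phi>"
    and \<xi>: "\<xi> \<in> L2_rv M G"
    and \<eta>: "\<eta> \<in> L2_rv M G"
    and \<beta>: "\<beta> \<in> o[at_right 0](\<lambda>\<epsilon>. \<epsilon>)"
    and hat: "stationary_solution M F W T b \<sigma> \<Phi> \<Psi> \<phi> \<xi> Xhat Yhat Zhat \<alpha>hat"
    and sol: "\<And>\<epsilon>. 0 < \<epsilon> \<Longrightarrow> two_scale_system M F W T b \<sigma> \<Phi> \<Psi> \<phi> \<Gamma> \<xi> \<eta> \<epsilon> (\<beta> \<epsilon>)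
                (X \<epsilon>) (Y \<epsilon>) (Z \<epsilon>) (Ybar \<epsilon>) (Zbar \<epsilon>) (A \<epsilon>)"
  shows "((\<lambda>\<epsilon>. H2_norm M T (\<lambda>t \<omega>.
              (A \<epsilon> t \<omega>, Y \<epsilon> t \<omega>, Z \<epsilon> t \<omega>, Ybar \<epsilon> t \<omega>, Zbar \<epsilon> t \<omega>)
                - (\<alpha>hat t \<omega>, Yhat t \<omega>, Zhat t \<omega>, 0, 0))) \<longlongrightarrow> 0) (at_right 0)
       \<and> ((\<lambda>\<epsilon>. S2_norm M T (\<lambda>t \<omega>. X \<epsilon> t \<omega> - Xhat t \<omega>)) \<longlongrightarrow> 0) (at_right 0)"
proof -
  interpret brownian_setting M G W F T by (rule setting)
  obtain K1 where K1: "0 < K1"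
    "\<And>t \<omega> x a \<mu> \<nu>. t \<in> {0..T} \<Longrightarrow> \<omega> \<in> space M \<Longrightarrow> \<mu> \<in> P2 \<Longrightarrow> \<nu> \<in> P2
      \<Longrightarrow> norm (b t \<omega> x \<mu> a \<nu>) + norm (\<sigma> t \<omega> x \<mu> a \<nu>) \<le> K1 * (1 + norm x + norm2 \<mu> + norm a + norm2 \<nu>)"
    "forward_lipschitz M T K1 b" "forward_lipschitz M T K1 \<sigma>"
    using A unfolding assumption_A_def by blast
  have C': "backward_growth T \<Phi> \<Psi> \<phi>" "backward_lipschitz T \<Phi> \<Psi> \<phi>" "monotonicity M T b \<sigma> \<Phi> \<Psi>"
    "terminal_monotonicity M \<phi>" "backward_measurable T \<Phi>" "backward_measurable T \<Psi>"
    using C unfolding assumption_C_def by blast+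
  obtain K2 where K2: "0 < K2"
    "\<And>t x y z a \<mu> \<pi>. t \<in> {0..T} \<Longrightarrow> \<mu> \<in> P2 \<Longrightarrow> \<pi> \<in> P2
      \<Longrightarrow> norm (\<Phi> t x y z a \<pi>) + norm (\<Psi> t x y z a \<pi>) + norm (\<phi> x \<mu>)
        \<le> K2 * (1 + norm x + norm2 \<mu> + norm y + norm z + norm a + norm2 \<pi>)"
    using C'(1) unfolding backward_growth_def by blast
  obtain K3 where K3: "0 < K3" and "\<forall>t\<in>{0..T}. \<forall>x x' y y' z z' a a'. \<forall>\<mu>\<in>P2. \<forall>\<mu>'\<in>P2. \<forall>\<pi>\<in>P2. \<forall>\<pi>'\<in>P2.
        norm (\<Phi> t x y z a \<pi> - \<Phi> t x' y' z' a' \<pi>') + norm (\<Psi> t x y z a \<pi> - \<Psi> t x' y' z' a' \<pi>')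
            + norm (\<phi> x \<mu> - \<phi> x' \<mu>')
          \<le> K3 * (norm (x - x') + W2 \<mu> \<mu>' + norm (y - y') + norm (z - z') + norm (a - a') + W2 \<pi> \<pi>')"
    using C'(2) unfolding backward_lipschitz_def by (elim exE conjE)
  note K3 = K3 this(2)[rule_format]
  obtain c where c: "0 < c" and mono: "\<forall>t\<in>{0..T}.
        \<forall>\<zeta>\<^sub>1\<in>L2_rv M M. \<forall>\<zeta>\<^sub>1'\<in>L2_rv M M. \<forall>\<upsilon>\<in>L2_rv M M. \<forall>\<upsilon>'\<in>L2_rv M M.
        \<forall>\<theta>\<in>L2_rv M M. \<forall>\<theta>'\<in>L2_rv M M. \<forall>\<zeta>\<in>L2_rv M M. \<forall>\<zeta>'\<in>L2_rv M M.
          (let \<pi> = law M (\<lambda>\<omega>. (\<zeta>\<^sub>1 \<omega>, \<upsilon> \<omega>, \<zeta> \<omega>, \<theta> \<omega>));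
               \<pi>' = law M (\<lambda>\<omega>. (\<zeta>\<^sub>1' \<omega>, \<upsilon>' \<omega>, \<zeta>' \<omega>, \<theta>' \<omega>))
           in
             (\<integral>\<omega>. (b t \<omega> (\<zeta>\<^sub>1 \<omega>) (law M \<zeta>\<^sub>1) (\<theta> \<omega>) (law M \<theta>)
                   - b t \<omega> (\<zeta>\<^sub>1' \<omega>) (law M \<zeta>\<^sub>1') (\<theta>' \<omega>) (law M \<theta>')) \<bullet> (\<upsilon> \<omega> - \<upsilon>' \<omega>) \<partial>M)
           + (\<integral>\<omega>. trace ((\<sigma> t \<omega> (\<zeta>\<^sub>1 \<omega>) (law M \<zeta>\<^sub>1) (\<theta> \<omega>) (law M \<theta>)
                   - \<sigma> t \<omega> (\<zeta>\<^sub>1' \<omega>) (law M \<zeta>\<^sub>1') (\<theta>' \<omega>) (law M \<theta>')) ** transpose (\<zeta> \<omega> - \<zeta>' \<omega>)) \<partial>M)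
           - (\<integral>\<omega>. (\<Phi> t (\<zeta>\<^sub>1 \<omega>) (\<upsilon> \<omega>) (\<zeta> \<omega>) (\<theta> \<omega>) \<pi>
                   - \<Phi> t (\<zeta>\<^sub>1' \<omega>) (\<upsilon>' \<omega>) (\<zeta>' \<omega>) (\<theta>' \<omega>) \<pi>') \<bullet> (\<zeta>\<^sub>1 \<omega> - \<zeta>\<^sub>1' \<omega>) \<partial>M)
           - (\<integral>\<omega>. (\<Psi> t (\<zeta>\<^sub>1 \<omega>) (\<upsilon> \<omega>) (\<zeta> \<omega>) (\<theta> \<omega>) \<pi>
                   - \<Psi> t (\<zeta>\<^sub>1' \<omega>) (\<upsilon>' \<omega>) (\<zeta>' \<omega>) (\<theta>' \<omega>) \<pi>') \<bullet> (\<theta> \<omega> - \<theta>' \<omega>) \<partial>M)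
           \<le> - c * (\<integral>\<omega>. (norm (\<theta> \<omega> - \<theta>' \<omega>))\<^sup>2 \<partial>M))"
    using C'(3) unfolding monotonicity_def by (elim exE conjE)
  \<comment> \<open>Growth and Lipschitz bounds survive a larger constant because the factors it
    multiplies are nonnegative.\<close>
  define K where "K = max K1 (max K2 K3)"
  have K: "0 < K" "K1 \<le> K" "K2 \<le> K" "K3 \<le> K" using K1(1) by (auto simp: K_def)
  have n2: "0 \<le> norm2 \<mu>" for \<mu> :: "'z::euclidean_space measure" by (simp add: norm2_def)
  interpret monotone_system M G W F T b \<sigma> \<Phi> \<Psi> \<phi> K c
  proof unfold_locales
    show "0 < K" "0 < c" by (fact K(1) c)+
    show "forward_measurable M F T b" using A unfolding assumption_A_def by blast
    show "backward_measurable T \<Phi>" "backward_measurable T \<Psi>" "terminal_monotonicity M \<phi>" by (fact C')+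
    show "forward_lipschitz M T K b" "forward_lipschitz M T K \<sigma>"
      using K1(3,4)[THEN forward_lipschitz_mono[OF _ K(2)]] by auto
    show "norm (b t \<omega> x \<mu> a \<nu>) \<le> K * (1 + norm x + norm2 \<mu> + norm a + norm2 \<nu>)"
      if "t \<in> {0..T}" "\<omega> \<in> space M" "\<mu> \<in> P2" "\<nu> \<in> P2" for t \<omega> x a \<mu> \<nu>
    proof -
      have "norm (b t \<omega> x \<mu> a \<nu>) \<le> K1 * (1 + norm x + norm2 \<mu> + norm a + norm2 \<nu>)"
        using K1(2)[OF that, of x a] norm_ge_zero[of "\<sigma> t \<omega> x \<mu> a \<nu>"] by linarith
      also have "\<dots> \<le> K * (1 + norm x + norm2 \<mu> + norm a + norm2 \<nu>)" by (rule mult_right_mono[OF K(2)]) (simp add: n2)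
      finally show ?thesis .
    qed
    \<comment> \<open>The joint growth bound is evaluated with \<open>\<mu>\<close> the law of 0,
      whose \<open>norm2\<close> is 0, which removes \<open>\<mu>\<close> from the right-hand
      side.\<close>
    have growth: "norm (\<Phi> t x y z a \<pi>) + norm (\<Psi> t x y z a \<pi>) \<le> K * (1 + norm x + norm y + norm z + norm a + norm2 \<pi>)"
      if "t \<in> {0..T}" "\<pi> \<in> P2" for t x y z a \<pi>
    proof -
      have "norm (\<Phi> t x y z a \<pi>) + norm (\<Psi> t x y z a \<pi>) \<le> K2 * (1 + norm x + norm y + norm z + norm a + norm2 \<pi>)"
        using K2(2)[OF that(1) law_P2[of "\<lambda>_. 0"] that(2), of x y z a] norm_ge_zero[of "\<phi> x (law M (\<lambda>_. 0))"]
        unfolding norm2_law_zero add_0_right by linarith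
      also have "\<dots> \<le> K * (1 + norm x + norm y + norm z + norm a + norm2 \<pi>)" by (rule mult_right_mono[OF K(3)]) (simp add: n2)
      finally show ?thesis .
    qed
    show "norm (\<Phi> t x y z a \<pi>) \<le> K * (1 + norm x + norm y + norm z + norm a + norm2 \<pi>)"
      "norm (\<Psi> t x y z a \<pi>) \<le> K * (1 + norm x + norm y + norm z + norm a + norm2 \<pi>)"
      if "t \<in> {0..T}" "\<pi> \<in> P2" for t x y z a \<pi>
      using growth[OF that, of x y z a] norm_ge_zero[of "\<Phi> t x y z a \<pi>"] norm_ge_zero[of "\<Psi> t x y z a \<pi>"] by linarith+
    have lip: "norm (\<Phi> t x y z a \<pi> - \<Phi> t x' y' z' a' \<pi>') + norm (\<Psi> t x y z a \<pi> - \<Psi> t x' y' z' a' \<pi>')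
            + norm (\<phi> x \<mu> - \<phi> x' \<mu>')
        \<le> K * (norm (x - x') + W2 \<mu> \<mu>' + norm (y - y') + norm (z - z') + norm (a - a') + W2 \<pi> \<pi>')"
      if "t \<in> {0..T}" "\<mu> \<in> P2" "\<mu>' \<in> P2" "\<pi> \<in> P2" "\<pi>' \<in> P2" for t x x' y y' z z' a a' \<mu> \<mu>' \<pi> \<pi>'
      by (rule order_trans[OF K3(2)[OF that] mult_right_mono[OF K(4)]]) (simp add: W2_nonneg)
    \<comment> \<open>Equal laws in the slot of \<open>\<phi>\<close> have distance 0, which leaves
      the separate bounds for \<open>\<Phi>\<close> and \<open>\<Psi>\<close>.\<close>
    show "norm (\<Phi> t x y z a \<pi> - \<Phi> t x' y' z' a' \<pi>')
        \<le> K * (norm (x - x') + norm (y - y') + norm (z - z') + norm (a - a') + W2 \<pi> \<pi>')"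
      "norm (\<Psi> t x y z a \<pi> - \<Psi> t x' y' z' a' \<pi>')
        \<le> K * (norm (x - x') + norm (y - y') + norm (z - z') + norm (a - a') + W2 \<pi> \<pi>')"
      if "t \<in> {0..T}" "\<pi> \<in> P2" "\<pi>' \<in> P2" for t x x' y y' z z' a a' \<pi> \<pi>'
      using lip[OF that(1) law_P2[of "\<lambda>_. 0"] law_P2[of "\<lambda>_. 0"] that(2,3), of x y z a x' y' z' a']
        norm_ge_zero[of "\<Phi> t x y z a \<pi> - \<Phi> t x' y' z' a' \<pi>'"] norm_ge_zero[of "\<Psi> t x y z a \<pi> - \<Psi> t x' y' z' a' \<pi>'"]
        norm_ge_zero[of "\<phi> x (law M (\<lambda>_. 0)) - \<phi> x' (law M (\<lambda>_. 0))"]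
      unfolding W2_self[OF law_P2] add_0_right by linarith+
    \<comment> \<open>Conversely \<open>\<phi>\<close> is isolated at time 0 with \<open>y\<close>,
      \<open>z\<close>, \<open>a\<close> and the joint law equal on both sides.\<close>
    show "norm (\<phi> x \<mu> - \<phi> x' \<mu>') \<le> K * (norm (x - x') + W2 \<mu> \<mu>')" if "\<mu> \<in> P2" "\<mu>' \<in> P2" for x x' \<mu> \<mu>'
      using lip[OF _ that law_P2[of "\<lambda>_. 0"] law_P2[of "\<lambda>_. 0"], of 0 x 0 0 0 x' 0 0 0] T_pos
      unfolding W2_self[OF law_P2] by (auto intro: order_trans[rotated])
  next
    fix t and \<zeta>\<^sub>1 \<zeta>\<^sub>1' \<upsilon> \<upsilon>' :: "'w \<Rightarrow> real^'d" and \<theta> \<theta>' :: "'w \<Rightarrow> real^'k" and \<zeta> \<zeta>' :: "'w \<Rightarrow> real^'m^'d"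
    assume L: "t \<in> {0..T}" "\<zeta>\<^sub>1 \<in> L2_rv M M" "\<zeta>\<^sub>1' \<in> L2_rv M M" "\<upsilon> \<in> L2_rv M M" "\<upsilon>' \<in> L2_rv M M"
      "\<theta> \<in> L2_rv M M" "\<theta>' \<in> L2_rv M M" "\<zeta> \<in> L2_rv M M" "\<zeta>' \<in> L2_rv M M"
    note bspec[OF bspec[OF bspec[OF bspec[OF bspec[OF bspec[OF bspec[OF bspec[OF bspec[OF mono L(1)] L(2)] L(3)] L(4)] L(5)] L(6)] L(7)] L(8)] L(9)]
    from this[unfolded Let_def trace_mult_transpose l2n_sq[symmetric]]
    show "(\<integral>\<omega>. (b t \<omega> (\<zeta>\<^sub>1 \<omega>) (law M \<zeta>\<^sub>1) (\<theta> \<omega>) (law M \<theta>) - b t \<omega> (\<zeta>\<^sub>1' \<omega>) (law M \<zeta>\<^sub>1') (\<theta>' \<omega>) (law M \<theta>'))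
          \<bullet> (\<upsilon> \<omega> - \<upsilon>' \<omega>) \<partial>M)
      + (\<integral>\<omega>. (\<sigma> t \<omega> (\<zeta>\<^sub>1 \<omega>) (law M \<zeta>\<^sub>1) (\<theta> \<omega>) (law M \<theta>) - \<sigma> t \<omega> (\<zeta>\<^sub>1' \<omega>) (law M \<zeta>\<^sub>1') (\<theta>' \<omega>) (law M \<theta>'))
          \<bullet> (\<zeta> \<omega> - \<zeta>' \<omega>) \<partial>M)
      - (\<integral>\<omega>. (\<Phi> t (\<zeta>\<^sub>1 \<omega>) (\<upsilon> \<omega>) (\<zeta> \<omega>) (\<theta> \<omega>) (law M (\<lambda>\<omega>. (\<zeta>\<^sub>1 \<omega>, \<upsilon> \<omega>, \<zeta> \<omega>, \<theta> \<omega>)))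
          - \<Phi> t (\<zeta>\<^sub>1' \<omega>) (\<upsilon>' \<omega>) (\<zeta>' \<omega>) (\<theta>' \<omega>) (law M (\<lambda>\<omega>. (\<zeta>\<^sub>1' \<omega>, \<upsilon>' \<omega>, \<zeta>' \<omega>, \<theta>' \<omega>)))) \<bullet> (\<zeta>\<^sub>1 \<omega> - \<zeta>\<^sub>1' \<omega>) \<partial>M)
      - (\<integral>\<omega>. (\<Psi> t (\<zeta>\<^sub>1 \<omega>) (\<upsilon> \<omega>) (\<zeta> \<omega>) (\<theta> \<omega>) (law M (\<lambda>\<omega>. (\<zeta>\<^sub>1 \<omega>, \<upsilon> \<omega>, \<zeta> \<omega>, \<theta> \<omega>)))
          - \<Psi> t (\<zeta>\<^sub>1' \<omega>) (\<upsilon>' \<omega>) (\<zeta>' \<omega>) (\<theta>' \<omega>) (law M (\<lambda>\<omega>. (\<zeta>\<^sub>1' \<omega>, \<upsilon>' \<omega>, \<zeta>' \<omega>, \<theta>' \<omega>)))) \<bullet> (\<theta> \<omega> - \<theta>' \<omega>) \<partial>M)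
      \<le> - c * (l2n M (\<lambda>\<omega>. \<theta> \<omega> - \<theta>' \<omega>))\<^sup>2" .
  qed
  have "\<eta> \<in> borel_measurable (F 0)" using \<eta> by (auto simp: L2_rv_def intro: measurable_G_F)
  moreover have "\<eta> \<in> L2_rv M M" using \<eta> G_sub by (auto simp: L2_rv_def intro: measurable_from_subalg)
  ultimately show ?thesis using two_scale_convergence[OF _ _ \<beta> hat sol] by blast
qed

end
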